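(* The category $C\mathbb{T}\text{-}\mathbb{C}at_c$ of contractible $\mathbb{T}$-categories over constant $\omega$-graphs (objects: $\mathbb{T}$-categories over constant $\omega$-graphs equipped with a specific contraction on the underlying pointed $\mathbb{T}$-graph; morphisms: morphisms of $\mathbb{T}$-categories preserving the contractions) is locally presentable, and the forgetful functor $$O: C\mathbb{T}\text{-}\mathbb{C}at_c\longrightarrow \mathbb{T}\text{-}\mathbb{G}\mathrm{r}_{p,c}$$ to the category of pointed $\mathbb{T}$-graphs over constant $\omega$-graphs, which forgets both the composition and the contraction, is monadic.
   Context: **$\omega$-graphs and the monad $\mathbb{T}$.** An $\omega$-graph (globular set) $C$ consists of sets $C(n)$, $n\in\mathbb{N}$, with source and target maps $s,t:C(n+1)\to C(n)$ satisfying $ss=st$ and $ts=tt$. For $n\geq 1$, $s^n_0,t^n_0:C(n)\to C(0)$ denote the iterated source and target maps. Two cells $x,y\in C(k)$ with $k\geq 1$ are parallel, written $x\|y$, if $s(x)=s(y)$ and $t(x)=t(y)$. $\mathbb{T}$ denotes the monad of strict $\omega$-categories on the category of $\omega$-graphs, with unit $\eta$ and multiplication $\mu$; it is cartesian. In the free strict $\omega$-category $\mathbb{T}(G)$, $1_a$ is the identity $(k+1)$-cell on a $k$-cell $a$, and $1^0_n$ is the operator sending a $0$-cell to its iterated identity $n$-cell. **Constant $\omega$-graphs.** An $\omega$-graph $G$ is constant if $G(n)=G(m)$ for all $n,m\in\mathbb{N}$ and all source and target maps are identities. Its elements are called colours; for a colour $g$, $g(p)$ denotes $g$ regarded as a $p$-cell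 of $G$. **$\mathbb{T}$-graphs.** A $\mathbb{T}$-graph $(C,d,c)$ over $G$ is a span of $\omega$-graphs $\mathbb{T}(G)\xleftarrow{d}C\xrightarrow{c}G$. A morphism $(C,d,c)\to(C',d',c')$ from a $\mathbb{T}$-graph over $G$ to one over $G'$ is a pair of morphisms of $\omega$-graphs $f:C\to C'$, $h:G\to G'$ with $d'f=\mathbb{T}(h)d$ and $c'f=hc$. A pointed $\mathbb{T}$-graph is a $\mathbb{T}$-graph $(C,d,c)$ over $G$ with a morphism $p:G\to C$ such that $dp=\eta_G$ and $cp=1_G$; morphisms $(f,h)$ of pointed $\mathbb{T}$-graphs satisfy in addition $fp=p'h$. $\mathbb{T}\text{-}\mathbb{G}\mathrm{r}_{p,c}$ is the category of pointed $\mathbb{T}$-graphs over (varying) constant $\omega$-graphs. **$\mathbb{T}$-categories.** A $\mathbb{T}$-category (coloured $\omega$-operad) over $G$ is a monad on $G$ in the bicategory of $\mathbb{T}$-spans, i.e. a pointed $\mathbb{T}$-graph $(C,d,c;p)$ over $G$ with a composition $m:\mathbb{T}(C)\times_{\mathbb{T}(G)}C\to C$ (pullback of $\mathbb{T}(c)$ and $d$) satisfying $d\circ m=\mu_G\circ\mathbb{T}(d)\circ\pi_1$ and $c\circ m=c\circ\pi_2$ (where $\pi_1,\pi_2$ are the projections of the pullback), which is associative and has $p$ as two-sided unit. Morphisms are morphisms $(f,h)$ of pointed $\mathbb{T}$-graphs compatible with composition. $\mathbb{T}\text{-}\mathbb{C}at_c$ is the category of $\mathbb{T}$-categories over (varying)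 constant $\omega$-graphs. **Contractions.** Let $(C,d,c)$ be a $\mathbb{T}$-graph over a constant $\omega$-graph $G$. A cell $x\in C(n)$, $n\geq 1$, is a root cell if $d(x)=1^0_n(g(0))$ for some $0$-cell $g(0)$ of $G$. A pair $(x,y)$ of cells of $C(n)$ has the loop property if $s^n_0(x)=s^n_0(y)=t^n_0(x)=t^n_0(y)$. For $k\geq1$ let $\tilde C(k)$ be the set of pairs $(x,y)\in C(k)\times C(k)$ such that $x\|y$, $d(x)=d(y)$, and, if $(x,y)$ is a pair of root cells, then $(x,y)$ has the loop property (equivalently, for parallel pairs, $s^k_0(x)=t^k_0(y)$). Let $\tilde C(0)=\{(x,x): x\in C(0)\}$. A contraction on $(C,d,c)$ is the datum, for every $k\in\mathbb{N}$, of a map $[\,,]_k:\tilde C(k)\to C(k+1)$ such that $s([\alpha,\beta]_k)=\alpha$, $t([\alpha,\beta]_k)=\beta$ and $d([\alpha,\beta]_k)=1_{d(\alpha)}=1_{d(\beta)}$. A morphism $(f,h)$ between $\mathbb{T}$-graphs equipped with contractions preserves contractions if $f([\alpha,\beta]_k)=[f(\alpha),f(\beta)]_k$ for all $k$ and all $(\alpha,\beta)\in\tilde C(k)$. *)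

theory Defs
  imports Main "HOL-Library.FuncSet" "HOL-Library.Countable_Set"
begin

unbundle cardinal_syntax

section \<open>Categories, functors, limits of size\<close>

text \<open>
  Arrows carry their domain and codomain. As in HOL-Algebra, the operations are only
  meaningful on the carriers. \<open>cmp C g f\<close> is the composite of \<open>f\<close> followed by \<open>g\<close>.
\<close>

record ('o, 'm) category =
  obj :: "'o set"
  arr :: "'m set"
  dom :: "'m \<Rightarrow> 'o"
  cod :: "'m \<Rightarrow> 'o"
  one :: "'o \<Rightarrow> 'm"
  cmp :: "'m \<Rightarrow> 'm \<Rightarrow> 'm"

definition Hom :: "('o, 'm) category \<Rightarrow> 'o \<Rightarrow> 'o \<Rightarrow> 'm set" where
  "Hom C a b = {f \<in> arr C. dom C f = a \<and> cod C f = b}"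

definition is_category :: "('o, 'm) category \<Rightarrow> bool" where
  "is_category C \<longleftrightarrow>
     (\<forall>f \<in> arr C. dom C f \<in> obj C \<and> cod C f \<in> obj C) \<and>
     (\<forall>a \<in> obj C. one C a \<in> Hom C a a) \<and>
     (\<forall>f \<in> arr C. \<forall>g \<in> arr C. cod C f = dom C g \<longrightarrow> cmp C g f \<in> Hom C (dom C f) (cod C g)) \<and>
     (\<forall>f \<in> arr C. cmp C (one C (cod C f)) f = f \<and> cmp C f (one C (dom C f)) = f) \<and>
     (\<forall>f \<in> arr C. \<forall>g \<in> arr C. \<forall>h \<in> arr C. cod C f = dom C g \<longrightarrow> cod C g = dom C h \<longrightarrow>
        cmp C h (cmp C g f) = cmp C (cmp C h g) f)"

text \<open>
  A category given by its objects, hom-sets \<open>H a b\<close>, identities and composition, where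
  \<open>k a g f\<close> is the composite of \<open>f\<close> (starting at \<open>a\<close>) and \<open>g\<close>; arrows are triples
  (domain, codomain, map).
\<close>

definition hom_category ::
  "'o set \<Rightarrow> ('o \<Rightarrow> 'o \<Rightarrow> 'a set) \<Rightarrow> ('o \<Rightarrow> 'a) \<Rightarrow> ('o \<Rightarrow> 'a \<Rightarrow> 'a \<Rightarrow> 'a) \<Rightarrow> ('o, 'o \<times> 'o \<times> 'a) category" where
  "hom_category X H i k =
     \<lparr> obj = X,
       arr = {(a, b, f) | a b f. a \<in> X \<and> b \<in> X \<and> f \<in> H a b},
       dom = fst,
       cod = (\<lambda>u. fst (snd u)),
       one = (\<lambda>a. (a, a, i a)),
       cmp = (\<lambda>v u. (fst u, fst (snd v), k (fst u) (snd (snd v)) (snd (snd u)))) \<rparr>"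

record ('o, 'm, 'p, 'q) cfunctor =
  fobj :: "'o \<Rightarrow> 'p"
  farr :: "'m \<Rightarrow> 'q"

definition is_functor :: "('o, 'm) category \<Rightarrow> ('p, 'q) category \<Rightarrow> ('o, 'm, 'p, 'q) cfunctor \<Rightarrow> bool" where
  "is_functor A B F \<longleftrightarrow> is_category A \<and> is_category B \<and>
     (\<forall>a \<in> obj A. fobj F a \<in> obj B) \<and>
     (\<forall>f \<in> arr A. farr F f \<in> Hom B (fobj F (dom A f)) (fobj F (cod A f))) \<and>
     (\<forall>a \<in> obj A. farr F (one A a) = one B (fobj F a)) \<and>
     (\<forall>f \<in> arr A. \<forall>g \<in> arr A. cod A f = dom A g \<longrightarrow>
        farr F (cmp A g f) = cmp B (farr F g) (farr F f))"

definition id_functor :: "('o, 'm, 'o, 'm) cfunctor" where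
  "id_functor = \<lparr> fobj = (\<lambda>a. a), farr = (\<lambda>f. f) \<rparr>"

definition comp_functor ::
  "('p, 'q, 'r, 's) cfunctor \<Rightarrow> ('o, 'm, 'p, 'q) cfunctor \<Rightarrow> ('o, 'm, 'r, 's) cfunctor" (infixl "\<circ>\<^sub>F" 55) where
  "G \<circ>\<^sub>F F = \<lparr> fobj = (\<lambda>a. fobj G (fobj F a)), farr = (\<lambda>f. farr G (farr F f)) \<rparr>"

definition nat_trans ::
  "('o, 'm) category \<Rightarrow> ('p, 'q) category \<Rightarrow> ('o, 'm, 'p, 'q) cfunctor \<Rightarrow> ('o, 'm, 'p, 'q) cfunctor
    \<Rightarrow> ('o \<Rightarrow> 'q) \<Rightarrow> bool" where
  "nat_trans A B F G \<tau> \<longleftrightarrow>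
     (\<forall>a \<in> obj A. \<tau> a \<in> Hom B (fobj F a) (fobj G a)) \<and>
     (\<forall>f \<in> arr A. cmp B (\<tau> (cod A f)) (farr F f) = cmp B (farr G f) (\<tau> (dom A f)))"

definition is_iso :: "('o, 'm) category \<Rightarrow> 'm \<Rightarrow> bool" where
  "is_iso A f \<longleftrightarrow> f \<in> arr A \<and>
     (\<exists>g \<in> Hom A (cod A f) (dom A f). cmp A g f = one A (dom A f) \<and> cmp A f g = one A (cod A f))"

definition nat_iso ::
  "('o, 'm) category \<Rightarrow> ('p, 'q) category \<Rightarrow> ('o, 'm, 'p, 'q) cfunctor \<Rightarrow> ('o, 'm, 'p, 'q) cfunctor
    \<Rightarrow> ('o \<Rightarrow> 'q) \<Rightarrow> bool" where
  "nat_iso A B F G \<tau> \<longleftrightarrow> nat_trans A B F G \<tau> \<and> (\<forall>a \<in> obj A. is_iso B (\<tau> a))"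

definition is_equivalence ::
  "('o, 'm) category \<Rightarrow> ('p, 'q) category \<Rightarrow> ('o, 'm, 'p, 'q) cfunctor \<Rightarrow> bool" where
  "is_equivalence A B F \<longleftrightarrow> is_functor A B F \<and>
     (\<exists>G :: ('p, 'q, 'o, 'm) cfunctor. is_functor B A G \<and>
       (\<exists>\<sigma>. nat_iso A A id_functor (G \<circ>\<^sub>F F) \<sigma>) \<and> (\<exists>\<tau>. nat_iso B B (F \<circ>\<^sub>F G) id_functor \<tau>))"


subsection \<open>Monadic functors\<close>

text \<open>\<open>F : B \<rightarrow> A\<close> is left adjoint to \<open>U : A \<rightarrow> B\<close> with unit \<open>\<eta>\<close> and counit \<open>\<epsilon>\<close>.\<close>

definition is_adjunction ::
  "('o, 'm) category \<Rightarrow> ('p, 'q) category \<Rightarrow> ('p, 'q, 'o, 'm) cfunctor \<Rightarrow> ('o, 'm, 'p, 'q) cfunctor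
    \<Rightarrow> ('p \<Rightarrow> 'q) \<Rightarrow> ('o \<Rightarrow> 'm) \<Rightarrow> bool" where
  "is_adjunction A B F U \<eta> \<epsilon> \<longleftrightarrow> is_functor B A F \<and> is_functor A B U \<and>
     nat_trans B B id_functor (U \<circ>\<^sub>F F) \<eta> \<and> nat_trans A A (F \<circ>\<^sub>F U) id_functor \<epsilon> \<and>
     (\<forall>b \<in> obj B. cmp A (\<epsilon> (fobj F b)) (farr F (\<eta> b)) = one A (fobj F b)) \<and>
     (\<forall>a \<in> obj A. cmp B (farr U (\<epsilon> a)) (\<eta> (fobj U a)) = one B (fobj U a))"

text \<open>The Eilenberg-Moore category of the monad \<open>(T, \<eta>, \<mu>)\<close> on \<open>B\<close>.\<close>

definition em_algebra ::
  "('p, 'q) category \<Rightarrow> ('p, 'q, 'p, 'q) cfunctor \<Rightarrow> ('p \<Rightarrow> 'q) \<Rightarrow> ('p \<Rightarrow> 'q) \<Rightarrow> 'p \<times> 'q \<Rightarrow> bool" where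
  "em_algebra B T \<eta> \<mu> = (\<lambda>(b, \<beta>). b \<in> obj B \<and> \<beta> \<in> Hom B (fobj T b) b \<and>
     cmp B \<beta> (\<eta> b) = one B b \<and> cmp B \<beta> (\<mu> b) = cmp B \<beta> (farr T \<beta>))"

definition em_category ::
  "('p, 'q) category \<Rightarrow> ('p, 'q, 'p, 'q) cfunctor \<Rightarrow> ('p \<Rightarrow> 'q) \<Rightarrow> ('p \<Rightarrow> 'q)
    \<Rightarrow> ('p \<times> 'q, ('p \<times> 'q) \<times> ('p \<times> 'q) \<times> 'q) category" where
  "em_category B T \<eta> \<mu> = hom_category
     {x. em_algebra B T \<eta> \<mu> x}
     (\<lambda>x y. {f \<in> Hom B (fst x) (fst y). cmp B f (snd x) = cmp B (snd y) (farr T f)})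
     (\<lambda>x. one B (fst x))
     (\<lambda>_ g f. cmp B g f)"

definition comparison_functor ::
  "('o, 'm) category \<Rightarrow> ('o, 'm, 'p, 'q) cfunctor \<Rightarrow> ('o \<Rightarrow> 'm)
    \<Rightarrow> ('o, 'm, 'p \<times> 'q, ('p \<times> 'q) \<times> ('p \<times> 'q) \<times> 'q) cfunctor" where
  "comparison_functor A U \<epsilon> =
     (let K = (\<lambda>a. (fobj U a, farr U (\<epsilon> a)))
      in \<lparr> fobj = K, farr = (\<lambda>f. (K (dom A f), K (cod A f), farr U f)) \<rparr>)"

text \<open>Monadicity is understood up to equivalence: the comparison functor is an equivalence of
  categories, not necessarily an isomorphism.\<close>

definition monadic ::
  "('o, 'm) category \<Rightarrow> ('p, 'q) category \<Rightarrow> ('o, 'm, 'p, 'q) cfunctor \<Rightarrow> bool" where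
  "monadic A B U \<longleftrightarrow> (\<exists>F \<eta> \<epsilon>. is_adjunction A B F U \<eta> \<epsilon> \<and>
     is_equivalence A (em_category B (U \<circ>\<^sub>F F) \<eta> (\<lambda>b. farr U (\<epsilon> (fobj F b)))) (comparison_functor A U \<epsilon>))"


subsection \<open>Locally presentable categories\<close>

text \<open>
  Size is measured by a type \<open>'u\<close>: a set is small if its cardinality is strictly below that of
  \<open>'u\<close>. When \<open>|UNIV :: 'u set|\<close> is inaccessible, the small sets are, up to bijection, those
  of a Grothendieck universe.
\<close>

definition small :: "'u itself \<Rightarrow> 'a set \<Rightarrow> bool" where
  "small _ X \<longleftrightarrow> |X| <o |UNIV :: 'u set|"

definition small_category :: "('u, 'u) category \<Rightarrow> bool" where
  "small_category J \<longleftrightarrow> is_category J \<and> small TYPE('u) (obj J) \<and> small TYPE('u) (arr J)"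

definition is_cocone ::
  "('o, 'm) category \<Rightarrow> ('i, 'j) category \<Rightarrow> ('i, 'j, 'o, 'm) cfunctor \<Rightarrow> 'o \<Rightarrow> ('i \<Rightarrow> 'm) \<Rightarrow> bool" where
  "is_cocone A J D x \<iota> \<longleftrightarrow> x \<in> obj A \<and> (\<forall>i \<in> obj J. \<iota> i \<in> Hom A (fobj D i) x) \<and>
     (\<forall>u \<in> arr J. cmp A (\<iota> (cod J u)) (farr D u) = \<iota> (dom J u))"

definition is_colimit ::
  "('o, 'm) category \<Rightarrow> ('i, 'j) category \<Rightarrow> ('i, 'j, 'o, 'm) cfunctor \<Rightarrow> 'o \<Rightarrow> ('i \<Rightarrow> 'm) \<Rightarrow> bool" where
  "is_colimit A J D x \<iota> \<longleftrightarrow> is_cocone A J D x \<iota> \<and>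
     (\<forall>y \<kappa>. is_cocone A J D y \<kappa> \<longrightarrow> (\<exists>!f. f \<in> Hom A x y \<and> (\<forall>i \<in> obj J. cmp A f (\<iota> i) = \<kappa> i)))"

definition cocomplete :: "'u itself \<Rightarrow> ('o, 'm) category \<Rightarrow> bool" where
  "cocomplete _ A \<longleftrightarrow> (\<forall>(J :: ('u, 'u) category) D. small_category J \<and> is_functor J A D \<longrightarrow>
     (\<exists>x \<iota>. is_colimit A J D x \<iota>))"

definition Set_cat :: "('a set, 'a set \<times> 'a set \<times> ('a \<Rightarrow> 'a)) category" where
  "Set_cat = hom_category UNIV (\<lambda>X Y. X \<rightarrow>\<^sub>E Y) (\<lambda>X. restrict (\<lambda>x. x) X) (\<lambda>X g f. compose X g f)"

definition hom_functor ::
  "('o, 'm) category \<Rightarrow> 'o \<Rightarrow> ('o, 'm, 'm set, 'm set \<times> 'm set \<times> ('m \<Rightarrow> 'm)) cfunctor" where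
  "hom_functor A a =
     \<lparr> fobj = (\<lambda>x. Hom A a x),
       farr = (\<lambda>f. (Hom A a (dom A f), Hom A a (cod A f), restrict (\<lambda>g. cmp A f g) (Hom A a (dom A f)))) \<rparr>"

definition preserves_colimits ::
  "('o, 'm) category \<Rightarrow> ('p, 'q) category \<Rightarrow> ('o, 'm, 'p, 'q) cfunctor \<Rightarrow> ('i, 'j) category \<Rightarrow> bool" where
  "preserves_colimits A B F J \<longleftrightarrow> (\<forall>D x \<iota>. is_functor J A D \<and> is_colimit A J D x \<iota> \<longrightarrow>
     is_colimit B J (F \<circ>\<^sub>F D) (fobj F x) (\<lambda>i. farr F (\<iota> i)))"

definition regular_cardinal :: "'u rel \<Rightarrow> bool" where
  "regular_cardinal r \<longleftrightarrow> Card_order r \<and> \<not> finite (Field r) \<and> regularCard r"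

text \<open>\<open>J\<close> is a partially ordered set in which every subset of fewer than \<open>r\<close> elements has
  an upper bound.\<close>

definition directed_poset :: "'u rel \<Rightarrow> ('i, 'j) category \<Rightarrow> bool" where
  "directed_poset r J \<longleftrightarrow> is_category J \<and>
     (\<forall>f \<in> arr J. \<forall>g \<in> arr J. dom J f = dom J g \<and> cod J f = cod J g \<longrightarrow> f = g) \<and>
     (\<forall>i \<in> obj J. \<forall>j \<in> obj J. Hom J i j \<noteq> {} \<and> Hom J j i \<noteq> {} \<longrightarrow> i = j) \<and>
     (\<forall>S \<subseteq> obj J. |S| <o r \<longrightarrow> (\<exists>j \<in> obj J. \<forall>i \<in> S. Hom J i j \<noteq> {}))"

definition presentable :: "'u rel \<Rightarrow> ('o, 'm) category \<Rightarrow> 'o \<Rightarrow> bool" where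
  "presentable r A a \<longleftrightarrow> a \<in> obj A \<and>
     (\<forall>J :: ('u, 'u) category. small_category J \<and> directed_poset r J \<longrightarrow>
        preserves_colimits A Set_cat (hom_functor A a) J)"

text \<open>
  Adamek and Rosicky's definition relative to the size \<open>'u\<close>. The generating set \<open>P\<close> is asked to
  span a small full subcategory; over an inaccessible \<open>|UNIV :: 'u set|\<close> this is the usual
  standing assumption of local smallness, since every \<open>Hom x y\<close> is then a small limit of small
  colimits of hom-sets between members of \<open>P\<close>.
\<close>

definition locally_presentable :: "'u itself \<Rightarrow> ('o, 'm) category \<Rightarrow> bool" where
  "locally_presentable _ A \<longleftrightarrow> is_category A \<and> cocomplete TYPE('u) A \<and>
     (\<exists>r :: 'u rel. regular_cardinal r \<and> r <o |UNIV :: 'u set| \<and>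
       (\<exists>P \<subseteq> obj A. small TYPE('u) P \<and> (\<forall>a \<in> P. \<forall>b \<in> P. small TYPE('u) (Hom A a b)) \<and>
          (\<forall>a \<in> P. presentable r A a) \<and>
          (\<forall>x \<in> obj A. \<exists>(J :: ('u, 'u) category) D \<iota>.
             small_category J \<and> directed_poset r J \<and> is_functor J A D \<and>
             (\<forall>i \<in> obj J. fobj D i \<in> P) \<and> is_colimit A J D x \<iota>)))"


section \<open>\<open>\<omega>\<close>-graphs and the monad of strict \<open>\<omega>\<close>-categories\<close>

record 'a ograph =
  cell :: "nat \<Rightarrow> 'a set"
  src :: "nat \<Rightarrow> 'a \<Rightarrow> 'a"  \<comment> \<open>\<open>src X n\<close> and \<open>tgt X n\<close> go from \<open>cell X (Suc n)\<close> to \<open>cell X n\<close>\<close>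
  tgt :: "nat \<Rightarrow> 'a \<Rightarrow> 'a"

definition is_ograph :: "'a ograph \<Rightarrow> bool" where
  "is_ograph X \<longleftrightarrow>
     (\<forall>n. \<forall>x \<in> cell X (Suc n). src X n x \<in> cell X n \<and> tgt X n x \<in> cell X n) \<and>
     (\<forall>n. \<forall>x \<in> cell X (Suc (Suc n)).
        src X n (src X (Suc n) x) = src X n (tgt X (Suc n) x) \<and>
        tgt X n (src X (Suc n) x) = tgt X n (tgt X (Suc n) x))"

definition constant_ograph :: "'a ograph \<Rightarrow> bool" where
  "constant_ograph X \<longleftrightarrow> is_ograph X \<and> (\<forall>n m. cell X n = cell X m) \<and>
     (\<forall>n. \<forall>x \<in> cell X (Suc n). src X n x = x \<and> tgt X n x = x)"

definition ograph_map :: "'a ograph \<Rightarrow> 'b ograph \<Rightarrow> (nat \<Rightarrow> 'a \<Rightarrow> 'b) \<Rightarrow> bool" where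
  "ograph_map X Y f \<longleftrightarrow>
     (\<forall>n. \<forall>x \<in> cell X n. f n x \<in> cell Y n) \<and>
     (\<forall>n. \<forall>x \<in> cell X (Suc n). f n (src X n x) = src Y n (f (Suc n) x) \<and>
                              f n (tgt X n x) = tgt Y n (f (Suc n) x))"

primrec src0 :: "'a ograph \<Rightarrow> nat \<Rightarrow> 'a \<Rightarrow> 'a" where
  "src0 X 0 x = x"
| "src0 X (Suc n) x = src0 X n (src X n x)"

primrec tgt0 :: "'a ograph \<Rightarrow> nat \<Rightarrow> 'a \<Rightarrow> 'a" where
  "tgt0 X 0 x = x"
| "tgt0 X (Suc n) x = tgt0 X n (tgt X n x)"

definition parallel :: "'a ograph \<Rightarrow> nat \<Rightarrow> 'a \<Rightarrow> 'a \<Rightarrow> bool" where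
  "parallel X k x y \<longleftrightarrow> x \<in> cell X k \<and> y \<in> cell X k \<and>
     (\<exists>j. k = Suc j \<and> src X j x = src X j y \<and> tgt X j x = tgt X j y)"


subsection \<open>Free strict \<open>\<omega>\<close>-categories by generators and relations\<close>

text \<open>
  \<open>Gen n x\<close> is the generating \<open>n\<close>-cell \<open>x\<close>, \<open>Idt t\<close> the identity cell on \<open>t\<close>, and
  \<open>Comp k t u\<close> the composite \<open>t \<circ>\<^sub>k u\<close> of two cells of the same dimension along
  their common boundary \<open>s\<^sub>k t = t\<^sub>k u\<close>.
\<close>

datatype 'a trm = Gen nat 'a | Idt "'a trm" | Comp nat "'a trm" "'a trm"

primrec tdim :: "'a trm \<Rightarrow> nat" where
  "tdim (Gen n x) = n"
| "tdim (Idt t) = Suc (tdim t)"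
| "tdim (Comp k t u) = tdim t"

primrec tsrc :: "'a ograph \<Rightarrow> 'a trm \<Rightarrow> 'a trm" where
  "tsrc X (Gen n x) = Gen (n - 1) (src X (n - 1) x)"
| "tsrc X (Idt t) = t"
| "tsrc X (Comp k t u) = (if Suc k = tdim t then tsrc X u else Comp k (tsrc X t) (tsrc X u))"

primrec ttgt :: "'a ograph \<Rightarrow> 'a trm \<Rightarrow> 'a trm" where
  "ttgt X (Gen n x) = Gen (n - 1) (tgt X (n - 1) x)"
| "ttgt X (Idt t) = t"
| "ttgt X (Comp k t u) = (if Suc k = tdim t then ttgt X t else Comp k (ttgt X t) (ttgt X u))"

text \<open>
  \<open>teq X n t u\<close>: the terms \<open>t\<close> and \<open>u\<close> are well formed and denote the same \<open>n\<close>-cell of the free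
  strict \<open>\<omega>\<close>-category on \<open>X\<close>. It is a partial equivalence relation; \<open>teq X n t t\<close> says
  that \<open>t\<close> is well formed.
\<close>

inductive teq :: "'a ograph \<Rightarrow> nat \<Rightarrow> 'a trm \<Rightarrow> 'a trm \<Rightarrow> bool" for X :: "'a ograph" where
  gen: "x \<in> cell X n \<Longrightarrow> teq X n (Gen n x) (Gen n x)"
| idt: "teq X n t t' \<Longrightarrow> teq X (Suc n) (Idt t) (Idt t')"
| cmp: "teq X n t t' \<Longrightarrow> teq X n u u' \<Longrightarrow> k < n \<Longrightarrow>
    teq X k ((tsrc X ^^ (n - k)) t) ((ttgt X ^^ (n - k)) u) \<Longrightarrow>
    teq X n (Comp k t u) (Comp k t' u')"
| sym: "teq X n t u \<Longrightarrow> teq X n u t"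
| trans: "teq X n t u \<Longrightarrow> teq X n u v \<Longrightarrow> teq X n t v"
| assoc: "teq X n t t \<Longrightarrow> teq X n u u \<Longrightarrow> teq X n v v \<Longrightarrow> k < n \<Longrightarrow>
    teq X k ((tsrc X ^^ (n - k)) t) ((ttgt X ^^ (n - k)) u) \<Longrightarrow>
    teq X k ((tsrc X ^^ (n - k)) u) ((ttgt X ^^ (n - k)) v) \<Longrightarrow>
    teq X n (Comp k (Comp k t u) v) (Comp k t (Comp k u v))"
| unit_src: "teq X n t t \<Longrightarrow> k < n \<Longrightarrow>
    teq X n (Comp k t ((Idt ^^ (n - k)) ((tsrc X ^^ (n - k)) t))) t"
| unit_tgt: "teq X n t t \<Longrightarrow> k < n \<Longrightarrow>
    teq X n (Comp k ((Idt ^^ (n - k)) ((ttgt X ^^ (n - k)) t)) t) t"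
| interchange: "teq X n t t \<Longrightarrow> teq X n u u \<Longrightarrow> teq X n v v \<Longrightarrow> teq X n w w \<Longrightarrow> j < k \<Longrightarrow> k < n \<Longrightarrow>
    teq X k ((tsrc X ^^ (n - k)) t) ((ttgt X ^^ (n - k)) u) \<Longrightarrow>
    teq X k ((tsrc X ^^ (n - k)) v) ((ttgt X ^^ (n - k)) w) \<Longrightarrow>
    teq X j ((tsrc X ^^ (n - j)) t) ((ttgt X ^^ (n - j)) v) \<Longrightarrow>
    teq X j ((tsrc X ^^ (n - j)) u) ((ttgt X ^^ (n - j)) w) \<Longrightarrow>
    teq X n (Comp j (Comp k t u) (Comp k v w)) (Comp k (Comp j t v) (Comp j u w))"
| idt_cmp: "teq X n t t \<Longrightarrow> teq X n u u \<Longrightarrow> k < n \<Longrightarrow>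
    teq X k ((tsrc X ^^ (n - k)) t) ((ttgt X ^^ (n - k)) u) \<Longrightarrow>
    teq X (Suc n) (Idt (Comp k t u)) (Comp k (Idt t) (Idt u))"


subsection \<open>The monad\<close>

text \<open>Cells of the free strict \<open>\<omega>\<close>-category are equivalence classes of well-formed terms.
  \<open>tcls X n K\<close> is the class of the elements of \<open>K\<close>, when these are equivalent terms.\<close>

definition tcls :: "'a ograph \<Rightarrow> nat \<Rightarrow> 'a trm set \<Rightarrow> 'a trm set" where
  "tcls X n K = {u. \<exists>t \<in> K. teq X n t u}"

definition T_graph :: "'a ograph \<Rightarrow> 'a trm set ograph" where
  "T_graph X =
     \<lparr> cell = (\<lambda>n. {tcls X n {t} | t. teq X n t t}),
       src = (\<lambda>n K. tcls X n (tsrc X ` K)),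
       tgt = (\<lambda>n K. tcls X n (ttgt X ` K)) \<rparr>"

primrec tmap :: "(nat \<Rightarrow> 'a \<Rightarrow> 'b) \<Rightarrow> 'a trm \<Rightarrow> 'b trm" where
  "tmap f (Gen n x) = Gen n (f n x)"
| "tmap f (Idt t) = Idt (tmap f t)"
| "tmap f (Comp k t u) = Comp k (tmap f t) (tmap f u)"

text \<open>The action of the monad on a map \<open>f\<close> of \<open>\<omega>\<close>-graphs with codomain \<open>Y\<close>.\<close>

definition T_map :: "'b ograph \<Rightarrow> (nat \<Rightarrow> 'a \<Rightarrow> 'b) \<Rightarrow> nat \<Rightarrow> 'a trm set \<Rightarrow> 'b trm set" where
  "T_map Y f n K = tcls Y n (tmap f ` K)"

definition T_unit :: "'a ograph \<Rightarrow> nat \<Rightarrow> 'a \<Rightarrow> 'a trm set" where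
  "T_unit X n x = tcls X n {Gen n x}"

primrec tflat :: "'a trm set trm \<Rightarrow> 'a trm" where
  "tflat (Gen n K) = (SOME t. t \<in> K)"
| "tflat (Idt t) = Idt (tflat t)"
| "tflat (Comp k t u) = Comp k (tflat t) (tflat u)"

definition T_mult :: "'a ograph \<Rightarrow> nat \<Rightarrow> 'a trm set trm set \<Rightarrow> 'a trm set" where
  "T_mult X n K = tcls X n (tflat ` K)"

definition T_id :: "'a ograph \<Rightarrow> nat \<Rightarrow> 'a trm set \<Rightarrow> 'a trm set" where
  "T_id X n K = tcls X (Suc n) (Idt ` K)"

primrec T_id0 :: "'a ograph \<Rightarrow> nat \<Rightarrow> 'a trm set \<Rightarrow> 'a trm set" where
  "T_id0 X 0 K = K"
| "T_id0 X (Suc n) K = T_id X n (T_id0 X n K)"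


section \<open>\<open>T\<close>-graphs and \<open>T\<close>-categories over constant \<open>\<omega>\<close>-graphs\<close>

record 'u tgraph =
  base :: "'u ograph"
  tot :: "'u ograph"
  dmap :: "nat \<Rightarrow> 'u \<Rightarrow> 'u trm set"
  cmap :: "nat \<Rightarrow> 'u \<Rightarrow> 'u"

record 'u ptgraph = "'u tgraph" +
  pt :: "nat \<Rightarrow> 'u \<Rightarrow> 'u"

record 'u tcat = "'u ptgraph" +
  mul :: "nat \<Rightarrow> 'u trm set \<times> 'u \<Rightarrow> 'u"

record 'u ctcat = "'u tcat" +
  contr :: "nat \<Rightarrow> 'u \<Rightarrow> 'u \<Rightarrow> 'u"

definition is_tgraph :: "('u, 'z) tgraph_scheme \<Rightarrow> bool" where
  "is_tgraph C \<longleftrightarrow> is_ograph (base C) \<and> is_ograph (tot C) \<and>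
     (\<forall>n. small TYPE('u) (cell (base C) n) \<and> small TYPE('u) (cell (tot C) n)) \<and>
     ograph_map (tot C) (T_graph (base C)) (dmap C) \<and>
     ograph_map (tot C) (base C) (cmap C)"

definition is_ptgraph :: "('u, 'z) ptgraph_scheme \<Rightarrow> bool" where
  "is_ptgraph C \<longleftrightarrow> is_tgraph C \<and> ograph_map (base C) (tot C) (pt C) \<and>
     (\<forall>n. \<forall>g \<in> cell (base C) n.
        dmap C n (pt C n g) = T_unit (base C) n g \<and> cmap C n (pt C n g) = g)"

text \<open>The pullback of \<open>T(c)\<close> and \<open>d\<close>.\<close>

definition pullback :: "('u, 'z) tgraph_scheme \<Rightarrow> ('u trm set \<times> 'u) ograph" where
  "pullback C =
     \<lparr> cell = (\<lambda>n. {(K, x). K \<in> cell (T_graph (tot C)) n \<and> x \<in> cell (tot C) n \<and>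
                           T_map (base C) (cmap C) n K = dmap C n x}),
       src = (\<lambda>n (K, x). (src (T_graph (tot C)) n K, src (tot C) n x)),
       tgt = (\<lambda>n (K, x). (tgt (T_graph (tot C)) n K, tgt (tot C) n x)) \<rparr>"

text \<open>
  Associativity is stated on the left-hand side \<open>(C \<otimes> C) \<otimes> C\<close> of the associativity
  isomorphism of \<open>T\<close>-spans: its cells are pairs of a cell \<open>\<theta>\<close> of \<open>T\<close> of the pullback and a
  cell \<open>x\<close> of \<open>C\<close>, and the isomorphism to \<open>C \<otimes> (C \<otimes> C)\<close> sends \<open>(\<theta>, x)\<close> to
  \<open>(\<mu> (T(\<pi>\<^sub>1) \<theta>), (T(\<pi>\<^sub>2) \<theta>, x))\<close>.
\<close>

definition is_tcat :: "('u, 'z) tcat_scheme \<Rightarrow> bool" where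
  "is_tcat C \<longleftrightarrow> is_ptgraph C \<and>
     ograph_map (pullback C) (tot C) (mul C) \<and>
     (\<forall>n K x. (K, x) \<in> cell (pullback C) n \<longrightarrow>
        dmap C n (mul C n (K, x)) = T_mult (base C) n (T_map (T_graph (base C)) (dmap C) n K) \<and>
        cmap C n (mul C n (K, x)) = cmap C n x) \<and>
     (\<forall>n. \<forall>x \<in> cell (tot C) n.
        mul C n (T_unit (tot C) n x, pt C n (cmap C n x)) = x \<and>
        mul C n (T_map (tot C) (pt C) n (dmap C n x), x) = x) \<and>
     (\<forall>n. \<forall>\<theta> \<in> cell (T_graph (pullback C)) n. \<forall>x \<in> cell (tot C) n.
        T_map (base C) (\<lambda>i Kx. cmap C i (snd Kx)) n \<theta> = dmap C n x \<longrightarrow>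
        mul C n (T_map (tot C) (mul C) n \<theta>, x) =
        mul C n (T_mult (tot C) n (T_map (T_graph (tot C)) (\<lambda>_. fst) n \<theta>),
                 mul C n (T_map (tot C) (\<lambda>_. snd) n \<theta>, x)))"


subsection \<open>Contractions\<close>

definition root_cell :: "('u, 'z) tgraph_scheme \<Rightarrow> nat \<Rightarrow> 'u \<Rightarrow> bool" where
  "root_cell C n x \<longleftrightarrow> n \<ge> 1 \<and> x \<in> cell (tot C) n \<and>
     (\<exists>g \<in> cell (base C) 0. dmap C n x = T_id0 (base C) n (T_unit (base C) 0 g))"

definition loop_property :: "('u, 'z) tgraph_scheme \<Rightarrow> nat \<Rightarrow> 'u \<Rightarrow> 'u \<Rightarrow> bool" where
  "loop_property C n x y \<longleftrightarrow> src0 (tot C) n x = src0 (tot C) n y \<and>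
     src0 (tot C) n y = tgt0 (tot C) n x \<and> tgt0 (tot C) n x = tgt0 (tot C) n y"

definition contractible_pairs :: "('u, 'z) tgraph_scheme \<Rightarrow> nat \<Rightarrow> ('u \<times> 'u) set" where
  "contractible_pairs C k =
     (if k = 0 then {(x, x) | x. x \<in> cell (tot C) 0}
      else {(x, y). x \<in> cell (tot C) k \<and> y \<in> cell (tot C) k \<and> parallel (tot C) k x y \<and>
                    dmap C k x = dmap C k y \<and>
                    (root_cell C k x \<and> root_cell C k y \<longrightarrow> loop_property C k x y)})"

definition is_contraction :: "('u, 'z) tgraph_scheme \<Rightarrow> (nat \<Rightarrow> 'u \<Rightarrow> 'u \<Rightarrow> 'u) \<Rightarrow> bool" where
  "is_contraction C br \<longleftrightarrow> (\<forall>k x y. (x, y) \<in> contractible_pairs C k \<longrightarrow>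
     br k x y \<in> cell (tot C) (Suc k) \<and>
     src (tot C) k (br k x y) = x \<and> tgt (tot C) k (br k x y) = y \<and>
     dmap C (Suc k) (br k x y) = T_id (base C) k (dmap C k x))"


subsection \<open>The categories\<close>

text \<open>Maps in arrows are extensional, so that equality of arrows is equality on cells. The
  structure maps of objects are not: values outside the carriers only give isomorphic copies.\<close>

definition ext_maps :: "'a ograph \<Rightarrow> (nat \<Rightarrow> 'a \<Rightarrow> 'b) set" where
  "ext_maps X = {f. \<forall>n. f n \<in> extensional (cell X n)}"

definition ptgraph_hom ::
  "('u, 'y) ptgraph_scheme \<Rightarrow> ('u, 'z) ptgraph_scheme \<Rightarrow> ((nat \<Rightarrow> 'u \<Rightarrow> 'u) \<times> (nat \<Rightarrow> 'u \<Rightarrow> 'u)) set" where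
  "ptgraph_hom C C' = {(f, h). f \<in> ext_maps (tot C) \<and> h \<in> ext_maps (base C) \<and>
     ograph_map (tot C) (tot C') f \<and> ograph_map (base C) (base C') h \<and>
     (\<forall>n. \<forall>x \<in> cell (tot C) n.
        dmap C' n (f n x) = T_map (base C') h n (dmap C n x) \<and>
        cmap C' n (f n x) = h n (cmap C n x)) \<and>
     (\<forall>n. \<forall>g \<in> cell (base C) n. f n (pt C n g) = pt C' n (h n g))}"

definition tcat_hom ::
  "('u, 'y) tcat_scheme \<Rightarrow> ('u, 'z) tcat_scheme \<Rightarrow> ((nat \<Rightarrow> 'u \<Rightarrow> 'u) \<times> (nat \<Rightarrow> 'u \<Rightarrow> 'u)) set" where
  "tcat_hom C C' = {(f, h) \<in> ptgraph_hom C C'.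
     \<forall>n K x. (K, x) \<in> cell (pullback C) n \<longrightarrow>
       f n (mul C n (K, x)) = mul C' n (T_map (tot C') f n K, f n x)}"

definition ctcat_hom ::
  "'u ctcat \<Rightarrow> 'u ctcat \<Rightarrow> ((nat \<Rightarrow> 'u \<Rightarrow> 'u) \<times> (nat \<Rightarrow> 'u \<Rightarrow> 'u)) set" where
  "ctcat_hom C C' = {(f, h) \<in> tcat_hom C C'.
     \<forall>k x y. (x, y) \<in> contractible_pairs C k \<longrightarrow>
       f (Suc k) (contr C k x y) = contr C' k (f k x) (f k y)}"

definition hom_id ::
  "('u, 'z) tgraph_scheme \<Rightarrow> (nat \<Rightarrow> 'u \<Rightarrow> 'u) \<times> (nat \<Rightarrow> 'u \<Rightarrow> 'u)" where
  "hom_id C = ((\<lambda>n. restrict (\<lambda>x. x) (cell (tot C) n)), (\<lambda>n. restrict (\<lambda>x. x) (cell (base C) n)))"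

definition hom_comp ::
  "('u, 'z) tgraph_scheme \<Rightarrow> (nat \<Rightarrow> 'u \<Rightarrow> 'u) \<times> (nat \<Rightarrow> 'u \<Rightarrow> 'u) \<Rightarrow>
   (nat \<Rightarrow> 'u \<Rightarrow> 'u) \<times> (nat \<Rightarrow> 'u \<Rightarrow> 'u) \<Rightarrow> (nat \<Rightarrow> 'u \<Rightarrow> 'u) \<times> (nat \<Rightarrow> 'u \<Rightarrow> 'u)" where
  "hom_comp C = (\<lambda>(f', h') (f, h).
     ((\<lambda>n. compose (cell (tot C) n) (f' n) (f n)), (\<lambda>n. compose (cell (base C) n) (h' n) (h n))))"

type_synonym ('o, 'u) arrow = "'o \<times> 'o \<times> (nat \<Rightarrow> 'u \<Rightarrow> 'u) \<times> (nat \<Rightarrow> 'u \<Rightarrow> 'u)"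

definition TGr_pc :: "('u ptgraph, ('u ptgraph, 'u) arrow) category" where
  "TGr_pc = hom_category {C. is_ptgraph C \<and> constant_ograph (base C)} ptgraph_hom hom_id hom_comp"

definition CTCat_c :: "('u ctcat, ('u ctcat, 'u) arrow) category" where
  "CTCat_c = hom_category
     {C. is_tcat C \<and> constant_ograph (base C) \<and> is_contraction C (contr C)}
     ctcat_hom hom_id hom_comp"

definition forgetful :: "('u ctcat, ('u ctcat, 'u) arrow, 'u ptgraph, ('u ptgraph, 'u) arrow) cfunctor" where
  "forgetful = \<lparr> fobj = ptgraph.truncate,
     farr = (\<lambda>(C, C', fh). (ptgraph.truncate C, ptgraph.truncate C', fh)) \<rparr>"

end

theory Submission
  imports Defs
begin

text \<open>
  Idea. A contractible \<open>T\<close>-category has a set of cells closed under operations each of which takes finitely many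
  arguments, because cells of \<open>T C\<close> are classes of finite terms. Hence every small set of equations between such
  operations is represented by an object, generated by a universal tuple inside a product of small objects; this gives
  free objects and colimits. An algebra of the resulting monad is a split quotient of a free object by
  the unit, and the operations descend along the split quotient map, whence monadicity. Finiteness of terms also
  makes directed colimits commute with all operations, so objects represented by finitely many equations are
  finitely presentable, and every object is the canonical colimit of these.
\<close>

section \<open>Boundaries in free strict \<open>\<omega>\<close>-categories\<close>

text \<open>Two obstacles shape the proof. Terms of T X are identified by rules whose side
  conditions speak of boundaries of the same terms, so that even well-definedness of boundaries and
  of substitution takes an induction on dimension around the induction on derivations. And
  contractible pairs contain an implication whose hypothesis, being a root cell, sits in the wrong
  place for transport along maps. Over a constant base, however, a cell of T G is a cell of T 1, its
  shape, with a colour. Morphisms fix shapes and being a root depends on the shape alone, so the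
  implication passes along morphisms and back along jointly injective families. For the same reason
  all objects lie over a terminal object made of shapes, products are fibred over it, and a variable
  of a presentation must carry a shape. As to size, \<open>|UNIV :: 'u set|\<close> is regular and
  uncountable but perhaps no strong limit, so products of small objects may be too large. Only the
  part generated by a small set is ever kept, and its elements are named by finite terms.\<close>

abbreviation fits :: "'a ograph => nat => nat => 'a trm => 'a trm => bool" where
 "fits X n k t u == teq X k ((tsrc X ^^ (n - k)) t) ((ttgt X ^^ (n - k)) u)"
abbreviation "Tcell X == cell (T_graph X)"
abbreviation "tcell C == cell (tot C)"
abbreviation "gcell C == cell (base C)"
abbreviation "pcell C == cell (pullback C)"

lemma teq_refl1: "teq X n t u ==> teq X n t t"
 and teq_refl2: "teq X n t u ==> teq X n u u"
 by (meson teq.sym teq.trans)+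

lemma tdim_Idt_pow: "tdim ((Idt ^^ j) t) = j + tdim t"
 by (induction j) auto

lemma tdim_ttgt: "tdim (ttgt X t) = tdim t - 1"
 by (induction t) auto

lemma tdim_ttgt_pow: "tdim ((ttgt X ^^ j) t) = tdim t - j"
 by (induction j) (auto simp: tdim_ttgt)

lemma funpow_Suc_diff: "k \<le> m ==> (f ^^ (Suc m - k)) x = (f ^^ (m - k)) (f x)"
 by (simp add: Suc_diff_le funpow_swap1)

lemma teq_tdim: "teq X n t u ==> tdim t = n \<and> tdim u = n"
 by (induction rule: teq.induct) (auto simp: tdim_Idt_pow tdim_ttgt_pow)

text \<open>
  Invariants of the induction showing that boundaries are well defined: \<open>globt\<close> collects
  what must be known about a single term, \<open>bdeq\<close> about two equal terms. The outer induction is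
  on the dimension (variable \<open>N\<close>), the inner one on the derivation.
\<close>

definition globt :: "'a ograph => nat => 'a trm => bool" where
 "globt X n t == teq X n t t \<and>
   (\<forall>m. n = Suc m --> teq X m (tsrc X t) (tsrc X t) \<and> teq X m (ttgt X t) (ttgt X t)) \<and>
   (\<forall>m. n = Suc (Suc m) --> teq X m (tsrc X (tsrc X t)) (tsrc X (ttgt X t)) \<and>
    teq X m (ttgt X (tsrc X t)) (ttgt X (ttgt X t)))"

definition bdeq :: "'a ograph => nat => 'a trm => 'a trm => bool" where
 "bdeq X n t u == globt X n t \<and> globt X n u \<and>
   (\<forall>m. n = Suc m --> teq X m (tsrc X t) (tsrc X u) \<and> teq X m (ttgt X t) (ttgt X u))"

lemma bdeq_sym: "bdeq X n t u ==> bdeq X n u t"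
 unfolding bdeq_def by (blast intro: teq.sym)

lemma bdeq_trans: "bdeq X n t u ==> bdeq X n u v ==> bdeq X n t v"
 unfolding bdeq_def by (blast intro: teq.trans)

lemma tsrc_Idt_pow: "(tsrc X ^^ j) ((Idt ^^ j) t) = t"
 and ttgt_Idt_pow: "(ttgt X ^^ j) ((Idt ^^ j) t) = t"
 by (induction j arbitrary: t) (simp_all add: funpow_swap1)

lemma globt_Idt: "globt X n t ==> globt X (Suc n) (Idt t)"
 unfolding globt_def using teq.idt by auto

lemma globt_Idt_pow: "globt X n t ==> globt X (j + n) ((Idt ^^ j) t)"
 by (induction j) (auto intro: globt_Idt)

lemma teq_Idt_pow: "teq X n t u ==> teq X (j + n) ((Idt ^^ j) t) ((Idt ^^ j) u)"
 by (induction j) (auto intro: teq.idt)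

section \<open>Induction step for boundaries: everything is known below dimension
  \<open>N\<close>\<close>

context
 fixes X :: "'a ograph" and N :: nat
 assumes IH: "!!n t u. n < N ==> teq X n t u ==> bdeq X n t u"
begin

private lemma IH_src: "n < N ==> teq X n t u ==> n = Suc m ==> teq X m (tsrc X t) (tsrc X u)"
 and IH_tgt: "n < N ==> teq X n t u ==> n = Suc m ==> teq X m (ttgt X t) (ttgt X u)"
 and IH_globt: "n < N ==> teq X n t u ==> globt X n t"
 using IH unfolding bdeq_def by blast+

private lemma src_pow: "n < N ==> teq X n t u ==> j \<le> n ==> teq X (n - j) ((tsrc X ^^ j) t) ((tsrc X ^^ j) u)"
 and tgt_pow: "n < N ==> teq X n t u ==> j \<le> n ==> teq X (n - j) ((ttgt X ^^ j) t) ((ttgt X ^^ j) u)"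
proof (induction j)
 case (Suc j)
 { case 1 thus ?case using Suc(1) IH_src[of "n - j" "(tsrc X ^^ j) t" "(tsrc X ^^ j) u" "n - Suc j"]
   by (simp add: less_imp_diff_less Suc_diff_Suc[symmetric] del: Suc_diff_Suc) }
 { case 2 thus ?case using Suc(2) IH_tgt[of "n - j" "(ttgt X ^^ j) t" "(ttgt X ^^ j) u" "n - Suc j"]
   by (simp add: less_imp_diff_less Suc_diff_Suc[symmetric] del: Suc_diff_Suc) }
qed auto

private lemma src_powk: "m < N ==> teq X m t u ==> k \<le> m ==> teq X k ((tsrc X ^^ (m - k)) t) ((tsrc X ^^ (m - k)) u)"
 and tgt_powk: "m < N ==> teq X m t u ==> k \<le> m ==> teq X k ((ttgt X ^^ (m - k)) t) ((ttgt X ^^ (m - k)) u)"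
 using src_pow[of m t u "m - k"] tgt_pow[of m t u "m - k"] by auto

text \<open>One globular step is part of \<open>globt\<close>; below it, equal terms have equal
  iterated sources by the hypothesis on smaller dimensions.\<close>

private lemma face_st:
 assumes "globt X (Suc m) t" "m < N" "k < m"
 shows "teq X k ((tsrc X ^^ (m - k)) (ttgt X t)) ((tsrc X ^^ (m - k)) (tsrc X t))"
proof -
 obtain m' where m: "m = Suc m'" using assms(3) by (cases m) auto
 have "teq X m' (tsrc X (ttgt X t)) (tsrc X (tsrc X t))"
  using assms(1) m unfolding globt_def by (auto intro: teq.sym)
 thus ?thesis using assms(2,3) m src_powk[of m' _ _ k] by (simp add: funpow_Suc_diff)
qed

private lemma face_ts:
 assumes "globt X (Suc m) t" "m < N" "k < m"
 shows "teq X k ((ttgt X ^^ (m - k)) (tsrc X t)) ((ttgt X ^^ (m - k)) (ttgt X t))"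
proof -
 obtain m' where m: "m = Suc m'" using assms(3) by (cases m) auto
 have "teq X m' (ttgt X (tsrc X t)) (ttgt X (ttgt X t))"
  using assms(1) m unfolding globt_def by (auto intro: teq.sym)
 thus ?thesis using assms(2,3) m tgt_powk[of m' _ _ k] by (simp add: funpow_Suc_diff)
qed

text \<open>For k < m a term and its two faces have the same k-boundaries by globularity, so
  composability along k passes to the faces.\<close>

lemma match_src:
 assumes "globt X (Suc m) t" "globt X (Suc m) u" "m < N" "k < m"
  and "fits X (Suc m) k t u"
 shows "fits X m k (tsrc X t) (tsrc X u)"
  and "fits X m k (ttgt X t) (ttgt X u)"
 using face_ts[OF assms(2,3,4)] face_st[OF assms(1,3,4)] assms(5) assms(4)
 by (auto simp: funpow_Suc_diff intro: teq.trans teq.sym)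

private lemma globt_sub:
 assumes "globt X (Suc m) t" "m < N"
 shows "globt X m (tsrc X t)" "globt X m (ttgt X t)"
 using assms IH_globt unfolding globt_def by blast+

text \<open>At the top, k = m, the faces of the composite are faces of its factors, and the premise
  provides their common boundary. Lower down they are composites of faces, well formed by
  \<open>match_src\<close>; the second faces split into the same two cases again.\<close>

private lemma globt_Comp:
 assumes t: "globt X n t" and u: "globt X n u" and n: "n \<le> N" and k: "k < n"
  and m: "fits X n k t u"
 shows "globt X n (Comp k t u)"
proof -
 obtain m where nm: "n = Suc m" using k by (cases n) auto
 have dt: "tdim t = n" "tdim u = n" using t u teq_tdim unfolding globt_def by blast+
 have mN: "m < N" using nm n by simp
 have wf: "teq X n (Comp k t u) (Comp k t u)"
  using t u k m unfolding globt_def by (auto intro: teq.cmp)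
 have st: "teq X m (tsrc X t) (tsrc X t)" "teq X m (ttgt X t) (ttgt X t)"
   "teq X m (tsrc X u) (tsrc X u)" "teq X m (ttgt X u) (ttgt X u)"
  using t u nm unfolding globt_def by auto
 have dst: "tdim (tsrc X t) = m" "tdim (ttgt X t) = m" using st teq_tdim by blast+
 show ?thesis
 proof (cases "k = m")
  case True
  have "teq X m (tsrc X t) (ttgt X u)" using m nm True by simp
  note mm = IH[OF mN this]
  have "teq X i (tsrc X (tsrc X u)) (tsrc X (ttgt X t)) \<and> teq X i (ttgt X (tsrc X u)) (ttgt X (ttgt X t))"
   if i: "m = Suc i" for i
  proof -
   have a: "teq X i (tsrc X (tsrc X t)) (tsrc X (ttgt X u))" "teq X i (ttgt X (tsrc X t)) (ttgt X (ttgt X u))"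
    using mm i unfolding bdeq_def by auto
   have b: "teq X i (tsrc X (tsrc X t)) (tsrc X (ttgt X t))" "teq X i (ttgt X (tsrc X t)) (ttgt X (ttgt X t))"
    "teq X i (tsrc X (tsrc X u)) (tsrc X (ttgt X u))" "teq X i (ttgt X (tsrc X u)) (ttgt X (ttgt X u))"
    using t u nm i unfolding globt_def by auto
   show ?thesis using teq.trans[OF teq.trans[OF b(3) teq.sym[OF a(1)]] b(1)]
    teq.trans[OF teq.trans[OF b(4) teq.sym[OF a(2)]] b(2)] by blast
  qed
  thus ?thesis using wf st True nm dt unfolding globt_def by auto
 next
  case False
  hence km: "k < m" using k nm by simp
  note ms = match_src[OF t[unfolded nm] u[unfolded nm] mN km m[unfolded nm]]
  have w1: "teq X m (Comp k (tsrc X t) (tsrc X u)) (Comp k (tsrc X t) (tsrc X u))"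
   using st km ms by (auto intro: teq.cmp)
  have w2: "teq X m (Comp k (ttgt X t) (ttgt X u)) (Comp k (ttgt X t) (ttgt X u))"
   using st km ms by (auto intro: teq.cmp)
  have "teq X i (tsrc X (Comp k (tsrc X t) (tsrc X u))) (tsrc X (Comp k (ttgt X t) (ttgt X u))) \<and>
    teq X i (ttgt X (Comp k (tsrc X t) (tsrc X u))) (ttgt X (Comp k (ttgt X t) (ttgt X u)))"
   if i: "m = Suc i" for i
  proof -
   have iN: "i < N" using i mN by simp
   have g: "teq X i (tsrc X (tsrc X t)) (tsrc X (ttgt X t))" "teq X i (ttgt X (tsrc X t)) (ttgt X (ttgt X t))"
    "teq X i (tsrc X (tsrc X u)) (tsrc X (ttgt X u))" "teq X i (ttgt X (tsrc X u)) (ttgt X (ttgt X u))"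
    using t u nm i unfolding globt_def by blast+
   show ?thesis
   proof (cases "k = i")
    case True
    thus ?thesis using g i dst by simp
   next
    case False
    hence ki: "k < i" using km i by simp
    note gs = globt_sub[OF t[unfolded nm] mN] globt_sub[OF u[unfolded nm] mN]
    have "fits X i k (tsrc X (tsrc X t)) (tsrc X (tsrc X u))"
     "fits X i k (ttgt X (tsrc X t)) (ttgt X (tsrc X u))"
     using match_src[OF gs(1)[unfolded i] gs(3)[unfolded i] iN ki] ms(1)[unfolded i] by auto
    thus ?thesis using False g i dst ki by (auto intro: teq.cmp)
   qed
  qed
  thus ?thesis using wf w1 w2 nm False dt unfolding globt_def by auto
 qed
qed

private lemma bdeq_cmp:
 assumes t: "bdeq X n t t'" and u: "bdeq X n u u'" and n: "n \<le> N" and k: "k < n"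
  and m: "fits X n k t u"
 shows "bdeq X n (Comp k t u) (Comp k t' u')"
proof -
 obtain m where nm: "n = Suc m" using k by (cases n) auto
 have mN: "m < N" using nm n by simp
 have g: "globt X n t" "globt X n u" "globt X n t'" "globt X n u'" using t u unfolding bdeq_def by auto
 have dt: "tdim t = n" "tdim t' = n" using g teq_tdim unfolding globt_def by blast+
 have st: "teq X m (tsrc X t) (tsrc X t')" "teq X m (ttgt X t) (ttgt X t')"
   "teq X m (tsrc X u) (tsrc X u')" "teq X m (ttgt X u) (ttgt X u')"
  using t u nm unfolding bdeq_def by auto
 have m': "fits X n k t' u'"
 proof -
  have "teq X k ((tsrc X ^^ (n - k)) t) ((tsrc X ^^ (n - k)) t')"
   using src_powk[OF mN st(1), of k] k nm by (simp add: funpow_Suc_diff)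
  moreover have "teq X k ((ttgt X ^^ (n - k)) u) ((ttgt X ^^ (n - k)) u')"
   using tgt_powk[OF mN st(4), of k] k nm by (simp add: funpow_Suc_diff)
  ultimately show ?thesis using m by (meson teq.sym teq.trans)
 qed
 have "teq X m (tsrc X (Comp k t u)) (tsrc X (Comp k t' u')) \<and> teq X m (ttgt X (Comp k t u)) (ttgt X (Comp k t' u'))"
 proof (cases "k = m")
  case True
  thus ?thesis using nm dt st by simp
 next
  case False
  hence km: "k < m" using k nm by simp
  note ms = match_src[OF g(1,2)[unfolded nm] mN km m[unfolded nm]]
  show ?thesis using st km ms False dt nm by (auto intro: teq.cmp)
 qed
 thus ?thesis using globt_Comp[OF g(1,2) n k m] globt_Comp[OF g(3,4) n k m'] nm unfolding bdeq_def by auto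
qed

private lemma bdeq_refl: "globt X n t ==> bdeq X n t t"
 unfolding bdeq_def globt_def by blast

text \<open>As long as the dimension stays above k, taking faces distributes over
  \<open>Comp k\<close> literally, not only up to \<open>teq\<close>. Composability of the faces is
  carried along to keep the induction going.\<close>

private lemma src_Comp_pow:
 assumes "tdim t = n" "tdim u = n" "globt X n t" "globt X n u" "n \<le> N" "k < i" "i \<le> n"
  and "fits X n k t u"
 shows "(tsrc X ^^ (n - i)) (Comp k t u) = Comp k ((tsrc X ^^ (n - i)) t) ((tsrc X ^^ (n - i)) u) \<and>
  (ttgt X ^^ (n - i)) (Comp k t u) = Comp k ((ttgt X ^^ (n - i)) t) ((ttgt X ^^ (n - i)) u)"
 using assms
proof (induction "n - i" arbitrary: n t u)
 case 0
 thus ?case by simp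
next
 case (Suc l)
 then obtain m where nm: "n = Suc m" by (cases n) auto
 have i: "i \<le> m" "l = m - i" and km: "k < m" and mN: "m < N" and mN': "m \<le> N" using Suc nm by auto
 note ms = match_src[OF Suc(5,6)[unfolded nm] mN km Suc(10)[unfolded nm]]
 note gs = globt_sub[OF Suc(5)[unfolded nm] mN] globt_sub[OF Suc(6)[unfolded nm] mN]
 have d: "tdim (tsrc X t) = m" "tdim (ttgt X t) = m" "tdim (tsrc X u) = m" "tdim (ttgt X u) = m"
  using gs teq_tdim unfolding globt_def by blast+
 have "Suc k \<noteq> tdim t" using km nm Suc by simp
 thus ?case
  using Suc(1)[OF i(2) d(1,3) gs(1,3) mN' Suc(8) i(1) ms(1)] Suc(1)[OF i(2) d(2,4) gs(2,4) mN' Suc(8) i(1) ms(2)] i nm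
  by (simp add: funpow_Suc_diff)
qed

lemma src_Comp_below:
 assumes "globt X n t" "globt X n u" "n \<le> N" "j \<le> k" "k < n"
  and "fits X n k t u"
 shows "(tsrc X ^^ (n - j)) (Comp k t u) = (tsrc X ^^ (n - j)) u"
  "(ttgt X ^^ (n - j)) (Comp k t u) = (ttgt X ^^ (n - j)) t"
proof -
 have d: "tdim t = n" "tdim u = n" using assms teq_tdim unfolding globt_def by blast+
 have p: "(tsrc X ^^ (n - Suc k)) (Comp k t u) = Comp k ((tsrc X ^^ (n - Suc k)) t) ((tsrc X ^^ (n - Suc k)) u)"
  "(ttgt X ^^ (n - Suc k)) (Comp k t u) = Comp k ((ttgt X ^^ (n - Suc k)) t) ((ttgt X ^^ (n - Suc k)) u)"
  using src_Comp_pow[OF d assms(1-3) lessI _ assms(6)] assms(5) by auto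
 \<comment> \<open>n - Suc k steps inside both factors down to dimension k + 1, one step that drops
   \<open>Comp k\<close> and keeps one factor, and k - j steps inside that factor.\<close>
 have eq: "n - j = (k - j) + (1 + (n - Suc k))" using assms by simp
 have "tdim ((tsrc X ^^ (n - Suc k)) t) = Suc k"
 proof (cases "Suc k = n")
  case False
  obtain m where nm: "n = Suc m" using assms by (cases n) auto
  have "teq X m (tsrc X t) (tsrc X t)" using assms nm unfolding globt_def by auto
  from src_powk[OF _ this, of "Suc k"] have "tdim ((tsrc X ^^ (m - Suc k)) (tsrc X t)) = Suc k"
   using nm assms False teq_tdim by auto
  moreover have "Suc k \<le> m" using nm assms False by simp
  ultimately show ?thesis unfolding nm by (subst funpow_Suc_diff) auto
 qed (use d in auto)
 moreover have "tdim ((ttgt X ^^ (n - Suc k)) t) = Suc k" using d assms by (simp add: tdim_ttgt_pow)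
 ultimately have "tsrc X ((tsrc X ^^ (n - Suc k)) (Comp k t u)) = tsrc X ((tsrc X ^^ (n - Suc k)) u)"
  "ttgt X ((ttgt X ^^ (n - Suc k)) (Comp k t u)) = ttgt X ((ttgt X ^^ (n - Suc k)) t)"
  unfolding p by simp_all
 moreover have "(f ^^ (n - j)) z = (f ^^ (k - j)) (f ((f ^^ (n - Suc k)) z))" for f :: "'a trm => 'a trm" and z
  unfolding eq funpow_add by simp
 ultimately show "(tsrc X ^^ (n - j)) (Comp k t u) = (tsrc X ^^ (n - j)) u"
  "(ttgt X ^^ (n - j)) (Comp k t u) = (ttgt X ^^ (n - j)) t"
  by simp_all
qed

private lemma top_src_pow:
 assumes "bdeq X n t u" "n \<le> N" "k < n"
 shows "teq X k ((tsrc X ^^ (n - k)) t) ((tsrc X ^^ (n - k)) u)"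
  "teq X k ((ttgt X ^^ (n - k)) t) ((ttgt X ^^ (n - k)) u)"
proof -
 obtain m where nm: "n = Suc m" using assms by (cases n) auto
 show "teq X k ((tsrc X ^^ (n - k)) t) ((tsrc X ^^ (n - k)) u)"
  "teq X k ((ttgt X ^^ (n - k)) t) ((ttgt X ^^ (n - k)) u)"
  using assms nm src_powk[of m "tsrc X t" _ k] tgt_powk[of m "ttgt X t" _ k]
  unfolding bdeq_def by (auto simp: funpow_Suc_diff)
qed

text \<open>One of the two faces of t gets composed with the identity on a k-boundary of t, whereas
  the unit law for that face wants the k-boundary of the face itself. Globularity identifies the
  two, and iterated identities respect equality.\<close>

private lemma unit_bdeq:
 assumes t: "globt X n t" and n: "n \<le> N" and k: "k < n"
 shows "bdeq X n (Comp k t ((Idt ^^ (n - k)) ((tsrc X ^^ (n - k)) t))) t"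
  and "bdeq X n (Comp k ((Idt ^^ (n - k)) ((ttgt X ^^ (n - k)) t)) t) t"
proof -
 obtain m where nm: "n = Suc m" using k by (cases n) auto
 have mN: "m < N" using nm n by simp
 have dt: "tdim t = n" using t teq_tdim unfolding globt_def by blast
 let ?x = "(tsrc X ^^ (n - k)) t" let ?y = "(ttgt X ^^ (n - k)) t"
 have st: "teq X m (tsrc X t) (tsrc X t)" "teq X m (ttgt X t) (ttgt X t)" using t nm unfolding globt_def by auto
 have x: "teq X k ?x ?x" "teq X k ?y ?y" using top_src_pow[OF bdeq_refl[OF t] n k] by auto
 have kN: "k < N" using k n by simp
 have gx: "globt X n ((Idt ^^ (n - k)) ?x)" "globt X n ((Idt ^^ (n - k)) ?y)"
  using globt_Idt_pow[OF IH_globt[OF kN x(1)], of "n - k"] globt_Idt_pow[OF IH_globt[OF kN x(2)], of "n - k"] k by auto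
 have d: "tdim ((Idt ^^ (n - k)) ?x) = n" "tdim ((Idt ^^ (n - k)) ?y) = n" using gx teq_tdim unfolding globt_def by blast+
 have g: "globt X n (Comp k t ((Idt ^^ (n - k)) ?x))" "globt X n (Comp k ((Idt ^^ (n - k)) ?y) t)"
  using globt_Comp[OF t gx(1) n k] globt_Comp[OF gx(2) t n k] x by (simp_all add: tsrc_Idt_pow ttgt_Idt_pow)
 have e: "(Idt ^^ (n - k)) z = Idt ((Idt ^^ (m - k)) z)" for z :: "'a trm" using nm k by (simp add: Suc_diff_le)
 have "teq X m (tsrc X (Comp k t ((Idt ^^ (n - k)) ?x))) (tsrc X t) \<and> teq X m (ttgt X (Comp k t ((Idt ^^ (n - k)) ?x))) (ttgt X t)"
 proof (cases "k = m")
  case True thus ?thesis using st nm dt by simp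
 next
  case False
  hence km: "k < m" using k nm by simp
  have 1: "teq X m (Comp k (tsrc X t) ((Idt ^^ (m - k)) ?x)) (tsrc X t)"
   using teq.unit_src[OF st(1) km] nm km by (simp add: funpow_Suc_diff)
  let ?z = "(tsrc X ^^ (m - k)) (ttgt X t)"
  have zx: "teq X k ?z ?x" using face_st[OF t[unfolded nm] mN km] nm km by (simp add: funpow_Suc_diff)
  have "teq X m ((Idt ^^ (m - k)) ?z) ((Idt ^^ (m - k)) ?x)" using teq_Idt_pow[OF zx, of "m - k"] km by simp
  hence "teq X m (Comp k (ttgt X t) ((Idt ^^ (m - k)) ?x)) (Comp k (ttgt X t) ((Idt ^^ (m - k)) ?z))"
   using st(2) km zx by (auto intro!: teq.cmp intro: teq.sym simp: ttgt_Idt_pow)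
  hence "teq X m (Comp k (ttgt X t) ((Idt ^^ (m - k)) ?x)) (ttgt X t)"
   using teq.unit_src[OF st(2) km] by (blast intro: teq.trans)
  thus ?thesis unfolding e using 1 False dt nm by simp
 qed
 thus "bdeq X n (Comp k t ((Idt ^^ (n - k)) ((tsrc X ^^ (n - k)) t))) t"
  using g t nm unfolding bdeq_def by simp
 have "teq X m (tsrc X (Comp k ((Idt ^^ (n - k)) ?y) t)) (tsrc X t) \<and> teq X m (ttgt X (Comp k ((Idt ^^ (n - k)) ?y) t)) (ttgt X t)"
 proof (cases "k = m")
  case True thus ?thesis using st nm d by simp
 next
  case False
  hence km: "k < m" using k nm by simp
  have 1: "teq X m (Comp k ((Idt ^^ (m - k)) ?y) (ttgt X t)) (ttgt X t)"
   using teq.unit_tgt[OF st(2) km] nm km by (simp add: funpow_Suc_diff)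
  let ?z = "(ttgt X ^^ (m - k)) (tsrc X t)"
  have zx: "teq X k ?z ?y" using face_ts[OF t[unfolded nm] mN km] nm km by (simp add: funpow_Suc_diff)
  have "teq X m ((Idt ^^ (m - k)) ?z) ((Idt ^^ (m - k)) ?y)" using teq_Idt_pow[OF zx, of "m - k"] km by simp
  hence "teq X m (Comp k ((Idt ^^ (m - k)) ?y) (tsrc X t)) (Comp k ((Idt ^^ (m - k)) ?z) (tsrc X t))"
   using st(1) km zx by (auto intro!: teq.cmp intro: teq.sym simp: tsrc_Idt_pow)
  hence "teq X m (Comp k ((Idt ^^ (m - k)) ?y) (tsrc X t)) (tsrc X t)"
   using teq.unit_tgt[OF st(1) km] by (blast intro: teq.trans)
  thus ?thesis unfolding e using 1 False d[unfolded e] nm by simp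
 qed
 thus "bdeq X n (Comp k ((Idt ^^ (n - k)) ?y) t) t"
  using g t nm unfolding bdeq_def by simp
qed

private lemma assoc_bdeq:
 assumes t: "globt X n t" and u: "globt X n u" and v: "globt X n v" and n: "n \<le> N" and k: "k < n"
  and tu: "fits X n k t u"
  and uv: "fits X n k u v"
 shows "bdeq X n (Comp k (Comp k t u) v) (Comp k t (Comp k u v))"
proof -
 obtain m where nm: "n = Suc m" using k by (cases n) auto
 have mN: "m < N" using nm n by simp
 have d: "tdim t = n" "tdim u = n" "tdim v = n" using t u v teq_tdim unfolding globt_def by blast+
 have gtu: "globt X n (Comp k t u)" and guv: "globt X n (Comp k u v)"
  using globt_Comp[OF t u n k tu] globt_Comp[OF u v n k uv] .
 note e = src_Comp_below[OF t u n order_refl k tu] src_Comp_below[OF u v n order_refl k uv]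
 have g: "globt X n (Comp k (Comp k t u) v)" "globt X n (Comp k t (Comp k u v))"
  using globt_Comp[OF gtu v n k] globt_Comp[OF t guv n k] e tu uv by simp_all
 have s: "teq X m (tsrc X t) (tsrc X t)" "teq X m (ttgt X t) (ttgt X t)" "teq X m (tsrc X u) (tsrc X u)"
   "teq X m (ttgt X u) (ttgt X u)" "teq X m (tsrc X v) (tsrc X v)" "teq X m (ttgt X v) (ttgt X v)"
  using t u v nm unfolding globt_def by auto
 have "teq X m (tsrc X (Comp k (Comp k t u) v)) (tsrc X (Comp k t (Comp k u v))) \<and>
   teq X m (ttgt X (Comp k (Comp k t u) v)) (ttgt X (Comp k t (Comp k u v)))"
 proof (cases "k = m")
  case True thus ?thesis using s nm d by simp
 next
  case False
  hence km: "k < m" using k nm by simp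
  note ms = match_src[OF t[unfolded nm] u[unfolded nm] mN km tu[unfolded nm]]
   match_src[OF u[unfolded nm] v[unfolded nm] mN km uv[unfolded nm]]
  show ?thesis using False d nm s km ms by (auto intro!: teq.assoc)
 qed
 thus ?thesis using g nm unfolding bdeq_def by simp
qed

text \<open>Iterated globularity: below dimension k it does not matter whether one descends through
  the k-target or through sources only.\<close>

private lemma src_mid:
 assumes "globt X n u" "n \<le> N" "k < n" "j < k"
 shows "teq X j ((tsrc X ^^ (n - j)) u) ((tsrc X ^^ (k - j)) ((ttgt X ^^ (n - k)) u))"
 using assms
proof (induction n arbitrary: u)
 case (Suc m)
 have mN: "m < N" and jm: "j < m" and km: "k \<le> m" using Suc by auto
 have f: "teq X j ((tsrc X ^^ (Suc m - j)) u) ((tsrc X ^^ (m - j)) (ttgt X u))"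
  using face_st[OF Suc(2) mN jm] jm by (auto simp: funpow_Suc_diff intro: teq.sym)
 show ?case
 proof (cases "k = m")
  case True thus ?thesis using f by simp
 next
  case False
  hence "teq X j ((tsrc X ^^ (m - j)) (ttgt X u)) ((tsrc X ^^ (k - j)) ((ttgt X ^^ (m - k)) (ttgt X u)))"
   using Suc(1)[OF globt_sub(2)[OF Suc(2) mN]] mN km Suc by simp
  thus ?thesis using f km by (auto simp: funpow_Suc_diff intro: teq.trans)
 qed
qed simp

private lemma match_pow:
 assumes "globt X n t" "globt X n v" "n \<le> N" "k \<le> n" "j < k"
  and "fits X n j t v"
 shows "fits X k j ((tsrc X ^^ (n - k)) t) ((tsrc X ^^ (n - k)) v)"
 using assms
proof (induction n arbitrary: t v)
 case (Suc m)
 show ?case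
 proof (cases "k = Suc m")
  case True thus ?thesis using Suc by simp
 next
  case False
  hence mN: "m < N" and jm: "j < m" and km: "k \<le> m" using Suc by auto
  note ms = match_src[OF Suc(2,3) mN jm Suc(7)]
  note gs = globt_sub[OF Suc(2) mN] globt_sub[OF Suc(3) mN]
  show ?thesis using Suc(1)[OF gs(1,3) _ km Suc(6) ms(1)] mN km by (simp add: funpow_Suc_diff)
 qed
qed simp

text \<open>The rule for interchange only demands composability of the four factors. That the outer
  composites can be formed is derived: the first by sliding the j-source across the k-boundary
  shared by t and u, the second by composing k-faces along j.\<close>

lemma interchange_match:
 assumes t: "globt X n t" and u: "globt X n u" and v: "globt X n v" and w: "globt X n w"
  and n: "n \<le> N" and j: "j < k" and k: "k < n"
  and tu: "fits X n k t u"
  and vw: "fits X n k v w"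
  and tv: "fits X n j t v"
  and uw: "fits X n j u w"
 shows "fits X n j (Comp k t u) (Comp k v w)"
  and "fits X n k (Comp j t v) (Comp j u w)"
proof -
 obtain m where nm: "n = Suc m" using k by (cases n) auto
 have mN: "m < N" using nm n by simp
 have jn: "j < n" and kN: "k < N" using j k n by auto
 have d: "tdim t = n" "tdim u = n" "tdim v = n" "tdim w = n" using t u v w teq_tdim unfolding globt_def by blast+
 have gc: "globt X n (Comp k t u)" "globt X n (Comp k v w)" "globt X n (Comp j t v)" "globt X n (Comp j u w)"
  using globt_Comp[OF t u n k tu] globt_Comp[OF v w n k vw] globt_Comp[OF t v n jn tv] globt_Comp[OF u w n jn uw] .
 have jk: "j \<le> k" using j by simp
 note e = src_Comp_below[OF t u n jk k tu] src_Comp_below[OF v w n jk k vw]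
 have pw: "(f ^^ (n - j)) z = (f ^^ (k - j)) ((f ^^ (n - k)) z)" for f :: "'a trm => 'a trm" and z
 proof -
  have "n - j = (k - j) + (n - k)" using j k by simp
  thus ?thesis by (simp add: funpow_add)
 qed
 show "fits X n j (Comp k t u) (Comp k v w)"
 proof -
  let ?a = "(tsrc X ^^ (n - k)) t" let ?b = "(ttgt X ^^ (n - k)) u"
  have "teq X j ((tsrc X ^^ (k - j)) ?a) ((tsrc X ^^ (k - j)) ?b)" using src_powk[OF kN tu jk] .
  moreover have "teq X j ((tsrc X ^^ (k - j)) ?b) ((tsrc X ^^ (n - j)) u)"
   using src_mid[OF u n k j] by (rule teq.sym)
  ultimately have "teq X j ((tsrc X ^^ (n - j)) t) ((tsrc X ^^ (n - j)) u)" unfolding pw[of _ t] by (rule teq.trans)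
  hence "fits X n j u v" using tv by (blast intro: teq.trans teq.sym)
  thus ?thesis using e by simp
 qed
 show "fits X n k (Comp j t v) (Comp j u w)"
 proof -
  have 1: "(tsrc X ^^ (n - k)) (Comp j t v) = Comp j ((tsrc X ^^ (n - k)) t) ((tsrc X ^^ (n - k)) v)"
   "(ttgt X ^^ (n - k)) (Comp j u w) = Comp j ((ttgt X ^^ (n - k)) u) ((ttgt X ^^ (n - k)) w)"
   using src_Comp_pow[OF d(1,3) t v n j] src_Comp_pow[OF d(2,4) u w n j] tv uw k by auto
  have "fits X k j ((tsrc X ^^ (n - k)) t) ((tsrc X ^^ (n - k)) v)"
   using match_pow[OF t v n _ j tv] k by simp
  thus ?thesis unfolding 1 using tu vw j by (auto intro: teq.cmp)
 qed
qed

private lemma interchange_bdeq: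
 assumes t: "globt X n t" and u: "globt X n u" and v: "globt X n v" and w: "globt X n w"
  and n: "n \<le> N" and j: "j < k" and k: "k < n"
  and tu: "fits X n k t u"
  and vw: "fits X n k v w"
  and tv: "fits X n j t v"
  and uw: "fits X n j u w"
 shows "bdeq X n (Comp j (Comp k t u) (Comp k v w)) (Comp k (Comp j t v) (Comp j u w))"
proof -
 obtain m where nm: "n = Suc m" using k by (cases n) auto
 have mN: "m < N" using nm n by simp
 have jn: "j < n" and kN: "k < N" using j k n by auto
 have d: "tdim t = n" "tdim u = n" "tdim v = n" "tdim w = n" using t u v w teq_tdim unfolding globt_def by blast+
 have gc: "globt X n (Comp k t u)" "globt X n (Comp k v w)" "globt X n (Comp j t v)" "globt X n (Comp j u w)"
  using globt_Comp[OF t u n k tu] globt_Comp[OF v w n k vw] globt_Comp[OF t v n jn tv] globt_Comp[OF u w n jn uw] .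
 have jk: "j \<le> k" using j by simp
 note e = src_Comp_below[OF t u n jk k tu] src_Comp_below[OF v w n jk k vw]
 have pw: "(f ^^ (n - j)) z = (f ^^ (k - j)) ((f ^^ (n - k)) z)" for f :: "'a trm => 'a trm" and z
 proof -
  have "n - j = (k - j) + (n - k)" using j k by simp
  thus ?thesis by (simp add: funpow_add)
 qed
 note m1 = interchange_match(1)[OF assms] and x = interchange_match(2)[OF assms]
 have g: "globt X n (Comp j (Comp k t u) (Comp k v w))" "globt X n (Comp k (Comp j t v) (Comp j u w))"
  using globt_Comp[OF gc(1,2) n jn m1] globt_Comp[OF gc(3,4) n k x] .
 have jm: "j < m" using j k nm by simp
 note mj = match_src[OF t[unfolded nm] v[unfolded nm] mN jm tv[unfolded nm]]
  match_src[OF u[unfolded nm] w[unfolded nm] mN jm uw[unfolded nm]]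
 have s: "teq X m (tsrc X t) (tsrc X t)" "teq X m (ttgt X t) (ttgt X t)" "teq X m (tsrc X u) (tsrc X u)"
   "teq X m (ttgt X u) (ttgt X u)" "teq X m (tsrc X v) (tsrc X v)" "teq X m (ttgt X v) (ttgt X v)"
   "teq X m (tsrc X w) (tsrc X w)" "teq X m (ttgt X w) (ttgt X w)"
  using t u v w nm unfolding globt_def by auto
 have "teq X m (tsrc X (Comp j (Comp k t u) (Comp k v w))) (tsrc X (Comp k (Comp j t v) (Comp j u w))) \<and>
   teq X m (ttgt X (Comp j (Comp k t u) (Comp k v w))) (ttgt X (Comp k (Comp j t v) (Comp j u w)))"
 proof (cases "k = m")
  case True
  thus ?thesis using s d nm jm mj by (auto intro: teq.cmp)
 next
  case False
  hence km: "k < m" using k nm by simp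
  note ms = match_src[OF t[unfolded nm] u[unfolded nm] mN km tu[unfolded nm]]
   match_src[OF v[unfolded nm] w[unfolded nm] mN km vw[unfolded nm]]
  show ?thesis using False jm d nm s km ms mj j by (auto intro!: teq.interchange)
 qed
 thus ?thesis using g nm unfolding bdeq_def by simp
qed

text \<open>The rule induction supplies the claim for premises of the same dimension. Premises about
  boundaries, and those of the two rules that form identities, fall to the hypothesis on smaller
  dimensions.\<close>

lemma bdeq_step:
 assumes X: "is_ograph X" and "teq X n t u" "n \<le> N"
 shows "bdeq X n t u"
 using assms(2,3)
proof (induction rule: teq.induct)
 case (gen x n)
 have "teq X m (Gen m (src X m x)) (Gen m (src X m x)) \<and> teq X m (Gen m (tgt X m x)) (Gen m (tgt X m x))"
  if "n = Suc m" for m using gen X that unfolding is_ograph_def by (auto intro: teq.gen)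
 moreover have "teq X m (Gen m (src X m (src X (Suc m) x))) (Gen m (src X m (tgt X (Suc m) x))) \<and>
   teq X m (Gen m (tgt X m (src X (Suc m) x))) (Gen m (tgt X m (tgt X (Suc m) x)))"
  if "n = Suc (Suc m)" for m using gen X that unfolding is_ograph_def by (auto intro!: teq.gen)
 ultimately show ?case using gen unfolding bdeq_def globt_def by (auto intro: teq.gen)
next
 case (idt n t t')
 hence b: "bdeq X n t t'" using IH[of n t t'] by simp
 hence "globt X (Suc n) (Idt t)" "globt X (Suc n) (Idt t')" using globt_Idt unfolding bdeq_def by blast+
 thus ?case using idt.hyps(1) unfolding bdeq_def by simp
next
 case (cmp n t t' u u' k)
 show ?case by (rule bdeq_cmp) (use cmp in auto)
next
 case (sym n t u)
 thus ?case using bdeq_sym by blast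
next
 case (trans n t u v)
 thus ?case using bdeq_trans by blast
next
 case (assoc n t u v k)
 show ?case by (rule assoc_bdeq) (use assoc in \<open>auto simp: bdeq_def\<close>)
next
 case (unit_src n t k)
 show ?case by (rule unit_bdeq(1)) (use unit_src in \<open>auto simp: bdeq_def\<close>)
next
 case (unit_tgt n t k)
 show ?case by (rule unit_bdeq(2)) (use unit_tgt in \<open>auto simp: bdeq_def\<close>)
next
 case (interchange n t u v w j k)
 show ?case by (rule interchange_bdeq) (use interchange in \<open>auto simp: bdeq_def\<close>)
next
 case (idt_cmp n t u k)
 have nN: "n < N" and k: "k < n" using \<open>Suc n \<le> N\<close> \<open>k < n\<close> by auto
 have w: "teq X n t t" "teq X n u u" by fact+
 have m0: "fits X n k t u" by fact
 have g: "globt X n t" "globt X n u" using IH_globt[OF nN w(1)] IH_globt[OF nN w(2)] by auto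
 have m: "fits X (Suc n) k (Idt t) (Idt u)"
  using m0 k by (subst (1 2) funpow_Suc_diff) auto
 have c: "globt X n (Comp k t u)" using globt_Comp[OF g less_imp_le[OF nN] k m0] .
 have "globt X (Suc n) (Comp k (Idt t) (Idt u))"
  using globt_Comp[OF globt_Idt[OF g(1)] globt_Idt[OF g(2)] _ _ m] k nN by simp
 moreover have "tsrc X (Comp k (Idt t) (Idt u)) = Comp k t u" "ttgt X (Comp k (Idt t) (Idt u)) = Comp k t u"
  using k teq_tdim[OF w(1)] by auto
 ultimately show ?case using globt_Idt[OF c] c unfolding bdeq_def by (auto simp: globt_def)
qed

end

lemma teq_bdeq: "is_ograph X ==> teq X n t u ==> bdeq X n t u"
proof (induction n arbitrary: t u rule: less_induct)
 case (less n)
 thus ?case using bdeq_step[of n X n t u] by blast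
qed

lemma teq_tsrc: "is_ograph X ==> teq X (Suc n) t u ==> teq X n (tsrc X t) (tsrc X u)"
 and teq_ttgt: "is_ograph X ==> teq X (Suc n) t u ==> teq X n (ttgt X t) (ttgt X u)"
 using teq_bdeq unfolding bdeq_def by blast+

lemma teq_glob:
 assumes "is_ograph X" "teq X (Suc (Suc n)) t t"
 shows "teq X n (tsrc X (tsrc X t)) (tsrc X (ttgt X t))" "teq X n (ttgt X (tsrc X t)) (ttgt X (ttgt X t))"
 using teq_bdeq[OF assms] unfolding bdeq_def globt_def by auto

lemma teq_src_pow: "is_ograph X ==> teq X n t u ==> k \<le> n ==> teq X k ((tsrc X ^^ (n - k)) t) ((tsrc X ^^ (n - k)) u)"
 and teq_tgt_pow: "is_ograph X ==> teq X n t u ==> k \<le> n ==> teq X k ((ttgt X ^^ (n - k)) t) ((ttgt X ^^ (n - k)) u)"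
proof (induction n arbitrary: t u)
 case (Suc n)
 { case 1 thus ?case using Suc(1)[OF 1(1) teq_tsrc[OF 1(1,2)]] by (cases "k = Suc n") (auto simp: funpow_Suc_diff) }
 { case 2 thus ?case using Suc(2)[OF 2(1) teq_ttgt[OF 2(1,2)]] by (cases "k = Suc n") (auto simp: funpow_Suc_diff) }
qed auto

lemma teq_match_src:
 assumes "is_ograph X" "teq X (Suc m) t t" "teq X (Suc m) u u" "k < m"
  and "fits X (Suc m) k t u"
 shows "fits X m k (tsrc X t) (tsrc X u)"
  and "fits X m k (ttgt X t) (ttgt X u)"
proof -
 have g: "globt X (Suc m) t" "globt X (Suc m) u" using teq_bdeq[OF assms(1)] assms(2,3) unfolding bdeq_def by blast+
 show "fits X m k (tsrc X t) (tsrc X u)"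
  "fits X m k (ttgt X t) (ttgt X u)"
  using match_src[OF teq_bdeq[OF assms(1)] g lessI assms(4,5)] by simp_all
qed

lemma teq_interchange_match:
 assumes "is_ograph X" "teq X n t t" "teq X n u u" "teq X n v v" "teq X n w w" "j < k" "k < n"
  and "fits X n k t u"
  and "fits X n k v w"
  and "fits X n j t v"
  and "fits X n j u w"
 shows "fits X n j (Comp k t u) (Comp k v w)"
  and "fits X n k (Comp j t v) (Comp j u w)"
proof -
 have g: "globt X n t" "globt X n u" "globt X n v" "globt X n w"
  using teq_bdeq[OF assms(1)] assms(2-5) unfolding bdeq_def by blast+
 show "fits X n j (Comp k t u) (Comp k v w)"
  "fits X n k (Comp j t v) (Comp j u w)"
  using interchange_match[OF teq_bdeq[OF assms(1)] g order_refl assms(6-11)] by simp_all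
qed

lemma teq_src_Comp:
 assumes "is_ograph X" "teq X n t t" "teq X n u u" "k < n"
  and "fits X n k t u"
 shows "(tsrc X ^^ (n - k)) (Comp k t u) = (tsrc X ^^ (n - k)) u"
  "(ttgt X ^^ (n - k)) (Comp k t u) = (ttgt X ^^ (n - k)) t"
proof -
 have g: "globt X n t" "globt X n u" using teq_bdeq[OF assms(1)] assms(2,3) unfolding bdeq_def by blast+
 show "(tsrc X ^^ (n - k)) (Comp k t u) = (tsrc X ^^ (n - k)) u"
  "(ttgt X ^^ (n - k)) (Comp k t u) = (ttgt X ^^ (n - k)) t"
  using src_Comp_below[OF teq_bdeq[OF assms(1)] g order_refl order_refl assms(4,5)] by simp_all
qed

section \<open>Substitution into terms, and the monad on classes\<close>

primrec tlv :: "'a trm => (nat \<times> 'a) set" where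
 "tlv (Gen n x) = {(n, x)}"
| "tlv (Idt t) = tlv t"
| "tlv (Comp k t u) = tlv t \<union> tlv u"

text \<open>Substitution of terms for generators. The functor action \<open>tmap\<close> and the
  multiplication \<open>tflat\<close> are both instances, so that one congruence theorem serves them
  all.\<close>

primrec tbind :: "(nat => 'a => 'b trm) => 'a trm => 'b trm" where
 "tbind phi (Gen n x) = phi n x"
| "tbind phi (Idt t) = Idt (tbind phi t)"
| "tbind phi (Comp k t u) = Comp k (tbind phi t) (tbind phi u)"

lemma tlv_ne: "tlv t \<noteq> {}"
 by (induction t) auto

lemma finite_tlv: "finite (tlv t)"
 by (induction t) auto

lemma tlv_Idt_pow: "tlv ((Idt ^^ j) t) = tlv t"
 by (induction j) auto

lemma tbind_Idt_pow: "tbind phi ((Idt ^^ j) t) = (Idt ^^ j) (tbind phi t)"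
 by (induction j) auto

lemma tmap_tbind: "tmap f t = tbind (%n x. Gen n (f n x)) t"
 by (induction t) auto

lemma tflat_tbind: "tflat t = tbind (%_ K. SOME t. t \<in> K) t"
 by (induction t) auto

lemma tbind_tmap: "tbind phi (tmap f t) = tbind (%n x. phi n (f n x)) t"
 by (induction t) auto

lemma tmap_tbind2: "tmap f (tbind phi t) = tbind (%n x. tmap f (phi n x)) t"
 by (induction t) auto

lemma tbind_tbind: "tbind psi (tbind phi t) = tbind (%n x. tbind psi (phi n x)) t"
 by (induction t) auto

lemma tmap_tmap: "tmap g (tmap f t) = tmap (%n x. g n (f n x)) t"
 by (induction t) auto

lemma tmap_leaf_cong: "(!!k x. (k, x) \<in> tlv t ==> f k x = g k x) ==> tmap f t = tmap g t"
 by (induction t) auto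

lemma tmap_ident: "(!!k x. (k, x) \<in> tlv t ==> f k x = x) ==> tmap f t = t"
 by (induction t) auto

lemma tlv_tmap: "tlv (tmap f t) = (%(k, x). (k, f k x)) ` tlv t"
 by (induction t) auto

text \<open>The unit laws introduce an identity on an iterated boundary, which is no subterm of the
  premise but has smaller dimension; hence the outer induction on dimension.\<close>

lemma teq_leaves:
 assumes X: "is_ograph X"
 shows "teq X n t u ==> \<forall>(k, x)\<in>tlv t \<union> tlv u. x \<in> cell X k \<and> k \<le> n"
proof (induction n arbitrary: t u rule: less_induct)
 case (less N)
 have "teq X n t u ==> n \<le> N ==> \<forall>(k, x)\<in>tlv t \<union> tlv u. x \<in> cell X k \<and> k \<le> n" for n t u
 proof (induction rule: teq.induct)
  case (unit_src n t k)
  have "teq X k ((tsrc X ^^ (n - k)) t) ((tsrc X ^^ (n - k)) t)"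
   using teq_src_pow[OF X unit_src(1), of k] unit_src(2) by simp
  thus ?case using less(1)[of k] unit_src by (fastforce simp: tlv_Idt_pow)
 next
  case (unit_tgt n t k)
  have "teq X k ((ttgt X ^^ (n - k)) t) ((ttgt X ^^ (n - k)) t)"
   using teq_tgt_pow[OF X unit_tgt(1), of k] unit_tgt(2) by simp
  thus ?case using less(1)[of k] unit_tgt by (fastforce simp: tlv_Idt_pow)
 qed (auto simp: le_Suc_eq)
 thus ?case using less(2) by blast
qed

lemma teq_leaf: "is_ograph X ==> teq X n t t ==> (k, x) \<in> tlv t ==> x \<in> cell X k"
 using teq_leaves by fastforce

text \<open>A map of omega-graphs from X to the free structure on Y, presented by representatives:
  faces need only match up to \<open>teq\<close>.\<close>

definition tsub :: "'a ograph => 'b ograph => (nat => 'a => 'b trm) => bool" where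
 "tsub X Y phi == (\<forall>n. \<forall>x\<in>cell X n. teq Y n (phi n x) (phi n x)) \<and>
   (\<forall>n. \<forall>x\<in>cell X (Suc n). teq Y n (phi n (src X n x)) (tsrc Y (phi (Suc n) x)) \<and>
    teq Y n (phi n (tgt X n x)) (ttgt Y (phi (Suc n) x)))"

section \<open>Substitution respects equality of terms and boundaries\<close>

context
 fixes X :: "'a ograph" and Y :: "'b ograph" and phi psi :: "nat => 'a => 'b trm"
 assumes X: "is_ograph X" and Y: "is_ograph Y" and sub: "tsub X Y phi"
  and phipsi: "!!n x. x \<in> cell X n ==> teq Y n (phi n x) (psi n x)"
begin

text \<open>The first conjunct carries congruence in the substitution and, since \<open>teq\<close>
  is partial, well-formedness of the result. Boundaries need to be followed for \<open>phi\<close>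
  only.\<close>

definition bndc :: "nat => 'a trm => bool" where
 "bndc n t == teq Y n (tbind phi t) (tbind psi t) \<and>
   (\<forall>m. n = Suc m --> teq Y m (tbind phi (tsrc X t)) (tsrc Y (tbind phi t)) \<and>
    teq Y m (tbind phi (ttgt X t)) (ttgt Y (tbind phi t)))"

context
 fixes N :: nat
 assumes IH: "!!n t u. n < N ==> teq X n t u ==> bndc n t \<and> teq Y n (tbind phi t) (tbind phi u)"
begin

private lemma bpow:
 "bndc n t ==> teq X n t t ==> n \<le> N ==> k \<le> n ==>
   teq Y k (tbind phi ((tsrc X ^^ (n - k)) t)) ((tsrc Y ^^ (n - k)) (tbind phi t)) \<and>
   teq Y k (tbind phi ((ttgt X ^^ (n - k)) t)) ((ttgt Y ^^ (n - k)) (tbind phi t))"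
proof (induction n arbitrary: t)
 case 0
 thus ?case unfolding bndc_def using teq_refl1 by auto
next
 case (Suc m)
 show ?case
 proof (cases "k = Suc m")
  case True
  thus ?thesis using Suc(2) unfolding bndc_def using teq_refl1 by auto
 next
  case False
  hence km: "k \<le> m" and mN: "m < N" using Suc by auto
  have w: "teq X m (tsrc X t) (tsrc X t)" "teq X m (ttgt X t) (ttgt X t)"
   using teq_tsrc[OF X Suc(3)] teq_ttgt[OF X Suc(3)] by auto
  have b: "bndc m (tsrc X t)" "bndc m (ttgt X t)" using IH[OF mN w(1)] IH[OF mN w(2)] by auto
  have e: "teq Y m (tbind phi (tsrc X t)) (tsrc Y (tbind phi t))" "teq Y m (tbind phi (ttgt X t)) (ttgt Y (tbind phi t))"
   using Suc(2) unfolding bndc_def by auto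
  have "teq Y k (tbind phi ((tsrc X ^^ (m - k)) (tsrc X t))) ((tsrc Y ^^ (m - k)) (tbind phi (tsrc X t)))"
   "teq Y k (tbind phi ((ttgt X ^^ (m - k)) (ttgt X t))) ((ttgt Y ^^ (m - k)) (tbind phi (ttgt X t)))"
   using Suc(1)[OF b(1) w(1) _ km] Suc(1)[OF b(2) w(2) _ km] mN by auto
  thus ?thesis using teq_src_pow[OF Y e(1) km] teq_tgt_pow[OF Y e(2) km] km
   by (auto simp: funpow_Suc_diff intro: teq.trans)
 qed
qed

text \<open>Composability is an equation in dimension k < n, so the outer hypothesis transports it
  along the substitution; \<open>bpow\<close> then moves the iterated faces outside.\<close>

private lemma bmatch:
 assumes "bndc n t" "teq X n t t" "bndc n u" "teq X n u u" "n \<le> N" "k < n"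
  and m: "fits X n k t u"
 shows "fits Y n k (tbind phi t) (tbind phi u)"
proof -
 have "teq Y k (tbind phi ((tsrc X ^^ (n - k)) t)) (tbind phi ((ttgt X ^^ (n - k)) u))"
  using IH[OF _ m] assms by auto
 thus ?thesis using bpow[OF assms(1,2,5), of k] bpow[OF assms(3,4,5), of k] assms(6)
  by (meson less_imp_le teq.sym teq.trans)
qed

private lemma bndc_refl: "bndc n t ==> teq Y n (tbind phi t) (tbind phi t)"
 unfolding bndc_def using teq_refl1 by blast

private lemma bndc_Comp:
 assumes t: "bndc n t" "teq X n t t" and u: "bndc n u" "teq X n u u" and n: "n \<le> N" "k < n"
  and m: "fits X n k t u"
 shows "bndc n (Comp k t u)"
proof -
 obtain i where ni: "n = Suc i" using n by (cases n) auto
 note M = bmatch[OF t u n m]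
 have c: "teq Y n (tbind phi t) (tbind psi t)" "teq Y n (tbind phi u) (tbind psi u)" using t u unfolding bndc_def by auto
 have 1: "teq Y n (Comp k (tbind phi t) (tbind phi u)) (Comp k (tbind psi t) (tbind psi u))"
  using teq.cmp[OF c n(2) M] .
 have d: "tdim t = n" "tdim (tbind phi t) = n" using t(2) c(1) teq_tdim by blast+
 have e: "teq Y i (tbind phi (tsrc X t)) (tsrc Y (tbind phi t))" "teq Y i (tbind phi (ttgt X t)) (ttgt Y (tbind phi t))"
  "teq Y i (tbind phi (tsrc X u)) (tsrc Y (tbind phi u))" "teq Y i (tbind phi (ttgt X u)) (ttgt Y (tbind phi u))"
  using t u ni unfolding bndc_def by auto
 have "teq Y i (tbind phi (tsrc X (Comp k t u))) (tsrc Y (Comp k (tbind phi t) (tbind phi u))) \<and>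
    teq Y i (tbind phi (ttgt X (Comp k t u))) (ttgt Y (Comp k (tbind phi t) (tbind phi u)))"
 proof (cases "k = i")
  case True
  thus ?thesis using d e ni by simp
 next
  case False
  hence ki: "k < i" using n ni by simp
  note ms = teq_match_src[OF X t(2)[unfolded ni] u(2)[unfolded ni] ki m[unfolded ni]]
  have w: "teq X i (tsrc X t) (tsrc X t)" "teq X i (ttgt X t) (ttgt X t)" "teq X i (tsrc X u) (tsrc X u)" "teq X i (ttgt X u) (ttgt X u)"
   using teq_tsrc[OF X] teq_ttgt[OF X] t(2) u(2) ni by auto
  have iN: "i < N" "i \<le> N" using ni n by auto
  have b: "bndc i (tsrc X t)" "bndc i (ttgt X t)" "bndc i (tsrc X u)" "bndc i (ttgt X u)"
   using IH[OF iN(1) w(1)] IH[OF iN(1) w(2)] IH[OF iN(1) w(3)] IH[OF iN(1) w(4)] by auto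
  have "teq Y i (Comp k (tbind phi (tsrc X t)) (tbind phi (tsrc X u))) (Comp k (tsrc Y (tbind phi t)) (tsrc Y (tbind phi u)))"
   using teq.cmp[OF e(1,3) ki bmatch[OF b(1) w(1) b(3) w(3) iN(2) ki ms(1)]] .
  moreover have "teq Y i (Comp k (tbind phi (ttgt X t)) (tbind phi (ttgt X u))) (Comp k (ttgt Y (tbind phi t)) (ttgt Y (tbind phi u)))"
   using teq.cmp[OF e(2,4) ki bmatch[OF b(2) w(2) b(4) w(4) iN(2) ki ms(2)]] .
  ultimately show ?thesis using d False ni by simp
 qed
 thus ?thesis using 1 ni unfolding bndc_def by simp
qed

private lemma bndc_Idt: "bndc n t ==> bndc (Suc n) (Idt t)"
 unfolding bndc_def using teq_refl1 by (auto intro: teq.idt)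

private lemma bndc_Idt_pow: "bndc n t ==> bndc (j + n) ((Idt ^^ j) t)"
 by (induction j) (auto intro: bndc_Idt)

text \<open>Each rule is answered by the same rule in Y. For the unit laws, substituting into the
  k-face of t gives a term equal but not identical to the k-face of the substituted term, so a
  congruence step precedes the law.\<close>

lemma tbind_step:
 "teq X n t u ==> n \<le> N ==> bndc n t \<and> bndc n u \<and> teq Y n (tbind phi t) (tbind phi u)"
proof (induction rule: teq.induct)
 case (gen x n)
 hence "bndc n (Gen n x)"
  using sub phipsi[OF gen(1)] unfolding bndc_def tsub_def by auto
 thus ?case using bndc_refl[of n "Gen n x"] by simp
next
 case (idt n t t')
 thus ?case using bndc_Idt by (auto intro: teq.idt)
next
 case (cmp n t t' u u' k)
 have w: "teq X n t t" "teq X n u u" "teq X n t' t'" "teq X n u' u'"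
  using cmp.hyps teq_refl1 teq_refl2 by blast+
 have m: "fits X n k t u" by fact
 have kn: "k < n" by fact
 have m': "fits X n k t' u'"
  using m teq_src_pow[OF X, of n t t' k] teq_tgt_pow[OF X, of n u u' k] cmp.hyps
  by (meson less_imp_le teq.sym teq.trans)
 have b: "bndc n t" "bndc n u" "bndc n t'" "bndc n u'" using cmp by auto
 have "teq Y n (Comp k (tbind phi t) (tbind phi u)) (Comp k (tbind phi t') (tbind phi u'))"
  by (rule teq.cmp[OF _ _ kn bmatch[OF b(1) w(1) b(2) w(2) cmp.prems kn m]]) (use cmp in auto)
 thus ?case using bndc_Comp[OF b(1) w(1) b(2) w(2) cmp.prems kn m]
   bndc_Comp[OF b(3) w(3) b(4) w(4) cmp.prems kn m'] by simp
next
 case (sym n t u)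
 thus ?case by (auto intro: teq.sym)
next
 case (trans n t u v)
 thus ?case by (auto intro: teq.trans)
next
 case (assoc n t u v k)
 have w: "teq X n t t" "teq X n u u" "teq X n v v" and kn: "k < n"
  and m1: "fits X n k t u"
  and m2: "fits X n k u v" by fact+
 have b: "bndc n t" "bndc n u" "bndc n v" using assoc by auto
 have wc: "teq X n (Comp k t u) (Comp k t u)" "teq X n (Comp k u v) (Comp k u v)"
  using teq.cmp[OF w(1,2) kn m1] teq.cmp[OF w(2,3) kn m2] .
 note bc = bndc_Comp[OF b(1) w(1) b(2) w(2) assoc.prems kn m1] bndc_Comp[OF b(2) w(2) b(3) w(3) assoc.prems kn m2]
 have M: "fits X n k (Comp k t u) v"
  "fits X n k t (Comp k u v)"
  using teq_src_Comp[OF X w(1,2) kn m1] teq_src_Comp[OF X w(2,3) kn m2] m1 m2 by simp_all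
 have "teq Y n (tbind phi (Comp k (Comp k t u) v)) (tbind phi (Comp k t (Comp k u v)))"
  using bmatch[OF b(1) w(1) b(2) w(2) assoc.prems kn m1] bmatch[OF b(2) w(2) b(3) w(3) assoc.prems kn m2]
   bndc_refl[OF b(1)] bndc_refl[OF b(2)] bndc_refl[OF b(3)] kn by (simp add: teq.assoc)
 thus ?case using bndc_Comp[OF bc(1) wc(1) b(3) w(3) assoc.prems kn M(1)]
   bndc_Comp[OF b(1) w(1) bc(2) wc(2) assoc.prems kn M(2)] by blast
next
 case (unit_src n t k)
 let ?s = "(tsrc X ^^ (n - k)) t"
 have w: "teq X n t t" and kn: "k < n" by fact+
 have b: "bndc n t" using unit_src by auto
 have s: "teq X k ?s ?s" using teq_src_pow[OF X w, of k] kn by simp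
 have bs: "bndc k ?s" using IH[OF _ s] kn unit_src.prems by auto
 have wi: "teq X n ((Idt ^^ (n - k)) ?s) ((Idt ^^ (n - k)) ?s)" using teq_Idt_pow[OF s, of "n - k"] kn by simp
 have bi: "bndc n ((Idt ^^ (n - k)) ?s)" using bndc_Idt_pow[OF bs, of "n - k"] kn by simp
 have m: "fits X n k t ((Idt ^^ (n - k)) ?s)" using s by (simp add: ttgt_Idt_pow)
 have e: "teq Y k (tbind phi ?s) ((tsrc Y ^^ (n - k)) (tbind phi t))" using bpow[OF b w unit_src.prems, of k] kn by simp
 have "teq Y n ((Idt ^^ (n - k)) (tbind phi ?s)) ((Idt ^^ (n - k)) ((tsrc Y ^^ (n - k)) (tbind phi t)))"
  using teq_Idt_pow[OF e, of "n - k"] kn by simp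
 hence "teq Y n (Comp k (tbind phi t) ((Idt ^^ (n - k)) (tbind phi ?s))) (Comp k (tbind phi t) ((Idt ^^ (n - k)) ((tsrc Y ^^ (n - k)) (tbind phi t))))"
  using bndc_refl[OF b] kn e by (auto intro!: teq.cmp intro: teq.sym simp: ttgt_Idt_pow)
 hence "teq Y n (tbind phi (Comp k t ((Idt ^^ (n - k)) ?s))) (tbind phi t)"
  using teq.unit_src[OF bndc_refl[OF b] kn] by (auto simp: tbind_Idt_pow intro: teq.trans)
 thus ?case using bndc_Comp[OF b w bi wi unit_src.prems kn m] b by blast
next
 case (unit_tgt n t k)
 let ?s = "(ttgt X ^^ (n - k)) t"
 have w: "teq X n t t" and kn: "k < n" by fact+
 have b: "bndc n t" using unit_tgt by auto
 have s: "teq X k ?s ?s" using teq_tgt_pow[OF X w, of k] kn by simp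
 have bs: "bndc k ?s" using IH[OF _ s] kn unit_tgt.prems by auto
 have wi: "teq X n ((Idt ^^ (n - k)) ?s) ((Idt ^^ (n - k)) ?s)" using teq_Idt_pow[OF s, of "n - k"] kn by simp
 have bi: "bndc n ((Idt ^^ (n - k)) ?s)" using bndc_Idt_pow[OF bs, of "n - k"] kn by simp
 have m: "fits X n k ((Idt ^^ (n - k)) ?s) t" using s by (simp add: tsrc_Idt_pow)
 have e: "teq Y k (tbind phi ?s) ((ttgt Y ^^ (n - k)) (tbind phi t))" using bpow[OF b w unit_tgt.prems, of k] kn by simp
 have "teq Y n ((Idt ^^ (n - k)) (tbind phi ?s)) ((Idt ^^ (n - k)) ((ttgt Y ^^ (n - k)) (tbind phi t)))"
  using teq_Idt_pow[OF e, of "n - k"] kn by simp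
 hence "teq Y n (Comp k ((Idt ^^ (n - k)) (tbind phi ?s)) (tbind phi t)) (Comp k ((Idt ^^ (n - k)) ((ttgt Y ^^ (n - k)) (tbind phi t))) (tbind phi t))"
  using bndc_refl[OF b] kn e by (auto intro!: teq.cmp simp: tsrc_Idt_pow)
 hence "teq Y n (tbind phi (Comp k ((Idt ^^ (n - k)) ?s) t)) (tbind phi t)"
  using teq.unit_tgt[OF bndc_refl[OF b] kn] by (auto simp: tbind_Idt_pow intro: teq.trans)
 thus ?case using bndc_Comp[OF bi wi b w unit_tgt.prems kn m] b by blast
next
 case (interchange n t u v w j k)
 have x: "teq X n t t" "teq X n u u" "teq X n v v" "teq X n w w" and j: "j < k" "k < n" and
  m: "fits X n k t u"
  "fits X n k v w"
  "fits X n j t v"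
  "fits X n j u w" by fact+
 have jn: "j < n" using j by simp
 have b: "bndc n t" "bndc n u" "bndc n v" "bndc n w" using interchange by auto
 note p = interchange.prems
 note M = teq_interchange_match[OF X x j m]
 note bc = bndc_Comp[OF b(1) x(1) b(2) x(2) p j(2) m(1)] bndc_Comp[OF b(3) x(3) b(4) x(4) p j(2) m(2)]
  bndc_Comp[OF b(1) x(1) b(3) x(3) p jn m(3)] bndc_Comp[OF b(2) x(2) b(4) x(4) p jn m(4)]
 note wc = teq.cmp[OF x(1,2) j(2) m(1)] teq.cmp[OF x(3,4) j(2) m(2)] teq.cmp[OF x(1,3) jn m(3)] teq.cmp[OF x(2,4) jn m(4)]
 have "teq Y n (tbind phi (Comp j (Comp k t u) (Comp k v w))) (tbind phi (Comp k (Comp j t v) (Comp j u w)))"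
  using bmatch[OF b(1) x(1) b(2) x(2) p j(2) m(1)] bmatch[OF b(3) x(3) b(4) x(4) p j(2) m(2)]
  bmatch[OF b(1) x(1) b(3) x(3) p jn m(3)] bmatch[OF b(2) x(2) b(4) x(4) p jn m(4)]
  bndc_refl[OF b(1)] bndc_refl[OF b(2)] bndc_refl[OF b(3)] bndc_refl[OF b(4)] j by (simp add: teq.interchange)
 thus ?case using bndc_Comp[OF bc(1) wc(1) bc(2) wc(2) p jn M(1)] bndc_Comp[OF bc(3) wc(3) bc(4) wc(4) p j(2) M(2)] by blast
next
 case (idt_cmp n t u k)
 have w: "teq X n t t" "teq X n u u" and kn: "k < n"
  and m: "fits X n k t u" by fact+
 have b: "bndc n t" "bndc n u" using idt_cmp by auto
 have nN: "n \<le> N" using idt_cmp.prems by simp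
 have kn': "k < Suc n" using kn by simp
 have M: "fits X (Suc n) k (Idt t) (Idt u)"
  using m kn by (subst (1 2) funpow_Suc_diff) auto
 have "teq Y (Suc n) (tbind phi (Idt (Comp k t u))) (tbind phi (Comp k (Idt t) (Idt u)))"
  using bmatch[OF b(1) w(1) b(2) w(2) nN kn m] bndc_refl[OF b(1)] bndc_refl[OF b(2)] kn by (simp add: teq.idt_cmp)
 thus ?case using bndc_Idt[OF bndc_Comp[OF b(1) w(1) b(2) w(2) nN kn m]]
   bndc_Comp[OF bndc_Idt[OF b(1)] teq.idt[OF w(1)] bndc_Idt[OF b(2)] teq.idt[OF w(2)] idt_cmp.prems kn' M] by blast
qed

end

private lemma tbind_all: "teq X n t u ==> bndc n t \<and> teq Y n (tbind phi t) (tbind phi u)"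
proof (induction n arbitrary: t u rule: less_induct)
 case (less n)
 thus ?case using tbind_step[of n n t u] by blast
qed

lemma tbind_teq: "teq X n t u ==> teq Y n (tbind phi t) (tbind phi u)"
 and tbind_teq_cong: "teq X n t t ==> teq Y n (tbind phi t) (tbind psi t)"
 using tbind_all unfolding bndc_def by blast+

lemma tbind_bnd:
 assumes "teq X (Suc n) t t"
 shows "teq Y n (tbind phi (tsrc X t)) (tsrc Y (tbind phi t))" "teq Y n (tbind phi (ttgt X t)) (ttgt Y (tbind phi t))"
 using tbind_all[OF assms] unfolding bndc_def by blast+

end

section \<open>Cells of the free structure as classes of terms\<close>

definition cl :: "'a ograph => nat => 'a trm => 'a trm set" where
 "cl X n t = {u. teq X n t u}"

lemma tcls_sing: "tcls X n {t} = cl X n t"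
 unfolding tcls_def cl_def by simp

lemma T_unit_cl: "T_unit X n x = cl X n (Gen n x)"
 unfolding T_unit_def tcls_sing ..

lemma T_cell: "Tcell X n = {cl X n t | t. teq X n t t}"
 unfolding T_graph_def tcls_sing by simp

lemma T_cellI: "teq X n t t ==> cl X n t \<in> Tcell X n"
 unfolding T_cell by blast

lemma T_cellE:
 assumes "K \<in> Tcell X n"
 obtains t where "teq X n t t" "K = cl X n t"
 using assms unfolding T_cell by blast

lemma cl_eqI: "teq X n t u ==> cl X n t = cl X n u"
 unfolding cl_def by (blast intro: teq.sym teq.trans)

lemma cl_eqD: "cl X n t = cl X n u ==> teq X n u u ==> teq X n t u"
 unfolding cl_def by blast

lemma cl_self: "teq X n t t ==> t \<in> cl X n t"
 unfolding cl_def by simp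

text \<open>The class of an ill-formed term is empty, whereas a cell is the class of a term that
  belongs to it. So being a cell certifies well-formedness.\<close>

lemma cl_wf: "cl X n t \<in> Tcell X n ==> teq X n t t"
proof -
 assume "cl X n t \<in> Tcell X n"
 then obtain u where u: "teq X n u u" "cl X n t = cl X n u" unfolding T_cell by blast
 show ?thesis using cl_eqD[OF u(2,1)] by (rule teq_refl1)
qed

lemma T_cell_rep: "K \<in> Tcell X n ==> t \<in> K ==> teq X n t t \<and> K = cl X n t"
proof -
 assume "K \<in> Tcell X n" and "t \<in> K"
 then obtain u where "t \<in> K" "K = cl X n u" unfolding T_cell by blast
 hence "teq X n u t" "K = cl X n u" unfolding cl_def by simp_all
 thus ?thesis using cl_eqI teq_refl2 by blast
qed

lemma T_cell_some: "K \<in> Tcell X n ==> (SOME t. t \<in> K) \<in> K"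
 by (metis T_cellE cl_self someI)

text \<open>An operation on terms that respects equality may be computed on a single representative,
  although \<open>tcls\<close> collects over all of them.\<close>

lemma tcls_image:
 assumes "teq X n t t" "!!u. teq X n t u ==> teq Y m (g t) (g u)"
 shows "tcls Y m (g ` cl X n t) = cl Y m (g t)"
proof -
 have "teq Y m (g t) v" if "teq X n t u" "teq Y m (g u) v" for u v
  using that assms(2) by (blast intro: teq.trans)
 thus ?thesis using assms(1) unfolding tcls_def cl_def by auto
qed

lemma T_src_cl: "is_ograph X ==> teq X (Suc n) t t ==> src (T_graph X) n (cl X (Suc n) t) = cl X n (tsrc X t)"
 and T_tgt_cl: "is_ograph X ==> teq X (Suc n) t t ==> tgt (T_graph X) n (cl X (Suc n) t) = cl X n (ttgt X t)"
 unfolding T_graph_def by (simp_all add: tcls_image teq_tsrc teq_ttgt)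

lemma T_graph_ograph: "is_ograph X ==> is_ograph (T_graph X)"
 unfolding is_ograph_def[of "T_graph X"]
 by (auto elim!: T_cellE simp: T_src_cl T_tgt_cl teq_tsrc teq_ttgt cl_eqI[OF teq_glob(1)] cl_eqI[OF teq_glob(2)] intro!: T_cellI)

lemma T_id_cl: "teq X n t t ==> T_id X n (cl X n t) = cl X (Suc n) (Idt t)"
 unfolding T_id_def by (rule tcls_image) (auto intro: teq.idt)

lemma T_id0_cl: "teq X 0 t t ==> T_id0 X n (cl X 0 t) = cl X n ((Idt ^^ n) t)"
proof (induction n)
 case (Suc n)
 have "teq X n ((Idt ^^ n) t) ((Idt ^^ n) t)" using teq_Idt_pow[OF Suc(2), of n] by simp
 thus ?case using Suc by (simp add: T_id_cl)
qed simp

lemma T_id_cell: "K \<in> Tcell X n ==> T_id X n K \<in> Tcell X (Suc n)"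
 by (auto elim!: T_cellE simp: T_id_cl intro!: T_cellI teq.idt)

section \<open>Maps of omega-graphs and the functor T\<close>

lemma omap_cell: "ograph_map X Y f ==> x \<in> cell X n ==> f n x \<in> cell Y n"
 and omap_src: "ograph_map X Y f ==> x \<in> cell X (Suc n) ==> f n (src X n x) = src Y n (f (Suc n) x)"
 and omap_tgt: "ograph_map X Y f ==> x \<in> cell X (Suc n) ==> f n (tgt X n x) = tgt Y n (f (Suc n) x)"
 unfolding ograph_map_def by auto

lemma ograph_map_comp: "ograph_map X Y f ==> ograph_map Y Z g ==> ograph_map X Z (%n x. g n (f n x))"
 unfolding ograph_map_def by auto

lemma ograph_src: "is_ograph X ==> x \<in> cell X (Suc n) ==> src X n x \<in> cell X n"
 and ograph_tgt: "is_ograph X ==> x \<in> cell X (Suc n) ==> tgt X n x \<in> cell X n"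
 unfolding is_ograph_def by auto

lemma ograph_map_cong:
 assumes X: "is_ograph X" and f: "ograph_map X Y f" and fg: "!!n x. x \<in> cell X n ==> f n x = g n x"
 shows "ograph_map X Y g"
proof -
 have "g n x \<in> cell Y n" if "x \<in> cell X n" for n x using omap_cell[OF f that] fg[OF that] by simp
 moreover have "g n (src X n x) = src Y n (g (Suc n) x) \<and> g n (tgt X n x) = tgt Y n (g (Suc n) x)"
  if x: "x \<in> cell X (Suc n)" for n x
  using omap_src[OF f x] omap_tgt[OF f x] fg[OF x] fg[OF ograph_src[OF X x]] fg[OF ograph_tgt[OF X x]] by simp
 ultimately show ?thesis unfolding ograph_map_def by blast
qed

lemma tsub_teq: "is_ograph X ==> is_ograph Y ==> tsub X Y phi ==> teq X n t u ==> teq Y n (tbind phi t) (tbind phi u)"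
 by (rule tbind_teq[where psi = phi]) (auto simp: tsub_def)

lemma tsub_bnd:
 assumes "is_ograph X" "is_ograph Y" "tsub X Y phi" "teq X (Suc n) t t"
 shows "teq Y n (tbind phi (tsrc X t)) (tsrc Y (tbind phi t))" "teq Y n (tbind phi (ttgt X t)) (ttgt Y (tbind phi t))"
proof -
 have e: "!!k x. x \<in> cell X k ==> teq Y k (phi k x) (phi k x)" using assms(3) unfolding tsub_def by blast
 show "teq Y n (tbind phi (tsrc X t)) (tsrc Y (tbind phi t))" "teq Y n (tbind phi (ttgt X t)) (ttgt Y (tbind phi t))"
  using tbind_bnd[OF assms(1-3) e assms(4)] by blast+
qed

lemma tsub_map: "is_ograph X ==> ograph_map X Y f ==> tsub X Y (%n x. Gen n (f n x))"
 unfolding tsub_def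
 by (simp add: teq.gen omap_cell flip: omap_src omap_tgt)
  (simp add: teq.gen omap_cell ograph_src ograph_tgt)

lemma teq_tmap:
 assumes "is_ograph X" "is_ograph Y" "ograph_map X Y f" "teq X n t u"
 shows "teq Y n (tmap f t) (tmap f u)"
 unfolding tmap_tbind by (rule tsub_teq[OF assms(1,2) tsub_map[OF assms(1,3)] assms(4)])

lemma teq_tmap_bnd:
 assumes "is_ograph X" "is_ograph Y" "ograph_map X Y f" "teq X (Suc n) t t"
 shows "teq Y n (tmap f (tsrc X t)) (tsrc Y (tmap f t))" "teq Y n (tmap f (ttgt X t)) (ttgt Y (tmap f t))"
 unfolding tmap_tbind by (rule tsub_bnd[OF assms(1,2) tsub_map[OF assms(1,3)] assms(4)])+

lemma T_map_cl:
 assumes "is_ograph X" "is_ograph Y" "ograph_map X Y f" "teq X n t t"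
 shows "T_map Y f n (cl X n t) = cl Y n (tmap f t)"
 unfolding T_map_def using teq_tmap[OF assms(1-3)] assms(4) by (intro tcls_image) auto

lemma T_map_cell:
 assumes "is_ograph X" "is_ograph Y" "ograph_map X Y f" "K \<in> Tcell X n"
 shows "T_map Y f n K \<in> Tcell Y n"
 using assms(4) by (elim T_cellE) (auto simp: T_map_cl[OF assms(1-3)] intro: T_cellI teq_tmap[OF assms(1-3)])

lemma T_map_ograph_map:
 assumes "is_ograph X" "is_ograph Y" "ograph_map X Y f"
 shows "ograph_map (T_graph X) (T_graph Y) (T_map Y f)"
 unfolding ograph_map_def
 by (auto simp: T_map_cell[OF assms])
  (auto elim!: T_cellE simp: T_map_cl[OF assms] T_src_cl T_tgt_cl assms teq_tsrc teq_ttgt teq_tmap[OF assms]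
   cl_eqI[OF teq_tmap_bnd(1)[OF assms]] cl_eqI[OF teq_tmap_bnd(2)[OF assms]])

lemma T_map_comp:
 assumes "is_ograph X" "is_ograph Y" "is_ograph Z" "ograph_map X Y f" "ograph_map Y Z g" "K \<in> Tcell X n"
 shows "T_map Z g n (T_map Y f n K) = T_map Z (%n x. g n (f n x)) n K"
 using assms(6)
 by (elim T_cellE) (simp add: T_map_cl[OF assms(1,2,4)] T_map_cl[OF assms(2,3,5)] teq_tmap[OF assms(1,2,4)]
   T_map_cl[OF assms(1,3) ograph_map_comp[OF assms(4,5)]] tmap_tmap)

lemma T_map_cong:
 assumes X: "is_ograph X" and "K \<in> Tcell X n" and fg: "!!k x. x \<in> cell X k ==> f k x = g k x"
 shows "T_map Y f n K = T_map Y g n K"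
proof -
 have "tmap f t = tmap g t" if "t \<in> K" for t
  using T_cell_rep[OF assms(2) that] teq_leaf[OF X] fg by (intro tmap_leaf_cong) blast
 thus ?thesis unfolding T_map_def by (metis (no_types, lifting) image_cong)
qed

lemma T_map_ident:
 assumes X: "is_ograph X" and "K \<in> Tcell X n" and f: "!!k x. x \<in> cell X k ==> f k x = x"
 shows "T_map X f n K = K"
proof -
 have id: "ograph_map X X (%_ x. x)" unfolding ograph_map_def by simp
 have "T_map X f n K = T_map X (%_ x. x) n K" using T_map_cong[OF X assms(2), of f "%_ x. x"] f by simp
 also have "\<dots> = K" using assms(2) by (elim T_cellE) (simp add: T_map_cl[OF X X id] tmap_ident)
 finally show ?thesis .
qed

lemma T_map_unit: "is_ograph X ==> is_ograph Y ==> ograph_map X Y f ==> x \<in> cell X n ==>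
  T_map Y f n (T_unit X n x) = T_unit Y n (f n x)"
 unfolding T_unit_cl by (simp add: T_map_cl teq.gen)

lemma T_unit_ograph_map: "is_ograph X ==> ograph_map X (T_graph X) (T_unit X)"
 unfolding ograph_map_def T_unit_cl by (auto simp: T_src_cl T_tgt_cl teq.gen intro: T_cellI)

lemma T_map_id:
 assumes "is_ograph X" "is_ograph Y" "ograph_map X Y f" "K \<in> Tcell X n"
 shows "T_map Y f (Suc n) (T_id X n K) = T_id Y n (T_map Y f n K)"
 using assms(4) by (elim T_cellE) (simp add: T_id_cl T_map_cl[OF assms(1-3)] teq.idt teq_tmap[OF assms(1-3)])

lemma T_id0_cell: "K \<in> Tcell X 0 ==> T_id0 X n K \<in> Tcell X n"
 by (induction n) (auto simp: T_id_cell)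

lemma T_map_id0:
 assumes "is_ograph X" "is_ograph Y" "ograph_map X Y f" "K \<in> Tcell X 0"
 shows "T_map Y f n (T_id0 X n K) = T_id0 Y n (T_map Y f 0 K)"
 by (induction n) (auto simp: T_map_id[OF assms(1-3)] T_id0_cell assms(4))

subsection \<open>Multiplication\<close>

text \<open>Choosing a representative of every value of \<open>d\<close> commutes with faces up to
  \<open>teq\<close>, because \<open>d\<close> commutes with them on classes.\<close>

lemma tsub_sections:
 assumes X: "is_ograph X" and d: "ograph_map Z (T_graph X) d" and phi: "!!n x. x \<in> cell Z n ==> phi n x \<in> d n x"
  and Z: "is_ograph Z"
 shows "tsub Z X phi"
proof -
 have r: "teq X n (phi n x) (phi n x) \<and> d n x = cl X n (phi n x)" if "x \<in> cell Z n" for n x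
  using T_cell_rep[OF omap_cell[OF d that] phi[OF that]] .
 have "teq X n (phi n (src Z n x)) (tsrc X (phi (Suc n) x)) \<and> teq X n (phi n (tgt Z n x)) (ttgt X (phi (Suc n) x))"
  if x: "x \<in> cell Z (Suc n)" for n x
 proof -
  have "cl X n (phi n (src Z n x)) = cl X n (tsrc X (phi (Suc n) x))" "cl X n (phi n (tgt Z n x)) = cl X n (ttgt X (phi (Suc n) x))"
   using omap_src[OF d x] omap_tgt[OF d x] r[OF x] r[OF ograph_src[OF Z x]] r[OF ograph_tgt[OF Z x]]
   by (simp_all add: T_src_cl[OF X] T_tgt_cl[OF X])
  thus ?thesis using r[OF x] by (auto intro!: cl_eqD teq_tsrc[OF X] teq_ttgt[OF X])
 qed
 thus ?thesis using r unfolding tsub_def by blast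
qed

lemma tsub_flat: "is_ograph X ==> tsub (T_graph X) X (%_ K. SOME t. t \<in> K)"
 by (rule tsub_sections[where d = "%_ K. K"]) (auto simp: ograph_map_def T_cell_some T_graph_ograph)

lemma teq_tflat: "is_ograph X ==> teq (T_graph X) n t u ==> teq X n (tflat t) (tflat u)"
 unfolding tflat_tbind by (rule tsub_teq[OF T_graph_ograph _ tsub_flat])

lemma T_mult_cl: "is_ograph X ==> teq (T_graph X) n t t ==> T_mult X n (cl (T_graph X) n t) = cl X n (tflat t)"
 unfolding T_mult_def by (rule tcls_image) (auto intro: teq_tflat)

lemma T_mult_cell: "is_ograph X ==> K \<in> Tcell (T_graph X) n ==> T_mult X n K \<in> Tcell X n"
 by (erule T_cellE[of K]) (simp add: T_mult_cl T_cellI teq_tflat)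

lemma T_mult_bind:
 assumes X: "is_ograph X" and Z: "is_ograph Z" and d: "ograph_map Z (T_graph X) d"
  and phi: "!!n x. x \<in> cell Z n ==> phi n x \<in> d n x" and t: "teq Z n t t"
 shows "T_mult X n (T_map (T_graph X) d n (cl Z n t)) = cl X n (tbind phi t)" "teq X n (tbind phi t) (tbind phi t)"
proof -
 let ?psi = "%n x. SOME u. u \<in> d n x"
 have s: "tsub Z X phi" using tsub_sections[OF X d phi Z] .
 have e: "teq X k (phi k x) (?psi k x)" if "x \<in> cell Z k" for k x
  using T_cell_rep[OF omap_cell[OF d that] phi[OF that]] T_cell_some[OF omap_cell[OF d that]]
  by (auto simp: cl_def)
 have w: "teq (T_graph X) n (tmap d t) (tmap d t)" using teq_tmap[OF Z T_graph_ograph[OF X] d t] .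
 have "T_mult X n (T_map (T_graph X) d n (cl Z n t)) = cl X n (tflat (tmap d t))"
  using T_map_cl[OF Z T_graph_ograph[OF X] d t] T_mult_cl[OF X w] by simp
 also have "tflat (tmap d t) = tbind ?psi t" unfolding tflat_tbind tbind_tmap by simp
 also have "cl X n (tbind ?psi t) = cl X n (tbind phi t)"
  using cl_eqI[OF tbind_teq_cong[OF Z X s e t]] by simp
 finally show "T_mult X n (T_map (T_graph X) d n (cl Z n t)) = cl X n (tbind phi t)" .
 show "teq X n (tbind phi t) (tbind phi t)" using tsub_teq[OF Z X s t] .
qed

lemma T_mult_nat:
 assumes X: "is_ograph X" and Y: "is_ograph Y" and f: "ograph_map X Y f" and K: "K \<in> Tcell (T_graph X) n"
 shows "T_map Y f n (T_mult X n K) = T_mult Y n (T_map (T_graph Y) (T_map Y f) n K)"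
 using K
proof (elim T_cellE)
 fix t assume t: "teq (T_graph X) n t t" "K = cl (T_graph X) n t"
 let ?phi = "%(_::nat) K. SOME t. t \<in> K"
 have r: "tmap f (?phi k L) \<in> T_map Y f k L" if L: "L \<in> Tcell X k" for k L
  using T_cell_rep[OF L T_cell_some[OF L]] by (metis T_map_cl[OF X Y f] cl_self teq_tmap[OF X Y f])
 have "T_mult Y n (T_map (T_graph Y) (T_map Y f) n K) = cl Y n (tbind (%n K. tmap f (?phi n K)) t)"
  unfolding t using T_mult_bind(1)[OF Y T_graph_ograph[OF X] T_map_ograph_map[OF X Y f] r t(1)] by simp
 also have "tbind (%n K. tmap f (?phi n K)) t = tmap f (tflat t)" by (simp add: tflat_tbind tmap_tbind2)
 also have "cl Y n \<dots> = T_map Y f n (T_mult X n K)"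
  unfolding t T_mult_cl[OF X t(1)] using T_map_cl[OF X Y f teq_tflat[OF X t(1)]] by simp
 finally show ?thesis by simp
qed

lemma T_mult_unit: "is_ograph X ==> K \<in> Tcell X n ==> T_mult X n (T_unit (T_graph X) n K) = K"
 unfolding T_unit_cl by (subst T_mult_cl) (auto intro: teq.gen dest: T_cell_rep[OF _ T_cell_some])

lemma tbind_Gen: "tbind Gen t = t"
 by (induction t) auto

lemma T_mult_map_unit:
 assumes X: "is_ograph X" and K: "K \<in> Tcell X n"
 shows "T_mult X n (T_map (T_graph X) (T_unit X) n K) = K"
 using K
proof (elim T_cellE)
 fix t assume t: "teq X n t t" "K = cl X n t"
 have "!!n x. x \<in> cell X n ==> Gen n x \<in> T_unit X n x" unfolding T_unit_cl by (rule cl_self) (rule teq.gen)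
 from T_mult_bind(1)[OF X X T_unit_ograph_map[OF X] this t(1)] show ?thesis unfolding t by (simp add: tbind_Gen)
qed

lemma T_mult_ograph_map: "is_ograph X ==> ograph_map (T_graph (T_graph X)) (T_graph X) (T_mult X)"
proof -
 assume X: "is_ograph X"
 note TX = T_graph_ograph[OF X]
 have b: "teq X n (tflat (tsrc (T_graph X) t)) (tsrc X (tflat t)) \<and> teq X n (tflat (ttgt (T_graph X) t)) (ttgt X (tflat t))"
  if "teq (T_graph X) (Suc n) t t" for n t
  unfolding tflat_tbind using tsub_bnd[OF TX X tsub_flat[OF X] that] by blast
 have "T_mult X n (src (T_graph (T_graph X)) n K) = src (T_graph X) n (T_mult X (Suc n) K) \<and>
   T_mult X n (tgt (T_graph (T_graph X)) n K) = tgt (T_graph X) n (T_mult X (Suc n) K)"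
  if "K \<in> Tcell (T_graph X) (Suc n)" for n K
  using that
 proof (elim T_cellE)
  fix t assume t: "teq (T_graph X) (Suc n) t t" "K = cl (T_graph X) (Suc n) t"
  have m: "T_mult X (Suc n) (cl (T_graph X) (Suc n) t) = cl X (Suc n) (tflat t)"
   "T_mult X n (cl (T_graph X) n (tsrc (T_graph X) t)) = cl X n (tflat (tsrc (T_graph X) t))"
   "T_mult X n (cl (T_graph X) n (ttgt (T_graph X) t)) = cl X n (tflat (ttgt (T_graph X) t))"
   using T_mult_cl[OF X t(1)] T_mult_cl[OF X teq_tsrc[OF TX t(1)]] T_mult_cl[OF X teq_ttgt[OF TX t(1)]] .
  have e: "cl X n (tflat (tsrc (T_graph X) t)) = cl X n (tsrc X (tflat t))" "cl X n (tflat (ttgt (T_graph X) t)) = cl X n (ttgt X (tflat t))"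
   using b[OF t(1)] cl_eqI by blast+
  show ?thesis unfolding t T_src_cl[OF TX t(1)] T_tgt_cl[OF TX t(1)] m e
   using T_src_cl[OF X teq_tflat[OF X t(1)]] T_tgt_cl[OF X teq_tflat[OF X t(1)]] by simp
 qed
 thus ?thesis unfolding ograph_map_def using T_mult_cell[OF X] by blast
qed

text \<open>With the flattening of a representative of L as representative of
  \<open>T_mult X k L\<close>, both sides become the same double substitution.\<close>

lemma T_mult_assoc:
 assumes X: "is_ograph X" and K: "K \<in> Tcell (T_graph (T_graph X)) n"
 shows "T_mult X n (T_map (T_graph X) (T_mult X) n K) = T_mult X n (T_mult (T_graph X) n K)"
 using K
proof (elim T_cellE)
 note TX = T_graph_ograph[OF X]
 fix t assume t: "teq (T_graph (T_graph X)) n t t" "K = cl (T_graph (T_graph X)) n t"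
 let ?psi = "%(_::nat) L. tflat (SOME s. s \<in> L)"
 have r: "?psi k L \<in> T_mult X k L" if L: "L \<in> Tcell (T_graph X) k" for k L
 proof -
  have "teq (T_graph X) k (SOME s. s \<in> L) (SOME s. s \<in> L)" "L = cl (T_graph X) k (SOME s. s \<in> L)"
   using T_cell_rep[OF L T_cell_some[OF L]] by auto
  thus ?thesis using T_mult_cl[OF X] cl_self[OF teq_tflat[OF X]] by metis
 qed
 have "T_mult X n (T_map (T_graph X) (T_mult X) n K) = cl X n (tbind ?psi t)"
  unfolding t using T_mult_bind(1)[OF X T_graph_ograph[OF TX] T_mult_ograph_map[OF X] r t(1)] by simp
 also have "tbind ?psi t = tflat (tflat t)" by (simp add: tflat_tbind tbind_tbind)
 finally show ?thesis unfolding t T_mult_cl[OF TX t(1)] T_mult_cl[OF X teq_tflat[OF TX t(1)]] .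
qed

section \<open>Constant \<open>\<omega>\<close>-graphs\<close>

text \<open>Over a constant graph all generators of a cell carry the same colour, because composable
  cells share boundaries; so a cell of \<open>T G\<close> is a cell of \<open>T 1\<close>, its shape, together with a colour.\<close>

definition uno :: "unit ograph" where
 "uno = \<lparr> cell = (%_. UNIV), src = (%_ _. ()), tgt = (%_ _. ()) \<rparr>"

lemma uno_ograph: "is_ograph uno"
 unfolding is_ograph_def uno_def by simp

lemma to_uno: "ograph_map X uno (%_ _. ())"
 unfolding ograph_map_def uno_def by simp

lemma const_ograph: "constant_ograph G ==> is_ograph G"
 unfolding constant_ograph_def by simp

lemma const_cell: "constant_ograph G ==> cell G n = cell G 0"
 unfolding constant_ograph_def by blast

lemma const_src: "constant_ograph G ==> x \<in> cell G 0 ==> src G n x = x \<and> tgt G n x = x"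
 unfolding constant_ograph_def by metis

text \<open>Faces are identities on both sides, so compatibility with them forces independence of
  the dimension.\<close>

lemma const_map:
 assumes "constant_ograph G" "constant_ograph H" "ograph_map G H h" "g \<in> cell G 0"
 shows "h n g = h 0 g"
proof (induction n)
 case (Suc n)
 have "g \<in> cell G (Suc n)" using const_cell[OF assms(1)] assms(4) by blast
 hence "h n (src G n g) = src H n (h (Suc n) g)" "h (Suc n) g \<in> cell H 0"
  using omap_src[OF assms(3)] omap_cell[OF assms(3)] const_cell[OF assms(2), of "Suc n"] by auto
 thus ?case using const_src[OF assms(1,4)] const_src[OF assms(2)] Suc by metis
qed simp

lemma const_tsrc:
 assumes "constant_ograph G" "snd ` tlv t \<subseteq> cell G 0"
 shows "snd ` tlv (tsrc G t) \<subseteq> snd ` tlv t \<and> snd ` tlv (ttgt G t) \<subseteq> snd ` tlv t"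
 using assms(2)
proof (induction t)
 case (Comp k t u)
 hence "snd ` tlv t \<subseteq> cell G 0" "snd ` tlv u \<subseteq> cell G 0" by (auto simp: image_Un)
 thus ?case using Comp.IH by (auto simp: image_Un simp del: image_subset_iff)
qed (auto simp: const_src[OF assms(1)])

lemma const_src_pow:
 assumes "constant_ograph G" "snd ` tlv t \<subseteq> cell G 0"
 shows "snd ` tlv ((tsrc G ^^ j) t) \<subseteq> snd ` tlv t \<and> snd ` tlv ((ttgt G ^^ j) t) \<subseteq> snd ` tlv t"
proof (induction j)
 case (Suc j)
 hence "snd ` tlv ((tsrc G ^^ j) t) \<subseteq> cell G 0" "snd ` tlv ((ttgt G ^^ j) t) \<subseteq> cell G 0"
  using assms(2) order_trans by blast+
 thus ?case
  using order_trans[OF conjunct1[OF const_tsrc[OF assms(1)]] conjunct1[OF Suc]] order_trans[OF conjunct2[OF const_tsrc[OF assms(1)]] conjunct2[OF Suc]]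
  by simp
qed simp

text \<open>The induction hypothesis for a composability premise yields one colour h for both
  boundary terms, and taking boundaries introduces no new colours; so h is the colour of either
  factor.\<close>

lemma const_match:
 assumes "constant_ograph G" "snd ` tlv t = {g}" "snd ` tlv u = {g'}" "g \<in> cell G 0" "g' \<in> cell G 0"
  and "\<exists>h\<in>cell G 0. snd ` tlv ((tsrc G ^^ j) t) = {h} \<and> snd ` tlv ((ttgt G ^^ j) u) = {h}"
 shows "g = g'"
 using const_src_pow[OF assms(1), of t j] const_src_pow[OF assms(1), of u j] assms by auto

lemma const_colour:
 assumes G: "constant_ograph G"
 shows "teq G n t u ==> \<exists>g\<in>cell G 0. snd ` tlv t = {g} \<and> snd ` tlv u = {g}"
proof (induction rule: teq.induct)
 case (gen x n) thus ?case using const_cell[OF G] by auto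
next
 case (cmp n t t' u u' k)
 from cmp.IH(1) obtain g1 where g1: "g1 \<in> cell G 0" "snd ` tlv t = {g1}" "snd ` tlv t' = {g1}" by blast
 from cmp.IH(2) obtain g2 where g2: "g2 \<in> cell G 0" "snd ` tlv u = {g2}" "snd ` tlv u' = {g2}" by blast
 have "g1 = g2" using const_match[OF G g1(2) g2(2) g1(1) g2(1) cmp.IH(3)] .
 thus ?case using g1 g2 by (auto simp: image_Un)
next
 case (assoc n t u v k)
 from assoc.IH(1) obtain g1 where g1: "g1 \<in> cell G 0" "snd ` tlv t = {g1}" by blast
 from assoc.IH(2) obtain g2 where g2: "g2 \<in> cell G 0" "snd ` tlv u = {g2}" by blast
 from assoc.IH(3) obtain g3 where g3: "g3 \<in> cell G 0" "snd ` tlv v = {g3}" by blast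
 have "g1 = g2" "g2 = g3"
  using const_match[OF G g1(2) g2(2) g1(1) g2(1) assoc.IH(4)] const_match[OF G g2(2) g3(2) g2(1) g3(1) assoc.IH(5)] .
 thus ?case using g1 g2 g3 by (auto simp: image_Un)
next
 case (unit_src n t k)
 then obtain g where g: "g \<in> cell G 0" "snd ` tlv t = {g}" by blast
 hence "snd ` tlv ((tsrc G ^^ (n - k)) t) \<subseteq> {g}" using const_src_pow[OF G, of t "n - k"] by auto
 thus ?case using g by (auto simp: tlv_Idt_pow image_Un)
next
 case (unit_tgt n t k)
 then obtain g where g: "g \<in> cell G 0" "snd ` tlv t = {g}" by blast
 hence "snd ` tlv ((ttgt G ^^ (n - k)) t) \<subseteq> {g}" using const_src_pow[OF G, of t "n - k"] by auto
 thus ?case using g by (auto simp: tlv_Idt_pow image_Un)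
next
 case (interchange n t u v w j k)
 from interchange.IH(1) obtain g1 where g1: "g1 \<in> cell G 0" "snd ` tlv t = {g1}" by blast
 from interchange.IH(2) obtain g2 where g2: "g2 \<in> cell G 0" "snd ` tlv u = {g2}" by blast
 from interchange.IH(3) obtain g3 where g3: "g3 \<in> cell G 0" "snd ` tlv v = {g3}" by blast
 from interchange.IH(4) obtain g4 where g4: "g4 \<in> cell G 0" "snd ` tlv w = {g4}" by blast
 have "g1 = g2" "g3 = g4" "g1 = g3"
  using const_match[OF G g1(2) g2(2) g1(1) g2(1) interchange.IH(5)] const_match[OF G g3(2) g4(2) g3(1) g4(1) interchange.IH(6)]
   const_match[OF G g1(2) g3(2) g1(1) g3(1) interchange.IH(7)] .
 thus ?case using g1 g2 g3 g4 by (auto simp: image_Un)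
next
 case (idt_cmp n t u k)
 from idt_cmp.IH(1) obtain g1 where g1: "g1 \<in> cell G 0" "snd ` tlv t = {g1}" by blast
 from idt_cmp.IH(2) obtain g2 where g2: "g2 \<in> cell G 0" "snd ` tlv u = {g2}" by blast
 have "g1 = g2" using const_match[OF G g1(2) g2(2) g1(1) g2(1) idt_cmp.IH(3)] .
 thus ?case using g1 g2 by (auto simp: image_Un)
qed auto

definition paint :: "'a ograph => nat => 'a => unit trm => 'a trm set" where
 "paint G n g w = cl G n (tmap (%_ _. g) w)"

definition shp :: "nat => 'a trm set => unit trm set" where
 "shp n K = T_map uno (%_ _. ()) n K"

definition tcol :: "'a trm set => 'a" where
 "tcol K = (SOME g. \<exists>t\<in>K. g \<in> snd ` tlv t)"

lemma paint_map: "constant_ograph G ==> g \<in> cell G 0 ==> ograph_map uno G (%_ _. g)"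
 unfolding ograph_map_def by (metis const_cell const_src)

lemma paint_teq: "constant_ograph G ==> g \<in> cell G 0 ==> teq uno n w w' ==> teq G n (tmap (%_ _. g) w) (tmap (%_ _. g) w')"
 using teq_tmap[OF uno_ograph const_ograph paint_map] .

lemma paint_cell: "constant_ograph G ==> g \<in> cell G 0 ==> teq uno n w w ==> paint G n g w \<in> Tcell G n"
 unfolding paint_def by (rule T_cellI) (rule paint_teq)

lemma paint_cong: "constant_ograph G ==> g \<in> cell G 0 ==> teq uno n w w' ==> paint G n g w = paint G n g w'"
 unfolding paint_def by (rule cl_eqI) (rule paint_teq)

lemma uno_tmap: "tmap (%_ _. ()) w = (w :: unit trm)"
 by (rule tmap_ident) simp

lemma shp_cl: "is_ograph X ==> teq X n t t ==> shp n (cl X n t) = cl uno n (tmap (%_ _. ()) t)"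
 unfolding shp_def by (rule T_map_cl[OF _ uno_ograph to_uno])

lemma shp_cell: "is_ograph X ==> K \<in> Tcell X n ==> shp n K \<in> Tcell uno n"
 unfolding shp_def by (rule T_map_cell[OF _ uno_ograph to_uno])

lemma shp_paint: "constant_ograph G ==> g \<in> cell G 0 ==> teq uno n w w ==> shp n (paint G n g w) = cl uno n w"
 unfolding paint_def by (simp add: shp_cl const_ograph paint_teq tmap_tmap uno_tmap)

lemma shp_map: "is_ograph X ==> is_ograph Y ==> ograph_map X Y f ==> K \<in> Tcell X n ==> shp n (T_map Y f n K) = shp n K"
 unfolding shp_def by (rule T_map_comp[OF _ _ uno_ograph _ to_uno])

lemma const_form:
 assumes G: "constant_ograph G" and K: "K \<in> Tcell G n"
 obtains g w where "g \<in> cell G 0" "teq uno n w w" "K = paint G n g w"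
 using K
proof (elim T_cellE)
 fix t assume t: "teq G n t t" "K = cl G n t"
 obtain g where g: "g \<in> cell G 0" "snd ` tlv t = {g}" using const_colour[OF G t(1)] by blast
 have "tmap (%_ _. g) (tmap (%_ _. ()) t) = t" unfolding tmap_tmap using g by (intro tmap_ident) force
 hence "K = paint G n g (tmap (%_ _. ()) t)" unfolding paint_def t by simp
 thus ?thesis using that g teq_tmap[OF const_ograph[OF G] uno_ograph to_uno t(1)] by blast
qed

lemma tcol_leaf:
 assumes G: "constant_ograph G" and "K \<in> Tcell G n" "t \<in> K" "(k, g) \<in> tlv t"
 shows "tcol K = g" "g \<in> cell G 0"
proof -
 have r: "teq G n t t" "K = cl G n t" using T_cell_rep[OF assms(2,3)] by auto
 obtain g' where g': "g' \<in> cell G 0" "snd ` tlv t = {g'}" using const_colour[OF G r(1)] by blast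
 have "g = g'" using g' assms(4) by force
 moreover have "snd ` tlv u = {g'}" if "u \<in> K" for u
 proof -
  have "teq G n t u" using that r(2) unfolding cl_def by blast
  from const_colour[OF G this] obtain h where "snd ` tlv t = {h}" "snd ` tlv u = {h}" by blast
  thus ?thesis using g'(2) by simp
 qed
 hence "tcol K = g'" unfolding tcol_def using assms(3) by (intro some_equality) auto
 ultimately show "tcol K = g" "g \<in> cell G 0" using g' by auto
qed

lemma tcol_paint: "constant_ograph G ==> g \<in> cell G 0 ==> teq uno n w w ==> tcol (paint G n g w) = g"
proof -
 assume a: "constant_ograph G" "g \<in> cell G 0" "teq uno n w w"
 obtain k where "(k, ()) \<in> tlv w" using tlv_ne[of w] by fastforce
 hence "(k, g) \<in> tlv (tmap (%_ _. g) w)" unfolding tlv_tmap by force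
 thus ?thesis using tcol_leaf(1)[OF a(1) paint_cell[OF a]] cl_self[OF paint_teq[OF a]] unfolding paint_def by blast
qed

lemma const_ext:
 assumes G: "constant_ograph G" and K: "K \<in> Tcell G n" "K' \<in> Tcell G n"
  and e: "shp n K = shp n K'" "tcol K = tcol K'"
 shows "K = K'"
proof -
 obtain g w where g: "g \<in> cell G 0" "teq uno n w w" "K = paint G n g w" using const_form[OF G K(1)] .
 obtain g' w' where g': "g' \<in> cell G 0" "teq uno n w' w'" "K' = paint G n g' w'" using const_form[OF G K(2)] .
 have "g = g'" using e(2) g g' tcol_paint[OF G] by simp
 moreover have "teq uno n w w'" using e(1) g g' shp_paint[OF G] cl_eqD by auto
 ultimately show ?thesis using g g' paint_cong[OF G g(1)] by blast
qed

lemma tcol_cell: "constant_ograph G ==> K \<in> Tcell G n ==> tcol K \<in> cell G 0"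
proof -
 assume G: "constant_ograph G" and K: "K \<in> Tcell G n"
 obtain g w where g: "g \<in> cell G 0" "teq uno n w w" "K = paint G n g w" using const_form[OF G K] .
 show ?thesis unfolding g(3) tcol_paint[OF G g(1,2)] by (rule g(1))
qed

lemma T_map_paint:
 assumes "constant_ograph G" "constant_ograph H" "ograph_map G H h" "g \<in> cell G 0" "teq uno n w w"
 shows "T_map H h n (paint G n g w) = paint H n (h 0 g) w"
proof -
 have "tmap (%n x. h n g) w = tmap (%_ _. h 0 g) w" by (rule tmap_leaf_cong) (rule const_map[OF assms(1-4)])
 thus ?thesis
  unfolding paint_def T_map_cl[OF const_ograph[OF assms(1)] const_ograph[OF assms(2)] assms(3) paint_teq[OF assms(1,4,5)]]
  by (simp add: tmap_tmap)
qed

lemma tcol_map: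
 assumes "constant_ograph G" "constant_ograph H" "ograph_map G H h" "K \<in> Tcell G n"
 shows "tcol (T_map H h n K) = h 0 (tcol K)"
proof -
 obtain g w where g: "g \<in> cell G 0" "teq uno n w w" "K = paint G n g w" using const_form[OF assms(1,4)] .
 have "h 0 g \<in> cell H 0" using omap_cell[OF assms(3) g(1)] .
 thus ?thesis unfolding g(3) T_map_paint[OF assms(1-3) g(1,2)] tcol_paint[OF assms(1) g(1,2)]
  by (rule tcol_paint[OF assms(2) _ g(2)])
qed

section \<open>Pointed \<open>T\<close>-graphs and their maps\<close>

lemma pgD:
 assumes "is_ptgraph C"
 shows "is_ograph (base C)" "is_ograph (tot C)" "ograph_map (tot C) (T_graph (base C)) (dmap C)"
  "ograph_map (tot C) (base C) (cmap C)" "ograph_map (base C) (tot C) (pt C)"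
  "g \<in> gcell C n ==> dmap C n (pt C n g) = T_unit (base C) n g"
  "g \<in> gcell C n ==> cmap C n (pt C n g) = g"
 using assms unfolding is_ptgraph_def is_tgraph_def by blast+

lemma pg_cell:
 assumes "is_ptgraph C"
 shows "x \<in> tcell C n ==> dmap C n x \<in> Tcell (base C) n" "x \<in> tcell C n ==> cmap C n x \<in> gcell C n"
  "g \<in> gcell C n ==> pt C n g \<in> tcell C n"
 using pgD(3-5)[OF assms] unfolding ograph_map_def by blast+

text \<open>\<open>ptgraph_hom\<close> without extensionality, so that composites are plain
  composites of functions and restriction is only dealt with when arrows are formed.\<close>

definition ptm :: "('u, 'y) ptgraph_scheme => ('u, 'z) ptgraph_scheme => (nat => 'u => 'u) => (nat => 'u => 'u) => bool" where
 "ptm C C' f h == ograph_map (tot C) (tot C') f \<and> ograph_map (base C) (base C') h \<and>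
   (\<forall>n. \<forall>x\<in>tcell C n.
    dmap C' n (f n x) = T_map (base C') h n (dmap C n x) \<and>
    cmap C' n (f n x) = h n (cmap C n x)) \<and>
   (\<forall>n. \<forall>g\<in>gcell C n. f n (pt C n g) = pt C' n (h n g))"

lemma ptmD:
 assumes "ptm C C' f h"
 shows "ograph_map (tot C) (tot C') f" "ograph_map (base C) (base C') h"
  "x \<in> tcell C n ==> dmap C' n (f n x) = T_map (base C') h n (dmap C n x)"
  "x \<in> tcell C n ==> cmap C' n (f n x) = h n (cmap C n x)"
  "g \<in> gcell C n ==> f n (pt C n g) = pt C' n (h n g)"
 using assms unfolding ptm_def by blast+

definition shape :: "('u, 'z) tgraph_scheme => nat => 'u => unit trm set" where
 "shape C n x = shp n (dmap C n x)"

definition incol :: "('u, 'z) tgraph_scheme => nat => 'u => 'u" where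
 "incol C n x = tcol (dmap C n x)"

lemma shape_cell: "is_ptgraph C ==> x \<in> tcell C n ==> shape C n x \<in> Tcell uno n"
 unfolding shape_def by (rule shp_cell[OF pgD(1) pg_cell(1)])

lemma incol_cell: "is_ptgraph C ==> constant_ograph (base C) ==> x \<in> tcell C n ==> incol C n x \<in> gcell C 0"
 unfolding incol_def by (rule tcol_cell[OF _ pg_cell(1)])

lemma cmap_cell: "is_ptgraph C ==> constant_ograph (base C) ==> x \<in> tcell C n ==> cmap C n x \<in> gcell C 0"
 using pg_cell(2) const_cell by metis

lemma ptm_shape:
 assumes "is_ptgraph C" "is_ptgraph C'" "ptm C C' f h" "x \<in> tcell C n"
 shows "shape C' n (f n x) = shape C n x"
 unfolding shape_def ptmD(3)[OF assms(3,4)]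
 by (rule shp_map[OF pgD(1)[OF assms(1)] pgD(1)[OF assms(2)] ptmD(2)[OF assms(3)]
   pg_cell(1)[OF assms(1) assms(4)]])

lemma ptm_incol:
 assumes "is_ptgraph C" "constant_ograph (base C)" "constant_ograph (base C')" "ptm C C' f h" "x \<in> tcell C n"
 shows "incol C' n (f n x) = h 0 (incol C n x)"
 unfolding incol_def ptmD(3)[OF assms(4,5)]
 by (rule tcol_map[OF assms(2,3) ptmD(2)[OF assms(4)] pg_cell(1)[OF assms(1) assms(5)]])

lemma ptm_cmap:
 assumes "is_ptgraph C" "constant_ograph (base C)" "constant_ograph (base C')" "ptm C C' f h" "x \<in> tcell C n"
 shows "cmap C' n (f n x) = h 0 (cmap C n x)"
 unfolding ptmD(4)[OF assms(4,5)]
 by (rule const_map[OF assms(2,3) ptmD(2)[OF assms(4)] cmap_cell[OF assms(1,2,5)]])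

text \<open>The unit cells make the base component a function of the total one. This is why
  morphisms are later compared on cells only and base components are quantified away.\<close>

lemma ptm_h: "is_ptgraph C' ==> ptm C C' f h ==> g \<in> gcell C n ==> h n g = cmap C' n (f n (pt C n g))"
 using ptmD(5) pgD(7) omap_cell[OF ptmD(2)] by metis

lemma ptm_comp:
 assumes "is_ptgraph A" "is_ptgraph B" "is_ptgraph C" "ptm A B f h" "ptm B C f' h'"
 shows "ptm A C (%n x. f' n (f n x)) (%n x. h' n (h n x))"
proof -
 have "dmap C n (f' n (f n x)) = T_map (base C) (%n x. h' n (h n x)) n (dmap A n x)" if x: "x \<in> tcell A n" for n x
  using ptmD(3)[OF assms(5) omap_cell[OF ptmD(1)[OF assms(4)] x]] ptmD(3)[OF assms(4) x]
   T_map_comp[OF pgD(1)[OF assms(1)] pgD(1)[OF assms(2)] pgD(1)[OF assms(3)] ptmD(2)[OF assms(4)]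
    ptmD(2)[OF assms(5)] pg_cell(1)[OF assms(1) x]] by simp
 moreover have "cmap C n (f' n (f n x)) = h' n (h n (cmap A n x))" if x: "x \<in> tcell A n" for n x
  using ptmD(4)[OF assms(5) omap_cell[OF ptmD(1)[OF assms(4)] x]] ptmD(4)[OF assms(4) x] by simp
 moreover have "f' n (f n (pt A n g)) = pt C n (h' n (h n g))" if g: "g \<in> gcell A n" for n g
  using ptmD(5)[OF assms(5) omap_cell[OF ptmD(2)[OF assms(4)] g]] ptmD(5)[OF assms(4) g] by simp
 ultimately show ?thesis
  using ograph_map_comp[OF ptmD(1)[OF assms(4)] ptmD(1)[OF assms(5)]]
   ograph_map_comp[OF ptmD(2)[OF assms(4)] ptmD(2)[OF assms(5)]] unfolding ptm_def by blast
qed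

lemma ptm_id: "is_ptgraph C ==> ptm C C (%_ x. x) (%_ x. x)"
proof -
 assume C: "is_ptgraph C"
 have "T_map (base C) (%_ x. x) n (dmap C n x) = dmap C n x" if "x \<in> tcell C n" for n x
  by (rule T_map_ident[OF pgD(1)[OF C] pg_cell(1)[OF C that]]) simp
 thus ?thesis unfolding ptm_def by (simp add: ograph_map_def)
qed

lemma ptm_cong:
 assumes C: "is_ptgraph C" and m: "ptm C C' f h"
  and f: "!!n x. x \<in> tcell C n ==> f n x = f' n x" and h: "!!n g. g \<in> gcell C n ==> h n g = h' n g"
 shows "ptm C C' f' h'"
proof -
 have "dmap C' n (f' n x) = T_map (base C') h' n (dmap C n x) \<and> cmap C' n (f' n x) = h' n (cmap C n x)"
  if x: "x \<in> tcell C n" for n x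
 proof -
  have "T_map (base C') h n (dmap C n x) = T_map (base C') h' n (dmap C n x)"
   by (rule T_map_cong[OF pgD(1)[OF C] pg_cell(1)[OF C x] h])
  thus ?thesis using ptmD(3,4)[OF m x] f[OF x] h[OF pg_cell(2)[OF C x]] by simp
 qed
 moreover have "f' n (pt C n g) = pt C' n (h' n g)" if g: "g \<in> gcell C n" for n g
  using ptmD(5)[OF m g] h[OF g] f[OF pg_cell(3)[OF C g]] by simp
 ultimately show ?thesis
  using ograph_map_cong[OF pgD(2)[OF C] ptmD(1)[OF m] f] ograph_map_cong[OF pgD(1)[OF C] ptmD(2)[OF m] h]
  unfolding ptm_def by blast
qed

subsection \<open>The pullback\<close>

lemma pb_iff: "(K, x) \<in> pcell C n \<longleftrightarrow>
  K \<in> Tcell (tot C) n \<and> x \<in> tcell C n \<and> T_map (base C) (cmap C) n K = dmap C n x"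
 unfolding pullback_def by simp

lemma pb_src: "src (pullback C) n (K, x) = (src (T_graph (tot C)) n K, src (tot C) n x)"
 and pb_tgt: "tgt (pullback C) n (K, x) = (tgt (T_graph (tot C)) n K, tgt (tot C) n x)"
 unfolding pullback_def by simp_all

lemma pb_face:
 assumes C: "is_ptgraph C" and k: "(K, x) \<in> pcell C (Suc n)"
 shows "(src (T_graph (tot C)) n K, src (tot C) n x) \<in> pcell C n"
  "(tgt (T_graph (tot C)) n K, tgt (tot C) n x) \<in> pcell C n"
proof -
 have K: "K \<in> Tcell (tot C) (Suc n)" and x: "x \<in> tcell C (Suc n)"
  and e: "T_map (base C) (cmap C) (Suc n) K = dmap C (Suc n) x" using k unfolding pb_iff by auto
 note Tc = T_map_ograph_map[OF pgD(2)[OF C] pgD(1)[OF C] pgD(4)[OF C]]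
 note T = T_graph_ograph[OF pgD(2)[OF C]]
 show "(src (T_graph (tot C)) n K, src (tot C) n x) \<in> pcell C n"
  "(tgt (T_graph (tot C)) n K, tgt (tot C) n x) \<in> pcell C n"
  unfolding pb_iff
  using omap_src[OF Tc K] omap_tgt[OF Tc K] omap_src[OF pgD(3)[OF C] x]
   omap_tgt[OF pgD(3)[OF C] x] e ograph_src[OF T K] ograph_tgt[OF T K]
   ograph_src[OF pgD(2)[OF C] x] ograph_tgt[OF pgD(2)[OF C] x] by simp_all
qed

lemma pb_ograph:
 assumes C: "is_ptgraph C"
 shows "is_ograph (pullback C)"
proof -
 note T = T_graph_ograph[OF pgD(2)[OF C]]
 have g: "src (T_graph (tot C)) n (src (T_graph (tot C)) (Suc n) K) = src (T_graph (tot C)) n (tgt (T_graph (tot C)) (Suc n) K) \<and>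
  tgt (T_graph (tot C)) n (src (T_graph (tot C)) (Suc n) K) = tgt (T_graph (tot C)) n (tgt (T_graph (tot C)) (Suc n) K) \<and>
  src (tot C) n (src (tot C) (Suc n) x) = src (tot C) n (tgt (tot C) (Suc n) x) \<and>
  tgt (tot C) n (src (tot C) (Suc n) x) = tgt (tot C) n (tgt (tot C) (Suc n) x)"
  if "(K, x) \<in> pcell C (Suc (Suc n))" for K x n
  using T pgD(2)[OF C] that unfolding is_ograph_def pb_iff by blast
 show ?thesis unfolding is_ograph_def by (auto simp: pb_src pb_tgt pb_face[OF C] g)
qed

definition pbmap :: "('u, 'z) tgraph_scheme => (nat => 'u => 'u) => nat => 'u trm set \<times> 'u => 'u trm set \<times> 'u" where
 "pbmap C' f n = (%(K, x). (T_map (tot C') f n K, f n x))"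

lemma pb_map_cell:
 assumes C: "is_ptgraph C" and C': "is_ptgraph C'" and m: "ptm C C' f h" and k: "(K, x) \<in> pcell C n"
 shows "(T_map (tot C') f n K, f n x) \<in> pcell C' n"
proof -
 have K: "K \<in> Tcell (tot C) n" and x: "x \<in> tcell C n"
  and e: "T_map (base C) (cmap C) n K = dmap C n x" using k unfolding pb_iff by auto
 have "T_map (base C') (cmap C') n (T_map (tot C') f n K) = T_map (base C') (%n x. cmap C' n (f n x)) n K"
  using T_map_comp[OF pgD(2)[OF C] pgD(2)[OF C'] pgD(1)[OF C'] ptmD(1)[OF m] pgD(4)[OF C'] K] .
 also have "\<dots> = T_map (base C') (%n x. h n (cmap C n x)) n K"
  by (rule T_map_cong[OF pgD(2)[OF C] K]) (rule ptmD(4)[OF m])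
 also have "\<dots> = T_map (base C') h n (T_map (base C) (cmap C) n K)"
  using T_map_comp[OF pgD(2)[OF C] pgD(1)[OF C] pgD(1)[OF C'] pgD(4)[OF C] ptmD(2)[OF m] K] by simp
 also have "\<dots> = dmap C' n (f n x)" unfolding e using ptmD(3)[OF m x] by simp
 finally show ?thesis unfolding pb_iff
  using T_map_cell[OF pgD(2)[OF C] pgD(2)[OF C'] ptmD(1)[OF m] K] omap_cell[OF ptmD(1)[OF m] x] by blast
qed

lemma pbmap_ograph_map:
 assumes C: "is_ptgraph C" and C': "is_ptgraph C'" and m: "ptm C C' f h"
 shows "ograph_map (pullback C) (pullback C') (pbmap C' f)"
proof -
 note Tf = T_map_ograph_map[OF pgD(2)[OF C] pgD(2)[OF C'] ptmD(1)[OF m]]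
 have "pbmap C' f n kx \<in> pcell C' n" if "kx \<in> pcell C n" for n kx
  using that pb_map_cell[OF C C' m] by (cases kx) (simp add: pbmap_def)
 moreover have "pbmap C' f n (src (pullback C) n kx) = src (pullback C') n (pbmap C' f (Suc n) kx) \<and>
   pbmap C' f n (tgt (pullback C) n kx) = tgt (pullback C') n (pbmap C' f (Suc n) kx)"
  if kx: "kx \<in> pcell C (Suc n)" for n kx
 proof (cases kx)
  case (Pair K x)
  hence "K \<in> Tcell (tot C) (Suc n)" "x \<in> tcell C (Suc n)" using kx unfolding Pair pb_iff by auto
  thus ?thesis using Pair omap_src[OF Tf] omap_tgt[OF Tf] omap_src[OF ptmD(1)[OF m]] omap_tgt[OF ptmD(1)[OF m]]
   by (simp add: pbmap_def pb_src pb_tgt)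
 qed
 ultimately show ?thesis unfolding ograph_map_def by blast
qed

lemma fst_ograph_map: "ograph_map (pullback C) (T_graph (tot C)) (%_. fst)"
 and snd_ograph_map: "ograph_map (pullback C) (tot C) (%_. snd)"
 unfolding ograph_map_def by (auto simp: pb_iff pb_src pb_tgt)

subsection \<open>Multiplicative maps\<close>

text \<open>Isolated because the two sides of the unit and associativity laws already make sense,
  and are natural, at this stage; the laws themselves can then be transported.\<close>

definition premul :: "('u, 'z) tcat_scheme => bool" where
 "premul C == is_ptgraph C \<and> ograph_map (pullback C) (tot C) (mul C) \<and>
   (\<forall>n K x. (K, x) \<in> pcell C n -->
    dmap C n (mul C n (K, x)) = T_mult (base C) n (T_map (T_graph (base C)) (dmap C) n K) \<and>
    cmap C n (mul C n (K, x)) = cmap C n x)"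

definition mulm :: "('u, 'y) tcat_scheme => ('u, 'z) tcat_scheme => (nat => 'u => 'u) => (nat => 'u => 'u) => bool" where
 "mulm C C' f h == ptm C C' f h \<and> (\<forall>n K x. (K, x) \<in> pcell C n -->
    f n (mul C n (K, x)) = mul C' n (T_map (tot C') f n K, f n x))"

lemma mulmD: "mulm C C' f h ==> ptm C C' f h"
 "mulm C C' f h ==> (K, x) \<in> pcell C n ==> f n (mul C n (K, x)) = mul C' n (T_map (tot C') f n K, f n x)"
 unfolding mulm_def by blast+

lemma premulD:
 assumes "premul C"
 shows "is_ptgraph C" "ograph_map (pullback C) (tot C) (mul C)"
  "(K, x) \<in> pcell C n ==> dmap C n (mul C n (K, x)) = T_mult (base C) n (T_map (T_graph (base C)) (dmap C) n K)"
  "(K, x) \<in> pcell C n ==> cmap C n (mul C n (K, x)) = cmap C n x"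
 using assms unfolding premul_def by blast+

lemma tcat_premul: "is_tcat C ==> premul C"
 unfolding is_tcat_def premul_def by blast

lemma mult_d_nat:
 assumes C: "is_ptgraph C" and C': "is_ptgraph C'" and m: "ptm C C' f h" and K: "K \<in> Tcell (tot C) n"
 shows "T_mult (base C') n (T_map (T_graph (base C')) (dmap C') n (T_map (tot C') f n K)) =
   T_map (base C') h n (T_mult (base C) n (T_map (T_graph (base C)) (dmap C) n K))"
proof -
 note o = pgD(1)[OF C] pgD(1)[OF C'] pgD(2)[OF C] pgD(2)[OF C']
 note To = T_graph_ograph[OF o(1)] T_graph_ograph[OF o(2)]
 have Kd: "T_map (T_graph (base C)) (dmap C) n K \<in> Tcell (T_graph (base C)) n"
  using T_map_cell[OF o(3) To(1) pgD(3)[OF C] K] .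
 have "T_map (T_graph (base C')) (dmap C') n (T_map (tot C') f n K) = T_map (T_graph (base C')) (%n x. dmap C' n (f n x)) n K"
  using T_map_comp[OF o(3,4) To(2) ptmD(1)[OF m] pgD(3)[OF C'] K] .
 also have "\<dots> = T_map (T_graph (base C')) (%n x. T_map (base C') h n (dmap C n x)) n K"
  by (rule T_map_cong[OF o(3) K]) (rule ptmD(3)[OF m])
 also have "\<dots> = T_map (T_graph (base C')) (T_map (base C') h) n (T_map (T_graph (base C)) (dmap C) n K)"
  using T_map_comp[OF o(3) To(1,2) pgD(3)[OF C] T_map_ograph_map[OF o(1,2) ptmD(2)[OF m]] K] by simp
 finally show ?thesis using T_mult_nat[OF o(1,2) ptmD(2)[OF m] Kd] by simp
qed

lemma unit_pb:
 assumes C: "is_ptgraph C" and x: "x \<in> tcell C n"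
 shows "(T_unit (tot C) n x, pt C n (cmap C n x)) \<in> pcell C n"
  "(T_map (tot C) (pt C) n (dmap C n x), x) \<in> pcell C n"
proof -
 note o = pgD(1)[OF C] pgD(2)[OF C]
 have c: "cmap C n x \<in> gcell C n" and d: "dmap C n x \<in> Tcell (base C) n"
  using pg_cell(2)[OF C x] pg_cell(1)[OF C x] .
 show "(T_unit (tot C) n x, pt C n (cmap C n x)) \<in> pcell C n"
  unfolding pb_iff using omap_cell[OF T_unit_ograph_map[OF o(2)] x] pg_cell(3)[OF C c]
   T_map_unit[OF o(2,1) pgD(4)[OF C] x] pgD(6)[OF C c] by simp
 have "T_map (base C) (cmap C) n (T_map (tot C) (pt C) n (dmap C n x)) = T_map (base C) (%n x. cmap C n (pt C n x)) n (dmap C n x)"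
  using T_map_comp[OF o o(1) pgD(5)[OF C] pgD(4)[OF C] d] .
 also have "\<dots> = dmap C n x" by (rule T_map_ident[OF o(1) d]) (rule pgD(7)[OF C])
 finally show "(T_map (tot C) (pt C) n (dmap C n x), x) \<in> pcell C n"
  unfolding pb_iff using T_map_cell[OF o pgD(5)[OF C] d] x by simp
qed

text \<open>Naturality of both sides of the unit laws. It serves twice: laws are pulled back along
  jointly injective families and pushed forward along jointly surjective ones.\<close>

lemma unit_push:
 assumes C: "premul C" and C': "is_ptgraph C'" and m: "mulm C C' f h" and x: "x \<in> tcell C n"
 shows "mul C' n (T_unit (tot C') n (f n x), pt C' n (cmap C' n (f n x))) = f n (mul C n (T_unit (tot C) n x, pt C n (cmap C n x)))"
  "mul C' n (T_map (tot C') (pt C') n (dmap C' n (f n x)), f n x) = f n (mul C n (T_map (tot C) (pt C) n (dmap C n x), x))"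
proof -
 note p = premulD(1)[OF C]
 note o = pgD(1)[OF p] pgD(2)[OF p] pgD(1)[OF C'] pgD(2)[OF C']
 note mp = mulmD(1)[OF m]
 have c: "cmap C n x \<in> gcell C n" and d: "dmap C n x \<in> Tcell (base C) n"
  using pg_cell(2)[OF p x] pg_cell(1)[OF p x] .
 show "mul C' n (T_unit (tot C') n (f n x), pt C' n (cmap C' n (f n x))) = f n (mul C n (T_unit (tot C) n x, pt C n (cmap C n x)))"
  using mulmD(2)[OF m unit_pb(1)[OF p x]] T_map_unit[OF o(2,4) ptmD(1)[OF mp] x] ptmD(4)[OF mp x] ptmD(5)[OF mp c] by simp
 have "T_map (tot C') f n (T_map (tot C) (pt C) n (dmap C n x)) = T_map (tot C') (%n x. f n (pt C n x)) n (dmap C n x)"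
  using T_map_comp[OF o(1,2,4) pgD(5)[OF p] ptmD(1)[OF mp] d] .
 also have "\<dots> = T_map (tot C') (%n x. pt C' n (h n x)) n (dmap C n x)"
  by (rule T_map_cong[OF o(1) d]) (rule ptmD(5)[OF mp])
 also have "\<dots> = T_map (tot C') (pt C') n (T_map (base C') h n (dmap C n x))"
  using T_map_comp[OF o(1,3,4) ptmD(2)[OF mp] pgD(5)[OF C'] d] by simp
 finally show "mul C' n (T_map (tot C') (pt C') n (dmap C' n (f n x)), f n x) = f n (mul C n (T_map (tot C) (pt C) n (dmap C n x), x))"
  using mulmD(2)[OF m unit_pb(2)[OF p x]] ptmD(3)[OF mp x] by simp
qed

abbreviation "flatten C n tht x == (T_mult (tot C) n (T_map (T_graph (tot C)) (%_. fst) n tht), mul C n (T_map (tot C) (%_. snd) n tht, x))"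

lemma assoc_pb:
 assumes C: "premul C" and tht: "tht \<in> Tcell (pullback C) n" and x: "x \<in> tcell C n"
  and e: "T_map (base C) (%i Kx. cmap C i (snd Kx)) n tht = dmap C n x"
 shows "(T_map (tot C) (mul C) n tht, x) \<in> pcell C n"
  "(T_map (tot C) (%_. snd) n tht, x) \<in> pcell C n"
  "(flatten C n tht x) \<in> pcell C n"
proof -
 note p = premulD(1)[OF C]
 note o = pgD(1)[OF p] pgD(2)[OF p] pb_ograph[OF p]
 note To = T_graph_ograph[OF o(1)] T_graph_ograph[OF o(2)]
 have "T_map (base C) (cmap C) n (T_map (tot C) (mul C) n tht) = T_map (base C) (%n x. cmap C n (mul C n x)) n tht"
  using T_map_comp[OF o(3,2,1) premulD(2)[OF C] pgD(4)[OF p] tht] .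
 also have "\<dots> = T_map (base C) (%i Kx. cmap C i (snd Kx)) n tht"
  by (rule T_map_cong[OF o(3) tht]) (use premulD(4)[OF C] in \<open>auto simp: pullback_def\<close>)
 finally show "(T_map (tot C) (mul C) n tht, x) \<in> pcell C n"
  unfolding pb_iff using e x T_map_cell[OF o(3,2) premulD(2)[OF C] tht] by simp
 have s: "T_map (tot C) (%_. snd) n tht \<in> Tcell (tot C) n" using T_map_cell[OF o(3,2) snd_ograph_map tht] .
 show sx: "(T_map (tot C) (%_. snd) n tht, x) \<in> pcell C n"
  unfolding pb_iff using e x s T_map_comp[OF o(3,2,1) snd_ograph_map pgD(4)[OF p] tht] by simp
 have f: "T_map (T_graph (tot C)) (%_. fst) n tht \<in> Tcell (T_graph (tot C)) n"
  using T_map_cell[OF o(3) To(2) fst_ograph_map tht] .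
 have "T_map (base C) (cmap C) n (T_mult (tot C) n (T_map (T_graph (tot C)) (%_. fst) n tht)) =
   T_mult (base C) n (T_map (T_graph (base C)) (T_map (base C) (cmap C)) n (T_map (T_graph (tot C)) (%_. fst) n tht))"
  using T_mult_nat[OF o(2,1) pgD(4)[OF p] f] .
 also have "T_map (T_graph (base C)) (T_map (base C) (cmap C)) n (T_map (T_graph (tot C)) (%_. fst) n tht) =
   T_map (T_graph (base C)) (%n y. T_map (base C) (cmap C) n (fst y)) n tht"
  using T_map_comp[OF o(3) To(2,1) fst_ograph_map T_map_ograph_map[OF o(2,1) pgD(4)[OF p]] tht] .
 also have "\<dots> = T_map (T_graph (base C)) (%n y. dmap C n (snd y)) n tht"
  by (rule T_map_cong[OF o(3) tht]) (auto simp: pullback_def)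
 also have "\<dots> = T_map (T_graph (base C)) (dmap C) n (T_map (tot C) (%_. snd) n tht)"
  using T_map_comp[OF o(3,2) To(1) snd_ograph_map pgD(3)[OF p] tht] by simp
 also have "T_mult (base C) n \<dots> = dmap C n (mul C n (T_map (tot C) (%_. snd) n tht, x))"
  using premulD(3)[OF C sx] by simp
 finally show "(flatten C n tht x) \<in> pcell C n"
  unfolding pb_iff using T_mult_cell[OF o(2) f] omap_cell[OF premulD(2)[OF C] sx] by simp
qed

text \<open>The counterpart of \<open>unit_push\<close> for associativity: \<open>tht\<close> is
  moved by T of \<open>pbmap\<close>, and each side is rewritten by functoriality of T and
  naturality of its multiplication.\<close>

lemma assoc_push:
 assumes C: "premul C" and C': "premul C'" and m: "mulm C C' f h"
  and tht: "tht \<in> Tcell (pullback C) n" and x: "x \<in> tcell C n"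
  and e: "T_map (base C) (%i Kx. cmap C i (snd Kx)) n tht = dmap C n x"
 defines "tht' \<equiv> T_map (pullback C') (pbmap C' f) n tht"
 shows "mul C' n (T_map (tot C') (mul C') n tht', f n x) = f n (mul C n (T_map (tot C) (mul C) n tht, x))"
  "mul C' n (T_mult (tot C') n (T_map (T_graph (tot C')) (%_. fst) n tht'), mul C' n (T_map (tot C') (%_. snd) n tht', f n x)) =
   f n (mul C n (flatten C n tht x))"
proof -
 note p = premulD(1)[OF C] and p' = premulD(1)[OF C']
 note o = pgD(2)[OF p] pb_ograph[OF p] pgD(2)[OF p'] pb_ograph[OF p']
 note To = T_graph_ograph[OF o(1)] T_graph_ograph[OF o(3)]
 note mp = mulmD(1)[OF m]
 note q = pbmap_ograph_map[OF p p' mp]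
 note a = assoc_pb[OF C tht x e]
 have "T_map (tot C') f n (T_map (tot C) (mul C) n tht) = T_map (tot C') (%n y. f n (mul C n y)) n tht"
  using T_map_comp[OF o(2,1,3) premulD(2)[OF C] ptmD(1)[OF mp] tht] .
 also have "\<dots> = T_map (tot C') (%n y. mul C' n (pbmap C' f n y)) n tht"
  by (rule T_map_cong[OF o(2) tht]) (use mulmD(2)[OF m] in \<open>auto simp: pbmap_def\<close>)
 also have "\<dots> = T_map (tot C') (mul C') n tht'"
  unfolding tht'_def using T_map_comp[OF o(2,4,3) q premulD(2)[OF C'] tht] by simp
 finally show "mul C' n (T_map (tot C') (mul C') n tht', f n x) = f n (mul C n (T_map (tot C) (mul C) n tht, x))"
  using mulmD(2)[OF m a(1)] by simp
 have "T_map (tot C') f n (T_map (tot C) (%_. snd) n tht) = T_map (tot C') (%n y. f n (snd y)) n tht"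
  using T_map_comp[OF o(2,1,3) snd_ograph_map ptmD(1)[OF mp] tht] .
 also have "\<dots> = T_map (tot C') (%n y. snd (pbmap C' f n y)) n tht"
  by (simp add: pbmap_def case_prod_beta)
 also have "\<dots> = T_map (tot C') (%_. snd) n tht'"
  unfolding tht'_def using T_map_comp[OF o(2,4,3) q snd_ograph_map tht] by simp
 finally have 1: "f n (mul C n (T_map (tot C) (%_. snd) n tht, x)) = mul C' n (T_map (tot C') (%_. snd) n tht', f n x)"
  using mulmD(2)[OF m a(2)] by simp
 have fc: "T_map (T_graph (tot C)) (%_. fst) n tht \<in> Tcell (T_graph (tot C)) n"
  using T_map_cell[OF o(2) To(1) fst_ograph_map tht] .
 have "T_map (tot C') f n (T_mult (tot C) n (T_map (T_graph (tot C)) (%_. fst) n tht)) =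
   T_mult (tot C') n (T_map (T_graph (tot C')) (T_map (tot C') f) n (T_map (T_graph (tot C)) (%_. fst) n tht))"
  using T_mult_nat[OF o(1,3) ptmD(1)[OF mp] fc] .
 also have "T_map (T_graph (tot C')) (T_map (tot C') f) n (T_map (T_graph (tot C)) (%_. fst) n tht) =
   T_map (T_graph (tot C')) (%n y. T_map (tot C') f n (fst y)) n tht"
  using T_map_comp[OF o(2) To fst_ograph_map T_map_ograph_map[OF o(1,3) ptmD(1)[OF mp]] tht] .
 also have "\<dots> = T_map (T_graph (tot C')) (%n y. fst (pbmap C' f n y)) n tht"
  by (simp add: pbmap_def case_prod_beta)
 also have "\<dots> = T_map (T_graph (tot C')) (%_. fst) n tht'"
  unfolding tht'_def using T_map_comp[OF o(2,4) To(2) q fst_ograph_map tht] by simp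
 finally show "mul C' n (T_mult (tot C') n (T_map (T_graph (tot C')) (%_. fst) n tht'), mul C' n (T_map (tot C') (%_. snd) n tht', f n x)) =
   f n (mul C n (flatten C n tht x))"
  using mulmD(2)[OF m a(3)] 1 by simp
qed

section \<open>Contractions and maps\<close>

text \<open>Maps preserve shapes, so any single index determines the shape, for which I must be
  nonempty; the colour is determined by all indices together.\<close>

lemma T_joint:
 assumes G: "constant_ograph G" and I: "I \<noteq> {}" and H: "!!i. i \<in> I ==> constant_ograph (H i) \<and> ograph_map G (H i) (h i)"
  and inj: "!!g g'. g \<in> cell G 0 ==> g' \<in> cell G 0 ==> (!!i. i \<in> I ==> h i 0 g = h i 0 g') ==> g = g'"
  and K: "K \<in> Tcell G n" "K' \<in> Tcell G n"
  and e: "!!i. i \<in> I ==> T_map (H i) (h i) n K = T_map (H i) (h i) n K'"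
 shows "K = K'"
proof (rule const_ext[OF G K])
 obtain i where i: "i \<in> I" using I by blast
 have "shp n (T_map (H i) (h i) n L) = shp n L" if "L \<in> Tcell G n" for L
  using shp_map[OF const_ograph[OF G] const_ograph _ that] H[OF i] by blast
 thus "shp n K = shp n K'" using e[OF i] K by metis
 have "h i 0 (tcol K) = h i 0 (tcol K')" if "i \<in> I" for i
  using tcol_map[OF G _ _ K(1)] tcol_map[OF G _ _ K(2)] H[OF that] e[OF that] by metis
 thus "tcol K = tcol K'" using inj tcol_cell[OF G] K by blast
qed

lemma src0_cell: "is_ograph X ==> x \<in> cell X n ==> src0 X n x \<in> cell X 0 \<and> tgt0 X n x \<in> cell X 0"
 by (induction n arbitrary: x) (auto simp: ograph_src ograph_tgt)

lemma src0_map: "is_ograph X ==> ograph_map X Y f ==> x \<in> cell X n ==>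
  f 0 (src0 X n x) = src0 Y n (f n x) \<and> f 0 (tgt0 X n x) = tgt0 Y n (f n x)"
 by (induction n arbitrary: x) (auto simp: ograph_src ograph_tgt omap_src omap_tgt)

definition root_shape :: "nat => unit trm set" where
 "root_shape n = T_id0 uno n (T_unit uno 0 ())"

text \<open>Any colour painted on the iterated identity shape gives a root, so only the shape
  matters. Since morphisms preserve shapes, they preserve and reflect root cells.\<close>

lemma root_iff:
 assumes C: "is_ptgraph C" and G: "constant_ograph (base C)" and x: "x \<in> tcell C n" and n: "n \<ge> 1"
 shows "root_cell C n x \<longleftrightarrow> shape C n x = root_shape n"
proof -
 note o = pgD(1)[OF C]
 have u: "T_unit (base C) 0 g \<in> Tcell (base C) 0" if "g \<in> gcell C 0" for g
  using omap_cell[OF T_unit_ograph_map[OF o] that] .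
 have s: "shp n (T_id0 (base C) n (T_unit (base C) 0 g)) = root_shape n" if g: "g \<in> gcell C 0" for g
  unfolding shp_def root_shape_def T_map_id0[OF o uno_ograph to_uno u[OF g]] T_map_unit[OF o uno_ograph to_uno g] ..
 have "dmap C n x = T_id0 (base C) n (T_unit (base C) 0 (incol C n x))" if e: "shape C n x = root_shape n"
 proof (rule const_ext[OF G pg_cell(1)[OF C x]])
  let ?g = "incol C n x"
  have g: "?g \<in> gcell C 0" using incol_cell[OF C G x] .
  show c: "T_id0 (base C) n (T_unit (base C) 0 ?g) \<in> Tcell (base C) n" using T_id0_cell[OF u[OF g]] .
  show "shp n (dmap C n x) = shp n (T_id0 (base C) n (T_unit (base C) 0 ?g))" using s[OF g] e unfolding shape_def by simp
  have "T_id0 (base C) n (T_unit (base C) 0 ?g) = cl (base C) n ((Idt ^^ n) (Gen 0 ?g))"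
   unfolding T_unit_cl by (rule T_id0_cl) (rule teq.gen[OF g])
  moreover have "teq (base C) n ((Idt ^^ n) (Gen 0 ?g)) ((Idt ^^ n) (Gen 0 ?g))"
   using teq_Idt_pow[OF teq.gen[OF g], of n] by simp
  ultimately have "(Idt ^^ n) (Gen 0 ?g) \<in> T_id0 (base C) n (T_unit (base C) 0 ?g)" using cl_self by simp
  from tcol_leaf(1)[OF G c this] show "tcol (dmap C n x) = tcol (T_id0 (base C) n (T_unit (base C) 0 ?g))"
   by (simp add: tlv_Idt_pow incol_def)
 qed
 thus ?thesis unfolding root_cell_def using n x s incol_cell[OF C G x] unfolding shape_def by metis
qed

lemma contractible_cells: "(x, y) \<in> contractible_pairs C k ==> x \<in> tcell C k \<and> y \<in> tcell C k \<and> dmap C k x = dmap C k y"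
 unfolding contractible_pairs_def by (auto split: if_splits)

text \<open>The loop property is only promised for pairs of roots. If the images are roots then so
  were x and y, because shapes are preserved; their loop property is then mapped forward.\<close>

lemma contractible_push:
 assumes C: "is_ptgraph C" "constant_ograph (base C)" and C': "is_ptgraph C'" "constant_ograph (base C')"
  and m: "ptm C C' f h" and xy: "(x, y) \<in> contractible_pairs C k"
 shows "(f k x, f k y) \<in> contractible_pairs C' k"
proof -
 note c = omap_cell[OF ptmD(1)[OF m]]
 note s = src0_map[OF pgD(2)[OF C(1)] ptmD(1)[OF m]]
 note xyc = contractible_cells[OF xy]
 show ?thesis
 proof (cases k)
  case 0
  thus ?thesis using xy c unfolding contractible_pairs_def by auto
 next
  case (Suc j)
  have p: "parallel (tot C) k x y" and l: "root_cell C k x \<and> root_cell C k y --> loop_property C k x y"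
   using xy Suc unfolding contractible_pairs_def by auto
  have xj: "x \<in> tcell C (Suc j)" "y \<in> tcell C (Suc j)" using xyc Suc by auto
  have xk: "x \<in> tcell C k" "y \<in> tcell C k" "k \<ge> 1" using xyc Suc by auto
  have "src (tot C') j (f (Suc j) x) = src (tot C') j (f (Suc j) y)" "tgt (tot C') j (f (Suc j) x) = tgt (tot C') j (f (Suc j) y)"
   using p Suc unfolding parallel_def
   by (simp_all flip: omap_src[OF ptmD(1)[OF m] xj(1)] omap_src[OF ptmD(1)[OF m] xj(2)]
     omap_tgt[OF ptmD(1)[OF m] xj(1)] omap_tgt[OF ptmD(1)[OF m] xj(2)])
  hence "parallel (tot C') k (f k x) (f k y)" using c[OF xk(1)] c[OF xk(2)] Suc unfolding parallel_def by simp
  moreover have "loop_property C' k (f k x) (f k y)" if r: "root_cell C' k (f k x)" "root_cell C' k (f k y)"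
  proof -
   have "root_cell C k x" "root_cell C k y"
    using r root_iff[OF C xk(1,3)] root_iff[OF C xk(2,3)] root_iff[OF C' c[OF xk(1)] xk(3)] root_iff[OF C' c[OF xk(2)] xk(3)]
     ptm_shape[OF C(1) C'(1) m xk(1)] ptm_shape[OF C(1) C'(1) m xk(2)] by simp_all
   hence "loop_property C k x y" using l by blast
   thus ?thesis using s[OF xk(1)] s[OF xk(2)] unfolding loop_property_def by metis
  qed
  ultimately show ?thesis using c xyc Suc ptmD(3)[OF m] unfolding contractible_pairs_def by simp
 qed
qed

text \<open>Parallelism and the loop property are equations between cells and so follow by joint
  injectivity. The equation between values of \<open>dmap\<close> lives in T of the base and is
  supplied separately.\<close>

lemma contractible_reflect:
 assumes C: "is_ptgraph C" "constant_ograph (base C)" and I: "I \<noteq> {}"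
  and M: "!!i. i \<in> I ==> is_ptgraph (M i) \<and> constant_ograph (base (M i)) \<and> ptm C (M i) (e i) (h i)"
  and inj: "!!n x y. x \<in> tcell C n ==> y \<in> tcell C n ==> (!!i. i \<in> I ==> e i n x = e i n y) ==> x = y"
  and d: "dmap C k x = dmap C k y"
  and x: "x \<in> tcell C k" and y: "y \<in> tcell C k"
  and xy: "!!i. i \<in> I ==> (e i k x, e i k y) \<in> contractible_pairs (M i) k"
 shows "(x, y) \<in> contractible_pairs C k"
proof (cases k)
 case 0
 hence "x = y" using inj[OF x y] xy unfolding contractible_pairs_def by auto
 thus ?thesis using x 0 unfolding contractible_pairs_def by simp
next
 case (Suc j)
 note o = pgD(2)[OF C(1)]
 have p: "parallel (tot (M i)) k (e i k x) (e i k y)" if "i \<in> I" for i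
  using xy[OF that] Suc unfolding contractible_pairs_def by auto
 have xj: "x \<in> tcell C (Suc j)" "y \<in> tcell C (Suc j)" using x y Suc by auto
 have "src (tot C) j x = src (tot C) j y"
 proof (rule inj[OF ograph_src[OF o xj(1)] ograph_src[OF o xj(2)]])
  fix i assume i: "i \<in> I"
  hence m: "ograph_map (tot C) (tot (M i)) (e i)" using M ptmD(1) by blast
  show "e i j (src (tot C) j x) = e i j (src (tot C) j y)"
   unfolding omap_src[OF m xj(1)] omap_src[OF m xj(2)] using p[OF i] Suc unfolding parallel_def by simp
 qed
 moreover have "tgt (tot C) j x = tgt (tot C) j y"
 proof (rule inj[OF ograph_tgt[OF o xj(1)] ograph_tgt[OF o xj(2)]])
  fix i assume i: "i \<in> I"
  hence m: "ograph_map (tot C) (tot (M i)) (e i)" using M ptmD(1) by blast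
  show "e i j (tgt (tot C) j x) = e i j (tgt (tot C) j y)"
   unfolding omap_tgt[OF m xj(1)] omap_tgt[OF m xj(2)] using p[OF i] Suc unfolding parallel_def by simp
 qed
 ultimately have par: "parallel (tot C) k x y" using x y Suc unfolding parallel_def by auto
 have "loop_property C k x y" if r: "root_cell C k x" "root_cell C k y"
 proof -
  have l: "loop_property (M i) k (e i k x) (e i k y)" if i: "i \<in> I" for i
  proof -
   have Mi: "is_ptgraph (M i)" "constant_ograph (base (M i))" "ptm C (M i) (e i) (h i)" using M[OF i] by auto
   have c: "e i k x \<in> tcell (M i) k" "e i k y \<in> tcell (M i) k"
    using omap_cell[OF ptmD(1)[OF Mi(3)]] x y by auto
   have "root_cell (M i) k (e i k x)" "root_cell (M i) k (e i k y)"
    using r root_iff[OF C x] root_iff[OF C y] root_iff[OF Mi(1,2) c(1)] root_iff[OF Mi(1,2) c(2)]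
     ptm_shape[OF C(1) Mi(1,3) x] ptm_shape[OF C(1) Mi(1,3) y] Suc by auto
   thus ?thesis using xy[OF i] Suc unfolding contractible_pairs_def by auto
  qed
  have s: "e i 0 (src0 (tot C) k x) = src0 (tot (M i)) k (e i k x) \<and> e i 0 (tgt0 (tot C) k x) = tgt0 (tot (M i)) k (e i k x)
   \<and> e i 0 (src0 (tot C) k y) = src0 (tot (M i)) k (e i k y) \<and> e i 0 (tgt0 (tot C) k y) = tgt0 (tot (M i)) k (e i k y)"
   if i: "i \<in> I" for i
   using src0_map[OF o ptmD(1) x] src0_map[OF o ptmD(1) y] M[OF i] by blast
  note cx = src0_cell[OF o x] and cy = src0_cell[OF o y]
  have "src0 (tot C) k x = src0 (tot C) k y"
   by (rule inj[OF conjunct1[OF cx] conjunct1[OF cy]]) (use l s in \<open>simp add: loop_property_def\<close>)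
  moreover have "src0 (tot C) k y = tgt0 (tot C) k x"
   by (rule inj[OF conjunct1[OF cy] conjunct2[OF cx]]) (use l s in \<open>simp add: loop_property_def\<close>)
  moreover have "tgt0 (tot C) k x = tgt0 (tot C) k y"
   by (rule inj[OF conjunct2[OF cx] conjunct2[OF cy]]) (use l s in \<open>simp add: loop_property_def\<close>)
  ultimately show ?thesis unfolding loop_property_def by blast
 qed
 thus ?thesis using Suc x y par d unfolding contractible_pairs_def by simp
qed

definition ctm :: "'u ctcat => 'u ctcat => (nat => 'u => 'u) => (nat => 'u => 'u) => bool" where
 "ctm C C' f h == mulm C C' f h \<and> (\<forall>k x y. (x, y) \<in> contractible_pairs C k -->
    f (Suc k) (contr C k x y) = contr C' k (f k x) (f k y))"

lemma ctmD: "ctm C C' f h ==> mulm C C' f h" "ctm C C' f h ==> ptm C C' f h"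
 "ctm C C' f h ==> (K, x) \<in> pcell C n ==> f n (mul C n (K, x)) = mul C' n (T_map (tot C') f n K, f n x)"
 "ctm C C' f h ==> (x, y) \<in> contractible_pairs C k ==> f (Suc k) (contr C k x y) = contr C' k (f k x) (f k y)"
 unfolding ctm_def mulm_def by blast+

definition ctob :: "'u ctcat => bool" where
 "ctob C == is_tcat C \<and> constant_ograph (base C) \<and> is_contraction C (contr C)"

lemma ctobD:
 assumes "ctob C"
 shows "is_tcat C" "premul C" "is_ptgraph C" "constant_ograph (base C)"
  "(x, y) \<in> contractible_pairs C k ==> contr C k x y \<in> tcell C (Suc k)"
  "(x, y) \<in> contractible_pairs C k ==> src (tot C) k (contr C k x y) = x"
  "(x, y) \<in> contractible_pairs C k ==> tgt (tot C) k (contr C k x y) = y"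
  "(x, y) \<in> contractible_pairs C k ==> dmap C (Suc k) (contr C k x y) = T_id (base C) k (dmap C k x)"
  "(K, x) \<in> pcell C n ==> mul C n (K, x) \<in> tcell C n"
 using assms tcat_premul[of C] premulD[of C] omap_cell[OF premulD(2)]
 unfolding ctob_def is_contraction_def by blast+

lemma tcat_unit:
 assumes "is_tcat C" "x \<in> tcell C n"
 shows "mul C n (T_unit (tot C) n x, pt C n (cmap C n x)) = x" "mul C n (T_map (tot C) (pt C) n (dmap C n x), x) = x"
 using assms unfolding is_tcat_def by blast+

lemma tcat_assoc:
 assumes "is_tcat C" "tht \<in> Tcell (pullback C) n" "x \<in> tcell C n"
  "T_map (base C) (%i Kx. cmap C i (snd Kx)) n tht = dmap C n x"
 shows "mul C n (T_map (tot C) (mul C) n tht, x) =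
    mul C n (flatten C n tht x)"
 using assms unfolding is_tcat_def by blast

lemma tcatI:
 assumes "premul C"
  and "!!n x. x \<in> tcell C n ==> mul C n (T_unit (tot C) n x, pt C n (cmap C n x)) = x"
  and "!!n x. x \<in> tcell C n ==> mul C n (T_map (tot C) (pt C) n (dmap C n x), x) = x"
  and "!!n tht x. tht \<in> Tcell (pullback C) n ==> x \<in> tcell C n ==>
    T_map (base C) (%i Kx. cmap C i (snd Kx)) n tht = dmap C n x ==>
    mul C n (T_map (tot C) (mul C) n tht, x) =
    mul C n (flatten C n tht x)"
 shows "is_tcat C"
 using assms unfolding is_tcat_def premul_def by blast

subsection \<open>Structure transported along jointly injective or jointly surjective families\<close>

text \<open>All axioms are equations between cells, colours or cells of T of the base, and each kind
  is tested after applying all \<open>e i\<close> or \<open>h i\<close>. Only the existence of the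
  operations in C has to be assumed.\<close>

lemma initial_lift:
 fixes C :: "'u ctcat" and M :: "'i => 'u ctcat"
 assumes C: "is_ptgraph C" "constant_ograph (base C)" and I: "I \<noteq> {}"
  and M: "!!i. i \<in> I ==> ctob (M i)" and e: "!!i. i \<in> I ==> ptm C (M i) (e i) (h i)"
  and inj: "!!n x y. x \<in> tcell C n ==> y \<in> tcell C n ==> (!!i. i \<in> I ==> e i n x = e i n y) ==> x = y"
  and mul: "!!n K x. (K, x) \<in> pcell C n ==> mul C n (K, x) \<in> tcell C n \<and>
    (\<forall>i\<in>I. e i n (mul C n (K, x)) = mul (M i) n (T_map (tot (M i)) (e i) n K, e i n x))"
  and con: "!!k x y. (x, y) \<in> contractible_pairs C k ==> contr C k x y \<in> tcell C (Suc k) \<and>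
    (\<forall>i\<in>I. e i (Suc k) (contr C k x y) = contr (M i) k (e i k x) (e i k y))"
 shows "ctob C" "i \<in> I ==> ctm C (M i) (e i) (h i)"
proof -
 note o = pgD(1)[OF C(1)] pgD(2)[OF C(1)]
 note Mp = ctobD(3)[OF M] and Mc = ctobD(4)[OF M]
 \<comment> \<open>Joint injectivity is assumed for cells; colours are compared through their unit
   0-cells.\<close>
 have hi: "g = g'" if g: "g \<in> gcell C 0" "g' \<in> gcell C 0" and eq: "!!i. i \<in> I ==> h i 0 g = h i 0 g'" for g g'
 proof -
  have "pt C 0 g = pt C 0 g'"
   by (rule inj) (use g eq pg_cell(3)[OF C(1)] ptmD(5)[OF e] in auto)
  thus ?thesis using pgD(7)[OF C(1)] g by metis
 qed
 have Tj: "K = K'" if K: "K \<in> Tcell (base C) n" "K' \<in> Tcell (base C) n"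
  and eq: "!!i. i \<in> I ==> T_map (base (M i)) (h i) n K = T_map (base (M i)) (h i) n K'" for n K K'
  by (rule T_joint[OF C(2) I _ hi K eq]) (use Mc ptmD(2)[OF e] in auto)
 have mm: "mulm C (M i) (e i) (h i)" if "i \<in> I" for i
  unfolding mulm_def using e[OF that] mul that by blast
 have src: "mul C n (src (pullback C) n kx) = src (tot C) n (mul C (Suc n) kx) \<and>
   mul C n (tgt (pullback C) n kx) = tgt (tot C) n (mul C (Suc n) kx)" if kx: "kx \<in> pcell C (Suc n)" for n kx
 proof (cases kx)
  case (Pair K x)
  have k: "(K, x) \<in> pcell C (Suc n)" using kx Pair by simp
  note f = pb_face[OF C(1) k]
  have mc: "mul C (Suc n) (K, x) \<in> tcell C (Suc n)" using mul[OF k] by blast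
  have Kc: "K \<in> Tcell (tot C) (Suc n)" and x: "x \<in> tcell C (Suc n)" using k unfolding pb_iff by auto
  have "e i n (mul C n (src (T_graph (tot C)) n K, src (tot C) n x)) = e i n (src (tot C) n (mul C (Suc n) (K, x))) \<and>
    e i n (mul C n (tgt (T_graph (tot C)) n K, tgt (tot C) n x)) = e i n (tgt (tot C) n (mul C (Suc n) (K, x)))"
   if i: "i \<in> I" for i
  proof -
   note eo = ptmD(1)[OF e[OF i]] and Mo = pgD(2)[OF Mp[OF i]]
   note Te = T_map_ograph_map[OF o(2) Mo eo]
   note pk = pb_map_cell[OF C(1) Mp[OF i] e[OF i] k]
   note mo = premulD(2)[OF ctobD(2)[OF M[OF i]]]
   have "e i n (mul C n (src (T_graph (tot C)) n K, src (tot C) n x)) =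
     mul (M i) n (src (pullback (M i)) n (T_map (tot (M i)) (e i) (Suc n) K, e i (Suc n) x))"
    using mul[OF f(1)] i omap_src[OF Te Kc] omap_src[OF eo x] by (simp add: pb_src)
   moreover have "e i n (mul C n (tgt (T_graph (tot C)) n K, tgt (tot C) n x)) =
     mul (M i) n (tgt (pullback (M i)) n (T_map (tot (M i)) (e i) (Suc n) K, e i (Suc n) x))"
    using mul[OF f(2)] i omap_tgt[OF Te Kc] omap_tgt[OF eo x] by (simp add: pb_tgt)
   ultimately show ?thesis using omap_src[OF mo pk] omap_tgt[OF mo pk] mul[OF k] i
     omap_src[OF eo mc] omap_tgt[OF eo mc] by simp
  qed
  thus ?thesis unfolding Pair pb_src pb_tgt
   using inj mul[OF f(1)] mul[OF f(2)] ograph_src[OF o(2) mc] ograph_tgt[OF o(2) mc] by blast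
 qed
 have pm: "premul C" unfolding premul_def
 proof (intro conjI allI impI)
  show "is_ptgraph C" by fact
  show "ograph_map (pullback C) (tot C) (mul C)"
   unfolding ograph_map_def using src mul by fastforce
  fix n K x assume k: "(K, x) \<in> pcell C n"
  hence Kc: "K \<in> Tcell (tot C) n" and x: "x \<in> tcell C n" unfolding pb_iff by auto
  have mc: "mul C n (K, x) \<in> tcell C n" using mul[OF k] by blast
  show "dmap C n (mul C n (K, x)) = T_mult (base C) n (T_map (T_graph (base C)) (dmap C) n K)"
  proof (rule Tj[OF pg_cell(1)[OF C(1) mc]])
   show "T_mult (base C) n (T_map (T_graph (base C)) (dmap C) n K) \<in> Tcell (base C) n"
    by (rule T_mult_cell[OF o(1) T_map_cell[OF o(2) T_graph_ograph[OF o(1)] pgD(3)[OF C(1)] Kc]])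
   fix i assume i: "i \<in> I"
   show "T_map (base (M i)) (h i) n (dmap C n (mul C n (K, x))) =
     T_map (base (M i)) (h i) n (T_mult (base C) n (T_map (T_graph (base C)) (dmap C) n K))"
    using ptmD(3)[OF e[OF i] mc] mul[OF k] i mult_d_nat[OF C(1) Mp[OF i] e[OF i] Kc]
     premulD(3)[OF ctobD(2)[OF M[OF i]] pb_map_cell[OF C(1) Mp[OF i] e[OF i] k]] by simp
  qed
  have "cmap C n (mul C n (K, x)) \<in> gcell C 0" "cmap C n x \<in> gcell C 0"
   using cmap_cell[OF C] mc x by blast+
  thus "cmap C n (mul C n (K, x)) = cmap C n x"
  proof (rule hi)
   fix i assume i: "i \<in> I"
   show "h i 0 (cmap C n (mul C n (K, x))) = h i 0 (cmap C n x)"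
    using ptm_cmap[OF C Mc[OF i] e[OF i] mc] ptm_cmap[OF C Mc[OF i] e[OF i] x] mul[OF k] i
     premulD(4)[OF ctobD(2)[OF M[OF i]] pb_map_cell[OF C(1) Mp[OF i] e[OF i] k]] by simp
  qed
 qed
 have tc: "is_tcat C"
 proof (rule tcatI[OF pm])
  fix n x assume x: "x \<in> tcell C n"
  have ex: "e i n x \<in> tcell (M i) n" if "i \<in> I" for i using omap_cell[OF ptmD(1)[OF e[OF that]] x] .
  show "mul C n (T_unit (tot C) n x, pt C n (cmap C n x)) = x"
   by (rule inj[OF _ x])
    (use mul[OF unit_pb(1)[OF C(1) x]] unit_push(1)[OF pm Mp mm x] tcat_unit(1)[OF ctobD(1)[OF M] ex] in auto)
  show "mul C n (T_map (tot C) (pt C) n (dmap C n x), x) = x"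
   by (rule inj[OF _ x])
    (use mul[OF unit_pb(2)[OF C(1) x]] unit_push(2)[OF pm Mp mm x] tcat_unit(2)[OF ctobD(1)[OF M] ex] in auto)
  fix tht assume tht: "tht \<in> Tcell (pullback C) n" and eq: "T_map (base C) (%i Kx. cmap C i (snd Kx)) n tht = dmap C n x"
  note ap = assoc_pb[OF pm tht x eq]
  show "mul C n (T_map (tot C) (mul C) n tht, x) =
    mul C n (flatten C n tht x)"
  proof (rule inj)
   fix i assume i: "i \<in> I"
   note pbo = pb_ograph[OF C(1)] pb_ograph[OF Mp[OF i]] and q = pbmap_ograph_map[OF C(1) Mp[OF i] e[OF i]]
   let ?tht = "T_map (pullback (M i)) (pbmap (M i) (e i)) n tht"
   have tht': "?tht \<in> Tcell (pullback (M i)) n" using T_map_cell[OF pbo q tht] .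
   have sc: "ograph_map (pullback D) (base D) (%i Kx. cmap D i (snd Kx))" if "is_ptgraph D" for D :: "'u ctcat"
    using ograph_map_comp[OF snd_ograph_map pgD(4)[OF that]] .
   have "T_map (base (M i)) (%i' Kx. cmap (M i) i' (snd Kx)) n ?tht = T_map (base (M i)) (%i' Kx. cmap (M i) i' (snd (pbmap (M i) (e i) i' Kx))) n tht"
    using T_map_comp[OF pbo pgD(1)[OF Mp[OF i]] q sc[OF Mp[OF i]] tht] .
   also have "\<dots> = T_map (base (M i)) (%i' Kx. h i i' (cmap C i' (snd Kx))) n tht"
    by (rule T_map_cong[OF pbo(1) tht]) (use ptmD(4)[OF e[OF i]] in \<open>auto simp: pbmap_def pb_iff\<close>)
   also have "\<dots> = T_map (base (M i)) (h i) n (T_map (base C) (%i Kx. cmap C i (snd Kx)) n tht)"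
    using T_map_comp[OF pbo(1) o(1) pgD(1)[OF Mp[OF i]] sc[OF C(1)] ptmD(2)[OF e[OF i]] tht] by simp
   also have "\<dots> = dmap (M i) n (e i n x)" unfolding eq using ptmD(3)[OF e[OF i] x] by simp
   finally show "e i n (mul C n (T_map (tot C) (mul C) n tht, x)) =
    e i n (mul C n (flatten C n tht x))"
    using tcat_assoc[OF ctobD(1)[OF M[OF i]] tht' ex[OF i]] assoc_push[OF pm ctobD(2)[OF M[OF i]] mm[OF i] tht x eq] by simp
  qed (use mul[OF ap(1)] mul[OF ap(3)] in auto)
 qed
 have "is_contraction C (contr C)" unfolding is_contraction_def
 proof (intro allI impI)
  fix k x y assume xy: "(x, y) \<in> contractible_pairs C k"
  have c: "contr C k x y \<in> tcell C (Suc k)" using con[OF xy] by blast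
  have xc: "x \<in> tcell C k" "y \<in> tcell C k" using contractible_cells[OF xy] by auto
  have p: "(e i k x, e i k y) \<in> contractible_pairs (M i) k" if "i \<in> I" for i
   using contractible_push[OF C Mp[OF that] Mc[OF that] e[OF that] xy] .
  have "src (tot C) k (contr C k x y) = x"
   by (rule inj[OF ograph_src[OF o(2) c] xc(1)])
    (use omap_src[OF ptmD(1)[OF e] c] con[OF xy] ctobD(6)[OF M p] in auto)
  moreover have "tgt (tot C) k (contr C k x y) = y"
   by (rule inj[OF ograph_tgt[OF o(2) c] xc(2)])
    (use omap_tgt[OF ptmD(1)[OF e] c] con[OF xy] ctobD(7)[OF M p] in auto)
  moreover have "dmap C (Suc k) (contr C k x y) = T_id (base C) k (dmap C k x)"
  proof (rule Tj[OF pg_cell(1)[OF C(1) c]])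
   have dx: "dmap C k x \<in> Tcell (base C) k" using pg_cell(1)[OF C(1) xc(1)] .
   show "T_id (base C) k (dmap C k x) \<in> Tcell (base C) (Suc k)" by (rule T_id_cell[OF dx])
   fix i assume i: "i \<in> I"
   show "T_map (base (M i)) (h i) (Suc k) (dmap C (Suc k) (contr C k x y)) = T_map (base (M i)) (h i) (Suc k) (T_id (base C) k (dmap C k x))"
    using ptmD(3)[OF e[OF i] c] con[OF xy] i ctobD(8)[OF M[OF i] p[OF i]] ptmD(3)[OF e[OF i] xc(1)]
     T_map_id[OF o(1) pgD(1)[OF Mp[OF i]] ptmD(2)[OF e[OF i]] dx] by simp
  qed
  ultimately show "contr C k x y \<in> tcell C (Suc k) \<and> src (tot C) k (contr C k x y) = x \<and>
    tgt (tot C) k (contr C k x y) = y \<and> dmap C (Suc k) (contr C k x y) = T_id (base C) k (dmap C k x)" using c by blast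
 qed
 thus "ctob C" unfolding ctob_def using tc C by blast
 show "i \<in> I ==> ctm C (M i) (e i) (h i)" unfolding ctm_def using mm con by blast
qed

text \<open>Dual to \<open>initial_lift\<close>. It is not enough that cells are covered: every
  instance of an axiom, with all its arguments and side conditions at once, has to come from a
  single \<open>M j\<close>.\<close>

lemma final_lift:
 fixes B :: "'u ctcat" and M :: "'i => 'u ctcat"
 assumes B: "is_ptgraph B" "constant_ograph (base B)"
  and M: "!!j. j \<in> J ==> ctob (M j)" and e: "!!j. j \<in> J ==> ctm (M j) B (e j) (h j)"
  and cells: "!!n x. x \<in> tcell B n ==> \<exists>j\<in>J. \<exists>x'\<in>tcell (M j) n. e j n x' = x"
  and pb: "!!n kx. kx \<in> pcell B n ==> \<exists>j\<in>J. \<exists>kx'\<in>pcell (M j) n. pbmap B (e j) n kx' = kx"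
  and ass: "!!n tht x. tht \<in> Tcell (pullback B) n ==> x \<in> tcell B n ==>
    T_map (base B) (%i Kx. cmap B i (snd Kx)) n tht = dmap B n x ==>
    \<exists>j\<in>J. \<exists>tht'\<in>Tcell (pullback (M j)) n. \<exists>x'\<in>tcell (M j) n.
     T_map (base (M j)) (%i Kx. cmap (M j) i (snd Kx)) n tht' = dmap (M j) n x' \<and>
     T_map (pullback B) (pbmap B (e j)) n tht' = tht \<and> e j n x' = x"
  and con: "!!k x y. (x, y) \<in> contractible_pairs B k ==>
    \<exists>j\<in>J. \<exists>x' y'. (x', y') \<in> contractible_pairs (M j) k \<and> e j k x' = x \<and> e j k y' = y"
 shows "ctob B"
proof -
 note Mp = ctobD(3)[OF M] and mm = ctmD(1)[OF e] and mp = ctmD(2)[OF e]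
 have pm: "premul B" unfolding premul_def
 proof (intro conjI allI impI)
  show "is_ptgraph B" by fact
  have "mul B n kx \<in> tcell B n" if kx: "kx \<in> pcell B n" for n kx
  proof -
   obtain j K x where j: "j \<in> J" "(K, x) \<in> pcell (M j) n" "pbmap B (e j) n (K, x) = kx" using pb[OF kx] by auto
   hence "mul B n kx = e j n (mul (M j) n (K, x))" using mulmD(2)[OF mm[OF j(1)] j(2)] by (simp add: pbmap_def)
   thus ?thesis using omap_cell[OF ptmD(1)[OF mp[OF j(1)]] ctobD(9)[OF M[OF j(1)] j(2)]] by simp
  qed
  moreover have "mul B n (src (pullback B) n kx) = src (tot B) n (mul B (Suc n) kx) \<and>
    mul B n (tgt (pullback B) n kx) = tgt (tot B) n (mul B (Suc n) kx)" if kx: "kx \<in> pcell B (Suc n)" for n kx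
  proof -
   obtain j K x where j: "j \<in> J" "(K, x) \<in> pcell (M j) (Suc n)" "pbmap B (e j) (Suc n) (K, x) = kx"
    using pb[OF kx] by auto
   note q = pbmap_ograph_map[OF Mp[OF j(1)] B(1) mp[OF j(1)]]
   note mc = ctobD(9)[OF M[OF j(1)] j(2)] and mo = premulD(2)[OF ctobD(2)[OF M[OF j(1)]]]
   note f = pb_face[OF Mp[OF j(1)] j(2)]
   have k: "mul B (Suc n) kx = e j (Suc n) (mul (M j) (Suc n) (K, x))"
    using mulmD(2)[OF mm[OF j(1)] j(2)] j(3) by (simp add: pbmap_def)
   have "mul B n (pbmap B (e j) n (src (pullback (M j)) n (K, x))) = e j n (mul (M j) n (src (pullback (M j)) n (K, x)))"
    "mul B n (pbmap B (e j) n (tgt (pullback (M j)) n (K, x))) = e j n (mul (M j) n (tgt (pullback (M j)) n (K, x)))"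
    using mulmD(2)[OF mm[OF j(1)] f(1)] mulmD(2)[OF mm[OF j(1)] f(2)] by (simp_all add: pbmap_def pb_src pb_tgt)
   thus ?thesis using omap_src[OF q j(2)] omap_tgt[OF q j(2)] j(3) k
     omap_src[OF mo j(2)] omap_tgt[OF mo j(2)] omap_src[OF ptmD(1)[OF mp[OF j(1)]] mc]
     omap_tgt[OF ptmD(1)[OF mp[OF j(1)]] mc] by simp
  qed
  ultimately show "ograph_map (pullback B) (tot B) (mul B)" unfolding ograph_map_def by blast
  fix n K x assume "(K, x) \<in> pcell B n"
  from pb[OF this] obtain j K' x' where j: "j \<in> J" and kx: "(K', x') \<in> pcell (M j) n" "pbmap B (e j) n (K', x') = (K, x)"
   by auto
  have K: "K = T_map (tot B) (e j) n K'" "x = e j n x'" using kx(2) by (auto simp: pbmap_def)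
  have c: "K' \<in> Tcell (tot (M j)) n" "x' \<in> tcell (M j) n" using kx(1) unfolding pb_iff by auto
  have m: "mul B n (K, x) = e j n (mul (M j) n (K', x'))" using mulmD(2)[OF mm[OF j] kx(1)] K by simp
  note mc = ctobD(9)[OF M[OF j] kx(1)] and pj = premulD(3,4)[OF ctobD(2)[OF M[OF j]] kx(1)]
  show "dmap B n (mul B n (K, x)) = T_mult (base B) n (T_map (T_graph (base B)) (dmap B) n K)"
   using m ptmD(3)[OF mp[OF j] mc] pj(1) mult_d_nat[OF Mp[OF j] B(1) mp[OF j] c(1)] K(1) by simp
  show "cmap B n (mul B n (K, x)) = cmap B n x"
   using m ptmD(4)[OF mp[OF j] mc] pj(2) ptmD(4)[OF mp[OF j] c(2)] K(2) by simp
 qed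
 have "is_tcat B"
 proof (rule tcatI[OF pm])
  fix n x assume x: "x \<in> tcell B n"
  obtain j x' where j: "j \<in> J" "x' \<in> tcell (M j) n" "e j n x' = x" using cells[OF x] by blast
  show "mul B n (T_unit (tot B) n x, pt B n (cmap B n x)) = x"
   using unit_push(1)[OF ctobD(2)[OF M[OF j(1)]] B(1) mm[OF j(1)] j(2)] tcat_unit(1)[OF ctobD(1)[OF M[OF j(1)]] j(2)] j(3) by simp
  show "mul B n (T_map (tot B) (pt B) n (dmap B n x), x) = x"
   using unit_push(2)[OF ctobD(2)[OF M[OF j(1)]] B(1) mm[OF j(1)] j(2)] tcat_unit(2)[OF ctobD(1)[OF M[OF j(1)]] j(2)] j(3) by simp
 next
  fix n tht x assume "tht \<in> Tcell (pullback B) n" "x \<in> tcell B n" "T_map (base B) (%i Kx. cmap B i (snd Kx)) n tht = dmap B n x"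
  from ass[OF this] obtain j tht' x' where j: "j \<in> J" and t: "tht' \<in> Tcell (pullback (M j)) n" "x' \<in> tcell (M j) n"
   "T_map (base (M j)) (%i Kx. cmap (M j) i (snd Kx)) n tht' = dmap (M j) n x'"
   and l: "T_map (pullback B) (pbmap B (e j)) n tht' = tht" "e j n x' = x" by blast
  show "mul B n (T_map (tot B) (mul B) n tht, x) =
    mul B n (flatten B n tht x)"
   using assoc_push[OF ctobD(2)[OF M[OF j]] pm mm[OF j] t] tcat_assoc[OF ctobD(1)[OF M[OF j]] t] l by simp
 qed
 moreover have "is_contraction B (contr B)" unfolding is_contraction_def
 proof (intro allI impI)
  fix k x y assume xy: "(x, y) \<in> contractible_pairs B k"
  then obtain j x' y' where j: "j \<in> J" and p: "(x', y') \<in> contractible_pairs (M j) k" and xe: "e j k x' = x" "e j k y' = y"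
   using con by blast
  note c = ctobD(5-8)[OF M[OF j] p] and mo = ptmD(1)[OF mp[OF j]]
  have br: "contr B k x y = e j (Suc k) (contr (M j) k x' y')" using ctmD(4)[OF e[OF j] p] xe by simp
  have x': "x' \<in> tcell (M j) k" using contractible_cells[OF p] by blast
  have dx: "dmap (M j) k x' \<in> Tcell (base (M j)) k" using pg_cell(1)[OF Mp[OF j] x'] .
  have "dmap B (Suc k) (contr B k x y) = T_id (base B) k (dmap B k x)"
   using br ptmD(3)[OF mp[OF j] c(1)] c(4) xe(1) ptmD(3)[OF mp[OF j] x']
    T_map_id[OF pgD(1)[OF Mp[OF j]] pgD(1)[OF B(1)] ptmD(2)[OF mp[OF j]] dx] by simp
  thus "contr B k x y \<in> tcell B (Suc k) \<and> src (tot B) k (contr B k x y) = x \<and>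
    tgt (tot B) k (contr B k x y) = y \<and> dmap B (Suc k) (contr B k x y) = T_id (base B) k (dmap B k x)"
   using omap_cell[OF mo c(1)] omap_src[OF mo c(1)] omap_tgt[OF mo c(1)] c(2,3) xe br by simp
 qed
 ultimately show ?thesis unfolding ctob_def using B by blast
qed

section \<open>Small sets\<close>

text \<open>Regularity makes small unions of small sets small, and uncountability makes countable
  sets small; every size estimate below rests on these two.\<close>

locale universe =
 fixes U :: "'u itself"
 assumes unc: "uncountable (UNIV :: 'u set)" and reg: "regular_cardinal |UNIV :: 'u set|"
begin

abbreviation sm :: "'b set => bool" where
 "sm X \<equiv> small U X"

lemma sm_iff: "small TYPE('u) X = sm X"
 unfolding small_def ..

lemma infinite_u: "infinite (UNIV :: 'u set)"
 using unc uncountable_infinite by blast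

lemma sm_countable: "countable X ==> sm X"
proof -
 assume "countable X"
 hence "|X| \<le>o |UNIV :: nat set|" unfolding countable_def card_of_ordLeq[symmetric] by blast
 moreover have "\<not> |UNIV :: 'u set| \<le>o |UNIV :: nat set|"
  using unc unfolding countable_def card_of_ordLeq[symmetric] by blast
 hence "|UNIV :: nat set| <o |UNIV :: 'u set|"
  using not_ordLeq_iff_ordLess[OF card_of_Well_order card_of_Well_order] by blast
 ultimately show ?thesis unfolding small_def by (rule ordLeq_ordLess_trans)
qed

lemma sm_finite: "finite X ==> sm X"
 by (simp add: sm_countable countable_finite)

lemma sm_subset: "sm X ==> Y \<subseteq> X ==> sm Y"
 unfolding small_def using card_of_mono1 ordLeq_ordLess_trans by blast

lemma sm_image: "sm X ==> sm (f ` X)"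
 unfolding small_def using card_of_image ordLeq_ordLess_trans by blast

lemma sm_UN: "sm I ==> (!!i. i \<in> I ==> sm (A i)) ==> sm (\<Union>i\<in>I. A i)"
 unfolding small_def
 by (rule regularCard_UNION_bound) (use reg in \<open>auto simp: regular_cardinal_def cinfinite_def\<close>)

lemma sm_Times: "sm A ==> sm B ==> sm (A \<times> B)"
proof -
 assume a: "sm A" "sm B"
 have "A \<times> B = (\<Union>a\<in>A. Pair a ` B)" by auto
 thus ?thesis using sm_UN[OF a(1), of "%a. Pair a ` B"] sm_image[OF a(2)] by metis
qed

lemma sm_Un: "sm A ==> sm B ==> sm (A \<union> B)"
proof -
 assume a: "sm A" "sm B"
 have "A \<union> B = (\<Union>b\<in>(UNIV :: bool set). if b then A else B)" by auto
 moreover have "sm (\<Union>b\<in>(UNIV :: bool set). if b then A else B)"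
  by (rule sm_UN) (use a in \<open>auto simp: sm_finite\<close>)
 ultimately show ?thesis by simp
qed

lemma sm_lists: "sm A ==> sm (lists A)"
proof -
 assume a: "sm A"
 have "sm {xs \<in> lists A. length xs = n}" for n
 proof (induction n)
  case 0
  have "{xs \<in> lists A. length xs = 0} = {[]}" by auto
  thus ?case by (simp add: sm_finite)
 next
  case (Suc n)
  have "{xs \<in> lists A. length xs = Suc n} \<subseteq> (%(x, xs). x # xs) ` (A \<times> {xs \<in> lists A. length xs = n})"
  proof
   fix ys assume "ys \<in> {xs \<in> lists A. length xs = Suc n}"
   then obtain x xs where "ys = x # xs" "x \<in> A" "xs \<in> lists A" "length xs = n" by (cases ys) auto
   thus "ys \<in> (%(x, xs). x # xs) ` (A \<times> {xs \<in> lists A. length xs = n})" by force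
  qed
  thus ?case using sm_subset[OF sm_image[OF sm_Times[OF a Suc]]] by blast
 qed
 hence "sm (\<Union>n\<in>(UNIV :: nat set). {xs \<in> lists A. length xs = n})" by (intro sm_UN) (simp_all add: sm_countable)
 moreover have "(\<Union>n\<in>(UNIV :: nat set). {xs \<in> lists A. length xs = n}) = lists A" by auto
 ultimately show ?thesis by simp
qed

lemma sm_Fpow: "sm A ==> sm {X. X \<subseteq> A \<and> finite X}"
proof -
 assume "sm A"
 moreover have "{X. X \<subseteq> A \<and> finite X} \<subseteq> set ` lists A"
 proof
  fix X assume "X \<in> {X. X \<subseteq> A \<and> finite X}"
  moreover then obtain xs where "set xs = X" using finite_list by blast
  ultimately show "X \<in> set ` lists A" by auto
 qed
 ultimately show ?thesis using sm_subset sm_image sm_lists by metis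
qed

text \<open>All objects take their cells from the one type \<open>'u\<close>; a small set built
  elsewhere becomes a set of cells along such an injection.\<close>

lemma sm_inj: "sm X ==> \<exists>f :: _ => 'u. inj_on f X"
 unfolding small_def using card_of_ordLeq[of X "UNIV :: 'u set"] ordLess_imp_ordLeq by blast

lemma sm_image_inj: "inj_on f X ==> sm (f ` X) ==> sm X"
 using sm_image[of "f ` X" "inv_into X f"] by simp

end

section \<open>The terminal object\<close>

instance trm :: (countable) countable
 by countable_datatype

lemma T_src_id:
 assumes "is_ograph X" "K \<in> Tcell X n"
 shows "src (T_graph X) n (T_id X n K) = K" "tgt (T_graph X) n (T_id X n K) = K"
 using assms(2)
 by (auto elim!: T_cellE simp: T_id_cl T_src_cl[OF assms(1) teq.idt] T_tgt_cl[OF assms(1) teq.idt])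

lemma T_map_const:
 assumes G: "constant_ograph G" "g \<in> cell G 0" and L: "L \<in> Tcell uno n"
 shows "T_map G (%_ _. g) n L \<in> Tcell G n" "shp n (T_map G (%_ _. g) n L) = L" "tcol (T_map G (%_ _. g) n L) = g"
proof -
 obtain w where w: "teq uno n w w" "L = cl uno n w" using T_cellE[OF L] .
 have e: "T_map G (%_ _. g) n L = paint G n g w"
  unfolding w(2) T_map_cl[OF uno_ograph const_ograph[OF G(1)] paint_map[OF G] w(1)] paint_def ..
 show "T_map G (%_ _. g) n L \<in> Tcell G n" "shp n (T_map G (%_ _. g) n L) = L" "tcol (T_map G (%_ _. g) n L) = g"
  unfolding e using paint_cell[OF G w(1)] shp_paint[OF G w(1)] tcol_paint[OF G w(1)] w(2) by auto
qed

lemma shape_src: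
 assumes C: "is_ptgraph C" and x: "x \<in> tcell C (Suc n)"
 shows "shape C n (src (tot C) n x) = src (T_graph uno) n (shape C (Suc n) x)"
  "shape C n (tgt (tot C) n x) = tgt (T_graph uno) n (shape C (Suc n) x)"
proof -
 note s = T_map_ograph_map[OF pgD(1)[OF C] uno_ograph to_uno] and d = pgD(3)[OF C]
 show "shape C n (src (tot C) n x) = src (T_graph uno) n (shape C (Suc n) x)"
  "shape C n (tgt (tot C) n x) = tgt (T_graph uno) n (shape C (Suc n) x)"
  unfolding shape_def shp_def
  using omap_src[OF s] omap_tgt[OF s] omap_cell[OF d x] omap_src[OF d x] omap_tgt[OF d x] by simp_all
qed

lemma shape_ograph_map: "is_ptgraph C ==> ograph_map (tot C) (T_graph uno) (shape C)"
 unfolding ograph_map_def by (simp add: shape_cell shape_src)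

lemma shape_mul:
 assumes C: "premul C" and k: "(K, x) \<in> pcell C n"
 shows "shape C n (mul C n (K, x)) = T_mult uno n (T_map (T_graph uno) (shape C) n K)"
proof -
 note p = premulD(1)[OF C]
 note o = pgD(1)[OF p] pgD(2)[OF p]
 note To = T_graph_ograph[OF o(1)] T_graph_ograph[OF uno_ograph]
 have K: "K \<in> Tcell (tot C) n" using k unfolding pb_iff by simp
 have Kd: "T_map (T_graph (base C)) (dmap C) n K \<in> Tcell (T_graph (base C)) n"
  using T_map_cell[OF o(2) To(1) pgD(3)[OF p] K] .
 have "shape C n (mul C n (K, x)) = T_map uno (%_ _. ()) n (T_mult (base C) n (T_map (T_graph (base C)) (dmap C) n K))"
  unfolding shape_def shp_def premulD(3)[OF C k] ..
 also have "\<dots> = T_mult uno n (T_map (T_graph uno) (T_map uno (%_ _. ())) n (T_map (T_graph (base C)) (dmap C) n K))"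
  using T_mult_nat[OF o(1) uno_ograph to_uno Kd] .
 also have "T_map (T_graph uno) (T_map uno (%_ _. ())) n (T_map (T_graph (base C)) (dmap C) n K) = T_map (T_graph uno) (shape C) n K"
  using T_map_comp[OF o(2) To pgD(3)[OF p] T_map_ograph_map[OF o(1) uno_ograph to_uno] K]
  unfolding shape_def[abs_def] shp_def by simp
 finally show ?thesis .
qed

lemma shape_contr:
 assumes C: "ctob C" and xy: "(x, y) \<in> contractible_pairs C k"
 shows "shape C (Suc k) (contr C k x y) = T_id uno k (shape C k x)"
 unfolding shape_def shp_def ctobD(8)[OF C xy]
 by (rule T_map_id[OF pgD(1)[OF ctobD(3)[OF C]] uno_ograph to_uno
    pg_cell(1)[OF ctobD(3)[OF C] conjunct1[OF contractible_cells[OF xy]]]])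

lemma shape_pt: "is_ptgraph C ==> g \<in> gcell C n ==> shape C n (pt C n g) = T_unit uno n ()"
 unfolding shape_def shp_def pgD(6) by (rule T_map_unit[OF pgD(1) uno_ograph to_uno])

context universe
begin

text \<open>The terminal object has one colour and the cells of T 1, coded in \<open>'u\<close>.
  Multiplication is that of the monad and the contraction forms identities; the map into it takes
  the shape. It supplies a solution, or a cocone, whenever the general construction needs one to
  start from.\<close>

lemma terminal_exists:
 "\<exists>N :: 'u ctcat. ctob N \<and> (\<forall>n. \<forall>x\<in>tcell N n. \<forall>y\<in>tcell N n. shape N n x = shape N n y --> x = y) \<and>
   (\<forall>b :: 'u ptgraph. is_ptgraph b --> constant_ograph (base b) --> (\<exists>f h. ptm b N f h)) \<and>
   (\<forall>M. ctob M --> (\<exists>f h. ctm M N f h))"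
proof -
 let ?U = "\<Union>n. Tcell uno n"
 have "countable (range (%(n, t). cl uno n t))" by simp
 moreover have "?U \<subseteq> range (%(n, t). cl uno n t)" unfolding T_cell by force
 ultimately have cU: "countable ?U" using countable_subset by blast
 obtain en :: "unit trm set => 'u" where en: "inj_on en ?U" using sm_inj[OF sm_countable[OF cU]] by blast
 define de where "de = inv_into ?U en"
 have de: "de (en K) = K" if "K \<in> Tcell uno n" for K n
  unfolding de_def using inv_into_f_f[OF en] that by blast
 \<comment> \<open>An arbitrary element of the type, taken as the only colour.\<close>
 obtain g0 :: 'u where True by blast
 define G :: "'u ograph" where "G = \<lparr> cell = (%_. {g0}), src = (%_ x. x), tgt = (%_ x. x) \<rparr>"
 have G: "constant_ograph G" "g0 \<in> cell G 0" unfolding constant_ograph_def is_ograph_def G_def by auto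
 have Gc: "g \<in> cell G n \<longleftrightarrow> g = g0" for g n unfolding G_def by simp
 define X :: "'u ograph" where "X = \<lparr> cell = (%n. en ` Tcell uno n),
   src = (%n z. en (src (T_graph uno) n (de z))), tgt = (%n z. en (tgt (T_graph uno) n (de z))) \<rparr>"
 note Tu = T_graph_ograph[OF uno_ograph]
 have Xc: "z \<in> cell X n \<longleftrightarrow> (\<exists>K\<in>Tcell uno n. z = en K)" for z n unfolding X_def by auto
 have dec: "de z \<in> Tcell uno n \<and> en (de z) = z" if "z \<in> cell X n" for z n
  using that de unfolding Xc by auto
 have Xs: "src X n z = en (src (T_graph uno) n (de z))" "tgt X n z = en (tgt (T_graph uno) n (de z))" for n z
  unfolding X_def by simp_all
 have Xcl: "src X n z \<in> cell X n \<and> tgt X n z \<in> cell X n \<and> de (src X n z) = src (T_graph uno) n (de z) \<and>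
   de (tgt X n z) = tgt (T_graph uno) n (de z)" if z: "z \<in> cell X (Suc n)" for z n
  using ograph_src[OF Tu] ograph_tgt[OF Tu] de dec[OF z] unfolding Xs Xc by blast
 have "src X n (src X (Suc n) z) = src X n (tgt X (Suc n) z) \<and> tgt X n (src X (Suc n) z) = tgt X n (tgt X (Suc n) z)"
  if z: "z \<in> cell X (Suc (Suc n))" for z n
  using Tu dec[OF z] Xcl[OF z] unfolding Xs[of n] is_ograph_def by simp
 hence X: "is_ograph X" using Xcl unfolding is_ograph_def by blast
 have de_map: "ograph_map X (T_graph uno) (%_. de)"
  unfolding ograph_map_def using dec Xcl by simp
 have en_map: "ograph_map (T_graph uno) X (%_. en)"
  unfolding ograph_map_def by (auto simp: Xc Xs de)
 note pm = paint_map[OF G]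
 define D where "D = (%n z. T_map G (%_ _. g0) n (de z))"
 have D: "ograph_map X (T_graph G) D"
  unfolding D_def using ograph_map_comp[OF de_map T_map_ograph_map[OF uno_ograph const_ograph[OF G(1)] pm]] .
 have c0: "ograph_map X G (%_ _. g0)" unfolding ograph_map_def G_def by simp
 have Tg: "shp n (D n z) = de z" if "z \<in> cell X n" for n z
  unfolding D_def using T_map_const(2)[OF G] dec[OF that] by blast
 define pp where "pp = (%n (_::'u). en (T_unit uno n ()))"
 have pp: "ograph_map G X pp"
  unfolding pp_def using ograph_map_comp[OF ograph_map_comp[OF to_uno T_unit_ograph_map[OF uno_ograph]] en_map] .
 have uc: "T_unit uno n () \<in> Tcell uno n" for n
  using omap_cell[OF T_unit_ograph_map[OF uno_ograph]] unfolding uno_def by simp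
 let ?Td = "%n K. T_map (T_graph uno) (%_. de) n K"
 note Td = T_map_ograph_map[OF X Tu de_map]
 define N :: "'u ctcat" where "N = \<lparr> base = G, tot = X, dmap = D, cmap = (%_ _. g0), pt = pp,
   mul = (%n (K, z). en (T_mult uno n (?Td n K))), contr = (%k x y. en (T_id uno k (de x))) \<rparr>"
 have N: "base N = G" "tot N = X" "dmap N = D" "cmap N = (%_ _. g0)" "pt N = pp"
  "!!n K z. mul N n (K, z) = en (T_mult uno n (?Td n K))" "!!k x y. contr N k x y = en (T_id uno k (de x))"
  unfolding N_def by simp_all
 have "sm (cell G n)" "sm (cell X n)" for n
  using sm_finite[of "{g0}"] sm_subset[OF sm_image[OF sm_countable[OF cU]], of "cell X n" en] unfolding Xc G_def X_def by auto
 hence "is_tgraph N" unfolding is_tgraph_def N sm_iff using const_ograph[OF G(1)] X D c0 by blast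
 moreover have "D n (pp n g) = T_unit G n g \<and> g0 = g" if "g \<in> cell G n" for n g
 proof -
  have "() \<in> cell uno n" unfolding uno_def by simp
  thus ?thesis unfolding D_def pp_def de[OF uc]
   using that T_map_unit[OF uno_ograph const_ograph[OF G(1)] pm, of "()" n] unfolding Gc by simp
 qed
 ultimately have pN: "is_ptgraph N" unfolding is_ptgraph_def N using pp by blast
 have shN: "shape N n z = de z" if "z \<in> cell X n" for n z unfolding shape_def N using Tg[OF that] .
 have TdK: "?Td n K \<in> Tcell (T_graph uno) n" if "K \<in> Tcell X n" for n K
  using omap_cell[OF Td that] .
 have muc: "T_mult uno n (?Td n K) \<in> Tcell uno n" if "K \<in> Tcell X n" for n K
  using T_mult_cell[OF uno_ograph TdK[OF that]] .
 have mo: "ograph_map (pullback N) X (%n y. en (T_mult uno n (?Td n (fst y))))"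
  using ograph_map_comp[OF ograph_map_comp[OF ograph_map_comp[OF fst_ograph_map[of N, unfolded N] Td] T_mult_ograph_map[OF uno_ograph]] en_map] .
 have mulN: "mul N = (%n y. en (T_mult uno n (?Td n (fst y))))" unfolding N_def by (auto simp: fun_eq_iff)
 have "premul N" unfolding premul_def
 proof (intro conjI allI impI)
  show "is_ptgraph N" by fact
  show "ograph_map (pullback N) (tot N) (mul N)" unfolding mulN using mo N by simp
  fix n K z assume k: "(K, z) \<in> pcell N n"
  have K: "K \<in> Tcell X n" using k unfolding pb_iff N by simp
  have "D n (en (T_mult uno n (?Td n K))) = T_map G (%_ _. g0) n (T_mult uno n (?Td n K))"
   unfolding D_def de[OF muc[OF K]] ..
  also have "\<dots> = T_mult G n (T_map (T_graph G) (T_map G (%_ _. g0)) n (?Td n K))"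
   using T_mult_nat[OF uno_ograph const_ograph[OF G(1)] pm TdK[OF K]] .
  also have "T_map (T_graph G) (T_map G (%_ _. g0)) n (?Td n K) = T_map (T_graph G) D n K"
   unfolding D_def using T_map_comp[OF X Tu T_graph_ograph[OF const_ograph[OF G(1)]] de_map
     T_map_ograph_map[OF uno_ograph const_ograph[OF G(1)] pm] K] .
  finally show "dmap N n (mul N n (K, z)) = T_mult (base N) n (T_map (T_graph (base N)) (dmap N) n K)" unfolding N .
  show "cmap N n (mul N n (K, z)) = cmap N n z" unfolding N ..
 qed
 note prN = this
 have tN: "is_tcat N"
 proof (rule tcatI[OF prN])
  fix n x assume "x \<in> tcell N n"
  hence x: "x \<in> cell X n" unfolding N .
  show "mul N n (T_unit (tot N) n x, pt N n (cmap N n x)) = x"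
   unfolding N T_map_unit[OF X Tu de_map x] T_mult_unit[OF uno_ograph conjunct1[OF dec[OF x]]] using dec[OF x] by simp
  have dx: "D n x \<in> Tcell G n" using omap_cell[OF D x] .
  have "?Td n (T_map X pp n (D n x)) = T_map (T_graph uno) (%n g. de (pp n g)) n (D n x)"
   using T_map_comp[OF const_ograph[OF G(1)] X Tu pp de_map dx] .
  also have "\<dots> = T_map (T_graph uno) (%n g. T_unit uno n ()) n (D n x)" unfolding pp_def de[OF uc] ..
  also have "\<dots> = T_map (T_graph uno) (T_unit uno) n (shp n (D n x))"
   unfolding shp_def using T_map_comp[OF const_ograph[OF G(1)] uno_ograph Tu to_uno T_unit_ograph_map[OF uno_ograph] dx] by simp
  also have "T_mult uno n \<dots> = de x" unfolding Tg[OF x] using T_mult_map_unit[OF uno_ograph conjunct1[OF dec[OF x]]] .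
  finally show "mul N n (T_map (tot N) (pt N) n (dmap N n x), x) = x" unfolding N using dec[OF x] by simp
 next
  fix n tht x assume "tht \<in> Tcell (pullback N) n" "x \<in> tcell N n"
  hence tht: "tht \<in> Tcell (pullback N) n" by blast
  note po = pb_ograph[OF pN] and TX = T_graph_ograph[OF X] and TTu = T_graph_ograph[OF Tu]
  note fm = fst_ograph_map[of N, unfolded N]
  have F: "T_map (T_graph X) (%_. fst) n tht \<in> Tcell (T_graph X) n" using T_map_cell[OF po TX fm tht] .
  have "?Td n (T_map X (mul N) n tht) = T_map (T_graph uno) (%n y. de (mul N n y)) n tht"
   using T_map_comp[OF po X Tu _ de_map tht] mo mulN by simp
  also have "\<dots> = T_map (T_graph uno) (%n y. T_mult uno n (?Td n (fst y))) n tht"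
   by (rule T_map_cong[OF po tht]) (use de[OF muc] in \<open>auto simp: mulN pb_iff N\<close>)
  also have "\<dots> = T_map (T_graph uno) (T_mult uno) n (T_map (T_graph (T_graph uno)) (%n y. ?Td n (fst y)) n tht)"
   using T_map_comp[OF po TTu Tu ograph_map_comp[OF fm Td] T_mult_ograph_map[OF uno_ograph] tht] by simp
  also have "T_map (T_graph (T_graph uno)) (%n y. ?Td n (fst y)) n tht = T_map (T_graph (T_graph uno)) ?Td n (T_map (T_graph X) (%_. fst) n tht)"
   using T_map_comp[OF po TX TTu fm Td tht] by simp
  finally have "T_mult uno n (?Td n (T_map X (mul N) n tht)) =
    T_mult uno n (T_map (T_graph uno) (T_mult uno) n (T_map (T_graph (T_graph uno)) ?Td n (T_map (T_graph X) (%_. fst) n tht)))" by simp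
  also have "\<dots> = T_mult uno n (T_mult (T_graph uno) n (T_map (T_graph (T_graph uno)) ?Td n (T_map (T_graph X) (%_. fst) n tht)))"
   by (rule T_mult_assoc[OF uno_ograph T_map_cell[OF TX TTu Td F]])
  also have "T_mult (T_graph uno) n (T_map (T_graph (T_graph uno)) ?Td n (T_map (T_graph X) (%_. fst) n tht)) =
    ?Td n (T_mult X n (T_map (T_graph X) (%_. fst) n tht))"
   using T_mult_nat[OF X Tu de_map F] by simp
  finally show "mul N n (T_map (tot N) (mul N) n tht, x) =
    mul N n (flatten N n tht x)"
   unfolding N(2,6) by simp
 qed
 have "is_contraction N (contr N)" unfolding is_contraction_def
 proof (intro allI impI)
  fix k x y assume xy: "(x, y) \<in> contractible_pairs N k"
  have x: "x \<in> cell X k" "y \<in> cell X k" "D k x = D k y" using contractible_cells[OF xy] unfolding N by auto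
  \<comment> \<open>Equal values of \<open>D\<close> have equal shapes, and a cell of this object is
    its shape. So contractible pairs are diagonal and an identity contracts them.\<close>
  have "x = y" using Tg[OF x(1)] Tg[OF x(2)] x(3) dec[OF x(1)] dec[OF x(2)] by metis
  have d: "de x \<in> Tcell uno k" "en (de x) = x" using dec[OF x(1)] by auto
  note i = T_id_cell[OF d(1)]
  have "D (Suc k) (en (T_id uno k (de x))) = T_id G k (D k x)"
   unfolding D_def de[OF i] by (rule T_map_id[OF uno_ograph const_ograph[OF G(1)] pm d(1)])
  thus "contr N k x y \<in> tcell N (Suc k) \<and> src (tot N) k (contr N k x y) = x \<and>
    tgt (tot N) k (contr N k x y) = y \<and> dmap N (Suc k) (contr N k x y) = T_id (base N) k (dmap N k x)"
   unfolding N Xs de[OF i] T_src_id[OF uno_ograph d(1)] Xc using i d \<open>x = y\<close> by auto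
 qed
 hence cN: "ctob N" unfolding ctob_def using tN N G by simp
 \<comment> \<open>Stated for any record extension, to serve pointed graphs as well as contractible
   categories.\<close>
 have mp: "ptm b N (%n x. en (shape b n x)) (%_ _. g0)" if b: "is_ptgraph b" "constant_ograph (base b)" for b :: "('u, 'z) ptgraph_scheme"
 proof -
  have sc: "shape b n x \<in> Tcell uno n" if "x \<in> tcell b n" for n x using shape_cell[OF b(1) that] .
  have bc: "ograph_map (base b) G (%_ _. g0)" unfolding ograph_map_def G_def by simp
  have "D n (en (shape b n x)) = T_map G (%_ _. g0) n (dmap b n x)" if x: "x \<in> tcell b n" for n x
   unfolding D_def de[OF sc[OF x]] unfolding shape_def shp_def
   using T_map_comp[OF pgD(1)[OF b(1)] uno_ograph const_ograph[OF G(1)] to_uno pm pg_cell(1)[OF b(1) x]] .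
  thus ?thesis unfolding ptm_def N
   using ograph_map_comp[OF shape_ograph_map[OF b(1)] en_map] bc shape_pt[OF b(1)] by (simp add: pp_def)
 qed
 have "ctm M N (%n x. en (shape M n x)) (%_ _. g0)" if M: "ctob M" for M
 proof -
  note Mp = ctobD(3)[OF M]
  have "en (shape M n (mul M n (K, x))) = mul N n (T_map X (%n x. en (shape M n x)) n K, en (shape M n x))"
   if k: "(K, x) \<in> pcell M n" for n K x
  proof -
   have K: "K \<in> Tcell (tot M) n" using k unfolding pb_iff by simp
   have "?Td n (T_map X (%n x. en (shape M n x)) n K) = T_map (T_graph uno) (%n x. de (en (shape M n x))) n K"
    using T_map_comp[OF pgD(2)[OF Mp] X Tu ograph_map_comp[OF shape_ograph_map[OF Mp] en_map] de_map K] .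
   also have "\<dots> = T_map (T_graph uno) (shape M) n K"
    by (rule T_map_cong[OF pgD(2)[OF Mp] K]) (rule de[OF shape_cell[OF Mp]])
   finally show ?thesis unfolding N shape_mul[OF ctobD(2)[OF M] k] by simp
  qed
  moreover have "en (shape M (Suc k) (contr M k x y)) = contr N k (en (shape M k x)) (en (shape M k y))"
   if xy: "(x, y) \<in> contractible_pairs M k" for k x y
   unfolding shape_contr[OF M xy] N using de[OF shape_cell[OF Mp conjunct1[OF contractible_cells[OF xy]]]] by simp
  ultimately show ?thesis unfolding ctm_def mulm_def using mp[OF Mp ctobD(4)[OF M]] N by simp
 qed
 moreover have "x = y" if "x \<in> tcell N n" "y \<in> tcell N n" "shape N n x = shape N n y" for n x y
  using that shN dec unfolding N by metis
 ultimately show ?thesis using cN mp by blast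
qed

end

section \<open>Generated objects\<close>

text \<open>
  Given a family \<open>M\<close> of objects indexed by \<open>I\<close> and a small set \<open>S\<close> of elements of its product, all
  of whose components have the same shape, the elements generated by \<open>S\<close> under the operations form
  an object. Terms over it must be well formed in the generated subobject itself, not only in each
  \<open>M i\<close>; hence the use of \<open>teq\<close> inside the inductive definition.
\<close>

definition prodg :: "'i set => ('i => 'u ctcat) => (nat => ('i => 'u) => bool) => ('i => 'u) ograph" where
 "prodg I M P = \<lparr> cell = (%n. {phi. P n phi}),
   src = (%n phi. \<lambda>i\<in>I. src (tot (M i)) n (phi i)), tgt = (%n phi. \<lambda>i\<in>I. tgt (tot (M i)) n (phi i)) \<rparr>"

definition wfprod :: "'i set => ('i => 'u ctcat) => (nat => ('i => 'u) => bool) => nat => ('i => 'u) trm => bool" where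
 "wfprod I M P n t == teq (prodg I M P) n t t"

lemma teq_prodg_mono:
 assumes "P \<le> Q"
 shows "teq (prodg I M P) n t u ==> teq (prodg I M Q) n t u"
proof -
 have s: "tsrc (prodg I M P) t = tsrc (prodg I M Q) t" "ttgt (prodg I M P) t = ttgt (prodg I M Q) t" for t
  by (induction t) (auto simp: prodg_def)
 hence s: "tsrc (prodg I M P) = tsrc (prodg I M Q)" "ttgt (prodg I M P) = ttgt (prodg I M Q)" by auto
 show "teq (prodg I M P) n t u ==> teq (prodg I M Q) n t u"
 proof (induction rule: teq.induct)
  case (gen x n)
  thus ?case using assms by (intro teq.gen) (auto simp: prodg_def)
 qed (auto intro: teq.intros simp: s)
qed

text \<open>Admits \<open>wfprod I M (Cl I M S)\<close> as a premise in the inductive definition of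
  \<open>Cl\<close>. Faces of terms do not depend on the set of available tuples, so enlarging that
  set keeps derivations.\<close>

lemma wfprod_mono [mono]: "P \<le> Q ==> wfprod I M P \<le> wfprod I M Q"
 unfolding wfprod_def using teq_prodg_mono by (intro le_funI le_boolI)

definition tev :: "('u ctcat) => 'i => nat => ('i => 'u) trm => 'u trm set" where
 "tev N i n t = cl (tot N) n (tmap (%_ psi. psi i) t)"

text \<open>The rules \<open>out\<close> and \<open>inn\<close> make the colours of generated cells
  available, as unit cells in every dimension. In \<open>mul\<close>, the premise on the leaves lets
  the induction principle deliver a hypothesis for each tuple occurring in t.\<close>

inductive Cl :: "'i set => ('i => 'u ctcat) => (nat => ('i => 'u) set) => nat => ('i => 'u) => bool"
 for I M S where
 gen: "phi \<in> S n ==> Cl I M S n phi"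
| src: "Cl I M S (Suc n) phi ==> Cl I M S n (\<lambda>i\<in>I. src (tot (M i)) n (phi i))"
| tgt: "Cl I M S (Suc n) phi ==> Cl I M S n (\<lambda>i\<in>I. tgt (tot (M i)) n (phi i))"
| out: "Cl I M S n phi ==> Cl I M S m (\<lambda>i\<in>I. pt (M i) m (cmap (M i) n (phi i)))"
| inn: "Cl I M S n phi ==> Cl I M S m (\<lambda>i\<in>I. pt (M i) m (incol (M i) n (phi i)))"
| mul: "wfprod I M (Cl I M S) n t ==> (!!k psi. (k, psi) \<in> tlv t ==> Cl I M S k psi) ==> Cl I M S n phi ==>
  (!!i. i \<in> I ==> (tev (M i) i n t, phi i) \<in> pcell (M i) n) ==>
  Cl I M S n (\<lambda>i\<in>I. mul (M i) n (tev (M i) i n t, phi i))"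
| con: "Cl I M S k phi ==> Cl I M S k psi ==> (!!i. i \<in> I ==> (phi i, psi i) \<in> contractible_pairs (M i) k) ==>
  Cl I M S (Suc k) (\<lambda>i\<in>I. contr (M i) k (phi i) (psi i))"

text \<open>Names for generated tuples: formal operations applied to generators. Their purpose is to
  bound the number of generated tuples.\<close>

datatype 'x rt = RG 'x | RS nat "'x rt" | RT nat "'x rt" | RO nat nat "'x rt" | RI nat nat "'x rt"
 | RM nat "'x rt trm" "'x rt" | RC nat "'x rt" "'x rt"

instance rt :: (countable) countable
 by countable_datatype

primrec rev :: "('i => 'u ctcat) => 'i => ('i => 'u) rt => 'u" where
 "rev M i (RG phi) = phi i"
| "rev M i (RS n r) = src (tot (M i)) n (rev M i r)"
| "rev M i (RT n r) = tgt (tot (M i)) n (rev M i r)"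
| "rev M i (RO m n r) = pt (M i) m (cmap (M i) n (rev M i r))"
| "rev M i (RI m n r) = pt (M i) m (incol (M i) n (rev M i r))"
| "rev M i (RM n t r) = mul (M i) n (cl (tot (M i)) n (map_trm (rev M i) t), rev M i r)"
| "rev M i (RC k r s) = contr (M i) k (rev M i r) (rev M i s)"

lemma map_trm_tmap: "map_trm f t = tmap (%_. f) t"
 by (induction t) auto

lemma set_trm_tlv: "set_trm t = snd ` tlv t"
 by (induction t) (auto simp: image_Un)

lemma finite_set_rt: "finite (set_rt r)"
 by (induction r) (auto simp: set_trm_tlv finite_tlv)

text \<open>A name is a skeleton with natural numbers in place of generators, together with a list
  of generators. There are countably many skeletons, whence the estimate in
  \<open>sm_rt\<close>.\<close>

lemma rt_nth:
 assumes "set_rt r \<subseteq> A"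
 shows "\<exists>s :: nat rt. \<exists>xs\<in>lists A. r = map_rt (nth xs) s"
proof -
 obtain xs where xs: "set xs = set_rt r" using finite_list[OF finite_set_rt[of r]] by blast
 define ix where "ix x = (SOME k. xs ! k = x)" for x
 have ix: "xs ! ix x = x" if "x \<in> set_rt r" for x
 proof -
  have "\<exists>k. xs ! k = x" using that unfolding xs[symmetric] in_set_conv_nth by blast
  thus ?thesis unfolding ix_def by (rule someI_ex)
 qed
 have "map_rt (nth xs) (map_rt ix r) = map_rt (%x. x) r"
  unfolding rt.map_comp by (rule rt.map_cong) (auto simp: ix)
 hence "r = map_rt (nth xs) (map_rt ix r)" by (simp add: rt.map_ident)
 thus ?thesis using xs assms by (intro exI[of _ "map_rt ix r"] bexI[of _ xs]) auto
qed

lemma (in universe) sm_rt: "sm A ==> sm {r. set_rt r \<subseteq> A}"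
proof -
 assume a: "sm A"
 have "{r. set_rt r \<subseteq> A} \<subseteq> (%(s, xs). map_rt (nth xs) s) ` ((UNIV :: nat rt set) \<times> lists A)"
 proof
  fix r assume "r \<in> {r. set_rt r \<subseteq> A}"
  then obtain s :: "nat rt" and xs where "xs \<in> lists A" "r = map_rt (nth xs) s" using rt_nth by blast
  thus "r \<in> (%(s, xs). map_rt (nth xs) s) ` ((UNIV :: nat rt set) \<times> lists A)"
   by (intro image_eqI[of _ _ "(s, xs)"]) auto
 qed
 thus ?thesis
  using sm_subset[OF sm_image[OF sm_Times[OF sm_countable[OF countableI_type] sm_lists[OF a]]]] by blast
qed

text \<open>\<open>S_shape\<close> places the generators in the fibre product over the terminal
  object. A tuple with components of different shapes could have no value of \<open>dmap\<close>
  projecting to all of theirs.\<close>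

locale gen_object = universe U for U :: "'u itself" +
 fixes I :: "'i set" and M :: "'i => 'u ctcat" and S :: "nat => ('i => 'u) set"
 assumes I: "I \<noteq> {}" and M: "!!i. i \<in> I ==> ctob (M i)"
  and S_cell: "!!n phi i. phi \<in> S n ==> i \<in> I ==> phi i \<in> tcell (M i) n"
  and S_ext: "!!n phi. phi \<in> S n ==> phi \<in> extensional I"
  and S_shape: "!!n phi i j. phi \<in> S n ==> i \<in> I ==> j \<in> I ==> shape (M i) n (phi i) = shape (M j) n (phi j)"
  and S_small: "!!n. small U (S n)"
begin

abbreviation "CL \<equiv> Cl I M S"
abbreviation "PG \<equiv> prodg I M CL"

lemma Mp: "i \<in> I ==> is_ptgraph (M i)" and Mc: "i \<in> I ==> constant_ograph (base (M i))" and Mm: "i \<in> I ==> premul (M i)"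
 and Mo: "i \<in> I ==> is_ograph (tot (M i))"
 using ctobD(2,3,4)[OF M] pgD(2) by blast+

lemma const_cellI: "constant_ograph G ==> g \<in> cell G n ==> g \<in> cell G m"
 using const_cell by blast

lemma Cl_cell: "CL n phi ==> i \<in> I ==> phi i \<in> tcell (M i) n"
proof (induction rule: Cl.induct)
 case (gen phi n) thus ?case using S_cell by blast
next
 case (src n phi) thus ?case using ograph_src[OF Mo] by simp
next
 case (tgt n phi) thus ?case using ograph_tgt[OF Mo] by simp
next
 case (out n phi m)
 thus ?case using pg_cell(3)[OF Mp] const_cellI[OF Mc cmap_cell[OF Mp Mc]] by simp
next
 case (inn n phi m)
 thus ?case using pg_cell(3)[OF Mp] const_cellI[OF Mc incol_cell[OF Mp Mc]] by simp
next
 case (mul n t phi) thus ?case using ctobD(9)[OF M] by simp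
next
 case (con k phi psi) thus ?case using ctobD(5)[OF M] by simp
qed

lemma Cl_ext: "CL n phi ==> phi \<in> extensional I"
 by (induction rule: Cl.induct) (rule S_ext, assumption, (rule restrict_extensional)+)

lemma PG_simps: "cell PG n = {phi. CL n phi}" "src PG n phi = (\<lambda>i\<in>I. src (tot (M i)) n (phi i))"
 "tgt PG n phi = (\<lambda>i\<in>I. tgt (tot (M i)) n (phi i))"
 unfolding prodg_def by simp_all

lemma Cl_eqI: "CL n phi ==> CL m psi ==> (!!i. i \<in> I ==> phi i = psi i) ==> phi = psi"
 using Cl_ext extensionalityI by blast

lemma PG_ograph: "is_ograph PG"
proof -
 have g: "src (tot (M i)) n (src (tot (M i)) (Suc n) x) = src (tot (M i)) n (tgt (tot (M i)) (Suc n) x) \<and>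
   tgt (tot (M i)) n (src (tot (M i)) (Suc n) x) = tgt (tot (M i)) n (tgt (tot (M i)) (Suc n) x)"
  if "i \<in> I" "x \<in> tcell (M i) (Suc (Suc n))" for i n x
  using Mo[OF that(1)] that(2) unfolding is_ograph_def by blast
 have "src PG n (src PG (Suc n) phi) = src PG n (tgt PG (Suc n) phi) \<and> tgt PG n (src PG (Suc n) phi) = tgt PG n (tgt PG (Suc n) phi)"
  if "CL (Suc (Suc n)) phi" for n phi
  unfolding PG_simps using g[OF _ Cl_cell[OF that]] by (auto intro!: restrict_ext)
 moreover have "src PG n phi \<in> cell PG n \<and> tgt PG n phi \<in> cell PG n" if "CL (Suc n) phi" for n phi
  unfolding PG_simps using Cl.src[OF that] Cl.tgt[OF that] by blast
 ultimately show ?thesis unfolding is_ograph_def PG_simps(1)[of "Suc _"] by blast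
qed

lemma ev_map: "i \<in> I ==> ograph_map PG (tot (M i)) (%_ psi. psi i)"
 unfolding ograph_map_def PG_simps by (simp add: Cl_cell)

lemma tev_teq: "i \<in> I ==> teq PG n t t ==> teq (tot (M i)) n (tmap (%_ psi. psi i) t) (tmap (%_ psi. psi i) t)"
 by (rule teq_tmap[OF PG_ograph Mo ev_map])

lemma Cl_shape: "CL n phi ==> i \<in> I ==> j \<in> I ==> shape (M i) n (phi i) = shape (M j) n (phi j)"
proof (induction rule: Cl.induct)
 case (gen phi n) thus ?case using S_shape by blast
next
 case (src n phi) thus ?case using shape_src(1)[OF Mp Cl_cell] by simp
next
 case (tgt n phi) thus ?case using shape_src(2)[OF Mp Cl_cell] by simp
next
 case (out n phi m)
 thus ?case using shape_pt[OF Mp const_cellI[OF Mc cmap_cell[OF Mp Mc Cl_cell]]] by simp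
next
 case (inn n phi m)
 thus ?case using shape_pt[OF Mp const_cellI[OF Mc incol_cell[OF Mp Mc Cl_cell]]] by simp
next
 case (mul n t phi)
 \<comment> \<open>The hypothesis concerns terms over generated tuples that satisfy the claim as
   well; monotonicity forgets the claim.\<close>
 have t: "teq PG n t t" using mul.IH(1) unfolding wfprod_def by (rule teq_prodg_mono[rotated]) auto
 have "shape (M k) n (mul (M k) n (tev (M k) k n t, phi k)) =
   T_mult uno n (cl (T_graph uno) n (tmap (%m psi. shape (M k) m (psi k)) t))" if k: "k \<in> I" for k
  unfolding shape_mul[OF Mm[OF k] mul.hyps(3)[OF k]] unfolding tev_def
  using T_map_cl[OF Mo[OF k] T_graph_ograph[OF uno_ograph] shape_ograph_map[OF Mp[OF k]] tev_teq[OF k t]] by (simp add: tmap_tmap)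
 moreover have "tmap (%m psi. shape (M i) m (psi i)) t = tmap (%m psi. shape (M j) m (psi j)) t"
  by (rule tmap_leaf_cong) (use mul in blast)
 ultimately show ?case using mul.prems by simp
next
 case (con k phi psi)
 thus ?case using shape_contr[OF M con.hyps(3)] by simp
qed

text \<open>Every generated tuple is the tuple of values of one name with parameters in S. For
  \<open>mul\<close> the names of the leaves are chosen and put into the term.\<close>

lemma Cl_small: "small U (\<Union>n. {phi. CL n phi})"
proof -
 let ?A = "\<Union>n. S n"
 have "\<exists>r. set_rt r \<subseteq> ?A \<and> phi = (\<lambda>i\<in>I. rev M i r)" if "CL n phi" for n phi
  using that
 proof (induction rule: Cl.induct)
  case (gen phi n)
  hence "phi = (\<lambda>i\<in>I. rev M i (RG phi))" using S_ext by (simp add: extensional_restrict)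
  thus ?case using gen by (intro exI[of _ "RG phi"]) auto
 next
  case (src n phi)
  show ?case using src.IH by (elim exE, rule_tac x = "RS n r" in exI) auto
 next
  case (tgt n phi)
  show ?case using tgt.IH by (elim exE, rule_tac x = "RT n r" in exI) auto
 next
  case (out n phi m)
  show ?case using out.IH by (elim exE, rule_tac x = "RO m n r" in exI) auto
 next
  case (inn n phi m)
  show ?case using inn.IH by (elim exE, rule_tac x = "RI m n r" in exI) auto
 next
  case (mul n t phi)
  then obtain r where r: "set_rt r \<subseteq> ?A" "phi = (\<lambda>i\<in>I. rev M i r)" by blast
  have "\<forall>psi. \<exists>q. psi \<in> set_trm t --> set_rt q \<subseteq> ?A \<and> psi = (\<lambda>i\<in>I. rev M i q)"
   using mul.IH(2) unfolding set_trm_tlv by force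
  then obtain R where R: "!!psi. psi \<in> set_trm t ==> set_rt (R psi) \<subseteq> ?A \<and> psi = (\<lambda>i\<in>I. rev M i (R psi))" by metis
  have "tmap (%_ psi. psi i) t = map_trm (rev M i) (map_trm R t)" if "i \<in> I" for i
   unfolding map_trm_tmap tmap_tmap
  proof (rule tmap_leaf_cong)
   fix k psi assume "(k, psi) \<in> tlv t"
   hence "psi \<in> set_trm t" unfolding set_trm_tlv by force
   thus "psi i = rev M i (R psi)" using R that by (metis restrict_apply')
  qed
  hence "(\<lambda>i\<in>I. mul (M i) n (tev (M i) i n t, phi i)) = (\<lambda>i\<in>I. rev M i (RM n (map_trm R t) r))"
   using r(2) by (auto simp: tev_def fun_eq_iff)
  moreover have "set_rt (RM n (map_trm R t) r) \<subseteq> ?A" using r(1) R by (auto simp: trm.set_map)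
  ultimately show ?case by blast
 next
  case (con k phi psi)
  then obtain r q where "set_rt r \<subseteq> ?A" "phi = (\<lambda>i\<in>I. rev M i r)" "set_rt q \<subseteq> ?A" "psi = (\<lambda>i\<in>I. rev M i q)" by blast
  thus ?case by (intro exI[of _ "RC k r q"]) auto
 qed
 hence "(\<Union>n. {phi. CL n phi}) \<subseteq> (%r. \<lambda>i\<in>I. rev M i r) ` {r. set_rt r \<subseteq> ?A}" by blast
 moreover have "sm ?A" by (rule sm_UN) (auto simp: S_small sm_countable)
 ultimately show ?thesis using sm_subset[OF sm_image[OF sm_rt]] by blast
qed

text \<open>A single code for the tuples of all dimensions, so that decoding does not depend on the
  dimension.\<close>

definition en :: "('i => 'u) => 'u" where
 "en = (SOME f. inj_on f (\<Union>n. {phi. CL n phi}))"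

definition de :: "'u => 'i => 'u" where
 "de = inv_into (\<Union>n. {phi. CL n phi}) en"

lemma en_inj: "inj_on en (\<Union>n. {phi. CL n phi})"
 unfolding en_def using someI_ex[OF sm_inj[OF Cl_small]] .

lemma de_en: "CL n phi ==> de (en phi) = phi"
 unfolding de_def using inv_into_f_f[OF en_inj] by blast

text \<open>Colours of the generated object are represented by their unit 0-cells, which are exactly
  the generated 0-cells fixed by forming the unit of the output colour.\<close>

definition isP :: "('i => 'u) => bool" where
 "isP phi == CL 0 phi \<and> (\<forall>i\<in>I. phi i = pt (M i) 0 (cmap (M i) 0 (phi i)))"

definition Gb :: "'u ograph" where
 "Gb = \<lparr> cell = (%_. {en phi | phi. isP phi}), src = (%_ g. g), tgt = (%_ g. g) \<rparr>"

definition Gt :: "'u ograph" where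
 "Gt = \<lparr> cell = (%n. {en phi | phi. CL n phi}),
   src = (%n z. en (\<lambda>i\<in>I. src (tot (M i)) n (de z i))),
   tgt = (%n z. en (\<lambda>i\<in>I. tgt (tot (M i)) n (de z i))) \<rparr>"

definition eout :: "nat => nat => 'u => 'u" where
 "eout m n z = en (\<lambda>i\<in>I. pt (M i) m (cmap (M i) n (de z i)))"

definition einn :: "nat => nat => 'u => 'u" where
 "einn m n z = en (\<lambda>i\<in>I. pt (M i) m (incol (M i) n (de z i)))"

definition ee :: "'i => nat => 'u => 'u" where
 "ee i n z = de z i"

definition hh :: "'i => nat => 'u => 'u" where
 "hh i n g = cmap (M i) 0 (de g i)"

definition i0 :: 'i where "i0 = (SOME i. i \<in> I)"

lemma i0: "i0 \<in> I"
 unfolding i0_def using I some_in_eq by blast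

text \<open>\<open>dmap\<close> is assembled from its two invariants: the shape, read off the
  component \<open>i0\<close> and the same in all others, and the input colour formed
  componentwise.\<close>

definition GO :: "'u ctcat" where
 "GO = \<lparr> base = Gb, tot = Gt, dmap = (%n z. T_map Gb (%_ _. einn 0 n z) n (shape (M i0) n (de z i0))),
   cmap = eout 0, pt = (%n g. eout n 0 g),
   mul = (%n (K, z). en (\<lambda>i\<in>I. mul (M i) n (T_map (tot (M i)) (ee i) n K, de z i))),
   contr = (%k y z. en (\<lambda>i\<in>I. contr (M i) k (de y i) (de z i))) \<rparr>"

lemma GO_simps: "base GO = Gb" "tot GO = Gt" "cmap GO = eout 0" "pt GO = (%n g. eout n 0 g)"
 "dmap GO n z = T_map Gb (%_ _. einn 0 n z) n (shape (M i0) n (de z i0))"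
 "mul GO n (K, z) = en (\<lambda>i\<in>I. mul (M i) n (T_map (tot (M i)) (ee i) n K, de z i))"
 "contr GO k y z = en (\<lambda>i\<in>I. contr (M i) k (de y i) (de z i))"
 unfolding GO_def by simp_all

lemma Gt_cell: "z \<in> cell Gt n \<longleftrightarrow> CL n (de z) \<and> en (de z) = z"
 unfolding Gt_def using de_en by simp metis

lemma Gt_en: "CL n phi ==> en phi \<in> cell Gt n"
 unfolding Gt_cell by (simp add: de_en)

lemma Gb_cell: "g \<in> cell Gb n \<longleftrightarrow> isP (de g) \<and> en (de g) = g"
 unfolding Gb_def isP_def using de_en by simp metis

lemma Gb_src: "src Gb n g = g" "tgt Gb n g = g"
 unfolding Gb_def by simp_all

lemma Gb_const: "constant_ograph Gb"
 unfolding constant_ograph_def is_ograph_def Gb_def by simp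

lemma Gt_src: "z \<in> cell Gt (Suc n) ==> src Gt n z \<in> cell Gt n \<and> de (src Gt n z) = (\<lambda>i\<in>I. src (tot (M i)) n (de z i))"
 and Gt_tgt: "z \<in> cell Gt (Suc n) ==> tgt Gt n z \<in> cell Gt n \<and> de (tgt Gt n z) = (\<lambda>i\<in>I. tgt (tot (M i)) n (de z i))"
proof -
 assume "z \<in> cell Gt (Suc n)"
 hence z: "CL (Suc n) (de z)" unfolding Gt_cell by simp
 have e: "src Gt n z = en (\<lambda>i\<in>I. src (tot (M i)) n (de z i))" "tgt Gt n z = en (\<lambda>i\<in>I. tgt (tot (M i)) n (de z i))"
  unfolding Gt_def by simp_all
 show "src Gt n z \<in> cell Gt n \<and> de (src Gt n z) = (\<lambda>i\<in>I. src (tot (M i)) n (de z i))"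
  "tgt Gt n z \<in> cell Gt n \<and> de (tgt Gt n z) = (\<lambda>i\<in>I. tgt (tot (M i)) n (de z i))"
  unfolding e using Gt_en[OF Cl.src[OF z]] de_en[OF Cl.src[OF z]] Gt_en[OF Cl.tgt[OF z]] de_en[OF Cl.tgt[OF z]] by auto
qed

lemma de_map: "ograph_map Gt PG (%_. de)"
 unfolding ograph_map_def PG_simps using Gt_src Gt_tgt Gt_cell by blast

lemma en_map: "ograph_map PG Gt (%_. en)"
 unfolding ograph_map_def PG_simps using Gt_en de_en by (simp add: Gt_def)

lemma Gt_ograph: "is_ograph Gt"
proof -
 have "src Gt n (src Gt (Suc n) z) = src Gt n (tgt Gt (Suc n) z) \<and> tgt Gt n (src Gt (Suc n) z) = tgt Gt n (tgt Gt (Suc n) z)"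
  if z: "z \<in> cell Gt (Suc (Suc n))" for n z
 proof -
  have d: "de z \<in> cell PG (Suc (Suc n))" "en (de z) = z" using z unfolding Gt_cell PG_simps by auto
  have p: "src PG (Suc n) (de z) \<in> cell PG (Suc n)" "tgt PG (Suc n) (de z) \<in> cell PG (Suc n)"
   using ograph_src[OF PG_ograph d(1)] ograph_tgt[OF PG_ograph d(1)] .
  have e: "src Gt (Suc n) z = en (src PG (Suc n) (de z))" "tgt Gt (Suc n) z = en (tgt PG (Suc n) (de z))"
   using omap_src[OF en_map d(1)] omap_tgt[OF en_map d(1)] d(2) by simp_all
  have "src PG n (src PG (Suc n) (de z)) = src PG n (tgt PG (Suc n) (de z)) \<and> tgt PG n (src PG (Suc n) (de z)) = tgt PG n (tgt PG (Suc n) (de z))"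
   using PG_ograph d(1) unfolding is_ograph_def by blast
  thus ?thesis unfolding e using omap_src[OF en_map p(1)] omap_src[OF en_map p(2)]
    omap_tgt[OF en_map p(1)] omap_tgt[OF en_map p(2)] by metis
 qed
 thus ?thesis unfolding is_ograph_def using Gt_src Gt_tgt by blast
qed

lemma ee_map: "i \<in> I ==> ograph_map Gt (tot (M i)) (ee i)"
 unfolding ee_def[abs_def] using ograph_map_comp[OF de_map ev_map] .

lemma ee_inj: "x \<in> cell Gt n ==> y \<in> cell Gt m ==> (!!i. i \<in> I ==> ee i n x = ee i m y) ==> x = y"
 unfolding Gt_cell ee_def using Cl_eqI by metis

lemma eout_cell: "z \<in> cell Gt n ==> eout m n z \<in> cell Gt m \<and> de (eout m n z) = (\<lambda>i\<in>I. pt (M i) m (cmap (M i) n (de z i)))"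
 and einn_cell: "z \<in> cell Gt n ==> einn m n z \<in> cell Gt m \<and> de (einn m n z) = (\<lambda>i\<in>I. pt (M i) m (incol (M i) n (de z i)))"
proof -
 assume "z \<in> cell Gt n"
 hence z: "CL n (de z)" unfolding Gt_cell by simp
 show "eout m n z \<in> cell Gt m \<and> de (eout m n z) = (\<lambda>i\<in>I. pt (M i) m (cmap (M i) n (de z i)))"
  "einn m n z \<in> cell Gt m \<and> de (einn m n z) = (\<lambda>i\<in>I. pt (M i) m (incol (M i) n (de z i)))"
  unfolding eout_def einn_def
  using Gt_en[OF Cl.out[OF z]] de_en[OF Cl.out[OF z]] Gt_en[OF Cl.inn[OF z]] de_en[OF Cl.inn[OF z]] by blast+
qed

lemma ee_cell: "z \<in> cell Gt n ==> i \<in> I ==> de z i \<in> tcell (M i) n"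
 unfolding Gt_cell using Cl_cell by blast

lemma ccell: "z \<in> cell Gt n ==> i \<in> I ==> cmap (M i) n (de z i) \<in> gcell (M i) m"
 using const_cellI[OF Mc cmap_cell[OF Mp Mc ee_cell]] .

lemma icell: "z \<in> cell Gt n ==> i \<in> I ==> incol (M i) n (de z i) \<in> gcell (M i) m"
 using const_cellI[OF Mc incol_cell[OF Mp Mc ee_cell]] .

lemma eout_base: "z \<in> cell Gt n ==> eout 0 n z \<in> cell Gb m"
 and einn_base: "z \<in> cell Gt n ==> einn 0 n z \<in> cell Gb m"
 unfolding Gb_cell isP_def using eout_cell[of z n 0] einn_cell[of z n 0] pgD(7)[OF Mp ccell] pgD(7)[OF Mp icell]
 by (auto simp: Gt_cell)

lemma Gb_Gt: "g \<in> cell Gb n ==> g \<in> cell Gt 0"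
 unfolding Gb_cell Gt_cell isP_def by blast

lemma hh_eout: "z \<in> cell Gt n ==> i \<in> I ==> hh i m (eout 0 n z) = cmap (M i) n (de z i)"
 and hh_einn: "z \<in> cell Gt n ==> i \<in> I ==> hh i m (einn 0 n z) = incol (M i) n (de z i)"
 unfolding hh_def using eout_cell[of z n 0] einn_cell[of z n 0] pgD(7)[OF Mp ccell] pgD(7)[OF Mp icell] by auto

lemma hh_map: "i \<in> I ==> ograph_map Gb (base (M i)) (hh i)"
 unfolding ograph_map_def hh_def using ccell[OF Gb_Gt] const_src[OF Mc] by (simp add: Gb_def)

lemma hh_inj: "g \<in> cell Gb 0 ==> g' \<in> cell Gb 0 ==> (!!i. i \<in> I ==> hh i 0 g = hh i 0 g') ==> g = g'"
proof -
 assume g: "g \<in> cell Gb 0" "g' \<in> cell Gb 0" and e: "!!i. i \<in> I ==> hh i 0 g = hh i 0 g'"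
 have "de g i = de g' i" if "i \<in> I" for i using g e[OF that] that unfolding Gb_cell isP_def hh_def by metis
 thus ?thesis using ee_inj[OF Gb_Gt[OF g(1)] Gb_Gt[OF g(2)]] unfolding ee_def by blast
qed

lemma Gb_Tj:
 assumes "K \<in> Tcell Gb n" "K' \<in> Tcell Gb n"
  and "!!i. i \<in> I ==> T_map (base (M i)) (hh i) n K = T_map (base (M i)) (hh i) n K'"
 shows "K = K'"
 by (rule T_joint[OF Gb_const I _ hh_inj assms]) (auto simp: Mc hh_map)

text \<open>\<open>hh i\<close> sends the input colour of the tuple to that of component i, and the
  shapes agree by \<open>Cl_shape\<close>; the two together determine the value of
  \<open>dmap\<close>.\<close>

lemma GO_d:
 assumes z: "z \<in> cell Gt n"
 shows "dmap GO n z \<in> Tcell Gb n"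
  "i \<in> I ==> T_map (base (M i)) (hh i) n (dmap GO n z) = dmap (M i) n (de z i)"
  "shape GO n z = shape (M i0) n (de z i0)" "incol GO n z = einn 0 n z"
proof -
 have sh: "shape (M i0) n (de z i0) \<in> Tcell uno n" using shape_cell[OF Mp[OF i0] ee_cell[OF z i0]] .
 note tc = T_map_const[OF Gb_const einn_base[OF z] sh]
 show d: "dmap GO n z \<in> Tcell Gb n" unfolding GO_simps using tc(1) .
 show "shape GO n z = shape (M i0) n (de z i0)" "incol GO n z = einn 0 n z"
  by (simp_all add: shape_def[of GO] incol_def GO_simps tc)
 assume i: "i \<in> I"
 note Go = const_ograph[OF Gb_const] const_ograph[OF Mc[OF i]]
 show "T_map (base (M i)) (hh i) n (dmap GO n z) = dmap (M i) n (de z i)"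
 proof (rule const_ext[OF Mc[OF i] T_map_cell[OF Go hh_map[OF i] d] pg_cell(1)[OF Mp[OF i] ee_cell[OF z i]]])
  show "shp n (T_map (base (M i)) (hh i) n (dmap GO n z)) = shp n (dmap (M i) n (de z i))"
  proof -
   have "shape (M i0) n (de z i0) = shape (M i) n (de z i)" using Cl_shape[OF _ i0 i] z unfolding Gt_cell by blast
   thus ?thesis unfolding shp_map[OF Go hh_map[OF i] d] unfolding GO_simps tc(2) unfolding shape_def .
  qed
  show "tcol (T_map (base (M i)) (hh i) n (dmap GO n z)) = tcol (dmap (M i) n (de z i))"
   unfolding tcol_map[OF Gb_const Mc[OF i] hh_map[OF i] d] unfolding GO_simps tc(3) hh_einn[OF z i] incol_def ..
 qed
qed

end

section \<open>Laws and universal property of the generated object\<close>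

context gen_object
begin

lemma ptm_ee_aux:
 "z \<in> cell Gt (Suc n) ==> i \<in> I ==> cmap (M i) n (src (tot (M i)) n (de z i)) = cmap (M i) (Suc n) (de z i)"
 "z \<in> cell Gt (Suc n) ==> i \<in> I ==> cmap (M i) n (tgt (tot (M i)) n (de z i)) = cmap (M i) (Suc n) (de z i)"
proof -
 assume z: "z \<in> cell Gt (Suc n)" and i: "i \<in> I"
 show "cmap (M i) n (src (tot (M i)) n (de z i)) = cmap (M i) (Suc n) (de z i)"
  "cmap (M i) n (tgt (tot (M i)) n (de z i)) = cmap (M i) (Suc n) (de z i)"
  using omap_src[OF pgD(4)[OF Mp[OF i]] ee_cell[OF z i]] omap_tgt[OF pgD(4)[OF Mp[OF i]] ee_cell[OF z i]]
   const_src[OF Mc[OF i] ccell[OF z i]] by simp_all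
qed

lemma GO_dmap: "ograph_map Gt (T_graph Gb) (dmap GO)"
proof -
 note Go = const_ograph[OF Gb_const]
 note To = T_graph_ograph[OF Go]
 have "dmap GO n (src Gt n z) = src (T_graph Gb) n (dmap GO (Suc n) z) \<and>
   dmap GO n (tgt Gt n z) = tgt (T_graph Gb) n (dmap GO (Suc n) z)" if z: "z \<in> cell Gt (Suc n)" for n z
 proof -
  have s: "src Gt n z \<in> cell Gt n" "tgt Gt n z \<in> cell Gt n" using Gt_src[OF z] Gt_tgt[OF z] by auto
  note d = GO_d(1)[OF z]
  have "T_map (base (M i)) (hh i) n (dmap GO n (src Gt n z)) = T_map (base (M i)) (hh i) n (src (T_graph Gb) n (dmap GO (Suc n) z)) \<and>
    T_map (base (M i)) (hh i) n (dmap GO n (tgt Gt n z)) = T_map (base (M i)) (hh i) n (tgt (T_graph Gb) n (dmap GO (Suc n) z))"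
   if i: "i \<in> I" for i
   using GO_d(2)[OF s(1) i] GO_d(2)[OF s(2) i] GO_d(2)[OF z i] Gt_src[OF z] Gt_tgt[OF z] i
    omap_src[OF T_map_ograph_map[OF Go const_ograph[OF Mc[OF i]] hh_map[OF i]] d]
    omap_tgt[OF T_map_ograph_map[OF Go const_ograph[OF Mc[OF i]] hh_map[OF i]] d]
    omap_src[OF pgD(3)[OF Mp[OF i]] ee_cell[OF z i]] omap_tgt[OF pgD(3)[OF Mp[OF i]] ee_cell[OF z i]] by simp
  thus ?thesis using Gb_Tj[OF GO_d(1)[OF s(1)] ograph_src[OF To d]] Gb_Tj[OF GO_d(1)[OF s(2)] ograph_tgt[OF To d]] by blast
 qed
 thus ?thesis unfolding ograph_map_def using GO_d(1) by blast
qed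

lemma GO_cmap: "ograph_map Gt Gb (eout 0)"
proof -
 have "eout 0 n (src Gt n z) = eout 0 (Suc n) z \<and> eout 0 n (tgt Gt n z) = eout 0 (Suc n) z" if z: "z \<in> cell Gt (Suc n)" for n z
  unfolding eout_def using Gt_src[OF z] Gt_tgt[OF z] ptm_ee_aux[OF z] by (auto intro!: arg_cong[where f = en] restrict_ext)
 thus ?thesis unfolding ograph_map_def using eout_base by (simp add: Gb_def)
qed

lemma pt_src:
 assumes "is_ptgraph C" "constant_ograph (base C)" "g \<in> gcell C 0"
 shows "src (tot C) n (pt C (Suc n) g) = pt C n g" "tgt (tot C) n (pt C (Suc n) g) = pt C n g"
proof -
 have g: "g \<in> gcell C (Suc n)" using const_cellI[OF assms(2,3)] .
 show "src (tot C) n (pt C (Suc n) g) = pt C n g" "tgt (tot C) n (pt C (Suc n) g) = pt C n g"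
  using omap_src[OF pgD(5)[OF assms(1)] g] omap_tgt[OF pgD(5)[OF assms(1)] g] const_src[OF assms(2,3)] by simp_all
qed

lemma GO_pt: "ograph_map Gb Gt (%n g. eout n 0 g)"
proof -
 have "eout n 0 g = src Gt n (eout (Suc n) 0 g) \<and> eout n 0 g = tgt Gt n (eout (Suc n) 0 g)" if g: "g \<in> cell Gb (Suc n)" for n g
 proof -
  note c = eout_cell[OF Gb_Gt[OF g], of n] eout_cell[OF Gb_Gt[OF g], of "Suc n"]
  have z: "eout (Suc n) 0 g \<in> cell Gt (Suc n)" using c by blast
  have p: "src (tot (M i)) n (pt (M i) (Suc n) (cmap (M i) 0 (de g i))) = pt (M i) n (cmap (M i) 0 (de g i))"
   "tgt (tot (M i)) n (pt (M i) (Suc n) (cmap (M i) 0 (de g i))) = pt (M i) n (cmap (M i) 0 (de g i))" if "i \<in> I" for i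
   using pt_src[OF Mp[OF that] Mc[OF that] ccell[OF Gb_Gt[OF g] that]] .
  have "de (eout n 0 g) = de (src Gt n (eout (Suc n) 0 g))" "de (eout n 0 g) = de (tgt Gt n (eout (Suc n) 0 g))"
   using Gt_src[OF z] Gt_tgt[OF z] c p by (auto intro!: restrict_ext)
  thus ?thesis using c Gt_src[OF z] Gt_tgt[OF z] unfolding Gt_cell by metis
 qed
 thus ?thesis unfolding ograph_map_def Gb_src using eout_cell[OF Gb_Gt] by blast
qed

lemma GO_ptgraph: "is_ptgraph GO"
proof -
 have c: "cell Gt n \<subseteq> en ` (\<Union>n. {phi. CL n phi})" "cell Gb n \<subseteq> en ` (\<Union>n. {phi. CL n phi})" for n
  unfolding Gt_def Gb_def isP_def by auto
 have s: "small U (cell Gt n)" "small U (cell Gb n)" for n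
  by (rule sm_subset[OF sm_image[OF Cl_small] c(1)], rule sm_subset[OF sm_image[OF Cl_small] c(2)])
 have tg: "is_tgraph GO" unfolding is_tgraph_def GO_simps(1-3) sm_iff
  by (intro conjI allI const_ograph[OF Gb_const] Gt_ograph s GO_dmap GO_cmap)
 have "dmap GO n (eout n 0 g) = T_unit Gb n g \<and> eout 0 n (eout n 0 g) = g" if g: "g \<in> cell Gb n" for n g
 proof
  note Go = const_ograph[OF Gb_const]
  note c = eout_cell[OF Gb_Gt[OF g], of n]
  have z: "eout n 0 g \<in> cell Gt n" using c by blast
  have hg: "hh i n g \<in> gcell (M i) n" if "i \<in> I" for i using omap_cell[OF hh_map[OF that] g] .
  show "dmap GO n (eout n 0 g) = T_unit Gb n g"
  proof (rule Gb_Tj[OF GO_d(1)[OF z] omap_cell[OF T_unit_ograph_map[OF Go] g]])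
   fix i assume i: "i \<in> I"
   have "de (eout n 0 g) i = pt (M i) n (hh i n g)" using c i unfolding hh_def by simp
   thus "T_map (base (M i)) (hh i) n (dmap GO n (eout n 0 g)) = T_map (base (M i)) (hh i) n (T_unit Gb n g)"
    unfolding GO_d(2)[OF z i] T_map_unit[OF Go const_ograph[OF Mc[OF i]] hh_map[OF i] g]
    using pgD(6)[OF Mp[OF i] hg[OF i]] by simp
  qed
  have g0: "g \<in> cell Gb 0" using g unfolding Gb_def by simp
  show "eout 0 n (eout n 0 g) = g"
  proof (rule hh_inj[OF eout_base[OF z] g0])
   fix i assume i: "i \<in> I"
   have "de (eout n 0 g) i = pt (M i) n (hh i n g)" using c i unfolding hh_def by simp
   thus "hh i 0 (eout 0 n (eout n 0 g)) = hh i 0 g"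
    unfolding hh_eout[OF z i] using pgD(7)[OF Mp[OF i] hg[OF i]] by (simp add: hh_def)
  qed
 qed
 thus ?thesis unfolding is_ptgraph_def GO_simps(1-4) by (intro conjI tg GO_pt) blast
qed

lemma GO_ptm: "i \<in> I ==> ptm GO (M i) (ee i) (hh i)"
 unfolding ptm_def GO_simps(1-4)
 using ee_map hh_map GO_d(2) hh_eout eout_cell[OF Gb_Gt] by (auto simp: ee_def hh_def)

lemma GO_tev:
 assumes "teq PG n t t" "i \<in> I"
 shows "T_map (tot (M i)) (ee i) n (cl Gt n (tmap (%_. en) t)) = tev (M i) i n t"
proof -
 have "tmap (%k psi. de (en psi) i) t = tmap (%_ psi. psi i) t"
 proof (rule tmap_leaf_cong)
  fix k psi assume "(k, psi) \<in> tlv t"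
  hence "CL k psi" using teq_leaf[OF PG_ograph assms(1)] unfolding PG_simps by blast
  thus "de (en psi) i = psi i" by (simp add: de_en)
 qed
 thus ?thesis
  unfolding T_map_cl[OF Gt_ograph Mo[OF assms(2)] ee_map[OF assms(2)] teq_tmap[OF PG_ograph Gt_ograph en_map assms(1)]]
  by (simp add: tmap_tmap tev_def ee_def)
qed

lemma GO_mul:
 assumes k: "(K, z) \<in> pcell GO n"
 shows "mul GO n (K, z) \<in> cell Gt n" "i \<in> I ==> ee i n (mul GO n (K, z)) = mul (M i) n (T_map (tot (M i)) (ee i) n K, ee i n z)"
proof -
 have K: "K \<in> Tcell Gt n" and z: "z \<in> cell Gt n" using k unfolding pb_iff GO_simps by auto
 obtain s where s: "teq Gt n s s" "K = cl Gt n s" using T_cellE[OF K] .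
 \<comment> \<open>Decoding the leaves returns to a term over tuples, the form in which
   \<open>Cl.mul\<close> accepts it; \<open>de_map\<close> keeps it well formed there.\<close>
 let ?t = "tmap (%_. de) s"
 have t: "teq PG n ?t ?t" using teq_tmap[OF Gt_ograph PG_ograph de_map s(1)] .
 have tv: "T_map (tot (M i)) (ee i) n K = tev (M i) i n ?t" if "i \<in> I" for i
  unfolding s(2) T_map_cl[OF Gt_ograph Mo[OF that] ee_map[OF that] s(1)] tev_def tmap_tmap ee_def ..
 have c: "CL n (\<lambda>i\<in>I. mul (M i) n (tev (M i) i n ?t, de z i))"
 proof (rule Cl.mul)
  show "wfprod I M CL n ?t" unfolding wfprod_def by (rule t)
  show "!!k psi. (k, psi) \<in> tlv ?t ==> CL k psi" using teq_leaf[OF PG_ograph t] unfolding PG_simps by blast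
  show "CL n (de z)" using z unfolding Gt_cell by blast
  show "(tev (M i) i n ?t, de z i) \<in> pcell (M i) n" if "i \<in> I" for i
   using pb_map_cell[OF GO_ptgraph Mp[OF that] GO_ptm[OF that] k] tv[OF that] by (simp add: ee_def)
 qed
 have e: "mul GO n (K, z) = en (\<lambda>i\<in>I. mul (M i) n (tev (M i) i n ?t, de z i))"
  unfolding GO_simps by (rule arg_cong[where f = en]) (auto intro!: restrict_ext simp: tv)
 show "mul GO n (K, z) \<in> cell Gt n" unfolding e using Gt_en[OF c] .
 show "i \<in> I ==> ee i n (mul GO n (K, z)) = mul (M i) n (T_map (tot (M i)) (ee i) n K, ee i n z)"
  unfolding e using tv by (simp add: ee_def de_en[OF c])
qed

lemma GO_con:
 assumes xy: "(x, y) \<in> contractible_pairs GO k"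
 shows "contr GO k x y \<in> cell Gt (Suc k)" "i \<in> I ==> ee i (Suc k) (contr GO k x y) = contr (M i) k (ee i k x) (ee i k y)"
proof -
 have c: "x \<in> cell Gt k" "y \<in> cell Gt k" using contractible_cells[OF xy] unfolding GO_simps by auto
 have p: "(de x i, de y i) \<in> contractible_pairs (M i) k" if "i \<in> I" for i
  using contractible_push[OF GO_ptgraph _ Mp[OF that] Mc[OF that] GO_ptm[OF that] xy] Gb_const unfolding GO_simps ee_def by simp
 have C: "CL (Suc k) (\<lambda>i\<in>I. contr (M i) k (de x i) (de y i))"
  by (rule Cl.con) (use c p in \<open>auto simp: Gt_cell\<close>)
 show "contr GO k x y \<in> cell Gt (Suc k)" unfolding GO_simps using Gt_en[OF C] .
 show "i \<in> I ==> ee i (Suc k) (contr GO k x y) = contr (M i) k (ee i k x) (ee i k y)"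
  unfolding GO_simps by (simp add: ee_def de_en[OF C])
qed

text \<open>The components are jointly injective and commute with the operations, so the laws are
  inherited through \<open>initial_lift\<close>.\<close>

theorem GO_object: "ctob GO" and GO_proj: "i \<in> I ==> ctm GO (M i) (ee i) (hh i)"
proof -
 have inj: "x = y" if "x \<in> tcell GO n" "y \<in> tcell GO n" "!!i. i \<in> I ==> ee i n x = ee i n y" for n x y
  using ee_inj[of x n y n] that unfolding GO_simps by blast
 have G: "constant_ograph (base GO)" unfolding GO_simps by (rule Gb_const)
 note il = initial_lift[OF GO_ptgraph G I M GO_ptm inj, unfolded GO_simps(2)]
 show "ctob GO" by (rule il(1)) (use GO_mul GO_con in \<open>auto simp: GO_simps(2)\<close>)
 show "i \<in> I ==> ctm GO (M i) (ee i) (hh i)" by (rule il(2)) (use GO_mul GO_con in \<open>auto simp: GO_simps(2)\<close>)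
qed

lemma GO_gen: "phi \<in> S n ==> en phi \<in> tcell GO n" "phi \<in> S n ==> i \<in> I ==> ee i n (en phi) = phi i"
 unfolding GO_simps ee_def using Gt_en[OF Cl.gen] de_en[OF Cl.gen] by auto

text \<open>For a term well formed over generated tuples, composability is tested on components, the
  base being jointly detected by the \<open>hh i\<close>.\<close>

lemma GO_pb:
 assumes t: "teq PG n t t" and phi: "CL n phi" and p: "!!i. i \<in> I ==> (tev (M i) i n t, phi i) \<in> pcell (M i) n"
 shows "(cl Gt n (tmap (%_. en) t), en phi) \<in> pcell GO n"
  "mul GO n (cl Gt n (tmap (%_. en) t), en phi) = en (\<lambda>i\<in>I. mul (M i) n (tev (M i) i n t, phi i))"
proof -
 let ?K = "cl Gt n (tmap (%_. en) t)"
 have K: "?K \<in> Tcell Gt n" using T_cellI[OF teq_tmap[OF PG_ograph Gt_ograph en_map t]] .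
 have z: "en phi \<in> cell Gt n" using Gt_en[OF phi] .
 have "T_map Gb (eout 0) n ?K = dmap GO n (en phi)"
 proof (rule Gb_Tj[OF T_map_cell[OF Gt_ograph const_ograph[OF Gb_const] GO_cmap K] GO_d(1)[OF z]])
  fix i assume i: "i \<in> I"
  note Mb = const_ograph[OF Mc[OF i]]
  have "T_map (base (M i)) (hh i) n (T_map Gb (eout 0) n ?K) = T_map (base (M i)) (%n z. hh i n (eout 0 n z)) n ?K"
   using T_map_comp[OF Gt_ograph const_ograph[OF Gb_const] Mb GO_cmap hh_map[OF i] K] .
  also have "\<dots> = T_map (base (M i)) (%n z. cmap (M i) n (ee i n z)) n ?K"
   by (rule T_map_cong[OF Gt_ograph K]) (simp add: hh_eout[OF _ i] ee_def)
  also have "\<dots> = T_map (base (M i)) (cmap (M i)) n (T_map (tot (M i)) (ee i) n ?K)"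
   using T_map_comp[OF Gt_ograph Mo[OF i] Mb ee_map[OF i] pgD(4)[OF Mp[OF i]] K] by simp
  also have "\<dots> = dmap (M i) n (phi i)" unfolding GO_tev[OF t i] using p[OF i] unfolding pb_iff by blast
  finally show "T_map (base (M i)) (hh i) n (T_map Gb (eout 0) n ?K) = T_map (base (M i)) (hh i) n (dmap GO n (en phi))"
   unfolding GO_d(2)[OF z i] de_en[OF phi] .
 qed
 thus "(?K, en phi) \<in> pcell GO n" unfolding pb_iff GO_simps(1-3) using K z by blast
 show "mul GO n (?K, en phi) = en (\<lambda>i\<in>I. mul (M i) n (tev (M i) i n t, phi i))"
  unfolding GO_simps by (rule arg_cong[where f = en]) (auto intro!: restrict_ext simp: GO_tev[OF t] de_en[OF phi])
qed

lemma GO_cpair: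
 assumes phi: "CL k phi" and psi: "CL k psi" and p: "!!i. i \<in> I ==> (phi i, psi i) \<in> contractible_pairs (M i) k"
 shows "(en phi, en psi) \<in> contractible_pairs GO k"
proof -
 have z: "en phi \<in> cell Gt k" "en psi \<in> cell Gt k" using Gt_en[OF phi] Gt_en[OF psi] .
 have G: "constant_ograph (base GO)" unfolding GO_simps by (rule Gb_const)
 have d: "dmap GO k (en phi) = dmap GO k (en psi)"
  by (rule Gb_Tj[OF GO_d(1)[OF z(1)] GO_d(1)[OF z(2)]])
   (use contractible_cells[OF p] in \<open>simp add: GO_d(2)[OF z(1)] GO_d(2)[OF z(2)] de_en[OF phi] de_en[OF psi]\<close>)
 have m: "is_ptgraph (M i) \<and> constant_ograph (base (M i)) \<and> ptm GO (M i) (ee i) (hh i)" if "i \<in> I" for i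
  using Mp[OF that] Mc[OF that] GO_ptm[OF that] by blast
 have inj: "x = y" if "x \<in> tcell GO n" "y \<in> tcell GO n" "!!i. i \<in> I ==> ee i n x = ee i n y" for n x y
  using ee_inj[of x n y n] that unfolding GO_simps by blast
 have pe: "(ee i k (en phi), ee i k (en psi)) \<in> contractible_pairs (M i) k" if "i \<in> I" for i
  using p[OF that] unfolding ee_def de_en[OF phi] de_en[OF psi] .
 have z': "en phi \<in> tcell GO k" "en psi \<in> tcell GO k" using z unfolding GO_simps .
 show ?thesis by (rule contractible_reflect[OF GO_ptgraph G I m inj d z' pe])
qed

text \<open>The generated tuples on which both maps agree contain S and are closed under all rules.
  Agreement on colours comes from agreement on the cells that carry them.\<close>

theorem GO_unique:
 assumes N: "ctob N" and f: "ctm GO N f h" and f': "ctm GO N f' h'"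
  and e: "!!n phi. phi \<in> S n ==> f n (en phi) = f' n (en phi)" and z: "z \<in> tcell GO n"
 shows "f n z = f' n z"
proof -
 note Np = ctobD(3)[OF N] and Nc = ctobD(4)[OF N]
 have G: "constant_ograph (base GO)" unfolding GO_simps by (rule Gb_const)
 have fo: "ograph_map Gt (tot N) f" "ograph_map Gt (tot N) f'"
  using ptmD(1)[OF ctmD(2)[OF f]] ptmD(1)[OF ctmD(2)[OF f']] unfolding GO_simps by auto
 have "f n (en phi) = f' n (en phi)" if "CL n phi" for n phi
  using that
 proof (induction rule: Cl.induct)
  case (gen phi n)
  thus ?case by (rule e)
 next
  case (src n phi)
  have z: "en phi \<in> cell Gt (Suc n)" using Gt_en[OF src.hyps] .
  have e: "en (\<lambda>i\<in>I. src (tot (M i)) n (phi i)) = src Gt n (en phi)" unfolding Gt_def by (simp add: de_en[OF src.hyps])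
  show ?case unfolding e using omap_src[OF fo(1) z] omap_src[OF fo(2) z] src.IH by simp
 next
  case (tgt n phi)
  have z: "en phi \<in> cell Gt (Suc n)" using Gt_en[OF tgt.hyps] .
  have e: "en (\<lambda>i\<in>I. tgt (tot (M i)) n (phi i)) = tgt Gt n (en phi)" unfolding Gt_def by (simp add: de_en[OF tgt.hyps])
  show ?case unfolding e using omap_tgt[OF fo(1) z] omap_tgt[OF fo(2) z] tgt.IH by simp
 next
  case (out n phi m)
  have z: "en phi \<in> cell Gt n" using Gt_en[OF out.hyps] .
  have z': "en phi \<in> tcell GO n" using z unfolding GO_simps .
  have g: "eout 0 n (en phi) \<in> gcell GO m" "eout 0 n (en phi) \<in> gcell GO 0"
   unfolding GO_simps using eout_base[OF z] by auto
  have e: "en (\<lambda>i\<in>I. pt (M i) m (cmap (M i) n (phi i))) = pt GO m (eout 0 n (en phi))"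
   unfolding GO_simps eout_def[of m 0]
   by (rule arg_cong[where f = en])
    (use hh_eout[OF z] in \<open>auto intro!: restrict_ext simp: hh_def de_en[OF out.hyps]\<close>)
  have "h m (eout 0 n (en phi)) = cmap N n (f n (en phi))" "h' m (eout 0 n (en phi)) = cmap N n (f' n (en phi))"
   using ptm_cmap[OF GO_ptgraph G Nc ctmD(2)[OF f] z'] ptm_cmap[OF GO_ptgraph G Nc ctmD(2)[OF f'] z']
    const_map[OF G Nc ptmD(2)[OF ctmD(2)[OF f]] g(2), of m] const_map[OF G Nc ptmD(2)[OF ctmD(2)[OF f']] g(2), of m]
   unfolding GO_simps by simp_all
  thus ?case unfolding e using ptmD(5)[OF ctmD(2)[OF f] g(1)] ptmD(5)[OF ctmD(2)[OF f'] g(1)] out.IH by simp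
 next
  case (inn n phi m)
  have z: "en phi \<in> cell Gt n" using Gt_en[OF inn.hyps] .
  have z': "en phi \<in> tcell GO n" using z unfolding GO_simps .
  have g: "einn 0 n (en phi) \<in> gcell GO m" "einn 0 n (en phi) \<in> gcell GO 0"
   unfolding GO_simps using einn_base[OF z] by auto
  have e: "en (\<lambda>i\<in>I. pt (M i) m (incol (M i) n (phi i))) = pt GO m (einn 0 n (en phi))"
   unfolding GO_simps eout_def[of m 0]
   by (rule arg_cong[where f = en])
    (use hh_einn[OF z] in \<open>auto intro!: restrict_ext simp: hh_def de_en[OF inn.hyps]\<close>)
  have "h m (einn 0 n (en phi)) = incol N n (f n (en phi))" "h' m (einn 0 n (en phi)) = incol N n (f' n (en phi))"
   using ptm_incol[OF GO_ptgraph G Nc ctmD(2)[OF f] z'] ptm_incol[OF GO_ptgraph G Nc ctmD(2)[OF f'] z']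
    const_map[OF G Nc ptmD(2)[OF ctmD(2)[OF f]] g(2), of m] const_map[OF G Nc ptmD(2)[OF ctmD(2)[OF f']] g(2), of m]
   unfolding GO_d(4)[OF z] by simp_all
  thus ?case unfolding e using ptmD(5)[OF ctmD(2)[OF f] g(1)] ptmD(5)[OF ctmD(2)[OF f'] g(1)] inn.IH by simp
 next
  case (mul n t phi)
  have t: "teq PG n t t" using mul.IH(1) unfolding wfprod_def by (rule teq_prodg_mono[rotated]) auto
  have tg: "teq Gt n (tmap (%_. en) t) (tmap (%_. en) t)" using teq_tmap[OF PG_ograph Gt_ograph en_map t] .
  note p = GO_pb[OF t mul.hyps(2,3)]
  have "tmap (%k psi. f k (en psi)) t = tmap (%k psi. f' k (en psi)) t" by (rule tmap_leaf_cong) (rule mul.IH(2))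
  hence "T_map (tot N) f n (cl Gt n (tmap (%_. en) t)) = T_map (tot N) f' n (cl Gt n (tmap (%_. en) t))"
   unfolding T_map_cl[OF Gt_ograph pgD(2)[OF Np] fo(1) tg] T_map_cl[OF Gt_ograph pgD(2)[OF Np] fo(2) tg] tmap_tmap by simp
  hence "f n (mul GO n (cl Gt n (tmap (%_. en) t), en phi)) = f' n (mul GO n (cl Gt n (tmap (%_. en) t), en phi))"
   using ctmD(3)[OF f p(1)] ctmD(3)[OF f' p(1)] mul.IH(3) by simp
  moreover have "mul GO n (cl Gt n (tmap (%_. en) t), en phi) = en (\<lambda>i\<in>I. mul (M i) n (tev (M i) i n t, phi i))"
   by (rule GO_pb(2)[OF t mul.hyps(2)]) (rule mul.hyps(3))
  ultimately show ?case by (simp only:)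
 next
  case (con k phi psi)
  have c: "(en phi, en psi) \<in> contractible_pairs GO k" using GO_cpair[OF con.hyps(1,2,3)] .
  have e: "en (\<lambda>i\<in>I. contr (M i) k (phi i) (psi i)) = contr GO k (en phi) (en psi)"
   unfolding GO_simps de_en[OF con.hyps(1)] de_en[OF con.hyps(2)] ..
  show ?case unfolding e using ctmD(4)[OF f c] ctmD(4)[OF f' c] con.IH by simp
 qed
 thus ?thesis using z unfolding GO_simps Gt_cell by metis
qed

end

section \<open>Finite presentations\<close>

text \<open>The equations of a presentation: \<open>v'\<close> is the value at \<open>v\<close> of a unary operation, of multiplication by the term
  \<open>t\<close>, or \<open>v''\<close> is the contraction of \<open>(v, v')\<close>. \<open>AU\<close> also declares \<open>w\<close> to represent the shape of \<open>v\<close>; every variable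
  must be declared in this way. \<open>Out m\<close> and \<open>Inn m\<close> form the unit \<open>m\<close>-cell of the output and input colour.\<close>

datatype uop = Ident | Src | Tgt | Out nat | Inn nat

instance uop :: countable
 by countable_datatype

datatype 'v atom = AU uop nat "unit trm" 'v 'v | AM nat "'v trm" 'v 'v | AC nat 'v 'v 'v

instance atom :: (countable) countable
 by countable_datatype

text \<open>In dimension 0, \<open>Src\<close> and \<open>Tgt\<close> act as the identity, in
  accordance with 0 - 1 = 0. Equations for them can thus be demanded of every variable without a
  case distinction.\<close>

primrec odim :: "uop => nat => nat" where
 "odim Ident n = n"
| "odim Src n = n - 1"
| "odim Tgt n = n - 1"
| "odim (Out m) n = m"
| "odim (Inn m) n = m"

primrec ap :: "('u, 'z) ptgraph_scheme => uop => nat => 'u => 'u" where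
 "ap M Ident n x = x"
| "ap M Src n x = (case n of 0 => x | Suc m => src (tot M) m x)"
| "ap M Tgt n x = (case n of 0 => x | Suc m => tgt (tot M) m x)"
| "ap M (Out m) n x = pt M m (cmap M n x)"
| "ap M (Inn m) n x = pt M m (incol M n x)"

lemma ap_cell:
 assumes M: "is_ptgraph M" "constant_ograph (base M)" and x: "x \<in> tcell M n"
 shows "ap M om n x \<in> tcell M (odim om n)"
proof -
 have b: "g \<in> gcell M 0 ==> pt M m g \<in> tcell M m" for g m
  using pg_cell(3)[OF M(1)] const_cell[OF M(2)] by blast
 show ?thesis
  using x ograph_src[OF pgD(2)[OF M(1)]] ograph_tgt[OF pgD(2)[OF M(1)]] b[OF cmap_cell[OF M x]] b[OF incol_cell[OF M x]]
  by (cases om) (auto split: nat.split)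
qed

lemma ap_map:
 assumes M: "is_ptgraph M" "constant_ograph (base M)" and N: "is_ptgraph N" "constant_ograph (base N)"
  and f: "ptm M N f h" and x: "x \<in> tcell M n"
 shows "f (odim om n) (ap M om n x) = ap N om n (f n x)"
proof -
 have b: "f m (pt M m g) = pt N m (h 0 g)" if "g \<in> gcell M 0" for g m
 proof -
  have g: "g \<in> gcell M m" using that const_cell[OF M(2)] by blast
  show ?thesis using ptmD(5)[OF f g] const_map[OF M(2) N(2) ptmD(2)[OF f] that, of m] by simp
 qed
 note s = omap_src[OF ptmD(1)[OF f]] omap_tgt[OF ptmD(1)[OF f]]
 show ?thesis
 proof (cases om)
  case Src
  thus ?thesis using s(1)[of x "n - 1"] x by (cases n) simp_all
 next
  case Tgt
  thus ?thesis using s(2)[of x "n - 1"] x by (cases n) simp_all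
 next
  case (Out m)
  thus ?thesis using b[OF cmap_cell[OF M x], of m] ptm_cmap[OF M N(2) f x] by simp
 next
  case (Inn m)
  thus ?thesis using b[OF incol_cell[OF M x], of m] ptm_incol[OF M N(2) f x] by simp
 qed simp
qed

text \<open>Assignments depend on the dimension, so one name may serve as a variable in several
  dimensions; this is the case when the cells of an object are their own variables. The side
  conditions of partial operations are part of the equation.\<close>

primrec holds :: "'u ctcat => (nat => 'v => 'u) => 'v atom => bool" where
 "holds M a (AU om n w v v') \<longleftrightarrow> a n v \<in> tcell M n \<and> shape M n (a n v) = cl uno n w \<and> a (odim om n) v' = ap M om n (a n v)"
| "holds M a (AM n t v v') \<longleftrightarrow> (cl (tot M) n (tmap a t), a n v) \<in> pcell M n \<and> a n v' = mul M n (cl (tot M) n (tmap a t), a n v)"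
| "holds M a (AC k v v' v'') \<longleftrightarrow> (a k v, a k v') \<in> contractible_pairs M k \<and> a (Suc k) v'' = contr M k (a k v) (a k v')"

primrec av :: "'v atom => (nat \<times> 'v) set" where
 "av (AU om n w v v') = {(n, v), (odim om n, v')}"
| "av (AM n t v v') = tlv t \<union> {(n, v), (n, v')}"
| "av (AC k v v' v'') = {(k, v), (k, v'), (Suc k, v'')}"

lemma finite_av: "finite (av al)"
 by (cases al) (auto simp: finite_tlv)

lemma finite_set_atom: "finite (set_atom al)"
 by (cases al) (auto simp: set_trm_tlv finite_tlv)

lemma av_map: "av (map_atom rho al) = (%(n, v). (n, rho v)) ` av al"
 by (cases al) (auto simp: map_trm_tmap tlv_tmap)

lemma av_set: "snd ` av al = set_atom al"
 by (cases al) (auto simp: set_trm_tlv)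

lemma holds_cong: "(!!n v. (n, v) \<in> av al ==> a n v = b n v) ==> holds M a al = holds M b al"
proof (induction al)
 case (AM n t v v')
 hence "tmap a t = tmap b t" by (intro tmap_leaf_cong) auto
 thus ?case using AM by simp
qed auto

lemma holds_map: "holds M a (map_atom rho al) \<longleftrightarrow> holds M (%n v. a n (rho v)) al"
 by (cases al) (simp_all add: map_trm_tmap tmap_tmap)

lemma holds_cell:
 assumes M: "ctob M" and h: "holds M a al" and v: "(n, v) \<in> av al"
 shows "a n v \<in> tcell M n"
proof (cases al)
 case (AU om m w y y')
 thus ?thesis using h v ap_cell[OF ctobD(3,4)[OF M]] by auto
next
 case (AM m t y y')
 note o = pgD(2)[OF ctobD(3)[OF M]]
 have p: "(cl (tot M) m (tmap a t), a m y) \<in> pcell M m" using h AM by simp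
 have "teq (tot M) m (tmap a t) (tmap a t)" using p cl_wf unfolding pb_iff by blast
 hence "a i z \<in> tcell M i" if "(i, z) \<in> tlv t" for i z
  using teq_leaf[OF o, of m "tmap a t" i "a i z"] rev_image_eqI[OF that, of "(i, a i z)" "%(k, x). (k, a k x)"] unfolding tlv_tmap by simp
 thus ?thesis using h v AM p ctobD(9)[OF M p] unfolding pb_iff by auto
next
 case (AC k y y' y'')
 thus ?thesis using h v ctobD(5)[OF M] contractible_cells by fastforce
qed

text \<open>Equations and their side conditions are positive and go along with morphisms,
  contractibility of pairs included by \<open>contractible_push\<close>.\<close>

lemma holds_push:
 assumes M: "ctob M" and N: "ctob N" and f: "ctm M N f h" and al: "holds M a al"
 shows "holds N (%n v. f n (a n v)) al"
proof (cases al)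
 case (AU om n w v v')
 note p = ctobD(3,4)[OF M] ctobD(3,4)[OF N] ctmD(2)[OF f]
 have v: "a n v \<in> tcell M n" using AU al by simp
 thus ?thesis using AU al ap_map[OF p v] ptm_shape[OF p(1,3,5) v] omap_cell[OF ptmD(1)[OF p(5)] v] by simp
next
 case (AM n t v v')
 have p: "(cl (tot M) n (tmap a t), a n v) \<in> pcell M n" using al AM by simp
 have t: "teq (tot M) n (tmap a t) (tmap a t)" using p cl_wf unfolding pb_iff by blast
 have "T_map (tot N) f n (cl (tot M) n (tmap a t)) = cl (tot N) n (tmap (%n v. f n (a n v)) t)"
  using T_map_cl[OF pgD(2)[OF ctobD(3)[OF M]] pgD(2)[OF ctobD(3)[OF N]] ptmD(1)[OF ctmD(2)[OF f]] t] by (simp add: tmap_tmap)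
 thus ?thesis using AM al ctmD(3)[OF f p] pb_map_cell[OF ctobD(3)[OF M] ctobD(3)[OF N] ctmD(2)[OF f] p] by simp
next
 case (AC k v v' v'')
 thus ?thesis
  using al ctmD(4)[OF f] contractible_push[OF ctobD(3,4)[OF M] ctobD(3,4)[OF N] ctmD(2)[OF f]] by simp
qed

definition agree :: "('u, 'z) tgraph_scheme => (nat => 'u => 'v) => (nat => 'u => 'v) => bool" where
 "agree C f g == (\<forall>n. \<forall>x\<in>tcell C n. f n x = g n x)"

definition decl :: "'v atom set => (nat \<times> 'v) set" where
 "decl R = {(n, v) | om n w v v'. AU om n w v v' \<in> R}"

definition pres :: "'v atom set => bool" where
 "pres R == (\<forall>al\<in>R. av al \<subseteq> decl R)"

text \<open>Q represents the functor sending M to the set of solutions of R in M, and u is the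
  universal solution.\<close>

definition represents :: "'v atom set => 'u ctcat => (nat => 'v => 'u) => bool" where
 "represents R Q u == pres R \<and> ctob Q \<and> (\<forall>al\<in>R. holds Q u al) \<and>
   (\<forall>M a. ctob M --> (\<forall>al\<in>R. holds M a al) --> (\<exists>f h. ctm Q M f h \<and> (\<forall>(n, v)\<in>decl R. f n (u n v) = a n v))) \<and>
   (\<forall>M f h f' h'. ctob M --> ctm Q M f h --> ctm Q M f' h' --> (\<forall>(n, v)\<in>decl R. f n (u n v) = f' n (u n v)) --> agree Q f f')"

lemma decl_av: "decl R \<subseteq> \<Union> (av ` R)"
 by (auto simp: decl_def intro!: bexI)

lemma finite_decl: "finite R ==> finite (decl R)"
 using finite_subset[OF decl_av] finite_av by blast

lemma decl_map: "decl (map_atom rho ` R) = (%(n, v). (n, rho v)) ` decl R"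
proof -
 have "(n, v) \<in> decl (map_atom rho ` R) ==> (n, v) \<in> (%(n, v). (n, rho v)) ` decl R" for n v
 proof -
  assume "(n, v) \<in> decl (map_atom rho ` R)"
  then obtain om w v' where "AU om n w v v' \<in> map_atom rho ` R" unfolding decl_def by blast
  then obtain al where "map_atom rho al = AU om n w v v'" "al \<in> R" by (metis imageE)
  then obtain y y' where y: "AU om n w y y' \<in> R" "v = rho y" by (cases al) auto
  hence "(n, y) \<in> decl R" unfolding decl_def by blast
  thus ?thesis using y(2) by (auto intro!: rev_image_eqI)
 qed
 moreover have "(n, v) \<in> decl R ==> (n, rho v) \<in> decl (map_atom rho ` R)" for n v
 proof -
  assume "(n, v) \<in> decl R"
  then obtain om w v' where y: "AU om n w v v' \<in> R" unfolding decl_def by blast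
  show ?thesis using imageI[OF y, of "map_atom rho"] unfolding decl_def by auto
 qed
 ultimately show ?thesis by auto
qed

text \<open>An injective renaming gives a bijection between solutions of R and of its image. It is
  used to pass to variables in the natural numbers and back.\<close>

lemma represents_rename:
 assumes rho: "inj_on rho (\<Union> (set_atom ` R))" and r: "represents (map_atom rho ` R) Q u"
 shows "represents R Q (%n v. u n (rho v))"
proof -
 let ?V = "\<Union> (set_atom ` R)" and ?R = "map_atom rho ` R"
 have dV: "v \<in> ?V" if "(n, v) \<in> decl R" for n v using that unfolding decl_def by force
 have aV: "av al \<subseteq> decl R" if al: "al \<in> R" for al
 proof (clarify)
  fix n v assume v: "(n, v) \<in> av al"
  hence "(n, rho v) \<in> decl ?R" using r al av_map[of rho al] unfolding represents_def pres_def by fastforce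
  then obtain v' where v': "(n, v') \<in> decl R" "rho v = rho v'" unfolding decl_map by auto
  moreover have "v \<in> ?V" using v al av_set[of al] by force
  ultimately show "(n, v) \<in> decl R" using inj_onD[OF rho _ _ dV[OF v'(1)]] by metis
 qed
 have p: "pres R" using aV unfolding pres_def by blast
 have ex: "\<exists>f h. ctm Q M f h \<and> (\<forall>(n, v)\<in>decl R. f n (u n (rho v)) = a n v)" if M: "ctob M" and a: "\<forall>al\<in>R. holds M a al" for M a
 proof -
  \<comment> \<open>A solution of R read along the inverse of the renaming; it is only evaluated at
    images of declared variables.\<close>
  define a' where "a' n k = a n (inv_into ?V rho k)" for n k
  have e: "a' n (rho v) = a n v" if "(n, v) \<in> decl R" for n v unfolding a'_def inv_into_f_f[OF rho dV[OF that]] ..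
  have "holds M a' (map_atom rho al)" if al: "al \<in> R" for al
  proof -
   have "holds M a al = holds M (%n v. a' n (rho v)) al" by (rule holds_cong) (use e aV[OF al] in auto)
   thus ?thesis unfolding holds_map using a al by blast
  qed
  hence "\<forall>al\<in>?R. holds M a' al" by blast
  then obtain f h where f: "ctm Q M f h" "\<forall>(n, v)\<in>decl ?R. f n (u n v) = a' n v" using r M unfolding represents_def by meson
  hence "f n (u n (rho v)) = a n v" if "(n, v) \<in> decl R" for n v using that e[OF that] unfolding decl_map by fastforce
  thus ?thesis using f(1) by blast
 qed
 have "agree Q f f'" if "ctob M" "ctm Q M f h" "ctm Q M f' h'" and e: "\<forall>(n, v)\<in>decl R. f n (u n (rho v)) = f' n (u n (rho v))" for M f h f' h'
 proof -
  have "\<forall>(n, v)\<in>decl ?R. f n (u n v) = f' n (u n v)" unfolding decl_map using e by fastforce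
  thus ?thesis using r that(1-3) unfolding represents_def by blast
 qed
 moreover have "ctob Q" "\<forall>al\<in>R. holds Q (%n v. u n (rho v)) al" using r unfolding represents_def by (simp_all add: holds_map)
 ultimately show ?thesis unfolding represents_def using p ex by blast
qed

context universe
begin

text \<open>The index set I consists of all solutions in all objects, so the morphism belonging to a
  solution is a projection and uniqueness is generation. \<open>M0\<close> keeps I nonempty. The
  graph \<open>Og\<close> of variables ensures that terms in multiplication equations are well
  formed among the generated tuples.\<close>

theorem represents_exists:
 fixes R :: "'v atom set" and M0 :: "'u ctcat"
 assumes R: "pres R" and Rs: "sm R" and M0: "ctob M0" "\<forall>al\<in>R. holds M0 a0 al" and Og: "is_ograph Og"
  and Oc: "!!n v. v \<in> cell Og n ==> (n, v) \<in> decl R"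
  and Os: "!!n v. v \<in> cell Og (Suc n) ==> \<exists>w. AU Src (Suc n) w v (src Og n v) \<in> R"
  and Ot: "!!n v. v \<in> cell Og (Suc n) ==> \<exists>w. AU Tgt (Suc n) w v (tgt Og n v) \<in> R"
  and Om: "!!n t v v'. AM n t v v' \<in> R ==> teq Og n t t"
 shows "\<exists>(Q :: 'u ctcat) u. represents R Q u"
proof -
 define I where "I = {(M :: 'u ctcat, a). ctob M \<and> (\<forall>al\<in>R. holds M a al)}"
 define phi where "phi n v = restrict (%(M, a). a n v) I" for n v
 define S where "S n = {phi n v | v. (n, v) \<in> decl R}" for n
 have Ih: "ctob (fst i)" "al \<in> R ==> holds (fst i) (snd i) al" if "i \<in> I" for i al using that unfolding I_def by auto
 have phii: "phi n v i = snd i n v" if "i \<in> I" for n v i using that unfolding phi_def by (simp add: case_prod_beta)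
 have ne: "I \<noteq> {}" using M0 unfolding I_def by blast
 have dec: "snd i n v \<in> tcell (fst i) n \<and> (\<exists>w. \<forall>j\<in>I. shape (fst j) n (snd j n v) = cl uno n w)" if i: "i \<in> I" and "(n, v) \<in> decl R" for i n v
 proof -
  obtain om w v' where "AU om n w v v' \<in> R" using \<open>(n, v) \<in> decl R\<close> unfolding decl_def by blast
  thus ?thesis using Ih(2) i by fastforce
 qed
 have dsm: "sm (decl R)" by (rule sm_subset[OF sm_UN[OF Rs] decl_av]) (rule sm_finite[OF finite_av])
 have "S n \<subseteq> (%(m, v). phi m v) ` decl R" for n unfolding S_def by force
 hence Ss: "sm (S n)" for n by (rule sm_subset[OF sm_image[OF dsm]])
 interpret g: gen_object U I fst S
 proof (unfold_locales)
  show "phi' i \<in> tcell (fst i) n" if "phi' \<in> S n" "i \<in> I" for n phi' i using that dec phii unfolding S_def by fastforce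
  show "phi' \<in> extensional I" if "phi' \<in> S n" for n phi' using that unfolding S_def phi_def by auto
  show "shape (fst i) n (phi' i) = shape (fst j) n (phi' j)" if phi': "phi' \<in> S n" and ij: "i \<in> I" "j \<in> I" for n phi' i j
  proof -
   obtain v where v: "(n, v) \<in> decl R" "phi' = phi n v" using phi' unfolding S_def by blast
   thus ?thesis using dec[OF ij(1) v(1)] ij phii by auto
  qed
  show "small U (S n)" for n by (rule Ss)
 qed (use ne Ih in auto)
 define u where "u n v = g.en (phi n v)" for n v
 have phiS: "phi n v \<in> S n" if "(n, v) \<in> decl R" for n v using that unfolding S_def by blast
 have uc: "u n v \<in> cell (tot g.GO) n" and ue: "i \<in> I ==> g.ee i n (u n v) = snd i n v" if "(n, v) \<in> decl R" for n v i
  using g.GO_gen[OF phiS[OF that]] phii unfolding u_def by auto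
 have uCl: "Cl I fst S n (phi n v)" if "(n, v) \<in> decl R" for n v
  using uc[OF that] g.de_en g.GO_gen(1)[OF phiS[OF that]] phiS[OF that] by (auto intro: Cl.intros)
 have avd: "av al \<subseteq> decl R" if "al \<in> R" for al using that R unfolding pres_def by blast
 note Gp = g.GO_ptgraph g.Gb_const[folded g.GO_simps(1)]
 note ip = ctobD(3,4)[OF Ih(1)]
 have U: "holds g.GO u al" if al: "al \<in> R" and eq: "al = AU om n w v v'" for al om n w v v'
 proof -
  have d: "(n, v) \<in> decl R" "(odim om n, v') \<in> decl R" using avd[OF al] eq by auto
  note c = uc[OF d(1)] uc[OF d(2)]
  have "u (odim om n) v' = ap g.GO om n (u n v)"
  proof (rule g.ee_inj[of _ "odim om n" _ "odim om n"])
   show "u (odim om n) v' \<in> cell g.Gt (odim om n)" using c(2) unfolding g.GO_simps .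
   show "ap g.GO om n (u n v) \<in> cell g.Gt (odim om n)" using ap_cell[OF Gp c(1)] unfolding g.GO_simps .
   fix i assume i: "i \<in> I"
   thus "g.ee i (odim om n) (u (odim om n) v') = g.ee i (odim om n) (ap g.GO om n (u n v))"
    using ue[OF d(1) i] ue[OF d(2) i] ap_map[OF Gp ip[OF i] g.GO_ptm[OF i] c(1), of om] Ih(2)[OF i al] eq by simp
  qed
  moreover obtain i where i: "i \<in> I" using ne by blast
  ultimately show ?thesis
   using c ue[OF d(1) i] ptm_shape[OF Gp(1) ip(1)[OF i] g.GO_ptm[OF i] c(1)] Ih(2)[OF i al] eq by simp
 qed
 \<comment> \<open>Has to come between the unary equations and the multiplicative ones: the former
   say that u respects faces, and only along a map of omega-graphs can well-formedness be carried
   from \<open>Og\<close> into the generated object.\<close>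
 have Ou: "ograph_map Og (tot g.GO) u" unfolding ograph_map_def
 proof (intro conjI allI ballI)
  show "v \<in> cell Og n ==> u n v \<in> cell (tot g.GO) n" for n v by (rule uc[OF Oc])
  fix n v assume v: "v \<in> cell Og (Suc n)"
  show "u n (src Og n v) = src (tot g.GO) n (u (Suc n) v)" using U[OF _ refl] Os[OF v] by fastforce
  show "u n (tgt Og n v) = tgt (tot g.GO) n (u (Suc n) v)" using U[OF _ refl] Ot[OF v] by fastforce
 qed
 have M: "holds g.GO u al" if al: "al \<in> R" and eq: "al = AM n t v v'" for al n t v v'
 proof -
  have d: "(n, v) \<in> decl R" "(n, v') \<in> decl R" "tlv t \<subseteq> decl R" using avd[OF al] eq by auto
  let ?t = "tmap (%n v. g.de (u n v)) t"
  have t: "teq (prodg I fst (Cl I fst S)) n ?t ?t"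
   using teq_tmap[OF Og g.PG_ograph ograph_map_comp[OF Ou[unfolded g.GO_simps(2)] g.de_map]] Om al eq by blast
  have deu: "g.de (u k x) = phi k x" if "(k, x) \<in> decl R" for k x unfolding u_def by (rule g.de_en[OF uCl[OF that]])
  have e1: "tmap (%_. g.en) ?t = tmap u t" unfolding tmap_tmap
   by (rule tmap_leaf_cong) (use d(3) deu in \<open>auto simp: u_def\<close>)
  have e2: "tev (fst i) i n ?t = cl (tot (fst i)) n (tmap (snd i) t)" if i: "i \<in> I" for i
  proof -
   have "tmap (%_ psi. psi i) ?t = tmap (snd i) t" unfolding tmap_tmap
    by (rule tmap_leaf_cong) (use d(3) deu phii[OF i] in auto)
   thus ?thesis unfolding tev_def by simp
  qed
  have tv: "(tev (fst i) i n ?t, phi n v i) \<in> pcell (fst i) n" if i: "i \<in> I" for i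
   using Ih(2)[OF i al] eq e2[OF i] phii[OF i] by simp
  have pb: "(cl g.Gt n (tmap u t), u n v) \<in> cell (pullback g.GO) n"
   by (rule g.GO_pb[OF t uCl[OF d(1)], unfolded e1, folded u_def]) (rule tv)
  have "u n v' = mul g.GO n (cl g.Gt n (tmap u t), u n v)"
  proof (rule g.ee_inj[of _ n _ n])
   show "u n v' \<in> cell g.Gt n" using uc[OF d(2)] unfolding g.GO_simps .
   show "mul g.GO n (cl g.Gt n (tmap u t), u n v) \<in> cell g.Gt n" using ctobD(9)[OF g.GO_object pb] unfolding g.GO_simps .
   fix i assume i: "i \<in> I"
   show "g.ee i n (u n v') = g.ee i n (mul g.GO n (cl g.Gt n (tmap u t), u n v))"
    using ctmD(3)[OF g.GO_proj[OF i] pb] g.GO_tev[OF t i, unfolded e1] e2[OF i] ue[OF d(1) i] ue[OF d(2) i] Ih(2)[OF i al] eq by simp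
  qed
  thus ?thesis using pb eq by (simp add: g.GO_simps)
 qed
 have C: "holds g.GO u al" if al: "al \<in> R" and eq: "al = AC k v v' v''" for al k v v' v''
 proof -
  have d: "(k, v) \<in> decl R" "(k, v') \<in> decl R" "(Suc k, v'') \<in> decl R" using avd[OF al] eq by auto
  have cv: "(phi k v i, phi k v' i) \<in> contractible_pairs (fst i) k" if i: "i \<in> I" for i using Ih(2)[OF i al] eq phii[OF i] by simp
  have cp: "(u k v, u k v') \<in> contractible_pairs g.GO k"
   by (rule g.GO_cpair[OF uCl[OF d(1)] uCl[OF d(2)], folded u_def]) (rule cv)
  have "u (Suc k) v'' = contr g.GO k (u k v) (u k v')"
  proof (rule g.ee_inj[of _ "Suc k" _ "Suc k"])
   show "u (Suc k) v'' \<in> cell g.Gt (Suc k)" using uc[OF d(3)] unfolding g.GO_simps .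
   show "contr g.GO k (u k v) (u k v') \<in> cell g.Gt (Suc k)" using ctobD(5)[OF g.GO_object cp] unfolding g.GO_simps .
   fix i assume i: "i \<in> I"
   show "g.ee i (Suc k) (u (Suc k) v'') = g.ee i (Suc k) (contr g.GO k (u k v) (u k v'))"
    using ctmD(4)[OF g.GO_proj[OF i] cp] ue[OF d(1) i] ue[OF d(2) i] ue[OF d(3) i] Ih(2)[OF i al] eq by simp
  qed
  thus ?thesis using cp eq by simp
 qed
 have "holds g.GO u al" if "al \<in> R" for al using U[OF that] M[OF that] C[OF that] by (cases al) auto
 moreover have "\<exists>f h. ctm g.GO N f h \<and> (\<forall>(n, v)\<in>decl R. f n (u n v) = a n v)" if "ctob N" "\<forall>al\<in>R. holds N a al" for N a
 proof -
  have i: "(N, a) \<in> I" using that unfolding I_def by simp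
  show ?thesis using g.GO_proj[OF i] ue[OF _ i] by (intro exI[of _ "g.ee (N, a)"] exI[of _ "g.hh (N, a)"]) auto
 qed
 moreover have "agree g.GO f f'" if N: "ctob N" and f: "ctm g.GO N f h" "ctm g.GO N f' h'"
  and e: "\<forall>(n, v)\<in>decl R. f n (u n v) = f' n (u n v)" for N f h f' h'
 proof -
  have "f n (g.en psi) = f' n (g.en psi)" if "psi \<in> S n" for n psi using that e unfolding S_def u_def by blast
  thus ?thesis unfolding agree_def using g.GO_unique[OF N f] by blast
 qed
 ultimately have "represents R g.GO u" unfolding represents_def using R g.GO_object by blast
 thus ?thesis by blast
qed

end

text \<open>A map of cells that keeps shapes and the unary operations has a base component: send a
  colour to the output colour of the image of its unit. Compatibility with d is checked on shape and
  colour.\<close>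

lemma ap_imp_ptm:
 fixes x :: "('u, 'y) ptgraph_scheme" and y :: "('u, 'z) ptgraph_scheme"
 assumes px: "is_ptgraph x" "constant_ograph (base x)" and py: "is_ptgraph y" "constant_ograph (base y)"
  and A: "!!om n v. v \<in> tcell x n ==> f n v \<in> tcell y n \<and> shape y n (f n v) = shape x n v \<and>
   f (odim om n) (ap x om n v) = ap y om n (f n v)"
 shows "ptm x y f (%n g. cmap y n (f n (pt x n g)))"
proof -
 let ?h = "%n g. cmap y n (f n (pt x n g))"
 have f: "ograph_map (tot x) (tot y) f" unfolding ograph_map_def
  using A[of _ _ Ident] A[of _ "Suc _" Src] A[of _ "Suc _" Tgt] by simp
 note ptx = pg_cell(3)[OF px(1)]
 have h: "ograph_map (base x) (base y) ?h" unfolding ograph_map_def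
 proof (intro conjI allI ballI)
  fix n g assume g: "g \<in> gcell x n"
  show "?h n g \<in> gcell y n" using pg_cell(2)[OF py(1) omap_cell[OF f ptx[OF g]]] .
 next
  fix n g assume g: "g \<in> gcell x (Suc n)"
  note p = ptx[OF g]
  show "?h n (src (base x) n g) = src (base y) n (?h (Suc n) g)" "?h n (tgt (base x) n g) = tgt (base y) n (?h (Suc n) g)"
   unfolding omap_src[OF pgD(5)[OF px(1)] g] omap_tgt[OF pgD(5)[OF px(1)] g] omap_src[OF f p] omap_tgt[OF f p]
   using omap_src[OF pgD(4)[OF py(1)] omap_cell[OF f p]] omap_tgt[OF pgD(4)[OF py(1)] omap_cell[OF f p]] by simp_all
 qed
 have d: "dmap y n (f n v) = T_map (base y) ?h n (dmap x n v)" if v: "v \<in> tcell x n" for n v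
 proof (rule const_ext[OF py(2), of _ n])
  note dx = pg_cell(1)[OF px(1) v] and dy = pg_cell(1)[OF py(1) omap_cell[OF f v]]
  show "dmap y n (f n v) \<in> Tcell (base y) n" by (rule dy)
  show "T_map (base y) ?h n (dmap x n v) \<in> Tcell (base y) n"
   by (rule T_map_cell[OF pgD(1)[OF px(1)] pgD(1)[OF py(1)] h dx])
  show "shp n (dmap y n (f n v)) = shp n (T_map (base y) ?h n (dmap x n v))"
   using A[OF v] shp_map[OF pgD(1)[OF px(1)] pgD(1)[OF py(1)] h dx] unfolding shape_def by simp
  \<comment> \<open>\<open>Inn 0\<close> produces the unit 0-cell of the input colour; its output
    colour gives the input colour back.\<close>
  have "cmap y 0 (pt y 0 (incol y n (f n v))) = incol y n (f n v)"
   using pgD(7)[OF py(1) incol_cell[OF py omap_cell[OF f v]]] .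
  thus "tcol (dmap y n (f n v)) = tcol (T_map (base y) ?h n (dmap x n v))"
   using A[OF v, of "Inn 0"] tcol_map[OF px(2) py(2) h dx] by (simp add: incol_def)
 qed
 have c: "cmap y n (f n v) = ?h n (cmap x n v)" if v: "v \<in> tcell x n" for n v
  using A[OF v, of "Out n"] pgD(7)[OF py(1) pg_cell(2)[OF py(1) omap_cell[OF f v]]] by simp
 have p: "f n (pt x n g) = pt y n (?h n g)" if g: "g \<in> gcell x n" for n g
  using A[OF ptx[OF g], of "Out n"] pgD(7)[OF px(1) g] by simp
 show ?thesis unfolding ptm_def using f h d c p by blast
qed

text \<open>The tautological presentation of x: its cells are the variables and all true equations
  the relations. Solutions in y are morphisms from x to y, by \<open>holds_imp_ctm\<close> and
  \<open>holds_push\<close>.\<close>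

definition tru :: "'u ctcat => 'u atom set" where
 "tru x = {al. holds x (%_ v. v) al}"

lemma cl_some: "K \<in> Tcell X n ==> cl X n (SOME t. t \<in> K) = K"
 using T_cell_rep[of K X n "SOME t. t \<in> K"] T_cell_some[of K X n] by simp

definition AUs :: "('u, 'z) ptgraph_scheme => uop => nat => 'u => 'u atom" where
 "AUs x om n v = AU om n (SOME t. t \<in> shape x n v) v (ap x om n v)"

lemma holds_AUs:
 assumes "is_ptgraph x" "v \<in> tcell x n"
 shows "holds M a (AUs x om n v) \<longleftrightarrow> a n v \<in> tcell M n \<and> shape M n (a n v) = shape x n v \<and>
  a (odim om n) (ap x om n v) = ap M om n (a n v)"
 unfolding AUs_def by (simp add: assms cl_some[OF shape_cell[OF assms]])

lemma AUs_tru: "is_ptgraph x ==> v \<in> tcell x n ==> AUs x om n v \<in> tru x"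
 unfolding tru_def mem_Collect_eq by (subst holds_AUs) auto

lemma holds_imp_ctm:
 assumes x: "ctob x" and y: "ctob y" and H: "!!al. al \<in> tru x ==> holds y f al"
 shows "ctm x y f (%n g. cmap y n (f n (pt x n g)))"
proof -
 note px = ctobD(3,4)[OF x] and py = ctobD(3,4)[OF y]
 note ox = pgD(2)[OF px(1)] and oy = pgD(2)[OF py(1)]
 have "holds y f (AUs x om n v)" if "v \<in> tcell x n" for om n v
  by (rule H[OF AUs_tru[OF px(1) that]])
 hence P: "ptm x y f (%n g. cmap y n (f n (pt x n g)))"
  using holds_AUs[OF px(1)] by (intro ap_imp_ptm[OF px py]) blast
 note f = ptmD(1)[OF P]
 have "f n (mul x n (K, v)) = mul y n (T_map (tot y) f n K, f n v)" if k: "(K, v) \<in> pcell x n" for n K v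
 proof -
  obtain t where t: "teq (tot x) n t t" "K = cl (tot x) n t" using k T_cellE unfolding pb_iff by metis
  have "holds y f (AM n t v (mul x n (K, v)))" by (rule H) (use k t tmap_ident[of t "%_ v. v"] in \<open>simp add: tru_def\<close>)
  thus ?thesis using T_map_cl[OF ox oy f t(1)] t(2) by simp
 qed
 moreover have "f (Suc k) (contr x k v v') = contr y k (f k v) (f k v')" if "(v, v') \<in> contractible_pairs x k" for k v v'
  using H[of "AC k v v' (contr x k v v')"] that by (simp add: tru_def)
 ultimately show ?thesis unfolding ctm_def mulm_def using P by blast
qed

context universe
begin

lemma cells_small: "is_ptgraph (x :: ('u, 'z) ptgraph_scheme) ==> sm (\<Union>n. tcell x n)"
 unfolding is_ptgraph_def is_tgraph_def by (intro sm_UN sm_countable[OF countableI_type]) (simp add: sm_iff)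

text \<open>As for names of tuples: an equation is one of countably many skeletons with a finite
  list of variables.\<close>

lemma sm_atoms:
 assumes A: "sm A"
 shows "sm {al. set_atom al \<subseteq> A}"
proof (rule sm_subset[OF sm_image[OF sm_Times[OF sm_countable[OF countableI_type] sm_lists[OF A]]]])
 show "{al. set_atom al \<subseteq> A} \<subseteq> (%(s, xs). map_atom (nth xs) s) ` ((UNIV :: nat atom set) \<times> lists A)"
 proof
  fix al :: "'a atom" assume A: "al \<in> {al. set_atom al \<subseteq> A}"
  obtain xs where xs: "set xs = set_atom al" using finite_list[OF finite_set_atom[of al]] by blast
  have "\<forall>x\<in>set xs. \<exists>k. xs ! k = x" by (metis in_set_conv_nth)
  from bchoice[OF this] obtain g where "!!x. x \<in> set xs ==> xs ! g x = x" by blast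
  hence "map_atom (nth xs) (map_atom g al) = map_atom (%x. x) al"
   unfolding atom.map_comp xs by (intro atom.map_cong) auto
  thus "al \<in> (%(s, xs). map_atom (nth xs) s) ` ((UNIV :: nat atom set) \<times> lists A)"
   using A xs by (intro image_eqI[of _ _ "(map_atom g al, xs)"]) (auto simp: atom.map_ident)
 qed
qed

lemma tru_set: "ctob x ==> al \<in> tru x ==> set_atom al \<subseteq> (\<Union>n. tcell x n)"
 unfolding tru_def av_set[symmetric] using holds_cell by fastforce

lemma sm_tru: "ctob (x :: 'u ctcat) ==> sm (tru x)"
 by (rule sm_subset[OF sm_atoms[OF cells_small[OF ctobD(3)]]]) (use tru_set in auto)

text \<open>The unary equations true in b form a presentation whose solutions in M are the maps of
  pointed graphs from b to M, so a representing object is free on b.\<close>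

theorem free_exists:
 fixes b :: "'u ptgraph"
 assumes b: "is_ptgraph b" "constant_ograph (base b)"
 shows "\<exists>N eta eta'. ctob N \<and> ptm b N eta eta' \<and>
   (\<forall>M f h. ctob M --> ptm b M f h --> (\<exists>g k. ctm N M g k \<and> agree b (%n x. g n (eta n x)) f)) \<and>
   (\<forall>M g k g' k'. ctob M --> ctm N M g k --> ctm N M g' k' -->
    agree b (%n x. g n (eta n x)) (%n x. g' n (eta n x)) --> agree N g g')"
proof -
 define R where "R = (%(om, n, v). AUs b om n v) ` (UNIV \<times> (SIGMA n:UNIV. tcell b n))"
 have R: "al \<in> R \<longleftrightarrow> (\<exists>om n v. v \<in> tcell b n \<and> al = AUs b om n v)" for al unfolding R_def by force
 have dR: "(n, v) \<in> decl R \<longleftrightarrow> v \<in> tcell b n" for n v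
  unfolding decl_def R AUs_def by auto
 have H: "(\<forall>al\<in>R. holds M f al) \<longleftrightarrow> (\<exists>h. ptm b M f h)" if M: "ctob M" for M f
 proof
  note p = ctobD(3,4)[OF M]
  show "\<exists>h. ptm b M f h" if h: "\<forall>al\<in>R. holds M f al"
  proof -
   have "holds M f (AUs b om n v)" if "v \<in> tcell b n" for om n v using h R that by blast
   hence "ptm b M f (%n g. cmap M n (f n (pt b n g)))" using holds_AUs[OF b(1)] by (intro ap_imp_ptm[OF b p]) blast
   thus ?thesis by blast
  qed
  show "\<forall>al\<in>R. holds M f al" if h: "\<exists>h. ptm b M f h"
  proof
   fix al assume "al \<in> R"
   then obtain om n v where v: "v \<in> tcell b n" "al = AUs b om n v" unfolding R by blast
   obtain h where h: "ptm b M f h" using h by blast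
   show "holds M f al" unfolding v(2) holds_AUs[OF b(1) v(1)]
    using ap_map[OF b p h v(1)] ptm_shape[OF b(1) p(1) h v(1)] omap_cell[OF ptmD(1)[OF h] v(1)] by blast
  qed
 qed
 obtain N :: "'u ctcat" and f h where N: "ctob N" "ptm b N f h" using terminal_exists b by metis
 have "sm (SIGMA n:UNIV. tcell b n)"
  by (rule sm_subset[OF sm_Times[OF sm_countable[OF countableI_type] cells_small[OF b(1)]]]) auto
 hence Rs: "sm R" unfolding R_def by (intro sm_image sm_Times sm_countable[OF countableI_type])
 have pR: "pres R" unfolding pres_def
 proof
  fix al assume "al \<in> R"
  then obtain om n v where "v \<in> tcell b n" "al = AUs b om n v" unfolding R by blast
  thus "av al \<subseteq> decl R" using ap_cell[OF b] unfolding AUs_def by (auto simp: dR simp del: ap.simps odim.simps)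
 qed
 have hN: "\<forall>al\<in>R. holds N f al" using N H[OF N(1)] by blast
 \<comment> \<open>There are no multiplication equations, hence no terms to be kept well formed, and
   the empty graph of variables will do.\<close>
 have "\<exists>(Q :: 'u ctcat) u. represents R Q u"
  by (rule represents_exists[OF pR Rs N(1) hN, of "\<lparr> cell = %_. {}, src = %_ v. v, tgt = %_ v. v \<rparr>"])
   (auto simp: is_ograph_def R AUs_def)
 then obtain Q :: "'u ctcat" and u where Q: "represents R Q u" by blast
 hence cQ: "ctob Q" and hQ: "\<forall>al\<in>R. holds Q u al"
  and ex: "!!M a. ctob M ==> \<forall>al\<in>R. holds M a al ==> \<exists>f h. ctm Q M f h \<and> (\<forall>(n, v)\<in>decl R. f n (u n v) = a n v)"
  and un: "!!M f h f' h'. ctob M ==> ctm Q M f h ==> ctm Q M f' h' ==> \<forall>(n, v)\<in>decl R. f n (u n v) = f' n (u n v) ==> agree Q f f'"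
  unfolding represents_def by blast+
 obtain l where l: "ptm b Q u l" using hQ H[OF cQ] by blast
 have "\<exists>g k. ctm Q M g k \<and> agree b (%n x. g n (u n x)) f" if M: "ctob M" "ptm b M f h" for M f h
 proof -
  obtain g k where g: "ctm Q M g k" "\<forall>(n, v)\<in>decl R. g n (u n v) = f n v" using ex[OF M(1)] H[OF M(1)] M(2) by blast
  have "agree b (%n x. g n (u n x)) f" using g(2) by (auto simp: agree_def dR)
  thus ?thesis using g(1) by blast
 qed
 moreover have "agree Q g g'" if "ctob M" "ctm Q M g k" "ctm Q M g' k'" "agree b (%n x. g n (u n x)) (%n x. g' n (u n x))" for M g k g' k'
  by (rule un[OF that(1-3)]) (use that(4) in \<open>auto simp: agree_def dR\<close>)
 ultimately show ?thesis using cQ l by blast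
qed

text \<open>Diagrams are given by their objects \<open>D j\<close> and a set \<open>R\<close> of transition maps \<open>(j, k, f)\<close>.\<close>

definition cocone :: "'j set => ('j => 'u ctcat) => ('j \<times> 'j \<times> (nat => 'u => 'u)) set => 'u ctcat =>
  ('j => nat => 'u => 'u) => bool" where
 "cocone J D R N ka \<longleftrightarrow> ctob N \<and> (\<forall>j\<in>J. \<exists>l. ctm (D j) N (ka j) l) \<and>
   (\<forall>j k f. (j, k, f) \<in> R --> agree (D j) (%n x. ka k n (f n x)) (ka j))"

text \<open>Cocones are the solutions of the union of the tautological presentations of the
  \<open>D j\<close>, together with equations that identify each cell with its images under the
  transition maps.\<close>

theorem colim_exists:
 fixes D :: "'j => 'u ctcat"
 assumes J: "small U J" and D: "!!j. j \<in> J ==> ctob (D j)"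
  and R: "!!j k f. (j, k, f) \<in> R ==> j \<in> J \<and> k \<in> J \<and> (\<exists>h. ptm (D j) (D k) f h)" and Rs: "small U R"
 shows "\<exists>N io. cocone J D R N io \<and>
   (\<forall>M ka. cocone J D R M ka --> (\<exists>g k. ctm N M g k \<and> (\<forall>j\<in>J. agree (D j) (%n x. g n (io j n x)) (ka j)))) \<and>
   (\<forall>M g k g' k'. ctob M --> ctm N M g k --> ctm N M g' k' -->
    (\<forall>j\<in>J. agree (D j) (%n x. g n (io j n x)) (%n x. g' n (io j n x))) --> agree N g g')"
proof -
 \<comment> \<open>Variables are tagged with j, so the presentations of different objects share
   none; \<open>S2\<close> relates them.\<close>
 define S1 where "S1 = (\<Union>j\<in>J. map_atom (Pair j) ` tru (D j))"
 define S2 where "S2 = (\<Union>(j, k, f)\<in>R. \<Union>n. (%v. AU Ident n (SOME t. t \<in> shape (D j) n v) (j, v) (k, f n v)) ` tcell (D j) n)"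
 define S where "S = S1 \<union> S2"
 have dv: "v \<in> tcell (D j) n" if "j \<in> J" "al \<in> tru (D j)" "(n, v) \<in> av al" for j n v al
  using holds_cell[OF D[OF that(1)], of "%_ v. v" al n v] that(2,3) unfolding tru_def by blast
 have S1: "map_atom (Pair j) al \<in> S" if "j \<in> J" "al \<in> tru (D j)" for j al using that unfolding S_def S1_def by blast
 have S2: "AU Ident n (SOME t. t \<in> shape (D j) n v) (j, v) (k, f n v) \<in> S" if "(j, k, f) \<in> R" "v \<in> tcell (D j) n" for j k f n v
  using that unfolding S_def S2_def by blast
 have SE: P if "al \<in> S" "!!j bet. j \<in> J ==> bet \<in> tru (D j) ==> al = map_atom (Pair j) bet ==> P"
  "!!j k f n v. (j, k, f) \<in> R ==> v \<in> tcell (D j) n ==> al = AU Ident n (SOME t. t \<in> shape (D j) n v) (j, v) (k, f n v) ==> P" for al P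
  using that unfolding S_def S1_def S2_def by blast
 have AUt: "AU om n (SOME t. t \<in> shape (D j) n v) (j, v) (j, ap (D j) om n v) \<in> S" if "j \<in> J" "v \<in> tcell (D j) n" for j om n v
  using S1[OF that(1) AUs_tru[OF ctobD(3)[OF D[OF that(1)]] that(2)], of om] unfolding AUs_def by simp
 have Rc: "j \<in> J" "k \<in> J" "v \<in> tcell (D j) n ==> f n v \<in> tcell (D k) n"
  "v \<in> tcell (D j) n ==> shape (D k) n (f n v) = shape (D j) n v" if "(j, k, f) \<in> R" for j k f n v
 proof -
  obtain h where h: "j \<in> J" "k \<in> J" "ptm (D j) (D k) f h" using R[OF \<open>(j, k, f) \<in> R\<close>] by blast
  thus "j \<in> J" "k \<in> J" by auto
  assume v: "v \<in> tcell (D j) n"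
  show "f n v \<in> tcell (D k) n" by (rule omap_cell[OF ptmD(1)[OF h(3)] v])
  show "shape (D k) n (f n v) = shape (D j) n v" by (rule ptm_shape[OF ctobD(3)[OF D[OF h(1)]] ctobD(3)[OF D[OF h(2)]] h(3) v])
 qed
 have dS: "(n, (j, v)) \<in> decl S" if "j \<in> J" "v \<in> tcell (D j) n" for n j v
  using AUt[OF that, of Ident] unfolding decl_def by blast
 have dS': "j \<in> J \<and> v \<in> tcell (D j) n" if dS: "(n, (j, v)) \<in> decl S" for n j v
 proof -
  obtain om w v' where "AU om n w (j, v) v' \<in> S" using dS unfolding decl_def by blast
  thus ?thesis
  proof (rule SE)
   fix i bet assume i: "i \<in> J" "bet \<in> tru (D i)" and e: "AU om n w (j, v) v' = map_atom (Pair i) bet"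
   have "(n, (j, v)) \<in> av (map_atom (Pair i) bet)" unfolding e[symmetric] by simp
   thus ?thesis using dv[OF i] i(1) unfolding av_map by auto
  qed (use Rc in auto)
 qed
 have pS: "pres S" unfolding pres_def
 proof
  fix al assume "al \<in> S"
  thus "av al \<subseteq> decl S"
  proof (rule SE)
   fix j bet assume "j \<in> J" "bet \<in> tru (D j)" "al = map_atom (Pair j) bet"
   thus ?thesis using dv dS by (auto simp: av_map)
  next
   fix j k f n v assume r: "(j, k, f) \<in> R" "v \<in> tcell (D j) n" "al = AU Ident n (SOME t. t \<in> shape (D j) n v) (j, v) (k, f n v)"
   thus ?thesis using Rc[OF r(1)] dS by simp
  qed
 qed
 have Ss: "sm S" unfolding S_def S1_def S2_def case_prod_beta
  by (intro sm_Un sm_UN sm_image J Rs sm_countable[OF countableI_type] sm_tru[OF D] sm_subset[OF cells_small[OF ctobD(3)[OF D]]])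
   (use Rc(1) in auto)
 have H: "(\<forall>al\<in>S. holds M a al) \<longleftrightarrow> cocone J D R M (%j n v. a n (j, v))" if M: "ctob M" for M a
 proof
  assume h: "\<forall>al\<in>S. holds M a al"
  have "ctm (D j) M (%n v. a n (j, v)) (%n g. cmap M n (a n (j, pt (D j) n g)))" if j: "j \<in> J" for j
   by (rule holds_imp_ctm[OF D[OF j] M]) (use h S1[OF j] holds_map in blast)
  moreover have "a n (k, f n v) = a n (j, v)" if "(j, k, f) \<in> R" "v \<in> tcell (D j) n" for j k f n v
   using bspec[OF h S2[OF that]] by simp
  ultimately show "cocone J D R M (%j n v. a n (j, v))" unfolding cocone_def agree_def using M by blast
 next
  assume c: "cocone J D R M (%j n v. a n (j, v))"
  show "\<forall>al\<in>S. holds M a al"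
  proof
   fix al assume "al \<in> S"
   thus "holds M a al"
   proof (rule SE)
    fix j bet assume j: "j \<in> J" "bet \<in> tru (D j)" and e: "al = map_atom (Pair j) bet"
    obtain l where l: "ctm (D j) M (%n v. a n (j, v)) l" using c j(1) unfolding cocone_def by blast
    show ?thesis using holds_push[OF D[OF j(1)] M l] j(2) unfolding e holds_map tru_def by simp
   next
    fix j k f n v assume r: "(j, k, f) \<in> R" and v: "v \<in> tcell (D j) n" and e: "al = AU Ident n (SOME t. t \<in> shape (D j) n v) (j, v) (k, f n v)"
    note j = Rc(1)[OF r] and p = ctobD(3)[OF D[OF Rc(1)[OF r]]]
    obtain l where l: "ctm (D j) M (%n v. a n (j, v)) l" using c j unfolding cocone_def by blast
    show ?thesis using c r v omap_cell[OF ptmD(1)[OF ctmD(2)[OF l]] v] ptm_shape[OF p ctobD(3)[OF M] ctmD(2)[OF l] v]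
      cl_some[OF shape_cell[OF p v]] unfolding e cocone_def agree_def by simp
   qed
  qed
 qed
 obtain N :: "'u ctcat" where N: "ctob N" "!!M. ctob M ==> \<exists>f h. ctm M N f h"
  "!!n x y. x \<in> tcell N n ==> y \<in> tcell N n ==> shape N n x = shape N n y ==> x = y"
  using terminal_exists by blast
 have "\<forall>j\<in>J. \<exists>f. \<exists>l. ctm (D j) N f l" using N(2)[OF D] by blast
 from bchoice[OF this] obtain ka where ka: "!!j. j \<in> J ==> \<exists>l. ctm (D j) N (ka j) l" by blast
 have kas: "ka j n x \<in> tcell N n" "shape N n (ka j n x) = shape (D j) n x" if "j \<in> J" "x \<in> tcell (D j) n" for j n x
 proof -
  obtain l where l: "ctm (D j) N (ka j) l" using ka[OF \<open>j \<in> J\<close>] by blast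
  show "ka j n x \<in> tcell N n" by (rule omap_cell[OF ptmD(1)[OF ctmD(2)[OF l]] that(2)])
  show "shape N n (ka j n x) = shape (D j) n x" by (rule ptm_shape[OF ctobD(3)[OF D[OF that(1)]] ctobD(3)[OF N(1)] ctmD(2)[OF l] that(2)])
 qed
 \<comment> \<open>A cell of the terminal object is determined by its shape and transition maps keep
   shapes, so any choice of maps into it is compatible.\<close>
 have "cocone J D R N ka" unfolding cocone_def agree_def
 proof (intro conjI allI impI ballI)
  fix j k f n x assume r: "(j, k, f) \<in> R" and x: "x \<in> tcell (D j) n"
  show "ka k n (f n x) = ka j n x"
   by (rule N(3)[OF kas(1)[OF Rc(2)[OF r] Rc(3)[OF r x]] kas(1)[OF Rc(1)[OF r] x]])
    (simp only: kas(2)[OF Rc(1)[OF r] x] kas(2)[OF Rc(2)[OF r] Rc(3)[OF r x]] Rc(4)[OF r x])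
 qed (use N(1) ka in auto)
 hence hN: "\<forall>al\<in>S. holds N (%n (j, v). ka j n v) al" using H[OF N(1), of "%n (j, v). ka j n v"] by simp
 \<comment> \<open>The disjoint union of the \<open>D j\<close>, in which the terms from all
   \<open>S1\<close> equations are well formed.\<close>
 define X where "X = \<lparr> cell = %n. {(j, v). j \<in> J \<and> v \<in> tcell (D j) n},
  src = %n (j, v). (j, src (tot (D j)) n v), tgt = %n (j, v). (j, tgt (tot (D j)) n v) \<rparr>"
 note Do = pgD(2)[OF ctobD(3)[OF D]]
 have X: "is_ograph X" using Do unfolding is_ograph_def X_def by auto
 have "\<exists>(Q :: 'u ctcat) u. represents S Q u"
 proof (rule represents_exists[OF pS Ss N(1) hN X])
  show "(n, p) \<in> decl S" if "p \<in> cell X n" for n p using that dS unfolding X_def by auto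
  show "\<exists>w. AU Src (Suc n) w p (src X n p) \<in> S" if "p \<in> cell X (Suc n)" for n p
   using that AUt[of _ _ "Suc n" Src] unfolding X_def by fastforce
  show "\<exists>w. AU Tgt (Suc n) w p (tgt X n p) \<in> S" if "p \<in> cell X (Suc n)" for n p
   using that AUt[of _ _ "Suc n" Tgt] unfolding X_def by fastforce
  fix n t p p' assume "AM n t p p' \<in> S"
  thus "teq X n t t"
  proof (rule SE)
   fix j bet assume j: "j \<in> J" "bet \<in> tru (D j)" and e: "AM n t p p' = map_atom (Pair j) bet"
   then obtain t' v v' where t: "bet = AM n t' v v'" "t = tmap (%_. Pair j) t'" by (cases bet) (auto simp: map_trm_tmap)
   have "(cl (tot (D j)) n t', v) \<in> pcell (D j) n" using j(2) t(1) tmap_ident[of t' "%_ v. v"] unfolding tru_def by simp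
   hence "teq (tot (D j)) n t' t'" using cl_wf unfolding pb_iff by blast
   moreover have "ograph_map (tot (D j)) X (%_. Pair j)" using j(1) unfolding ograph_map_def X_def by simp
   ultimately show ?thesis using teq_tmap[OF Do[OF j(1)] X] t(2) by blast
  qed simp
 qed
 then obtain Q :: "'u ctcat" and u where Q: "represents S Q u" by blast
 hence cQ: "ctob Q" and hQ: "\<forall>al\<in>S. holds Q u al"
  and ex: "!!M a. ctob M ==> \<forall>al\<in>S. holds M a al ==> \<exists>f h. ctm Q M f h \<and> (\<forall>(n, v)\<in>decl S. f n (u n v) = a n v)"
  and un: "!!M f h f' h'. ctob M ==> ctm Q M f h ==> ctm Q M f' h' ==> \<forall>(n, v)\<in>decl S. f n (u n v) = f' n (u n v) ==> agree Q f f'"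
  unfolding represents_def by blast+
 have "\<exists>g k. ctm Q M g k \<and> (\<forall>j\<in>J. agree (D j) (%n x. g n (u n (j, x))) (ka j))" if c: "cocone J D R M ka" for M ka
 proof -
  have M: "ctob M" using c unfolding cocone_def by blast
  have "\<forall>al\<in>S. holds M (%n (j, v). ka j n v) al" using H[OF M, of "%n (j, v). ka j n v"] c by simp
  then obtain g k where g: "ctm Q M g k" "\<forall>(n, v)\<in>decl S. g n (u n v) = (case v of (j, v) => ka j n v)" using ex[OF M] by blast
  have "g n (u n (j, x)) = ka j n x" if "j \<in> J" "x \<in> tcell (D j) n" for j n x using bspec[OF g(2) dS[OF that]] by simp
  thus ?thesis using g(1) unfolding agree_def by blast
 qed
 moreover have "agree Q g g'" if "ctob M" "ctm Q M g k" "ctm Q M g' k'"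
  and a: "\<forall>j\<in>J. agree (D j) (%n x. g n (u n (j, x))) (%n x. g' n (u n (j, x)))" for M g k g' k'
  by (rule un[OF that(1-3)]) (use a dS' in \<open>auto simp: agree_def\<close>)
 moreover have "cocone J D R Q (%j n v. u n (j, v))" using H[OF cQ] hQ by blast
 ultimately show ?thesis by (intro exI[of _ Q] exI[of _ "%j n v. u n (j, v)"]) blast
qed

end

section \<open>Directed colimits of \<open>\<omega>\<close>-graphs: terms live at a finite stage\<close>

definition subg :: "'a ograph => (nat \<times> 'a) set => 'a ograph" where
 "subg X W = \<lparr> cell = (%n. {v. (n, v) \<in> W}), src = src X, tgt = tgt X \<rparr>"

text \<open>Closure under faces makes W an omega-graph, so that terms over W alone can be
  considered.\<close>

definition fsub :: "'a ograph => (nat \<times> 'a) set => bool" where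
 "fsub X W == finite W \<and> (\<forall>(n, v)\<in>W. v \<in> cell X n) \<and>
   (\<forall>n v. (Suc n, v) \<in> W --> (n, src X n v) \<in> W \<and> (n, tgt X n v) \<in> W)"

primrec below :: "'a ograph => nat => 'a => (nat \<times> 'a) set" where
 "below X 0 v = {(0, v)}"
| "below X (Suc n) v = insert (Suc n, v) (below X n (src X n v) \<union> below X n (tgt X n v))"

lemma below_self: "(n, v) \<in> below X n v"
 by (cases n) auto

lemma fsub_below: "is_ograph X ==> v \<in> cell X n ==> fsub X (below X n v)"
proof (induction n arbitrary: v)
 case (Suc n)
 note s = ograph_src[OF Suc.prems] ograph_tgt[OF Suc.prems]
 show ?case
  using Suc.IH[OF Suc.prems(1) s(1)] Suc.IH[OF Suc.prems(1) s(2)] Suc.prems below_self[of n "src X n v" X] below_self[of n "tgt X n v" X]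
  unfolding fsub_def by auto
qed (simp add: fsub_def)

lemma fsub_ex:
 assumes X: "is_ograph X" and V: "finite V" "\<forall>(n, v)\<in>V. v \<in> cell X n"
 shows "\<exists>W. fsub X W \<and> V \<subseteq> W"
proof (intro exI conjI)
 have "fsub X (below X n v)" if "(n, v) \<in> V" for n v using fsub_below[OF X] V(2) that by blast
 thus "fsub X (\<Union>(n, v)\<in>V. below X n v)" using V(1) unfolding fsub_def by fast
 show "V \<subseteq> (\<Union>(n, v)\<in>V. below X n v)" using below_self by fastforce
qed

lemma fsub_Un: "fsub X V ==> fsub X W ==> fsub X (V \<union> W)"
 unfolding fsub_def by auto

lemma subg_ograph: "is_ograph X ==> fsub X W ==> is_ograph (subg X W)"
 unfolding is_ograph_def fsub_def subg_def by fastforce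

lemma teq_subg: "is_ograph X ==> fsub X V ==> fsub X W ==> V \<subseteq> W ==> teq (subg X V) n t u ==> teq (subg X W) n t u"
 using teq_tmap[OF subg_ograph subg_ograph, of X V X W "%_ x. x" n t u] tmap_ident[of t "%_ x. x"] tmap_ident[of u "%_ x. x"]
 by (auto simp: ograph_map_def subg_def)

lemma tsrc_subg [simp]: "tsrc (subg X W) = tsrc X" "ttgt (subg X W) = ttgt X"
proof -
 have "tsrc (subg X W) t = tsrc X t \<and> ttgt (subg X W) t = ttgt X t" for t
  by (induction t) (simp_all add: subg_def)
 thus "tsrc (subg X W) = tsrc X" "ttgt (subg X W) = ttgt X" by auto
qed

lemma fsub_join:
 assumes X: "is_ograph X"
 shows "finite F ==> \<forall>(n, t, u)\<in>F. \<exists>W. fsub X W \<and> teq (subg X W) n t u ==>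
  \<exists>W. fsub X W \<and> (\<forall>(n, t, u)\<in>F. teq (subg X W) n t u)"
proof (induction rule: finite_induct)
 case empty
 thus ?case by (auto simp: fsub_def)
next
 case (insert a F)
 obtain n t u where a: "a = (n, t, u)" by (cases a)
 obtain V where V: "fsub X V" "\<forall>(n, t, u)\<in>F. teq (subg X V) n t u" using insert by blast
 obtain W where W: "fsub X W" "teq (subg X W) n t u" using insert.prems a by auto
 note VW = fsub_Un[OF V(1) W(1)]
 have "teq (subg X (V \<union> W)) n t u" by (rule teq_subg[OF X W(1) VW _ W(2)]) simp
 moreover have "\<forall>(n, t, u)\<in>F. teq (subg X (V \<union> W)) n t u" using V(2) teq_subg[OF X V(1) VW] by blast
 ultimately show ?case using VW a by blast
qed

text \<open>A derivation uses finitely many rules and each of them finitely many cells. Premises of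
  a rule are brought into one subgraph by \<open>fsub_join\<close>, since derivations survive
  enlargement.\<close>

lemma teq_fsub:
 assumes X: "is_ograph X"
 shows "teq X n t u ==> \<exists>W. fsub X W \<and> teq (subg X W) n t u"
proof (induction rule: teq.induct)
 case (gen x n)
 thus ?case using fsub_below[OF X] below_self[of n x X] teq.gen[of x "subg X (below X n x)" n] by (auto simp: subg_def)
next
 case (idt n t t')
 thus ?case by (auto intro: teq.idt)
next
 case (cmp n t t' u u' k)
 thus ?case
  using fsub_join[OF X, of "{(n, t, t'), (n, u, u'), (k, (tsrc X ^^ (n - k)) t, (ttgt X ^^ (n - k)) u)}"]
  by (auto intro!: teq.cmp)
next
 case (sym n t u)
 thus ?case by (auto intro: teq.sym)
next
 case (trans n t u v)
 thus ?case using fsub_join[OF X, of "{(n, t, u), (n, u, v)}"] by (auto intro: teq.trans)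
next
 case (assoc n t u v k)
 thus ?case
  using fsub_join[OF X, of "{(n, t, t), (n, u, u), (n, v, v), (k, (tsrc X ^^ (n - k)) t, (ttgt X ^^ (n - k)) u),
   (k, (tsrc X ^^ (n - k)) u, (ttgt X ^^ (n - k)) v)}"]
  by (auto intro!: teq.assoc)
next
 case (unit_src n t k)
 thus ?case using teq.unit_src[where X = "subg X _"] by (simp add: tsrc_subg) blast
next
 case (unit_tgt n t k)
 thus ?case using teq.unit_tgt[where X = "subg X _"] by (simp add: tsrc_subg) blast
next
 case (interchange n t u v w j k)
 thus ?case
  using fsub_join[OF X, of "{(n, t, t), (n, u, u), (n, v, v), (n, w, w), (k, (tsrc X ^^ (n - k)) t, (ttgt X ^^ (n - k)) u),
   (k, (tsrc X ^^ (n - k)) v, (ttgt X ^^ (n - k)) w), (j, (tsrc X ^^ (n - j)) t, (ttgt X ^^ (n - j)) v),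
   (j, (tsrc X ^^ (n - j)) u, (ttgt X ^^ (n - j)) w)}"]
  by (auto intro!: teq.interchange)
next
 case (idt_cmp n t u k)
 thus ?case
  using fsub_join[OF X, of "{(n, t, t), (n, u, u), (k, (tsrc X ^^ (n - k)) t, (ttgt X ^^ (n - k)) u)}"]
  by (auto intro!: teq.idt_cmp)
qed

definition inc :: "'a ograph => 'a trm => bool" where
 "inc X t == (\<forall>(k, x)\<in>tlv t. x \<in> cell X k)"

lemma teq_inc: "is_ograph X ==> teq X n t u ==> inc X t \<and> inc X u"
 using teq_leaves unfolding inc_def by fastforce

section \<open>Directed systems of omega-graphs and their colimits\<close>

locale dirset =
 fixes J :: "'j set" and le :: "'j => 'j => bool"
 assumes J: "J \<noteq> {}" and le_refl: "j \<in> J ==> le j j"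
  and le_trans: "j \<in> J ==> k \<in> J ==> l \<in> J ==> le j k ==> le k l ==> le j l"
  and dir: "j \<in> J ==> k \<in> J ==> \<exists>l\<in>J. le j l \<and> le k l"
begin

text \<open>Asking for a whole tail beyond some stage, not just for one stage, makes the notion
  stable under finite conjunction.\<close>

definition ev :: "'j => ('j => bool) => bool" where
 "ev m P == (\<exists>l\<in>J. le m l \<and> (\<forall>l'\<in>J. le l l' --> P l'))"

lemma ev_conj: "m \<in> J ==> ev m P ==> ev m Q ==> ev m (%l. P l \<and> Q l)"
proof -
 assume m: "m \<in> J" and "ev m P" "ev m Q"
 then obtain a b where a: "a \<in> J" "le m a" "\<forall>l'\<in>J. le a l' --> P l'" and b: "b \<in> J" "le m b" "\<forall>l'\<in>J. le b l' --> Q l'"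
  unfolding ev_def by blast
 obtain l where l: "l \<in> J" "le a l" "le b l" using dir[OF a(1) b(1)] by blast
 have "P l' \<and> Q l'" if "l' \<in> J" "le l l'" for l'
  using a(3) b(3) le_trans[OF a(1) l(1) that(1) l(2) that(2)] le_trans[OF b(1) l(1) that(1) l(3) that(2)] that(1) by blast
 thus ?thesis unfolding ev_def using l(1) le_trans[OF m a(1) l(1) a(2) l(2)] by blast
qed

lemma ev_ex: "ev m P ==> \<exists>l\<in>J. le m l \<and> P l"
 unfolding ev_def using le_refl by blast

lemma ev_always: "m \<in> J ==> (!!l. l \<in> J ==> le m l ==> P l) ==> ev m P"
 unfolding ev_def using le_refl by blast

lemma ev_mono: "ev m P ==> (!!l. l \<in> J ==> le m l ==> P l ==> Q l) ==> m \<in> J ==> ev m Q"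
 unfolding ev_def using le_trans by metis

lemma ev_ball: "finite W ==> m \<in> J ==> (!!w. w \<in> W ==> ev m (P w)) ==> ev m (%l. \<forall>w\<in>W. P w l)"
proof (induction rule: finite_induct)
 case empty
 thus ?case by (intro ev_always) auto
next
 case (insert w W)
 thus ?case using ev_conj[OF insert.prems(1), of "P w"] by simp
qed

end

text \<open>\<open>surj\<close> and \<open>uniq\<close> express in elementary terms that Z is the
  directed colimit. The locale is instantiated for cells, for colours and for pullbacks.\<close>

locale dircol = dirset J le for J :: "'j set" and le +
 fixes X :: "'j => 'a ograph" and tr :: "'j => 'j => nat => 'a => 'a" and Z :: "'b ograph" and e :: "'j => nat => 'a => 'b"
 assumes X: "j \<in> J ==> is_ograph (X j)" and Z: "is_ograph Z"
  and tr: "j \<in> J ==> k \<in> J ==> le j k ==> ograph_map (X j) (X k) (tr j k)"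
  and tr_refl: "j \<in> J ==> x \<in> cell (X j) n ==> tr j j n x = x"
  and tr_trans: "j \<in> J ==> k \<in> J ==> l \<in> J ==> le j k ==> le k l ==> x \<in> cell (X j) n ==> tr k l n (tr j k n x) = tr j l n x"
  and e: "j \<in> J ==> ograph_map (X j) Z (e j)"
  and e_tr: "j \<in> J ==> k \<in> J ==> le j k ==> x \<in> cell (X j) n ==> e k n (tr j k n x) = e j n x"
  and surj: "z \<in> cell Z n ==> \<exists>j\<in>J. \<exists>x\<in>cell (X j) n. e j n x = z"
  and uniq: "j \<in> J ==> k \<in> J ==> x \<in> cell (X j) n ==> y \<in> cell (X k) n ==> e j n x = e k n y ==>
    \<exists>l\<in>J. le j l \<and> le k l \<and> tr j l n x = tr k l n y"
begin

lemma uniq1: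
 assumes "j \<in> J" "x \<in> cell (X j) n" "y \<in> cell (X j) n" "e j n x = e j n y"
 shows "\<exists>l\<in>J. le j l \<and> tr j l n x = tr j l n y"
 using uniq[OF assms(1,1,2,3,4)] by blast

lemma tm_tr: "j \<in> J ==> k \<in> J ==> l \<in> J ==> le j k ==> le k l ==> inc (X j) t ==> tmap (tr k l) (tmap (tr j k) t) = tmap (tr j l) t"
 unfolding tmap_tmap inc_def by (rule tmap_leaf_cong) (auto intro: tr_trans)

lemma tm_e: "j \<in> J ==> k \<in> J ==> le j k ==> inc (X j) t ==> tmap (e k) (tmap (tr j k) t) = tmap (e j) t"
 unfolding tmap_tmap inc_def by (rule tmap_leaf_cong) (auto intro: e_tr)

lemma teq_tr: "j \<in> J ==> k \<in> J ==> le j k ==> teq (X j) n t u ==> teq (X k) n (tmap (tr j k) t) (tmap (tr j k) u)"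
 using teq_tmap[OF X X tr] .

lemma T_tr:
 assumes "j \<in> J" "k \<in> J" "l \<in> J" "le j k" "le k l" "K \<in> Tcell (X j) n"
 shows "T_map (X l) (tr k l) n (T_map (X k) (tr j k) n K) = T_map (X l) (tr j l) n K"
proof -
 have "T_map (X l) (tr k l) n (T_map (X k) (tr j k) n K) = T_map (X l) (%n x. tr k l n (tr j k n x)) n K"
  by (rule T_map_comp[OF X[OF assms(1)] X[OF assms(2)] X[OF assms(3)] tr[OF assms(1,2,4)] tr[OF assms(2,3,5)] assms(6)])
 also have "\<dots> = T_map (X l) (tr j l) n K"
  by (rule T_map_cong[OF X[OF assms(1)] assms(6)]) (rule tr_trans[OF assms(1-5)])
 finally show ?thesis .
qed

lemma T_e:
 assumes "j \<in> J" "k \<in> J" "le j k" "K \<in> Tcell (X j) n"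
 shows "T_map Z (e k) n (T_map (X k) (tr j k) n K) = T_map Z (e j) n K"
proof -
 have "T_map Z (e k) n (T_map (X k) (tr j k) n K) = T_map Z (%n x. e k n (tr j k n x)) n K"
  by (rule T_map_comp[OF X[OF assms(1)] X[OF assms(2)] Z tr[OF assms(1-3)] e[OF assms(2)] assms(4)])
 also have "\<dots> = T_map Z (e j) n K"
  by (rule T_map_cong[OF X[OF assms(1)] assms(4)]) (rule e_tr[OF assms(1-3)])
 finally show ?thesis .
qed

lemma ev_eq:
 assumes m: "m \<in> J" "x \<in> cell (X m) n" "y \<in> cell (X m) n" and eq: "e m n x = e m n y"
 shows "ev m (%l. tr m l n x = tr m l n y)"
proof -
 obtain l where l: "l \<in> J" "le m l" "tr m l n x = tr m l n y" using uniq1[OF assms] by blast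
 have "tr m l' n x = tr m l' n y" if "l' \<in> J" "le l l'" for l'
  using tr_trans[OF m(1) l(1) that(1) l(2) that(2) m(2)] tr_trans[OF m(1) l(1) that(1) l(2) that(2) m(3)] l(3) by simp
 thus ?thesis unfolding ev_def using l by blast
qed

lemma common_stage:
 assumes "finite W" "!!n z. (n, z) \<in> W ==> z \<in> cell Z n"
 shows "\<exists>j\<in>J. \<forall>(n, z)\<in>W. \<exists>x\<in>cell (X j) n. e j n x = z"
 using assms
proof (induction rule: finite_induct)
 case empty
 thus ?case using J by auto
next
 case (insert w W)
 obtain n z where w: "w = (n, z)" by (cases w)
 obtain j where j: "j \<in> J" "\<forall>(n, z)\<in>W. \<exists>x\<in>cell (X j) n. e j n x = z" using insert by blast
 have "z \<in> cell Z n" using insert.prems w by simp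
 from surj[OF this] obtain k x where k: "k \<in> J" "x \<in> cell (X k) n" "e k n x = z" by blast
 obtain l where l: "l \<in> J" "le j l" "le k l" using dir[OF j(1) k(1)] by blast
 have "\<exists>x\<in>cell (X l) i. e l i x = y" if "(i, y) \<in> W" for i y
 proof -
  obtain x where x: "x \<in> cell (X j) i" "e j i x = y" using bspec[OF j(2) \<open>(i, y) \<in> W\<close>] by auto
  thus ?thesis using omap_cell[OF tr[OF j(1) l(1,2)] x(1)] e_tr[OF j(1) l(1,2) x(1)] by auto
 qed
 moreover have "\<exists>x\<in>cell (X l) n. e l n x = z"
  using k omap_cell[OF tr[OF k(1) l(1,3)] k(2)] e_tr[OF k(1) l(1,3) k(2)] by auto
 ultimately show ?case using l(1) w by auto
qed

text \<open>Lift the finitely many cells of W to one stage. Their faces need not match there, but do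
  so in Z, hence at a later stage.\<close>

lemma section_stage:
 assumes W: "fsub Z W"
 shows "\<exists>j\<in>J. \<exists>s. ograph_map (subg Z W) (X j) s \<and> (\<forall>(n, z)\<in>W. e j n (s n z) = z)"
proof -
 have W1: "finite W" "!!n z. (n, z) \<in> W ==> z \<in> cell Z n"
  and W2: "!!n z. (Suc n, z) \<in> W ==> (n, src Z n z) \<in> W \<and> (n, tgt Z n z) \<in> W" using W unfolding fsub_def by auto
 obtain j where j: "j \<in> J" "\<forall>(n, z)\<in>W. \<exists>x\<in>cell (X j) n. e j n x = z" using common_stage[OF W1] by blast
 define a where "a n z = (SOME x. x \<in> cell (X j) n \<and> e j n x = z)" for n z
 have a: "a n z \<in> cell (X j) n" "e j n (a n z) = z" if "(n, z) \<in> W" for n z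
  using someI_ex[of "%x. x \<in> cell (X j) n \<and> e j n x = z"] bspec[OF j(2) that] unfolding a_def by auto
 let ?P = "%w l. case w of (n, z) => \<forall>m. n = Suc m -->
  tr j l m (src (X j) m (a n z)) = tr j l m (a m (src Z m z)) \<and> tr j l m (tgt (X j) m (a n z)) = tr j l m (a m (tgt Z m z))"
 have P: "ev j (?P w)" if "w \<in> W" for w
 proof (cases w)
  case (Pair n z)
  show ?thesis
  proof (cases n)
   case 0
   thus ?thesis using Pair j(1) by (auto intro: ev_always)
  next
   case (Suc m)
   hence w: "(Suc m, z) \<in> W" using Pair that by simp
   note aw = a[OF w] and b = W2[OF w]
   note c = ograph_src[OF X[OF j(1)] aw(1)] ograph_tgt[OF X[OF j(1)] aw(1)]
   have "e j m (src (X j) m (a (Suc m) z)) = e j m (a m (src Z m z))" "e j m (tgt (X j) m (a (Suc m) z)) = e j m (a m (tgt Z m z))"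
    using omap_src[OF e[OF j(1)] aw(1)] omap_tgt[OF e[OF j(1)] aw(1)] aw(2) a(2) b by simp_all
   thus ?thesis using ev_conj[OF j(1) ev_eq[OF j(1) c(1) a(1)] ev_eq[OF j(1) c(2) a(1)]] b Pair Suc by simp
  qed
 qed
 have "ev j (%l. \<forall>w\<in>W. ?P w l)" by (rule ev_ball[OF W1(1) j(1)]) (rule P)
 from ev_ex[OF this] obtain l where l: "l \<in> J" "le j l" and P: "\<forall>w\<in>W. ?P w l" by blast
 note t = tr[OF j(1) l]
 have "ograph_map (subg Z W) (X l) (%n z. tr j l n (a n z))"
  unfolding ograph_map_def subg_def
  using omap_cell[OF t a(1)] omap_src[OF t a(1)] omap_tgt[OF t a(1)] bspec[OF P] by auto
 moreover have "\<forall>(n, z)\<in>W. e l n (tr j l n (a n z)) = z" using e_tr[OF j(1) l a(1)] a(2) by auto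
 ultimately show ?thesis using l(1) by blast
qed

lemma teq_section:
 assumes "teq Z n t u"
 shows "\<exists>j\<in>J. \<exists>s. teq (X j) n (tmap s t) (tmap s u) \<and> (\<forall>(k, z)\<in>tlv t \<union> tlv u. s k z \<in> cell (X j) k \<and> e j k (s k z) = z)"
proof -
 obtain W where W: "fsub Z W" "teq (subg Z W) n t u" using teq_fsub[OF Z assms] by blast
 obtain j s where j: "j \<in> J" and s: "ograph_map (subg Z W) (X j) s" "\<forall>(n, z)\<in>W. e j n (s n z) = z"
  using section_stage[OF W(1)] by blast
 note o = subg_ograph[OF Z W(1)]
 have "(k, z) \<in> W \<and> z \<in> cell (subg Z W) k" if "(k, z) \<in> tlv t \<union> tlv u" for k z
  using teq_leaves[OF o W(2)] that unfolding subg_def by auto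
 thus ?thesis using j teq_tmap[OF o X[OF j] s(1) W(2)] omap_cell[OF s(1)] s(2) by blast
qed

text \<open>The equation lives on a finite subgraph of Z and is lifted to some stage. The lifted
  leaves and the given ones have the same images in Z, so they coincide from some stage on, where
  the lifted equation becomes the desired one.\<close>

lemma ev_teq:
 assumes j: "j \<in> J" and t: "inc (X j) t" "inc (X j) u" and eq: "teq Z n (tmap (e j) t) (tmap (e j) u)"
 shows "ev j (%l. teq (X l) n (tmap (tr j l) t) (tmap (tr j l) u))"
proof -
 let ?W = "tlv t \<union> tlv u"
 obtain k s where k: "k \<in> J" and s: "teq (X k) n (tmap s (tmap (e j) t)) (tmap s (tmap (e j) u))"
  and "\<forall>(i, z)\<in>tlv (tmap (e j) t) \<union> tlv (tmap (e j) u). s i z \<in> cell (X k) i \<and> e k i (s i z) = z"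
  using teq_section[OF eq] by blast
 hence se: "s i (e j i x) \<in> cell (X k) i" "e k i (s i (e j i x)) = e j i x" if "(i, x) \<in> ?W" for i x
  using that unfolding tlv_tmap by fastforce+
 have x: "x \<in> cell (X j) i" if "(i, x) \<in> ?W" for i x using t that unfolding inc_def by blast
 obtain m where m: "m \<in> J" "le j m" "le k m" using dir[OF j k] by blast
 note tc = omap_cell[OF tr[OF j m(1,2)] x] omap_cell[OF tr[OF k m(1,3)] se(1)]
 have "ev m (%l. case w of (i, x) => tr m l i (tr j m i x) = tr m l i (tr k m i (s i (e j i x))))" if "w \<in> ?W" for w
  using ev_eq[OF m(1) tc] e_tr[OF j m(1,2) x] e_tr[OF k m(1,3) se(1)] se(2) that by (cases w) simp
 hence E: "ev m (%l. \<forall>w\<in>?W. case w of (i, x) => tr m l i (tr j m i x) = tr m l i (tr k m i (s i (e j i x))))"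
  by (intro ev_ball m(1)) (simp_all add: finite_tlv)
 have "ev m (%l. teq (X l) n (tmap (tr j l) t) (tmap (tr j l) u))"
 proof (rule ev_mono[OF E _ m(1)])
  fix l assume l: "l \<in> J" "le m l" and q: "\<forall>w\<in>?W. case w of (i, x) => tr m l i (tr j m i x) = tr m l i (tr k m i (s i (e j i x)))"
  have "tr j l i x = tr k l i (s i (e j i x))" if "(i, x) \<in> ?W" for i x
   using bspec[OF q that] tr_trans[OF j m(1) l(1) m(2) l(2) x[OF that]] tr_trans[OF k m(1) l(1) m(3) l(2) se(1)[OF that]] by simp
  hence "tmap (tr j l) t = tmap (tr k l) (tmap s (tmap (e j) t))" "tmap (tr j l) u = tmap (tr k l) (tmap s (tmap (e j) u))"
   unfolding tmap_tmap by (auto intro!: tmap_leaf_cong)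
  thus "teq (X l) n (tmap (tr j l) t) (tmap (tr j l) u)"
   using teq_tr[OF k l(1) le_trans[OF k m(1) l(1) m(3) l(2)] s] by simp
 qed
 thus ?thesis unfolding ev_def using le_trans[OF j m(1) _ m(2)] by blast
qed

lemma T_lift:
 assumes K: "K \<in> Tcell Z n"
 shows "\<exists>j\<in>J. \<exists>K'\<in>Tcell (X j) n. T_map Z (e j) n K' = K"
proof -
 obtain t where t: "teq Z n t t" "K = cl Z n t" using T_cellE[OF K] .
 obtain j s where j: "j \<in> J" and s: "teq (X j) n (tmap s t) (tmap s t)" "\<forall>(k, z)\<in>tlv t. e j k (s k z) = z"
  using teq_section[OF t(1)] by fast
 have "tmap (e j) (tmap s t) = t" unfolding tmap_tmap by (rule tmap_ident) (use s(2) in auto)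
 hence "T_map Z (e j) n (cl (X j) n (tmap s t)) = K" using T_map_cl[OF X[OF j] Z e[OF j] s(1)] t(2) by simp
 thus ?thesis using j T_cellI[OF s(1)] by blast
qed

lemma ev_Teq:
 assumes j: "j \<in> J" and K: "K \<in> Tcell (X j) n" "K' \<in> Tcell (X j) n"
  and eq: "T_map Z (e j) n K = T_map Z (e j) n K'"
 shows "ev j (%l. T_map (X l) (tr j l) n K = T_map (X l) (tr j l) n K')"
proof -
 obtain t where t: "teq (X j) n t t" "K = cl (X j) n t" using T_cellE[OF K(1)] .
 obtain u where u: "teq (X j) n u u" "K' = cl (X j) n u" using T_cellE[OF K(2)] .
 note m = T_map_cl[OF X[OF j] _ _ t(1)] T_map_cl[OF X[OF j] _ _ u(1)]
 have "teq Z n (tmap (e j) t) (tmap (e j) u)"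
  using eq teq_tmap[OF X[OF j] Z e[OF j] u(1)] unfolding t u m[OF Z e[OF j]] by (rule cl_eqD)
 from ev_teq[OF j _ _ this] have "ev j (%l. teq (X l) n (tmap (tr j l) t) (tmap (tr j l) u))"
  using teq_inc[OF X[OF j]] t(1) u(1) by blast
 thus ?thesis unfolding t u by (rule ev_mono) (use m[OF X tr[OF j]] j in \<open>simp_all add: cl_eqI\<close>)
qed

end

section \<open>Directed colimits of contractible \<open>T\<close>-categories\<close>

lemma ctm_cong:
 assumes C: "ctob C" and m: "ctm C N f h"
  and f: "!!n x. x \<in> tcell C n ==> f n x = f' n x" and h: "!!n g. g \<in> gcell C n ==> h n g = h' n g"
 shows "ctm C N f' h'"
proof -
 note Cp = ctobD(3)[OF C]
 have "f' n (mul C n (K, x)) = mul N n (T_map (tot N) f' n K, f' n x)" if k: "(K, x) \<in> pcell C n" for n K x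
 proof -
  have K: "K \<in> Tcell (tot C) n" and x: "x \<in> tcell C n" using k unfolding pb_iff by auto
  have "T_map (tot N) f n K = T_map (tot N) f' n K" by (rule T_map_cong[OF pgD(2)[OF Cp] K f])
  thus ?thesis using ctmD(3)[OF m k] f[OF ctobD(9)[OF C k]] f[OF x] by simp
 qed
 moreover have "f' (Suc k) (contr C k x y) = contr N k (f' k x) (f' k y)" if "(x, y) \<in> contractible_pairs C k" for k x y
  using ctmD(4)[OF m that] f[OF ctobD(5)[OF C that]] f[OF conjunct1[OF contractible_cells[OF that]]] f contractible_cells[OF that] by simp
 ultimately show ?thesis unfolding ctm_def mulm_def using ptm_cong[OF Cp ctmD(2)[OF m] f h] by blast
qed

lemma ctm_canon:
 assumes "ctob C" "ctob N" "ctm C N f h"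
 shows "ctm C N f (%n g. cmap N n (f n (pt C n g)))"
 by (rule ctm_cong[OF assms(1,3)]) (use ptm_h[OF ctobD(3)[OF assms(2)] ctmD(2)[OF assms(3)]] in auto)

text \<open>The value at z of a function defined on representatives, written as a choice;
  \<open>pick_eq\<close> states the independence that makes it meaningful.\<close>

definition pick :: "'j set => ('j => 'a set) => ('j => 'a => 'b) => ('j => 'a => 'c) => 'b => 'c" where
 "pick J A e F z = (SOME w. \<exists>j\<in>J. \<exists>x\<in>A j. e j x = z \<and> w = F j x)"

lemma pick_eq:
 assumes "j \<in> J" "x \<in> A j" "!!k y. k \<in> J ==> y \<in> A k ==> e k y = e j x ==> F k y = F j x"
 shows "pick J A e F (e j x) = F j x"
 unfolding pick_def
proof (rule some_equality)
 show "\<exists>k\<in>J. \<exists>y\<in>A k. e k y = e j x \<and> F j x = F k y" using assms(1,2) by blast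
 show "w = F j x" if "\<exists>k\<in>J. \<exists>y\<in>A k. e k y = e j x \<and> w = F k y" for w using that assms(3) by blast
qed

locale dirdiag = universe U + dirset J le for U :: "'u itself" and J :: "'j set" and le +
 fixes D :: "'j => 'u ctcat" and tr :: "'j => 'j => nat => 'u => 'u"
 assumes Jsm: "small U J" and D: "j \<in> J ==> ctob (D j)"
  and trm: "j \<in> J ==> k \<in> J ==> le j k ==> \<exists>h. ctm (D j) (D k) (tr j k) h"
  and tr_refl: "j \<in> J ==> x \<in> tcell (D j) n ==> tr j j n x = x"
  and tr_trans: "j \<in> J ==> k \<in> J ==> l \<in> J ==> le j k ==> le k l ==> x \<in> tcell (D j) n ==> tr k l n (tr j k n x) = tr j l n x"
begin

abbreviation "Tt j k == T_map (tot (D k)) (tr j k)"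

text \<open>The locale only provides some base component for each transition; this formula fixes a
  definite one.\<close>

definition th :: "'j => 'j => nat => 'u => 'u" where
 "th j k n g = cmap (D k) n (tr j k n (pt (D j) n g))"

abbreviation "Tb j k == T_map (base (D k)) (th j k)"

lemma trc: "j \<in> J ==> k \<in> J ==> le j k ==> ctm (D j) (D k) (tr j k) (th j k)"
 unfolding th_def[abs_def] using trm ctm_canon[OF D D] by blast

lemma Dp: "j \<in> J ==> is_ptgraph (D j)" and Dc: "j \<in> J ==> constant_ograph (base (D j))"
 and Do: "j \<in> J ==> is_ograph (tot (D j))" and Db: "j \<in> J ==> is_ograph (base (D j))"
 using ctobD(3,4)[OF D] pgD(1,2) by blast+

lemma trp: "j \<in> J ==> k \<in> J ==> le j k ==> ptm (D j) (D k) (tr j k) (th j k)"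
 by (rule ctmD(2)[OF trc])

lemma tro: "j \<in> J ==> k \<in> J ==> le j k ==> ograph_map (tot (D j)) (tot (D k)) (tr j k)"
 and tho: "j \<in> J ==> k \<in> J ==> le j k ==> ograph_map (base (D j)) (base (D k)) (th j k)"
 by (rule ptmD(1)[OF trp], assumption+, rule ptmD(2)[OF trp])

lemma tr_cell: "j \<in> J ==> k \<in> J ==> le j k ==> x \<in> tcell (D j) n ==> tr j k n x \<in> tcell (D k) n"
 by (rule omap_cell[OF tro])

text \<open>The germ of x as a set of tagged cells, so that equality in the colimit is equality of
  sets.\<close>

definition cls :: "nat => 'j => 'u => ('j \<times> 'u) set" where
 "cls n j x = {(k, y). k \<in> J \<and> y \<in> tcell (D k) n \<and> (\<exists>l\<in>J. le j l \<and> le k l \<and> tr j l n x = tr k l n y)}"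

definition clss :: "nat => ('j \<times> 'u) set set" where
 "clss n = (\<Union>j\<in>J. cls n j ` tcell (D j) n)"

lemma clss_small: "small U (clss n)"
proof -
 have "small U (tcell (D j) n)" if "j \<in> J" for j
  using Dp[OF that] unfolding is_ptgraph_def is_tgraph_def sm_iff by blast
 thus ?thesis unfolding clss_def by (intro sm_UN[OF Jsm] sm_image)
qed

definition enc :: "nat => ('j \<times> 'u) set => 'u" where
 "enc n = (SOME f. inj_on f (clss n))"

lemma enc_inj: "inj_on (enc n) (clss n)"
 unfolding enc_def using someI_ex[OF sm_inj[OF clss_small]] .

definition e :: "'j => nat => 'u => 'u" where
 "e j n x = enc n (cls n j x)"

lemma cls_sym: "(k, y) \<in> cls n j x ==> j \<in> J ==> x \<in> tcell (D j) n ==> (j, x) \<in> cls n k y"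
 unfolding cls_def by auto

lemma cls_trans:
 assumes "j \<in> J" "x \<in> tcell (D j) n" "(k, y) \<in> cls n j x" "(m, z) \<in> cls n k y"
 shows "(m, z) \<in> cls n j x"
proof -
 from assms(3) obtain l where l: "k \<in> J" "y \<in> tcell (D k) n" "l \<in> J" "le j l" "le k l" "tr j l n x = tr k l n y"
  unfolding cls_def by blast
 from assms(4) obtain l' where l': "m \<in> J" "z \<in> tcell (D m) n" "l' \<in> J" "le k l'" "le m l'" "tr k l' n y = tr m l' n z"
  unfolding cls_def by blast
 obtain p where p: "p \<in> J" "le l p" "le l' p" using dir[OF l(3) l'(3)] by blast
 have "tr j p n x = tr m p n z"
  using tr_trans[OF assms(1) l(3) p(1) l(4) p(2) assms(2)] tr_trans[OF l(1) l(3) p(1) l(5) p(2) l(2)]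
   tr_trans[OF l(1) l'(3) p(1) l'(4) p(3) l(2)] tr_trans[OF l'(1) l'(3) p(1) l'(5) p(3) l'(2)] l(6) l'(6) by simp
 thus ?thesis unfolding cls_def
  using l'(1,2) p(1) le_trans[OF assms(1) l(3) p(1) l(4) p(2)] le_trans[OF l'(1) l'(3) p(1) l'(5) p(3)] by blast
qed

lemma cls_self: "j \<in> J ==> x \<in> tcell (D j) n ==> (j, x) \<in> cls n j x"
 unfolding cls_def using le_refl by auto

lemma e_eq:
 assumes "j \<in> J" "k \<in> J" "x \<in> tcell (D j) n" "y \<in> tcell (D k) n"
 shows "e j n x = e k n y \<longleftrightarrow> (\<exists>l\<in>J. le j l \<and> le k l \<and> tr j l n x = tr k l n y)"
proof
 assume "e j n x = e k n y"
 moreover have "cls n j x \<in> clss n" "cls n k y \<in> clss n" using assms unfolding clss_def by auto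
 ultimately have "cls n j x = cls n k y" using enc_inj unfolding e_def inj_on_def by blast
 hence "(k, y) \<in> cls n j x" using cls_self[OF assms(2,4)] by simp
 thus "\<exists>l\<in>J. le j l \<and> le k l \<and> tr j l n x = tr k l n y" unfolding cls_def by blast
next
 assume "\<exists>l\<in>J. le j l \<and> le k l \<and> tr j l n x = tr k l n y"
 hence a: "(k, y) \<in> cls n j x" unfolding cls_def using assms by blast
 have b: "(j, x) \<in> cls n k y" using cls_sym[OF a assms(1,3)] .
 have "cls n j x = cls n k y"
  using cls_trans[OF assms(1,3) a] cls_trans[OF assms(2,4) b] by auto
 thus "e j n x = e k n y" unfolding e_def by simp
qed

lemma e_tr: "j \<in> J ==> k \<in> J ==> le j k ==> x \<in> tcell (D j) n ==> e k n (tr j k n x) = e j n x"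
proof -
 assume a: "j \<in> J" "k \<in> J" "le j k" "x \<in> tcell (D j) n"
 show ?thesis unfolding e_eq[OF a(2,1) tr_cell[OF a] a(4)]
  by (rule bexI[OF _ a(2)]) (use a le_refl tr_refl[OF a(2) tr_cell[OF a]] in simp)
qed

lemma pick_nat:
 assumes "j \<in> J" "x \<in> tcell (D j) n"
  and nat: "!!j k x. j \<in> J ==> k \<in> J ==> le j k ==> x \<in> tcell (D j) n ==> F k (tr j k n x) = F j x"
 shows "pick J (%j. tcell (D j) n) (%j. e j n) F (e j n x) = F j x"
proof (rule pick_eq)
 fix k y assume k: "k \<in> J" "y \<in> tcell (D k) n" "e k n y = e j n x"
 then obtain l where "l \<in> J" "le k l" "le j l" "tr k l n y = tr j l n x" using e_eq[OF k(1) assms(1) k(2) assms(2)] by blast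
 thus "F k y = F j x" using nat[OF k(1) _ _ k(2)] nat[OF assms(1) _ _ assms(2)] by metis
qed fact+

definition Et :: "'u ograph" where
 "Et = \<lparr> cell = (%n. \<Union>j\<in>J. e j n ` tcell (D j) n),
   src = (%n. pick J (%j. tcell (D j) (Suc n)) (%j. e j (Suc n)) (%j x. e j n (src (tot (D j)) n x))),
   tgt = (%n. pick J (%j. tcell (D j) (Suc n)) (%j. e j (Suc n)) (%j x. e j n (tgt (tot (D j)) n x))) \<rparr>"

abbreviation "Te j == T_map Et (e j)"

lemma Et_cell: "z \<in> cell Et n \<longleftrightarrow> (\<exists>j\<in>J. \<exists>x\<in>tcell (D j) n. e j n x = z)"
 unfolding Et_def by auto

lemma Et_src:
 assumes j: "j \<in> J" "x \<in> tcell (D j) (Suc n)"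
 shows "src Et n (e j (Suc n) x) = e j n (src (tot (D j)) n x)" "tgt Et n (e j (Suc n) x) = e j n (tgt (tot (D j)) n x)"
proof -
 have s: "e k n (src (tot (D k)) n (tr j k (Suc n) x)) = e j n (src (tot (D j)) n x) \<and>
   e k n (tgt (tot (D k)) n (tr j k (Suc n) x)) = e j n (tgt (tot (D j)) n x)"
  if jk: "j \<in> J" "k \<in> J" "le j k" and x: "x \<in> tcell (D j) (Suc n)" for j k x
  using e_tr[OF jk ograph_src[OF Do[OF jk(1)] x]] e_tr[OF jk ograph_tgt[OF Do[OF jk(1)] x]]
   omap_src[OF tro[OF jk] x] omap_tgt[OF tro[OF jk] x] by simp
 show "src Et n (e j (Suc n) x) = e j n (src (tot (D j)) n x)" "tgt Et n (e j (Suc n) x) = e j n (tgt (tot (D j)) n x)"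
  unfolding Et_def using pick_nat[OF j, of "%j x. e j n (src (tot (D j)) n x)"] pick_nat[OF j, of "%j x. e j n (tgt (tot (D j)) n x)"] s by simp_all
qed

lemma Et_ograph: "is_ograph Et"
proof -
 have "src Et n z \<in> cell Et n \<and> tgt Et n z \<in> cell Et n" if z: "z \<in> cell Et (Suc n)" for n z
 proof -
  obtain j x where j: "j \<in> J" "x \<in> tcell (D j) (Suc n)" "e j (Suc n) x = z" using z unfolding Et_cell by blast
  show ?thesis unfolding j(3)[symmetric] Et_src[OF j(1,2)] Et_cell
   using j(1) ograph_src[OF Do[OF j(1)] j(2)] ograph_tgt[OF Do[OF j(1)] j(2)] by blast
 qed
 moreover have "src Et n (src Et (Suc n) z) = src Et n (tgt Et (Suc n) z) \<and> tgt Et n (src Et (Suc n) z) = tgt Et n (tgt Et (Suc n) z)"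
  if z: "z \<in> cell Et (Suc (Suc n))" for n z
 proof -
  obtain j x where j: "j \<in> J" "x \<in> tcell (D j) (Suc (Suc n))" "e j (Suc (Suc n)) x = z" using z unfolding Et_cell by blast
  note s = ograph_src[OF Do[OF j(1)] j(2)] ograph_tgt[OF Do[OF j(1)] j(2)]
  show ?thesis unfolding j(3)[symmetric] Et_src[OF j(1,2)] Et_src[OF j(1) s(1)] Et_src[OF j(1) s(2)]
   using Do[OF j(1)] j(2) unfolding is_ograph_def by simp
 qed
 ultimately show ?thesis unfolding is_ograph_def by blast
qed

lemma e_map: "j \<in> J ==> ograph_map (tot (D j)) Et (e j)"
 unfolding ograph_map_def using Et_cell Et_src by auto

sublocale td: dircol J le "%j. tot (D j)" tr Et e
 by unfold_locales (fact Do Et_ograph tro tr_refl tr_trans e_map e_tr Et_cell[THEN iffD1] e_eq[THEN iffD1])+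

text \<open>As in the generated object, colours are represented by their unit 0-cells.\<close>

definition Eb :: "'u ograph" where
 "Eb = \<lparr> cell = (%_. \<Union>j\<in>J. (%g. e j 0 (pt (D j) 0 g)) ` gcell (D j) 0), src = (%_ g. g), tgt = (%_ g. g) \<rparr>"

definition he :: "'j => nat => 'u => 'u" where
 "he j n g = e j 0 (pt (D j) 0 g)"

abbreviation "Th j == T_map Eb (he j)"

lemma Eb_const: "constant_ograph Eb"
 unfolding constant_ograph_def is_ograph_def Eb_def by simp

text \<open>The dimension m of the representing colour is left free, colours being the same in all
  dimensions.\<close>

lemma Eb_cell: "z \<in> cell Eb n \<longleftrightarrow> (\<exists>j\<in>J. \<exists>g\<in>gcell (D j) m. he j n g = z)"
 if "True" for m
proof -
 have "gcell (D j) m = gcell (D j) 0" if "j \<in> J" for j using const_cell[OF Dc[OF that]] .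
 thus ?thesis unfolding Eb_def he_def by auto
qed

lemma bcell: "j \<in> J ==> g \<in> gcell (D j) n ==> g \<in> gcell (D j) m"
 using const_cell[OF Dc] by blast

lemma pt_cell: "j \<in> J ==> g \<in> gcell (D j) n ==> pt (D j) m g \<in> tcell (D j) m"
 using pg_cell(3)[OF Dp bcell] .

lemma th_pt: "j \<in> J ==> k \<in> J ==> le j k ==> g \<in> gcell (D j) n ==> tr j k m (pt (D j) m g) = pt (D k) m (th j k n g)"
 using ptmD(5)[OF trp bcell] const_map[OF Dc Dc tho bcell] by metis

lemma he_map: "j \<in> J ==> ograph_map (base (D j)) Eb (he j)"
 unfolding ograph_map_def
proof (intro conjI allI ballI)
 fix n x assume j: "j \<in> J" and x: "x \<in> gcell (D j) n"
 show "he j n x \<in> cell Eb n" using Eb_cell[OF TrueI, of _ n n] j x by blast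
next
 fix n x assume j: "j \<in> J" and x: "x \<in> gcell (D j) (Suc n)"
 show "he j n (src (base (D j)) n x) = src Eb n (he j (Suc n) x)" "he j n (tgt (base (D j)) n x) = tgt Eb n (he j (Suc n) x)"
  using const_src[OF Dc[OF j] bcell[OF j x]] unfolding he_def Eb_def by simp_all
qed

lemma th_cell: "j \<in> J ==> k \<in> J ==> le j k ==> g \<in> gcell (D j) n ==> th j k m g \<in> gcell (D k) m"
 using omap_cell[OF tho bcell] .

lemma he_th: "j \<in> J ==> k \<in> J ==> le j k ==> g \<in> gcell (D j) n ==> he k n (th j k n g) = he j n g"
 unfolding he_def using e_tr[OF _ _ _ pt_cell, of j k g n 0] th_pt[of j k g n 0] by simp

lemma he_uniq:
 assumes j: "j \<in> J" "k \<in> J" and g: "g \<in> gcell (D j) n" "g' \<in> gcell (D k) n" and eq: "he j n g = he k n g'"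
 shows "\<exists>l\<in>J. le j l \<and> le k l \<and> th j l n g = th k l n g'"
proof -
 obtain l where l: "l \<in> J" "le j l" "le k l" "tr j l 0 (pt (D j) 0 g) = tr k l 0 (pt (D k) 0 g')"
  using eq e_eq[OF j pt_cell[OF j(1) g(1)] pt_cell[OF j(2) g(2)]] unfolding he_def by blast
 have "pt (D l) 0 (th j l n g) = pt (D l) 0 (th k l n g')"
  using l(4) th_pt[OF j(1) l(1,2) g(1)] th_pt[OF j(2) l(1,3) g(2)] by simp
 hence "th j l n g = th k l n g'"
  using pgD(7)[OF Dp[OF l(1)] bcell[OF l(1) th_cell[OF j(1) l(1,2) g(1)]]]
   pgD(7)[OF Dp[OF l(1)] bcell[OF l(1) th_cell[OF j(2) l(1,3) g(2)]]] by metis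
 thus ?thesis using l by blast
qed

sublocale bd: dircol J le "%j. base (D j)" th Eb he
proof
 show "th j j n x = x" if "j \<in> J" "x \<in> gcell (D j) n" for j n x
  unfolding th_def using tr_refl[OF that(1) pt_cell[OF that]] pgD(7)[OF Dp[OF that(1)] that(2)] by simp
 show "th k l n (th j k n x) = th j l n x" if "j \<in> J" "k \<in> J" "l \<in> J" "le j k" "le k l" "x \<in> gcell (D j) n" for j k l n x
 proof -
  note a = that
  have "pt (D l) n (th k l n (th j k n x)) = pt (D l) n (th j l n x)"
   using th_pt[OF a(1,2,4,6), of n] th_pt[OF a(2,3,5) th_cell[OF a(1,2,4,6)], of n n]
    th_pt[OF a(1,3) le_trans[OF a(1-5)] a(6), of n] tr_trans[OF a(1-5) pt_cell[OF a(1,6), of n]] by simp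
  from arg_cong[OF this, of "cmap (D l) n"] show ?thesis
   using pgD(7)[OF Dp[OF a(3)] th_cell[OF a(2,3,5) th_cell[OF a(1,2,4,6)]]]
    pgD(7)[OF Dp[OF a(3)] th_cell[OF a(1,3) le_trans[OF a(1-5)] a(6)]] by simp
 qed
 show "\<exists>j\<in>J. \<exists>x\<in>gcell (D j) n. he j n x = z" if "z \<in> cell Eb n" for z n using Eb_cell[OF TrueI] that by blast
qed (fact Db const_ograph[OF Eb_const] tho he_map he_th he_uniq)+

definition pbm :: "'j => nat => 'u trm set \<times> 'u => 'u trm set \<times> 'u" where
 "pbm j n = (%(K, x). (Te j n K, e j n x))"

definition E :: "'u ctcat" where
 "E = \<lparr> base = Eb, tot = Et,
   dmap = (%n. pick J (%j. tcell (D j) n) (%j. e j n) (%j x. Th j n (dmap (D j) n x))),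
   cmap = (%n. pick J (%j. tcell (D j) n) (%j. e j n) (%j x. he j n (cmap (D j) n x))),
   pt = (%n. pick J (%j. gcell (D j) n) (%j. he j n) (%j g. e j n (pt (D j) n g))),
   mul = (%n. pick J (%j. pcell (D j) n) (%j. pbm j n) (%j kx. e j n (mul (D j) n kx))),
   contr = (%k z z'. pick J (%j. contractible_pairs (D j) k) (%j (x, y). (e j k x, e j k y))
    (%j (x, y). e j (Suc k) (contr (D j) k x y)) (z, z')) \<rparr>"

lemma E_simps: "base E = Eb" "tot E = Et"
 unfolding E_def by simp_all

lemma E_dmap: "j \<in> J ==> x \<in> tcell (D j) n ==> dmap E n (e j n x) = Th j n (dmap (D j) n x)"
proof -
 assume j: "j \<in> J" "x \<in> tcell (D j) n"
 have "Th k n (dmap (D k) n (tr j k n x)) = Th j n (dmap (D j) n x)"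
  if jk: "j \<in> J" "k \<in> J" "le j k" and x: "x \<in> tcell (D j) n" for j k x
 proof -
  note d = pg_cell(1)[OF Dp[OF jk(1)] x]
  have "Th k n (dmap (D k) n (tr j k n x)) = T_map Eb (%n g. he k n (th j k n g)) n (dmap (D j) n x)"
   unfolding ptmD(3)[OF trp[OF jk] x]
   by (rule T_map_comp[OF Db[OF jk(1)] Db[OF jk(2)] const_ograph[OF Eb_const] tho[OF jk] he_map[OF jk(2)] d])
  also have "\<dots> = Th j n (dmap (D j) n x)"
   by (rule T_map_cong[OF Db[OF jk(1)] d]) (rule he_th[OF jk])
  finally show ?thesis .
 qed
 from pick_nat[OF j, of "%j x. Th j n (dmap (D j) n x)", OF this] show ?thesis unfolding E_def by simp
qed

lemma E_cmap: "j \<in> J ==> x \<in> tcell (D j) n ==> cmap E n (e j n x) = he j n (cmap (D j) n x)"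
proof -
 assume j: "j \<in> J" "x \<in> tcell (D j) n"
 have "he k n (cmap (D k) n (tr j k n x)) = he j n (cmap (D j) n x)"
  if jk: "j \<in> J" "k \<in> J" "le j k" and x: "x \<in> tcell (D j) n" for j k x
  unfolding ptmD(4)[OF trp[OF jk] x] by (rule he_th[OF jk pg_cell(2)[OF Dp[OF jk(1)] x]])
 from pick_nat[OF j, of "%j x. he j n (cmap (D j) n x)", OF this] show ?thesis unfolding E_def by simp
qed

lemma E_pt: "j \<in> J ==> g \<in> gcell (D j) n ==> pt E n (he j n g) = e j n (pt (D j) n g)"
proof -
 assume j: "j \<in> J" "g \<in> gcell (D j) n"
 have "pick J (%j. gcell (D j) n) (%j. he j n) (%j g. e j n (pt (D j) n g)) (he j n g) = e j n (pt (D j) n g)"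
 proof (rule pick_eq)
  fix k g' assume k: "k \<in> J" "g' \<in> gcell (D k) n" "he k n g' = he j n g"
  then obtain l where l: "l \<in> J" "le k l" "le j l" "th k l n g' = th j l n g" using he_uniq[OF k(1) j(1) k(2) j(2)] by blast
  show "e k n (pt (D k) n g') = e j n (pt (D j) n g)"
   unfolding e_eq[OF k(1) j(1) pt_cell[OF k(1,2)] pt_cell[OF j]]
   using l th_pt[OF k(1) l(1,2) k(2), of n] th_pt[OF j(1) l(1,3) j(2), of n] by auto
 qed fact+
 thus ?thesis unfolding E_def by simp
qed

lemma E_ptgraph: "is_ptgraph E"
proof -
 note bo = const_ograph[OF Eb_const]
 have "Et_c": "small U (cell Et n)" for n
 proof -
  have "cell Et n \<subseteq> enc n ` clss n" unfolding clss_def Et_def e_def by auto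
  thus ?thesis using sm_subset[OF sm_image[OF clss_small]] by blast
 qed
 have "cell Eb n \<subseteq> cell Et 0" for n unfolding Eb_def Et_def using pt_cell by auto
 hence Eb_c: "small U (cell Eb n)" for n using sm_subset[OF Et_c] by blast
 have d: "ograph_map Et (T_graph Eb) (dmap E)" unfolding ograph_map_def
 proof (intro conjI allI ballI)
  fix n z assume "z \<in> cell Et n"
  then obtain j x where j: "j \<in> J" "x \<in> tcell (D j) n" "e j n x = z" unfolding Et_cell by blast
  show "dmap E n z \<in> Tcell Eb n" unfolding j(3)[symmetric] E_dmap[OF j(1,2)]
   by (rule T_map_cell[OF Db[OF j(1)] bo he_map[OF j(1)] pg_cell(1)[OF Dp[OF j(1)] j(2)]])
 next
  fix n z assume "z \<in> cell Et (Suc n)"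
  then obtain j x where j: "j \<in> J" "x \<in> tcell (D j) (Suc n)" "e j (Suc n) x = z" unfolding Et_cell by blast
  note dm = pgD(3)[OF Dp[OF j(1)]] and Th = T_map_ograph_map[OF Db[OF j(1)] bo he_map[OF j(1)]]
  note s = ograph_src[OF Do[OF j(1)] j(2)] ograph_tgt[OF Do[OF j(1)] j(2)]
  show "dmap E n (src Et n z) = src (T_graph Eb) n (dmap E (Suc n) z)" "dmap E n (tgt Et n z) = tgt (T_graph Eb) n (dmap E (Suc n) z)"
   unfolding j(3)[symmetric] Et_src[OF j(1,2)] E_dmap[OF j(1) s(1)] E_dmap[OF j(1) s(2)] E_dmap[OF j(1,2)]
   using omap_src[OF dm j(2)] omap_tgt[OF dm j(2)] omap_src[OF Th omap_cell[OF dm j(2)]]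
    omap_tgt[OF Th omap_cell[OF dm j(2)]] by simp_all
 qed
 have c: "ograph_map Et Eb (cmap E)" unfolding ograph_map_def
 proof (intro conjI allI ballI)
  fix n z assume "z \<in> cell Et n"
  then obtain j x where j: "j \<in> J" "x \<in> tcell (D j) n" "e j n x = z" unfolding Et_cell by blast
  show "cmap E n z \<in> cell Eb n" unfolding j(3)[symmetric] E_cmap[OF j(1,2)]
   by (rule omap_cell[OF he_map[OF j(1)] pg_cell(2)[OF Dp[OF j(1)] j(2)]])
 next
  fix n z assume "z \<in> cell Et (Suc n)"
  then obtain j x where j: "j \<in> J" "x \<in> tcell (D j) (Suc n)" "e j (Suc n) x = z" unfolding Et_cell by blast
  note dm = pgD(4)[OF Dp[OF j(1)]]
  note s = ograph_src[OF Do[OF j(1)] j(2)] ograph_tgt[OF Do[OF j(1)] j(2)]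
  show "cmap E n (src Et n z) = src Eb n (cmap E (Suc n) z)" "cmap E n (tgt Et n z) = tgt Eb n (cmap E (Suc n) z)"
   unfolding j(3)[symmetric] Et_src[OF j(1,2)] E_cmap[OF j(1) s(1)] E_cmap[OF j(1) s(2)] E_cmap[OF j(1,2)]
   using omap_src[OF dm j(2)] omap_tgt[OF dm j(2)] omap_src[OF he_map[OF j(1)] omap_cell[OF dm j(2)]]
    omap_tgt[OF he_map[OF j(1)] omap_cell[OF dm j(2)]] by simp_all
 qed
 have p: "ograph_map Eb Et (pt E)" unfolding ograph_map_def
 proof (intro conjI allI ballI)
  fix n z assume "z \<in> cell Eb n"
  then obtain j g where j: "j \<in> J" "g \<in> gcell (D j) n" "he j n g = z" using bd.surj by blast
  show "pt E n z \<in> cell Et n" unfolding j(3)[symmetric] E_pt[OF j(1,2)] Et_cell using j(1) pt_cell[OF j(1,2)] by blast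
 next
  fix n z assume "z \<in> cell Eb (Suc n)"
  then obtain j g where j: "j \<in> J" "g \<in> gcell (D j) (Suc n)" "he j (Suc n) g = z" using bd.surj by blast
  note pm = pgD(5)[OF Dp[OF j(1)]]
  have s: "src (base (D j)) n g = g" "tgt (base (D j)) n g = g" using const_src[OF Dc[OF j(1)] bcell[OF j(1,2)]] by auto
  have "src Eb n z = he j n g" "tgt Eb n z = he j n g" unfolding j(3)[symmetric] he_def Eb_def by simp_all
  thus "pt E n (src Eb n z) = src Et n (pt E (Suc n) z)" "pt E n (tgt Eb n z) = tgt Et n (pt E (Suc n) z)"
   using E_pt[OF j(1) bcell[OF j(1,2)], of n] E_pt[OF j(1,2)] j(3) Et_src[OF j(1) pt_cell[OF j(1,2)]]
    omap_src[OF pm j(2)] omap_tgt[OF pm j(2)] s by simp_all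
 qed
 have "is_tgraph E" unfolding is_tgraph_def E_simps sm_iff by (intro conjI allI bo Et_ograph Et_c Eb_c d c)
 moreover have "dmap E n (pt E n z) = T_unit Eb n z \<and> cmap E n (pt E n z) = z" if z: "z \<in> cell Eb n" for n z
 proof -
  obtain j g where j: "j \<in> J" "g \<in> gcell (D j) n" "he j n g = z" using bd.surj[OF z] by blast
  show ?thesis unfolding j(3)[symmetric] E_pt[OF j(1,2)] E_dmap[OF j(1) pt_cell[OF j(1,2)]] E_cmap[OF j(1) pt_cell[OF j(1,2)]]
   pgD(6,7)[OF Dp[OF j(1)] j(2)] T_map_unit[OF Db[OF j(1)] bo he_map[OF j(1)] j(2)] by simp
 qed
 ultimately show ?thesis unfolding is_ptgraph_def E_simps using p by blast
qed

lemma E_ptm: "j \<in> J ==> ptm (D j) E (e j) (he j)"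
 unfolding ptm_def E_simps using e_map he_map E_dmap E_cmap E_pt by simp

lemma pbm_pbmap: "pbm j = pbmap E (e j)"
 unfolding pbm_def pbmap_def E_simps by auto

end

section \<open>Operations and laws of the directed colimit\<close>

context dirdiag
begin

lemma T_bd:
 assumes "j \<in> J" "k \<in> J" "le j k" "x \<in> tcell (D j) n" "y \<in> tcell (D j) n"
  and "Tb j k n (dmap (D j) n x) = Tb j k n (dmap (D j) n y)"
 shows "dmap (D k) n (tr j k n x) = dmap (D k) n (tr j k n y)"
 using ptmD(3)[OF trp[OF assms(1-3)] assms(4)] ptmD(3)[OF trp[OF assms(1-3)] assms(5)] assms(6) by simp

text \<open>Composability is an equation between cells of T of the base, and T commutes with the
  directed colimit of the bases; so it holds from some stage on.\<close>

lemma pb_tr: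
 assumes j: "j \<in> J" and K: "K \<in> Tcell (tot (D j)) n" and x: "x \<in> tcell (D j) n"
  and p: "(Te j n K, e j n x) \<in> pcell E n"
 shows "ev j (%l. (Tt j l n K, tr j l n x) \<in> pcell (D l) n)"
proof -
 note cm = pgD(4)[OF Dp[OF j]] and bo = const_ograph[OF Eb_const]
 have Kc: "T_map (base (D j)) (cmap (D j)) n K \<in> Tcell (base (D j)) n" using T_map_cell[OF Do[OF j] Db[OF j] cm K] .
 have dx: "dmap (D j) n x \<in> Tcell (base (D j)) n" using pg_cell(1)[OF Dp[OF j] x] .
 note Ec = pgD(4)[OF E_ptgraph, unfolded E_simps]
 have "Th j n (T_map (base (D j)) (cmap (D j)) n K) = T_map Eb (%n x. he j n (cmap (D j) n x)) n K"
  by (rule T_map_comp[OF Do[OF j] Db[OF j] bo cm he_map[OF j] K])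
 also have "\<dots> = T_map Eb (%n x. cmap E n (e j n x)) n K"
  by (rule T_map_cong[OF Do[OF j] K]) (rule E_cmap[OF j, symmetric])
 also have "\<dots> = T_map Eb (cmap E) n (Te j n K)"
  by (rule T_map_comp[OF Do[OF j] Et_ograph bo e_map[OF j] Ec K, symmetric])
 also have "\<dots> = Th j n (dmap (D j) n x)"
  using p unfolding pb_iff E_simps E_dmap[OF j x] by blast
 finally have "ev j (%l. Tb j l n (T_map (base (D j)) (cmap (D j)) n K) = Tb j l n (dmap (D j) n x))"
  by (rule bd.ev_Teq[OF j Kc dx])
 thus ?thesis
 proof (rule ev_mono[OF _ _ j])
  fix l' assume l': "l' \<in> J" "le j l'" and a: "Tb j l' n (T_map (base (D j)) (cmap (D j)) n K) = Tb j l' n (dmap (D j) n x)"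
  have "T_map (base (D l')) (cmap (D l')) n (Tt j l' n K) = T_map (base (D l')) (%n x. cmap (D l') n (tr j l' n x)) n K"
   by (rule T_map_comp[OF Do[OF j] Do[OF l'(1)] Db[OF l'(1)] tro[OF j l'] pgD(4)[OF Dp[OF l'(1)]] K])
  also have "\<dots> = T_map (base (D l')) (%n x. th j l' n (cmap (D j) n x)) n K"
   by (rule T_map_cong[OF Do[OF j] K]) (rule ptmD(4)[OF trp[OF j l']])
  also have "\<dots> = Tb j l' n (T_map (base (D j)) (cmap (D j)) n K)"
   by (rule T_map_comp[OF Do[OF j] Db[OF j] Db[OF l'(1)] cm tho[OF j l'] K, symmetric])
  also have "\<dots> = dmap (D l') n (tr j l' n x)" using a ptmD(3)[OF trp[OF j l'] x] by simp
  finally show "(Tt j l' n K, tr j l' n x) \<in> pcell (D l') n"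
   unfolding pb_iff using T_map_cell[OF Do[OF j] Do[OF l'(1)] tro[OF j l'] K] tr_cell[OF j l' x] by blast
 qed
qed

lemma pb_surj:
 assumes p: "p \<in> pcell E n"
 shows "\<exists>j\<in>J. \<exists>q\<in>pcell (D j) n. pbmap E (e j) n q = p"
proof -
 obtain K x where Kx: "p = (K, x)" "K \<in> Tcell Et n" "x \<in> cell Et n" using p unfolding pullback_def E_simps by auto
 obtain j1 K1 where j1: "j1 \<in> J" "K1 \<in> Tcell (tot (D j1)) n" "Te j1 n K1 = K" using td.T_lift[OF Kx(2)] by blast
 obtain j2 x2 where j2: "j2 \<in> J" "x2 \<in> tcell (D j2) n" "e j2 n x2 = x" using td.surj[OF Kx(3)] by blast
 obtain m where m: "m \<in> J" "le j1 m" "le j2 m" using dir[OF j1(1) j2(1)] by blast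
 let ?K = "Tt j1 m n K1" and ?x = "tr j2 m n x2"
 have K: "?K \<in> Tcell (tot (D m)) n" using T_map_cell[OF Do[OF j1(1)] Do[OF m(1)] tro[OF j1(1) m(1,2)] j1(2)] .
 have x: "?x \<in> tcell (D m) n" using tr_cell[OF j2(1) m(1,3) j2(2)] .
 have eK: "Te m n ?K = K" using td.T_e[OF j1(1) m(1,2) j1(2)] j1(3) by simp
 have ex: "e m n ?x = x" using e_tr[OF j2(1) m(1,3) j2(2)] j2(3) by simp
 obtain l where l: "l \<in> J" "le m l" "(Tt m l n ?K, tr m l n ?x) \<in> pcell (D l) n"
  using ev_ex[OF pb_tr[OF m(1) K x]] p unfolding Kx(1) eK ex by blast
 have "pbmap E (e l) n (Tt m l n ?K, tr m l n ?x) = p"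
  unfolding pbmap_def E_simps prod.case td.T_e[OF m(1) l(1,2) K] e_tr[OF m(1) l(1,2) x] eK ex Kx(1) ..
 thus ?thesis using l by blast
qed

lemma T_uniq:
 assumes j: "j \<in> J" "k \<in> J" and K: "K \<in> Tcell (tot (D j)) n" "K' \<in> Tcell (tot (D k)) n"
  and eq: "Te j n K = Te k n K'"
 shows "\<exists>l\<in>J. le j l \<and> le k l \<and> Tt j l n K = Tt k l n K'"
proof -
 obtain m where m: "m \<in> J" "le j m" "le k m" using dir[OF j] by blast
 let ?K = "Tt j m n K" and ?K' = "Tt k m n K'"
 have Kc: "?K \<in> Tcell (tot (D m)) n" "?K' \<in> Tcell (tot (D m)) n"
  using T_map_cell[OF Do[OF j(1)] Do[OF m(1)] tro[OF j(1) m(1,2)] K(1)] T_map_cell[OF Do[OF j(2)] Do[OF m(1)] tro[OF j(2) m(1,3)] K(2)] .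
 have "Te m n ?K = Te m n ?K'" using td.T_e[OF j(1) m(1,2) K(1)] td.T_e[OF j(2) m(1,3) K(2)] eq by simp
 then obtain l where l: "l \<in> J" "le m l" "Tt m l n ?K = Tt m l n ?K'"
  using ev_ex[OF td.ev_Teq[OF m(1) Kc]] by blast
 have "Tt j l n K = Tt k l n K'"
  using l(3) unfolding td.T_tr[OF j(1) m(1) l(1) m(2) l(2) K(1)] td.T_tr[OF j(2) m(1) l(1) m(3) l(2) K(2)] .
 thus ?thesis using l(1) le_trans[OF j(1) m(1) l(1) m(2) l(2)] le_trans[OF j(2) m(1) l(1) m(3) l(2)] by blast
qed

lemma pb_uniq:
 assumes j: "j \<in> J" "k \<in> J" and p: "p \<in> pcell (D j) n" "q \<in> pcell (D k) n"
  and eq: "pbmap E (e j) n p = pbmap E (e k) n q"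
 shows "\<exists>l\<in>J. le j l \<and> le k l \<and> pbmap (D l) (tr j l) n p = pbmap (D l) (tr k l) n q"
proof -
 obtain K x where Kx: "p = (K, x)" "K \<in> Tcell (tot (D j)) n" "x \<in> tcell (D j) n" using p(1) unfolding pullback_def by auto
 obtain K' y where Ky: "q = (K', y)" "K' \<in> Tcell (tot (D k)) n" "y \<in> tcell (D k) n" using p(2) unfolding pullback_def by auto
 have eqs: "Te j n K = Te k n K'" "e j n x = e k n y" using eq unfolding pbmap_def Kx(1) Ky(1) E_simps by auto
 obtain l1 where l1: "l1 \<in> J" "le j l1" "le k l1" "Tt j l1 n K = Tt k l1 n K'"
  using T_uniq[OF j Kx(2) Ky(2) eqs(1)] by blast
 obtain l2 where l2: "l2 \<in> J" "le j l2" "le k l2" "tr j l2 n x = tr k l2 n y"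
  using td.uniq[OF j Kx(3) Ky(3) eqs(2)] by blast
 obtain l where l: "l \<in> J" "le l1 l" "le l2 l" using dir[OF l1(1) l2(1)] by blast
 have "Tt j l n K = Tt k l n K'"
  using td.T_tr[OF j(1) l1(1) l(1) l1(2) l(2) Kx(2)] td.T_tr[OF j(2) l1(1) l(1) l1(3) l(2) Ky(2)] l1(4) by simp
 moreover have "tr j l n x = tr k l n y"
  using tr_trans[OF j(1) l2(1) l(1) l2(2) l(3) Kx(3)] tr_trans[OF j(2) l2(1) l(1) l2(3) l(3) Ky(3)] l2(4) by simp
 ultimately show ?thesis unfolding Kx(1) Ky(1) pbmap_def
  using l(1) le_trans[OF j(1) l1(1) l(1) l1(2) l(2)] le_trans[OF j(2) l1(1) l(1) l1(3) l(2)] by auto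
qed

text \<open>Pullbacks commute with directed colimits as well. Having this as an instance of
  \<open>dircol\<close> allows T to be applied once more, as needed for the cells on which
  associativity is stated.\<close>

sublocale pd: dircol J le "%j. pullback (D j)" "%j k. pbmap (D k) (tr j k)" "pullback E" "%j. pbmap E (e j)"
proof
 show "ograph_map (pullback (D j)) (pullback (D k)) (pbmap (D k) (tr j k))" if "j \<in> J" "k \<in> J" "le j k" for j k
  by (rule pbmap_ograph_map[OF Dp[OF that(1)] Dp[OF that(2)] trp[OF that]])
 show "ograph_map (pullback (D j)) (pullback E) (pbmap E (e j))" if "j \<in> J" for j
  by (rule pbmap_ograph_map[OF Dp[OF that] E_ptgraph E_ptm[OF that]])
 show "pbmap (D j) (tr j j) n p = p" if "j \<in> J" "p \<in> pcell (D j) n" for j n p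
  using that T_map_ident[OF Do[OF that(1)], of _ n "tr j j"] tr_refl[OF that(1)] unfolding pullback_def pbmap_def by auto
 show "pbmap (D l) (tr k l) n (pbmap (D k) (tr j k) n p) = pbmap (D l) (tr j l) n p"
  if "j \<in> J" "k \<in> J" "l \<in> J" "le j k" "le k l" "p \<in> pcell (D j) n" for j k l n p
  using that(6) td.T_tr[OF that(1-5)] tr_trans[OF that(1-5)] unfolding pullback_def pbmap_def by auto
 show "pbmap E (e k) n (pbmap (D k) (tr j k) n p) = pbmap E (e j) n p"
  if "j \<in> J" "k \<in> J" "le j k" "p \<in> pcell (D j) n" for j k n p
  using that(4) td.T_e[OF that(1-3)] e_tr[OF that(1-3)] unfolding pullback_def pbmap_def E_simps by auto
qed (fact pb_ograph[OF Dp] pb_ograph[OF E_ptgraph] pb_surj pb_uniq)+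

lemma E_mul:
 assumes j: "j \<in> J" and p: "p \<in> pcell (D j) n"
 shows "mul E n (pbmap E (e j) n p) = e j n (mul (D j) n p)"
proof -
 have mt: "e l n (mul (D l) n (pbmap (D l) (tr j l) n p)) = e j n (mul (D j) n p)"
  if "j \<in> J" "l \<in> J" "le j l" "p \<in> pcell (D j) n" for j l p
 proof -
  obtain K x where Kx: "p = (K, x)" by (cases p)
  show ?thesis using ctmD(3)[OF trc[OF that(1-3)] that(4)[unfolded Kx]] e_tr[OF that(1-3) ctobD(9)[OF D[OF that(1)] that(4)[unfolded Kx]]]
   unfolding Kx pbmap_def by simp
 qed
 have "pick J (%j. pcell (D j) n) (%j. pbmap E (e j) n) (%j kx. e j n (mul (D j) n kx)) (pbmap E (e j) n p) = e j n (mul (D j) n p)"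
 proof (rule pick_eq)
  fix k q assume k: "k \<in> J" "q \<in> pcell (D k) n" "pbmap E (e k) n q = pbmap E (e j) n p"
  obtain l where "l \<in> J" "le k l" "le j l" "pbmap (D l) (tr k l) n q = pbmap (D l) (tr j l) n p"
   using pb_uniq[OF k(1) j k(2) p k(3)] by blast
  thus "e k n (mul (D k) n q) = e j n (mul (D j) n p)" using mt[OF k(1) _ _ k(2)] mt[OF j _ _ p] by metis
 qed fact+
 thus ?thesis unfolding pbm_pbmap[symmetric] by (simp add: E_def)
qed

lemma E_con:
 assumes j: "j \<in> J" and p: "(x, y) \<in> contractible_pairs (D j) k"
 shows "contr E k (e j k x) (e j k y) = e j (Suc k) (contr (D j) k x y)"
proof -
 let ?F = "%j (x, y). e j (Suc k) (contr (D j) k x y)" and ?e = "%j (x, y). (e j k x, e j k y)"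
 have ct: "e l (Suc k) (contr (D l) k (tr j l k x) (tr j l k y)) = e j (Suc k) (contr (D j) k x y)"
  if "j \<in> J" "l \<in> J" "le j l" "(x, y) \<in> contractible_pairs (D j) k" for j l x y
  using ctmD(4)[OF trc[OF that(1-3)] that(4)] e_tr[OF that(1-3) ctobD(5)[OF D[OF that(1)] that(4)]] by simp
 have "pick J (%j. contractible_pairs (D j) k) ?e ?F (?e j (x, y)) = ?F j (x, y)"
 proof (rule pick_eq)
  fix m q assume m: "m \<in> J" "q \<in> contractible_pairs (D m) k" "?e m q = ?e j (x, y)"
  obtain x' y' where q: "q = (x', y')" by (cases q)
  have c: "x' \<in> tcell (D m) k" "y' \<in> tcell (D m) k" "x \<in> tcell (D j) k" "y \<in> tcell (D j) k"
   using contractible_cells[OF m(2)[unfolded q]] contractible_cells[OF p] by auto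
  obtain l1 where l1: "l1 \<in> J" "le m l1" "le j l1" "tr m l1 k x' = tr j l1 k x"
   using td.uniq[OF m(1) j c(1,3)] m(3) q by auto
  obtain l2 where l2: "l2 \<in> J" "le m l2" "le j l2" "tr m l2 k y' = tr j l2 k y"
   using td.uniq[OF m(1) j c(2,4)] m(3) q by auto
  obtain l where l: "l \<in> J" "le l1 l" "le l2 l" using dir[OF l1(1) l2(1)] by blast
  have "tr m l k x' = tr j l k x" "tr m l k y' = tr j l k y"
   using tr_trans[OF m(1) l1(1) l(1) l1(2) l(2) c(1)] tr_trans[OF j l1(1) l(1) l1(3) l(2) c(3)] l1(4)
    tr_trans[OF m(1) l2(1) l(1) l2(2) l(3) c(2)] tr_trans[OF j l2(1) l(1) l2(3) l(3) c(4)] l2(4) by simp_all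
  thus "?F m q = ?F j (x, y)"
   using ct[OF m(1) l(1) le_trans[OF m(1) l1(1) l(1) l1(2) l(2)] m(2)[unfolded q]] ct[OF j l(1) le_trans[OF j l1(1) l(1) l1(3) l(2)] p]
   unfolding q by simp
 qed fact+
 thus ?thesis by (simp add: E_def)
qed

lemma E_ctm: "j \<in> J ==> ctm (D j) E (e j) (he j)"
proof -
 assume j: "j \<in> J"
 have "e j n (mul (D j) n (K, x)) = mul E n (T_map (tot E) (e j) n K, e j n x)" if "(K, x) \<in> pcell (D j) n" for n K x
  using E_mul[OF j that] unfolding pbmap_def by simp
 thus ?thesis unfolding ctm_def mulm_def using E_ptm[OF j] E_con[OF j] by simp
qed

text \<open>Equality of faces, of values of d and of 0-boundaries each holds from some stage on. The
  hypothesis of the implication for roots can be decided in advance, since being a root depends on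
  the shape and is the same at all stages and in the colimit.\<close>

lemma con_ev:
 assumes m: "m \<in> J" and x: "x \<in> tcell (D m) k" "y \<in> tcell (D m) k"
  and c: "(e m k x, e m k y) \<in> contractible_pairs E k"
 shows "ev m (%l. (tr m l k x, tr m l k y) \<in> contractible_pairs (D l) k)"
proof (cases k)
 case 0
 hence "e m 0 x = e m 0 y" using c unfolding contractible_pairs_def by simp
 hence "ev m (%l. tr m l 0 x = tr m l 0 y)" using td.ev_eq[OF m] x 0 by simp
 thus ?thesis
  by (rule ev_mono[OF _ _ m]) (use tr_cell[OF m _ _ x(1)] tr_cell[OF m _ _ x(2)] 0 in \<open>auto simp: contractible_pairs_def\<close>)
next
 case (Suc i)
 have xi: "x \<in> tcell (D m) (Suc i)" "y \<in> tcell (D m) (Suc i)" using x Suc by auto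
 note sx = ograph_src[OF Do[OF m] xi(1)] ograph_tgt[OF Do[OF m] xi(1)] ograph_src[OF Do[OF m] xi(2)] ograph_tgt[OF Do[OF m] xi(2)]
 have par: "parallel Et k (e m k x) (e m k y)" and d: "dmap E k (e m k x) = dmap E k (e m k y)"
  and lp: "root_cell E k (e m k x) \<and> root_cell E k (e m k y) --> loop_property E k (e m k x) (e m k y)"
  using c Suc unfolding contractible_pairs_def E_simps by auto
 have "e m i (src (tot (D m)) i x) = e m i (src (tot (D m)) i y)" "e m i (tgt (tot (D m)) i x) = e m i (tgt (tot (D m)) i y)"
  using par Suc Et_src[OF m xi(1)] Et_src[OF m xi(2)] unfolding parallel_def by auto
 note p = td.ev_eq[OF m sx(1,3) this(1)] td.ev_eq[OF m sx(2,4) this(2)]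
 have "Th m k (dmap (D m) k x) = Th m k (dmap (D m) k y)" using d E_dmap[OF m x(1)] E_dmap[OF m x(2)] by simp
 from bd.ev_Teq[OF m pg_cell(1)[OF Dp[OF m] x(1)] pg_cell(1)[OF Dp[OF m] x(2)] this]
 have "ev m (%l. Tb m l k (dmap (D m) k x) = Tb m l k (dmap (D m) k y))"
  .
 hence dd: "ev m (%l. dmap (D l) k (tr m l k x) = dmap (D l) k (tr m l k y))"
  by (rule ev_mono[OF _ _ m]) (rule T_bd[OF m _ _ x])
 note Ec = E_ptgraph Eb_const[folded E_simps(1)]
 have ec: "e m k x \<in> tcell E k" "e m k y \<in> tcell E k" unfolding E_simps using omap_cell[OF e_map[OF m]] x by auto
 have k1: "k \<ge> 1" using Suc by simp
 have rt: "root_cell (D l) k (tr m l k z) \<longleftrightarrow> root_cell E k (e m k z)" if l: "l \<in> J" "le m l" and z: "z \<in> tcell (D m) k" for l z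
  using root_iff[OF Dp[OF l(1)] Dc[OF l(1)] tr_cell[OF m l z] k1]
   root_iff[OF Ec _ k1, of "e m k z"] omap_cell[OF e_map[OF m] z]
   ptm_shape[OF Dp[OF m] Dp[OF l(1)] trp[OF m l] z] ptm_shape[OF Dp[OF m] E_ptgraph E_ptm[OF m] z] unfolding E_simps by simp
 have lo: "ev m (%l. root_cell (D l) k (tr m l k x) \<and> root_cell (D l) k (tr m l k y) --> loop_property (D l) k (tr m l k x) (tr m l k y))"
 proof (cases "root_cell E k (e m k x) \<and> root_cell E k (e m k y)")
  case False
  thus ?thesis using rt[OF _ _ x(1)] rt[OF _ _ x(2)] by (intro ev_always[OF m]) blast
 next
  case True
  hence l: "loop_property E k (e m k x) (e m k y)" using lp by blast
  note s = src0_map[OF Do[OF m] e_map[OF m] x(1)] src0_map[OF Do[OF m] e_map[OF m] x(2)]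
  note cc = src0_cell[OF Do[OF m] x(1)] src0_cell[OF Do[OF m] x(2)]
  have "e m 0 (src0 (tot (D m)) k x) = e m 0 (src0 (tot (D m)) k y)"
   "e m 0 (src0 (tot (D m)) k y) = e m 0 (tgt0 (tot (D m)) k x)"
   "e m 0 (tgt0 (tot (D m)) k x) = e m 0 (tgt0 (tot (D m)) k y)"
   using l s unfolding loop_property_def E_simps by simp_all
  note q = td.ev_eq[OF m conjunct1[OF cc(1)] conjunct1[OF cc(2)] this(1)]
   td.ev_eq[OF m conjunct1[OF cc(2)] conjunct2[OF cc(1)] this(2)]
   td.ev_eq[OF m conjunct2[OF cc(1)] conjunct2[OF cc(2)] this(3)]
  from ev_conj[OF m q(1) ev_conj[OF m q(2,3)]] show ?thesis
  proof (rule ev_mono[OF _ _ m])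
   fix l assume l: "l \<in> J" "le m l" and h: "tr m l 0 (src0 (tot (D m)) k x) = tr m l 0 (src0 (tot (D m)) k y) \<and>
    tr m l 0 (src0 (tot (D m)) k y) = tr m l 0 (tgt0 (tot (D m)) k x) \<and>
    tr m l 0 (tgt0 (tot (D m)) k x) = tr m l 0 (tgt0 (tot (D m)) k y)"
   show "root_cell (D l) k (tr m l k x) \<and> root_cell (D l) k (tr m l k y) --> loop_property (D l) k (tr m l k x) (tr m l k y)"
    using h src0_map[OF Do[OF m] tro[OF m l] x(1)] src0_map[OF Do[OF m] tro[OF m l] x(2)] unfolding loop_property_def by metis
  qed
 qed
 from ev_conj[OF m ev_conj[OF m p(1) p(2)] ev_conj[OF m dd lo]] show ?thesis
 proof (rule ev_mono[OF _ _ m])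
  fix l assume l: "l \<in> J" "le m l"
   and h: "(tr m l i (src (tot (D m)) i x) = tr m l i (src (tot (D m)) i y) \<and> tr m l i (tgt (tot (D m)) i x) = tr m l i (tgt (tot (D m)) i y)) \<and>
    dmap (D l) k (tr m l k x) = dmap (D l) k (tr m l k y) \<and>
    (root_cell (D l) k (tr m l k x) \<and> root_cell (D l) k (tr m l k y) --> loop_property (D l) k (tr m l k x) (tr m l k y))"
  have c: "tr m l k x \<in> tcell (D l) k" "tr m l k y \<in> tcell (D l) k" using tr_cell[OF m l] x by auto
  have "parallel (tot (D l)) k (tr m l k x) (tr m l k y)"
   using c h Suc omap_src[OF tro[OF m l] xi(1)] omap_src[OF tro[OF m l] xi(2)]
    omap_tgt[OF tro[OF m l] xi(1)] omap_tgt[OF tro[OF m l] xi(2)] unfolding parallel_def by auto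
  thus "(tr m l k x, tr m l k y) \<in> contractible_pairs (D l) k"
   using c h Suc unfolding contractible_pairs_def by simp
 qed
qed

lemma pair_lift:
 assumes "z \<in> cell Et n" "w \<in> cell Et k"
 shows "\<exists>m\<in>J. \<exists>x\<in>tcell (D m) n. \<exists>y\<in>tcell (D m) k. e m n x = z \<and> e m k y = w"
proof -
 obtain j x where j: "j \<in> J" "x \<in> tcell (D j) n" "e j n x = z" using td.surj[OF assms(1)] by blast
 obtain l y where l: "l \<in> J" "y \<in> tcell (D l) k" "e l k y = w" using td.surj[OF assms(2)] by blast
 obtain m where m: "m \<in> J" "le j m" "le l m" using dir[OF j(1) l(1)] by blast
 show ?thesis using m(1) tr_cell[OF j(1) m(1,2) j(2)] tr_cell[OF l(1) m(1,3) l(2)] e_tr[OF j(1) m(1,2) j(2)] e_tr[OF l(1) m(1,3) l(2)] j(3) l(3) by metis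
qed

lemma con_lift:
 assumes c: "(z, w) \<in> contractible_pairs E k"
 shows "\<exists>j\<in>J. \<exists>x y. (x, y) \<in> contractible_pairs (D j) k \<and> e j k x = z \<and> e j k y = w"
proof -
 have "z \<in> cell Et k" "w \<in> cell Et k" using contractible_cells[OF c] unfolding E_simps by auto
 from pair_lift[OF this] obtain m x y where m: "m \<in> J" and x: "x \<in> tcell (D m) k" "y \<in> tcell (D m) k" and eq: "e m k x = z" "e m k y = w" by blast
 obtain l where l: "l \<in> J" "le m l" "(tr m l k x, tr m l k y) \<in> contractible_pairs (D l) k"
  using ev_ex[OF con_ev[OF m x]] c unfolding eq by blast
 show ?thesis using l(1,3) e_tr[OF m l(1,2) x(1)] e_tr[OF m l(1,2) x(2)] eq by blast
qed

text \<open>\<open>tht\<close> and x are lifted to one stage; their compatibility, an equation in T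
  of the base, then holds at a later one.\<close>

lemma assoc_lift:
 assumes tht: "tht \<in> Tcell (pullback E) n" and x: "x \<in> cell Et n"
  and eq: "T_map Eb (%i Kx. cmap E i (snd Kx)) n tht = dmap E n x"
 shows "\<exists>j\<in>J. \<exists>tht'\<in>Tcell (pullback (D j)) n. \<exists>x'\<in>tcell (D j) n.
     T_map (base (D j)) (%i Kx. cmap (D j) i (snd Kx)) n tht' = dmap (D j) n x' \<and>
     T_map (pullback E) (pbmap E (e j)) n tht' = tht \<and> e j n x' = x"
proof -
 obtain j1 t1 where j1: "j1 \<in> J" "t1 \<in> Tcell (pullback (D j1)) n" "T_map (pullback E) (pbmap E (e j1)) n t1 = tht"
  using pd.T_lift[OF tht] by blast
 obtain j2 x2 where j2: "j2 \<in> J" "x2 \<in> tcell (D j2) n" "e j2 n x2 = x" using td.surj[OF x] by blast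
 obtain m where m: "m \<in> J" "le j1 m" "le j2 m" using dir[OF j1(1) j2(1)] by blast
 define t y where "t = T_map (pullback (D m)) (pbmap (D m) (tr j1 m)) n t1" and "y = tr j2 m n x2"
 have t: "t \<in> Tcell (pullback (D m)) n" unfolding t_def using T_map_cell[OF pd.X[OF j1(1)] pd.X[OF m(1)] pd.tr[OF j1(1) m(1,2)] j1(2)] .
 have y: "y \<in> tcell (D m) n" unfolding y_def using tr_cell[OF j2(1) m(1,3) j2(2)] .
 have et: "T_map (pullback E) (pbmap E (e m)) n t = tht" unfolding t_def using pd.T_e[OF j1(1) m(1,2) j1(2)] j1(3) by simp
 have ey: "e m n y = x" unfolding y_def using e_tr[OF j2(1) m(1,3) j2(2)] j2(3) by simp
 have cs: "ograph_map (pullback (D j)) (base (D j)) (%i Kx. cmap (D j) i (snd Kx))" if "j \<in> J" for j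
  using ograph_map_comp[OF snd_ograph_map pgD(4)[OF Dp[OF that]]] .
 have csE: "ograph_map (pullback E) Eb (%i Kx. cmap E i (snd Kx))"
  using ograph_map_comp[OF snd_ograph_map pgD(4)[OF E_ptgraph]] unfolding E_simps .
 note bo = const_ograph[OF Eb_const]
 have pbs: "p \<in> pcell (D j) i ==> snd p \<in> tcell (D j) i" for p j i unfolding pullback_def by auto
 have "Th m n (T_map (base (D m)) (%i Kx. cmap (D m) i (snd Kx)) n t) = T_map Eb (%i Kx. he m i (cmap (D m) i (snd Kx))) n t"
  by (rule T_map_comp[OF pd.X[OF m(1)] Db[OF m(1)] bo cs[OF m(1)] he_map[OF m(1)] t])
 also have "\<dots> = T_map Eb (%i Kx. cmap E i (snd (pbmap E (e m) i Kx))) n t"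
  by (rule T_map_cong[OF pd.X[OF m(1)] t]) (use E_cmap[OF m(1) pbs] in \<open>simp add: pbmap_def case_prod_beta\<close>)
 also have "\<dots> = T_map Eb (%i Kx. cmap E i (snd Kx)) n (T_map (pullback E) (pbmap E (e m)) n t)"
  by (rule T_map_comp[OF pd.X[OF m(1)] pd.Z bo pd.e[OF m(1)] csE t, symmetric])
 also have "\<dots> = Th m n (dmap (D m) n y)" unfolding et eq ey[symmetric] by (rule E_dmap[OF m(1) y])
 finally obtain l where l: "l \<in> J" "le m l" and le: "Tb m l n (T_map (base (D m)) (%i Kx. cmap (D m) i (snd Kx)) n t) =
   Tb m l n (dmap (D m) n y)"
  using ev_ex[OF bd.ev_Teq[OF m(1) T_map_cell[OF pd.X[OF m(1)] Db[OF m(1)] cs[OF m(1)] t] pg_cell(1)[OF Dp[OF m(1)] y]]] by blast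
 let ?t = "T_map (pullback (D l)) (pbmap (D l) (tr m l)) n t"
 have "T_map (base (D l)) (%i Kx. cmap (D l) i (snd Kx)) n ?t = T_map (base (D l)) (%i Kx. cmap (D l) i (snd (pbmap (D l) (tr m l) i Kx))) n t"
  by (rule T_map_comp[OF pd.X[OF m(1)] pd.X[OF l(1)] Db[OF l(1)] pd.tr[OF m(1) l] cs[OF l(1)] t])
 also have "\<dots> = T_map (base (D l)) (%i Kx. th m l i (cmap (D m) i (snd Kx))) n t"
  by (rule T_map_cong[OF pd.X[OF m(1)] t]) (use ptmD(4)[OF trp[OF m(1) l] pbs] in \<open>simp add: pbmap_def case_prod_beta\<close>)
 also have "\<dots> = Tb m l n (T_map (base (D m)) (%i Kx. cmap (D m) i (snd Kx)) n t)"
  by (rule T_map_comp[OF pd.X[OF m(1)] Db[OF m(1)] Db[OF l(1)] cs[OF m(1)] tho[OF m(1) l] t, symmetric])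
 also have "\<dots> = dmap (D l) n (tr m l n y)" unfolding le ptmD(3)[OF trp[OF m(1) l] y] ..
 finally show ?thesis
  using l(1) T_map_cell[OF pd.X[OF m(1)] pd.X[OF l(1)] pd.tr[OF m(1) l] t] tr_cell[OF m(1) l y]
   pd.T_e[OF m(1) l t] et e_tr[OF m(1) l y] ey by blast
qed

text \<open>Every instance of an axiom has finitely many ingredients and so comes from one stage,
  which is what \<open>final_lift\<close> asks for.\<close>

theorem E_object: "ctob E"
proof (rule final_lift[of E J D e he])
 show "is_ptgraph E" by (rule E_ptgraph)
 show "constant_ograph (base E)" unfolding E_simps by (rule Eb_const)
 show "ctob (D j)" if "j \<in> J" for j by (rule D[OF that])
 show "ctm (D j) E (e j) (he j)" if "j \<in> J" for j by (rule E_ctm[OF that])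
 show "\<exists>j\<in>J. \<exists>x'\<in>tcell (D j) n. e j n x' = x" if "x \<in> tcell E n" for n x using td.surj that unfolding E_simps .
 show "\<exists>j\<in>J. \<exists>kx'\<in>pcell (D j) n. pbmap E (e j) n kx' = kx" if "kx \<in> pcell E n" for n kx by (rule pb_surj[OF that])
 show "\<exists>j\<in>J. \<exists>tht'\<in>Tcell (pullback (D j)) n. \<exists>x'\<in>tcell (D j) n.
     T_map (base (D j)) (%i Kx. cmap (D j) i (snd Kx)) n tht' = dmap (D j) n x' \<and>
     T_map (pullback E) (pbmap E (e j)) n tht' = tht \<and> e j n x' = x"
  if "tht \<in> Tcell (pullback E) n" "x \<in> tcell E n" "T_map (base E) (%i Kx. cmap E i (snd Kx)) n tht = dmap E n x" for n tht x
  using assoc_lift[OF that(1) that(2,3)[unfolded E_simps]] .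
 show "\<exists>j\<in>J. \<exists>x' y'. (x', y') \<in> contractible_pairs (D j) k \<and> e j k x' = x \<and> e j k y' = y"
  if "(x, y) \<in> contractible_pairs E k" for k x y by (rule con_lift[OF that])
qed

end

lemma ctm_comp:
 assumes A: "ctob A" and B: "ctob B" and C: "ctob C" and f: "ctm A B f h" and f': "ctm B C f' h'"
 shows "ctm A C (%n x. f' n (f n x)) (%n x. h' n (h n x))"
proof -
 note p = ctobD(3)[OF A] ctobD(3)[OF B] ctobD(3)[OF C] ctmD(2)[OF f] ctmD(2)[OF f']
 have "f' n (f n (mul A n (K, x))) = mul C n (T_map (tot C) (%n x. f' n (f n x)) n K, f' n (f n x))" if k: "(K, x) \<in> pcell A n" for n K x
 proof -
  have "T_map (tot C) f' n (T_map (tot B) f n K) = T_map (tot C) (%n x. f' n (f n x)) n K"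
   by (rule T_map_comp[OF pgD(2)[OF p(1)] pgD(2)[OF p(2)] pgD(2)[OF p(3)] ptmD(1)[OF p(4)] ptmD(1)[OF p(5)]]) (use k in \<open>simp add: pb_iff\<close>)
  thus ?thesis using ctmD(3)[OF f k] ctmD(3)[OF f' pb_map_cell[OF p(1,2,4) k]] by simp
 qed
 moreover have "f' (Suc k) (f (Suc k) (contr A k x y)) = contr C k (f' k (f k x)) (f' k (f k y))" if c: "(x, y) \<in> contractible_pairs A k" for k x y
  using ctmD(4)[OF f c] ctmD(4)[OF f' contractible_push[OF ctobD(3,4)[OF A] ctobD(3,4)[OF B] p(4) c]] by simp
 ultimately show ?thesis unfolding ctm_def mulm_def using ptm_comp[OF p] by blast
qed

section \<open>Universal property of the colimit and finite presentability\<close>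

context dirdiag
begin

lemma holds_ev:
 assumes j: "j \<in> J" and a: "!!n v. (n, v) \<in> av al ==> a n v \<in> tcell (D j) n"
  and l: "l \<in> J" "le j l" and h: "holds (D l) (%n v. tr j l n (a n v)) al"
 shows "ev j (%l. holds (D l) (%n v. tr j l n (a n v)) al)"
 unfolding ev_def
proof (intro bexI[of _ l] conjI ballI impI)
 fix m assume m: "m \<in> J" "le l m"
 have "holds (D m) (%n v. tr l m n (tr j l n (a n v))) al" by (rule holds_push[OF D[OF l(1)] D[OF m(1)] trc[OF l(1) m] h])
 thus "holds (D m) (%n v. tr j m n (a n v)) al"
  using holds_cong[of al "%n v. tr l m n (tr j l n (a n v))" "%n v. tr j m n (a n v)"] tr_trans[OF j l(1) m(1) l(2) m(2) a] by blast
qed (use l in auto)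

text \<open>Side conditions become true at a later stage first; only then does the operation make
  sense there, and the equation between its value and the named cell can be moved to a still later
  stage.\<close>

lemma holds_stage:
 assumes j: "j \<in> J" and a: "!!n v. (n, v) \<in> av al ==> a n v \<in> tcell (D j) n" and h: "holds E (%n v. e j n (a n v)) al"
 shows "\<exists>l\<in>J. le j l \<and> holds (D l) (%n v. tr j l n (a n v)) al"
proof (cases al)
 case (AU om n w v v')
 note Ep = E_ptgraph Eb_const[folded E_simps(1)]
 have c: "a n v \<in> tcell (D j) n" "a (odim om n) v' \<in> tcell (D j) (odim om n)" using a AU by auto
 have "e j (odim om n) (a (odim om n) v') = e j (odim om n) (ap (D j) om n (a n v))"
  using h AU ap_map[OF Dp[OF j] Dc[OF j] Ep E_ptm[OF j] c(1)] by simp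
 from td.uniq1[OF j c(2) ap_cell[OF Dp[OF j] Dc[OF j] c(1)] this]
 obtain l where l: "l \<in> J" "le j l" "tr j l (odim om n) (a (odim om n) v') = tr j l (odim om n) (ap (D j) om n (a n v))" by blast
 have "holds (D l) (%n v. tr j l n (a n v)) al"
  using AU h l(3) ap_map[OF Dp[OF j] Dc[OF j] Dp[OF l(1)] Dc[OF l(1)] trp[OF j l(1,2)] c(1)] tr_cell[OF j l(1,2) c(1)]
   ptm_shape[OF Dp[OF j] Dp[OF l(1)] trp[OF j l(1,2)] c(1)] ptm_shape[OF Dp[OF j] Ep(1) E_ptm[OF j] c(1)] by simp
 thus ?thesis using l by blast
next
 case (AM n t v v')
 let ?t = "tmap a t"
 have c: "a n v \<in> tcell (D j) n" "a n v' \<in> tcell (D j) n" "inc (tot (D j)) ?t"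
  using a AM unfolding inc_def tlv_tmap by auto
 have p: "(cl Et n (tmap (e j) ?t), e j n (a n v)) \<in> pcell E n"
  and m: "e j n (a n v') = mul E n (cl Et n (tmap (e j) ?t), e j n (a n v))" using h AM by (simp_all add: tmap_tmap E_simps)
 have "teq Et n (tmap (e j) ?t) (tmap (e j) ?t)" using p cl_wf unfolding pb_iff E_simps by blast
 \<comment> \<open>Three successive stages: at k the term is well formed, at l the pair is
   composable, at m the product has the right value.\<close>
 from ev_ex[OF td.ev_teq[OF j c(3,3) this]] obtain k where k: "k \<in> J" "le j k" "teq (tot (D k)) n (tmap (tr j k) ?t) (tmap (tr j k) ?t)" by blast
 have T: "Tt k l n (cl (tot (D k)) n (tmap (tr j k) ?t)) = cl (tot (D l)) n (tmap (tr j l) ?t)" if "l \<in> J" "le k l" for l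
  using T_map_cl[OF Do[OF k(1)] Do[OF that(1)] tro[OF k(1) that] k(3)] td.tm_tr[OF j k(1) that(1) k(2) that(2) c(3)] by simp
 have TE: "Te k n (cl (tot (D k)) n (tmap (tr j k) ?t)) = cl Et n (tmap (e j) ?t)"
  using T_map_cl[OF Do[OF k(1)] Et_ograph e_map[OF k(1)] k(3)] td.tm_e[OF j k(1,2) c(3)] by simp
 have "(Te k n (cl (tot (D k)) n (tmap (tr j k) ?t)), e k n (tr j k n (a n v))) \<in> pcell E n"
  unfolding TE e_tr[OF j k(1,2) c(1)] by (rule p)
 from ev_ex[OF pb_tr[OF k(1) T_cellI[OF k(3)] tr_cell[OF j k(1,2) c(1)] this]]
 obtain l where l: "l \<in> J" "le k l" and q: "(cl (tot (D l)) n (tmap (tr j l) ?t), tr j l n (a n v)) \<in> pcell (D l) n"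
  using T tr_trans[OF j k(1) _ k(2) _ c(1)] by auto
 have jl: "le j l" by (rule le_trans[OF j k(1) l(1) k(2) l(2)])
 have Tl: "Tt l m n (cl (tot (D l)) n (tmap (tr j l) ?t)) = cl (tot (D m)) n (tmap (tr j m) ?t)" if "m \<in> J" "le l m" for m
  using td.T_tr[OF k(1) l(1) that(1) l(2) that(2) T_cellI[OF k(3)]] T[OF l] T[OF that(1) le_trans[OF k(1) l(1) that(1) l(2) that(2)]] by simp
 have "Te l n (cl (tot (D l)) n (tmap (tr j l) ?t)) = cl Et n (tmap (e j) ?t)"
  using td.T_e[OF k(1) l T_cellI[OF k(3)]] T[OF l] TE by simp
 hence "e l n (tr j l n (a n v')) = e l n (mul (D l) n (cl (tot (D l)) n (tmap (tr j l) ?t), tr j l n (a n v)))"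
  using E_mul[OF l(1) q] m e_tr[OF j l(1) jl c(1)] e_tr[OF j l(1) jl c(2)] by (simp add: pbmap_def E_simps)
 from td.uniq1[OF l(1) tr_cell[OF j l(1) jl c(2)] ctobD(9)[OF D[OF l(1)] q] this]
 obtain m where m: "m \<in> J" "le l m" and eq: "tr l m n (tr j l n (a n v')) = tr l m n (mul (D l) n (cl (tot (D l)) n (tmap (tr j l) ?t), tr j l n (a n v)))" by blast
 have "holds (D m) (%n v. tr j m n (a n v)) al"
  using eq ctmD(3)[OF trc[OF l(1) m] q] pb_map_cell[OF Dp[OF l(1)] Dp[OF m(1)] trp[OF l(1) m] q] Tl[OF m] AM
   tr_trans[OF j l(1) m(1) jl m(2) c(1)] tr_trans[OF j l(1) m(1) jl m(2) c(2)] by (simp add: tmap_tmap)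
 thus ?thesis using m le_trans[OF j l(1) m(1) jl m(2)] by blast
next
 case (AC k v v' v'')
 have c: "a k v \<in> tcell (D j) k" "a k v' \<in> tcell (D j) k" "a (Suc k) v'' \<in> tcell (D j) (Suc k)" using a AC by auto
 have p: "(e j k (a k v), e j k (a k v')) \<in> contractible_pairs E k"
  and m: "e j (Suc k) (a (Suc k) v'') = contr E k (e j k (a k v)) (e j k (a k v'))" using h AC by simp_all
 from ev_ex[OF con_ev[OF j c(1,2) p]] obtain l where l: "l \<in> J" "le j l" and q: "(tr j l k (a k v), tr j l k (a k v')) \<in> contractible_pairs (D l) k" by blast
 have "e l (Suc k) (tr j l (Suc k) (a (Suc k) v'')) = e l (Suc k) (contr (D l) k (tr j l k (a k v)) (tr j l k (a k v')))"
  using E_con[OF l(1) q] m e_tr[OF j l c(1)] e_tr[OF j l c(2)] e_tr[OF j l c(3)] by simp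
 from td.uniq1[OF l(1) tr_cell[OF j l c(3)] ctobD(5)[OF D[OF l(1)] q] this]
 obtain m where m: "m \<in> J" "le l m" and eq: "tr l m (Suc k) (tr j l (Suc k) (a (Suc k) v'')) = tr l m (Suc k) (contr (D l) k (tr j l k (a k v)) (tr j l k (a k v')))" by blast
 have "holds (D m) (%n v. tr j m n (a n v)) al"
  using eq ctmD(4)[OF trc[OF l(1) m] q] contractible_push[OF Dp[OF l(1)] Dc[OF l(1)] Dp[OF m(1)] Dc[OF m(1)] trp[OF l(1) m] q] AC
   tr_trans[OF j l(1) m(1) l(2) m(2) c(1)] tr_trans[OF j l(1) m(1) l(2) m(2) c(2)] tr_trans[OF j l(1) m(1) l(2) m(2) c(3)] by simp
 thus ?thesis using m le_trans[OF j l(1) m(1) l(2) m(2)] by blast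
qed

text \<open>The function g induced on germs solves the tautological presentation of E: the finitely
  many cells of an equation come from one stage, the equation holds at a later one, and
  \<open>ka\<close> sends it to N.\<close>

theorem E_desc:
 assumes N: "ctob N" and ka: "!!j. j \<in> J ==> \<exists>l. ctm (D j) N (ka j) l"
  and kat: "!!j k n x. j \<in> J ==> k \<in> J ==> le j k ==> x \<in> tcell (D j) n ==> ka k n (tr j k n x) = ka j n x"
 shows "\<exists>g k. ctm E N g k \<and> (\<forall>j\<in>J. \<forall>n. \<forall>x\<in>tcell (D j) n. g n (e j n x) = ka j n x)"
proof -
 define g where "g n = pick J (%j. tcell (D j) n) (%j. e j n) (%j. ka j n)" for n
 have ge: "g n (e j n x) = ka j n x" if "j \<in> J" "x \<in> tcell (D j) n" for j n x
  unfolding g_def by (rule pick_nat[OF that]) (rule kat)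
 have "holds N g al" if al: "al \<in> tru E" for al
 proof -
  have h: "holds E (%_ v. v) al" using al unfolding tru_def by blast
  obtain j where j: "j \<in> J" and s: "\<forall>(n, z)\<in>av al. \<exists>x\<in>tcell (D j) n. e j n x = z"
   using td.common_stage[OF finite_av[of al]] holds_cell[OF E_object h] unfolding E_simps by blast
  define a where "a n z = (SOME x. x \<in> tcell (D j) n \<and> e j n x = z)" for n z
  have a: "a n z \<in> tcell (D j) n \<and> e j n (a n z) = z" if "(n, z) \<in> av al" for n z
   unfolding a_def by (rule someI_ex) (use bspec[OF s that] in auto)
  have "holds E (%n v. e j n (a n v)) al" using h holds_cong[of al "%_ v. v" "%n v. e j n (a n v)"] a by simp
  from holds_stage[OF j _ this] a obtain l where l: "l \<in> J" "le j l" "holds (D l) (%n v. tr j l n (a n v)) al" by blast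
  obtain h' where h': "ctm (D l) N (ka l) h'" using ka[OF l(1)] by blast
  have "ka l n (tr j l n (a n v)) = g n v" if v: "(n, v) \<in> av al" for n v
   using kat[OF j l(1,2), of "a n v" n] ge[OF j, of "a n v" n] a[OF v] by simp
  thus ?thesis
   using holds_push[OF D[OF l(1)] N h' l(3)] holds_cong[of al "%n v. ka l n (tr j l n (a n v))" g] by blast
 qed
 from holds_imp_ctm[OF E_object N this] show ?thesis using ge by blast
qed

text \<open>The images of the finitely many declared variables come from one stage, and the finitely
  many equations hold at a later one. The solution found there is the factorization.\<close>

theorem factor:
 assumes r: "represents R Q u" and fin: "finite R" and g: "ctm Q E g k"
 shows "\<exists>j\<in>J. \<exists>q h. ctm Q (D j) q h \<and> agree Q (%n x. e j n (q n x)) g"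
proof -
 have Q: "ctob Q" and h: "\<forall>al\<in>R. holds Q u al" and avd: "!!al. al \<in> R ==> av al \<subseteq> decl R"
  using r unfolding represents_def pres_def by auto
 have uc: "u n v \<in> tcell Q n" if "(n, v) \<in> decl R" for n v using that h unfolding decl_def by force
 let ?W = "(%(n, v). (n, g n (u n v))) ` decl R"
 have "\<exists>j\<in>J. \<forall>(n, z)\<in>?W. \<exists>x\<in>tcell (D j) n. e j n x = z"
  by (rule td.common_stage) (use finite_decl[OF fin] omap_cell[OF ptmD(1)[OF ctmD(2)[OF g]]] uc E_simps in auto)
 then obtain j where j: "j \<in> J" and s: "\<forall>(n, v)\<in>decl R. \<exists>x\<in>tcell (D j) n. e j n x = g n (u n v)" by force
 define a where "a n v = (SOME x. x \<in> tcell (D j) n \<and> e j n x = g n (u n v))" for n v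
 have a: "a n v \<in> tcell (D j) n \<and> e j n (a n v) = g n (u n v)" if "(n, v) \<in> decl R" for n v
  unfolding a_def by (rule someI_ex) (use s that in blast)
 have H: "ev j (%l. holds (D l) (%n v. tr j l n (a n v)) al)" if al: "al \<in> R" for al
 proof -
  have "holds E (%n v. e j n (a n v)) al"
   using holds_push[OF Q E_object g, of u al] holds_cong[of al "%n v. g n (u n v)" "%n v. e j n (a n v)"] h a avd[OF al] al by force
  from holds_stage[OF j _ this] holds_ev[OF j] show ?thesis using a avd[OF al] by blast
 qed
 have "ev j (%l. \<forall>al\<in>R. holds (D l) (%n v. tr j l n (a n v)) al)" by (rule ev_ball[OF fin j]) (rule H)
 from ev_ex[OF this] obtain l where l: "l \<in> J" "le j l" "\<forall>al\<in>R. holds (D l) (%n v. tr j l n (a n v)) al" by blast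
 from r D[OF l(1)] l(3) obtain q h' where q: "ctm Q (D l) q h'" "\<forall>(n, v)\<in>decl R. q n (u n v) = tr j l n (a n v)"
  unfolding represents_def by meson
 have "\<forall>(n, v)\<in>decl R. e l n (q n (u n v)) = g n (u n v)" using q(2) e_tr[OF j l(1,2)] a by fastforce
 hence "agree Q (%n x. e l n (q n x)) g"
  using r E_object ctm_comp[OF Q D[OF l(1)] E_object q(1) E_ctm[OF l(1)]] g unfolding represents_def by blast
 thus ?thesis using l(1) q(1) by blast
qed

text \<open>The two maps need only be compared on the finitely many declared variables, and each of
  these comparisons succeeds from some stage on.\<close>

theorem factor_unique:
 assumes r: "represents R Q u" and fin: "finite R" and j: "j \<in> J" and q: "ctm Q (D j) q h" "ctm Q (D j) q' h'"
  and eq: "agree Q (%n x. e j n (q n x)) (%n x. e j n (q' n x))"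
 shows "\<exists>l\<in>J. le j l \<and> agree Q (%n x. tr j l n (q n x)) (%n x. tr j l n (q' n x))"
proof -
 have Q: "ctob Q" and h: "\<forall>al\<in>R. holds Q u al" using r unfolding represents_def by auto
 have uc: "u n v \<in> tcell Q n" if "(n, v) \<in> decl R" for n v using that h unfolding decl_def by force
 let ?P = "%w l. case w of (n, v) => tr j l n (q n (u n v)) = tr j l n (q' n (u n v))"
 have H: "ev j (?P w)" if "w \<in> decl R" for w
 proof (cases w)
  case (Pair n v)
  hence c: "u n v \<in> tcell Q n" using uc that by blast
  thus ?thesis
   using td.ev_eq[OF j omap_cell[OF ptmD(1)[OF ctmD(2)[OF q(1)]] c] omap_cell[OF ptmD(1)[OF ctmD(2)[OF q(2)]] c]] eq Pair
   unfolding agree_def by simp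
 qed
 have "ev j (%l. \<forall>w\<in>decl R. ?P w l)" by (rule ev_ball[OF finite_decl[OF fin] j]) (rule H)
 from ev_ex[OF this] obtain l where l: "l \<in> J" "le j l" "\<forall>w\<in>decl R. ?P w l" by blast
 hence "agree Q (%n x. tr j l n (q n x)) (%n x. tr j l n (q' n x))"
  using r ctm_comp[OF Q D[OF j] D[OF l(1)] q(1) trc[OF j l(1,2)]] ctm_comp[OF Q D[OF j] D[OF l(1)] q(2) trc[OF j l(1,2)]] D[OF l(1)]
  unfolding represents_def by blast
 thus ?thesis using l by blast
qed

end

section \<open>Every object is a colimit of presented ones\<close>

text \<open>The finite parts of the tautological presentation of \<open>x\<close>. The last two conditions make the terms in \<open>R\<close>
  well formed in the graph of declared variables, so that \<open>R\<close> is representable.\<close>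

definition gd :: "'u ctcat => 'u atom set => bool" where
 "gd x R == finite R \<and> pres R \<and> R \<subseteq> tru x \<and>
   (\<forall>(n, v)\<in>decl R. (\<exists>w. AU Src n w v (ap x Src n v) \<in> R) \<and> (\<exists>w. AU Tgt n w v (ap x Tgt n v) \<in> R)) \<and>
   (\<forall>n t v v'. AM n t v v' \<in> R --> teq (subg (tot x) (decl R)) n t t)"

lemma decl_Un: "decl (R \<union> R') = decl R \<union> decl R'"
 unfolding decl_def by blast

lemma decl_mono: "R \<subseteq> R' ==> decl R \<subseteq> decl R'"
 unfolding decl_def by blast

lemma gd_fsub:
 assumes x: "ctob x" and R: "gd x R"
 shows "fsub (tot x) (decl R)"
proof -
 have "v \<in> tcell x n" if "(n, v) \<in> decl R" for n v using R that unfolding gd_def decl_def tru_def by fastforce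
 moreover have "(odim om n, v') \<in> decl R" if "AU om n w v v' \<in> R" for om n w v v'
  using R that unfolding gd_def pres_def by (auto dest!: bspec)
 hence "(n, src (tot x) n v) \<in> decl R \<and> (n, tgt (tot x) n v) \<in> decl R" if "(Suc n, v) \<in> decl R" for n v
  using R that unfolding gd_def by fastforce
 ultimately show ?thesis using R finite_decl unfolding gd_def fsub_def by blast
qed

lemma gd_Un:
 assumes x: "ctob x" and R: "gd x R" and S: "gd x S"
 shows "gd x (R \<union> S)"
proof -
 note f = gd_fsub[OF x R] gd_fsub[OF x S] and o = pgD(2)[OF ctobD(3)[OF x]]
 have "teq (subg (tot x) (decl R \<union> decl S)) n t t" if "AM n t v v' \<in> R \<union> S" for n t v v'
  using that teq_subg[OF o f(1) fsub_Un[OF f]] teq_subg[OF o f(2) fsub_Un[OF f]] R S unfolding gd_def by blast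
 moreover have "pres (R \<union> S)" using R S unfolding gd_def pres_def decl_Un by blast
 ultimately show ?thesis using R S unfolding gd_def decl_Un by blast
qed

lemma gd_empty: "gd x {}"
 unfolding gd_def pres_def decl_def by simp

text \<open>An equation alone may use cells that are not declared, lack faces or do not make its
  term well formed. Adding declarations for a finite graph repairs this.\<close>

lemma gd_ex:
 assumes x: "ctob x" and al': "al \<in> tru x"
 shows "\<exists>R. gd x R \<and> al \<in> R"
proof -
 have al: "holds x (%_ v. v) al" using al' unfolding tru_def by blast
 note p = ctobD(3,4)[OF x] and o = pgD(2)[OF ctobD(3)[OF x]]
 have "\<exists>W. fsub (tot x) W \<and> (\<forall>n t v v'. al = AM n t v v' --> teq (subg (tot x) W) n t t)"
 proof (cases al)
  case (AM n t v v')
  hence "(cl (tot x) n t, v) \<in> pcell x n" using al tmap_ident[of t "%_ v. v"] by simp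
  hence "teq (tot x) n t t" using cl_wf unfolding pb_iff by blast
  thus ?thesis using teq_fsub[OF o] AM by auto
 qed (auto simp: fsub_def)
 then obtain V where V: "fsub (tot x) V" "!!n t v v'. al = AM n t v v' ==> teq (subg (tot x) V) n t t" by blast
 have "\<forall>(n, v)\<in>av al. v \<in> tcell x n" using holds_cell[OF x al] by blast
 then obtain V' where V': "fsub (tot x) V'" "av al \<subseteq> V'" using fsub_ex[OF o finite_av] by blast
 \<comment> \<open>V makes the term of a multiplication equation well formed, V' contains the
   variables of the equation; both are closed under faces.\<close>
 define W where "W = V \<union> V'"
 have W: "fsub (tot x) W" "av al \<subseteq> W" "!!n t v v'. al = AM n t v v' ==> teq (subg (tot x) W) n t t"
  using fsub_Un[OF V(1) V'(1)] V'(2) V(2) teq_subg[OF o V(1), of W] unfolding W_def by auto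
 \<comment> \<open>\<open>Ident\<close> declares each cell of W with its shape, while
   \<open>Src\<close> and \<open>Tgt\<close> tie it to its faces as \<open>gd\<close>
   demands.\<close>
 define DG where "DG = (%(om, n, v). AUs x om n v) ` ({Ident, Src, Tgt} \<times> W)"
 have cW: "v \<in> tcell x n" if "(n, v) \<in> W" for n v using W(1) that unfolding fsub_def by blast
 have apW: "(odim om n, ap x om n v) \<in> W" if "(n, v) \<in> W" "om \<in> {Ident, Src, Tgt}" for om n v
  using that W(1) unfolding fsub_def by (cases n) auto
 have dDG: "decl DG = W" unfolding decl_def DG_def AUs_def by force
 have "decl {al} \<subseteq> av al" unfolding decl_def by auto
 hence dR: "decl (insert al DG) = W" using dDG W(2) decl_Un[of "{al}" DG] by auto
 have "av bet \<subseteq> W" if "bet \<in> DG" for bet using that apW unfolding DG_def AUs_def by (auto simp del: ap.simps odim.simps)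
 moreover have "finite DG" using W(1) unfolding DG_def fsub_def by simp
 ultimately have F1: "finite (insert al DG)" "pres (insert al DG)" using W(2) unfolding pres_def dR by blast+
 have F2: "insert al DG \<subseteq> tru x" using AUs_tru[OF p(1) cW] al' unfolding DG_def by auto
 have F3: "\<exists>w. AU om n w v (ap x om n v) \<in> insert al DG" if "(n, v) \<in> W" "om \<in> {Ident, Src, Tgt}" for om n v
 proof -
  have "AUs x om n v \<in> DG" using that unfolding DG_def by (intro image_eqI[of _ _ "(om, n, v)"]) auto
  thus ?thesis unfolding AUs_def by blast
 qed
 have "AM n t v v' \<notin> DG" for n t v v' unfolding DG_def AUs_def by auto
 hence F4: "\<forall>n t v v'. AM n t v v' \<in> insert al DG --> teq (subg (tot x) W) n t t" using W(3) by blast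
 have "\<forall>(n, v)\<in>W. (\<exists>w. AU Src n w v (ap x Src n v) \<in> insert al DG) \<and> (\<exists>w. AU Tgt n w v (ap x Tgt n v) \<in> insert al DG)"
  using F3 by blast
 hence "gd x (insert al DG)" unfolding gd_def dR using F1 F2 F4 by blast
 thus ?thesis by blast
qed

text \<open>x with its own cells is a solution, and the declared cells, closed under faces by
  \<open>gd_fsub\<close>, serve as the graph of variables.\<close>

lemma (in universe) gd_represented:
 fixes x :: "'u ctcat"
 assumes x: "ctob x" and R: "gd x R"
 shows "\<exists>(Q :: 'u ctcat) u. represents R Q u"
proof (rule represents_exists[of R x "%_ v. v" "subg (tot x) (decl R)"])
 show "small U R" using R sm_finite unfolding gd_def by blast
 show "is_ograph (subg (tot x) (decl R))" by (rule subg_ograph[OF pgD(2)[OF ctobD(3)[OF x]] gd_fsub[OF x R]])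
 show "\<exists>w. AU Src (Suc n) w v (src (subg (tot x) (decl R)) n v) \<in> R" "\<exists>w. AU Tgt (Suc n) w v (tgt (subg (tot x) (decl R)) n v) \<in> R"
  if "v \<in> cell (subg (tot x) (decl R)) (Suc n)" for n v
  using R that unfolding gd_def subg_def by fastforce+
 show "teq (subg (tot x) (decl R)) n t t" if "AM n t v v' \<in> R" for n t v v' using R that unfolding gd_def by blast
 show "\<forall>al\<in>R. holds x (%_ v. v) al" using R unfolding gd_def tru_def by blast
 show "pres R" using R unfolding gd_def by blast
 show "(n, v) \<in> decl R" if "v \<in> cell (subg (tot x) (decl R)) n" for n v using that unfolding subg_def by simp
qed (rule x)

text \<open>Every true equation of x lies in a finite part, so compatible solutions of the finite
  parts glue to a solution of the whole tautological presentation, which is a morphism.\<close>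

theorem density:
 assumes x: "ctob x" and y: "ctob y" and Q: "!!R. gd x R ==> represents R (Q R) (u R)"
  and g: "!!R. gd x R ==> \<exists>k. ctm (Q R) y (g R) k"
  and gg: "!!R R' n v. gd x R ==> gd x R' ==> R \<subseteq> R' ==> (n, v) \<in> decl R ==> g R' n (u R' n v) = g R n (u R n v)"
 shows "\<exists>f h. ctm x y f h \<and> (\<forall>R. gd x R --> (\<forall>(n, v)\<in>decl R. g R n (u R n v) = f n v))"
proof -
 define f where "f n v = (let R = SOME R. gd x R \<and> (n, v) \<in> decl R in g R n (u R n v))" for n v
 have f: "g R n (u R n v) = f n v" if R: "gd x R" "(n, v) \<in> decl R" for R n v
 proof -
  let ?R = "SOME R. gd x R \<and> (n, v) \<in> decl R"
  have S: "gd x ?R \<and> (n, v) \<in> decl ?R" by (rule someI[of _ R]) (use R in blast)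
  \<comment> \<open>Two parts that both declare v are compared inside their union.\<close>
  have U: "gd x (R \<union> ?R)" using gd_Un[OF x] R S by blast
  show ?thesis using gg[OF R(1) U _ R(2)] gg[OF conjunct1[OF S] U _ conjunct2[OF S]] unfolding f_def Let_def by simp
 qed
 have "holds y f al" if al: "al \<in> tru x" for al
 proof -
  obtain R where R: "gd x R" "al \<in> R" using gd_ex[OF x al] by blast
  obtain k where k: "ctm (Q R) y (g R) k" using g[OF R(1)] by blast
  have r: "ctob (Q R)" "holds (Q R) (u R) al" "av al \<subseteq> decl R" using Q[OF R(1)] R(2) unfolding represents_def pres_def by auto
  show ?thesis using holds_push[OF r(1) y k r(2)] holds_cong[of al "%n v. g R n (u R n v)" f] f[OF R(1)] r(3) by blast
 qed
 from holds_imp_ctm[OF x y this] show ?thesis using f by blast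
qed

section \<open>Criteria for adjunctions, equivalences and presentability\<close>

lemma Hom_arr: "f \<in> Hom C a b \<longleftrightarrow> f \<in> arr C \<and> dom C f = a \<and> cod C f = b"
 unfolding Hom_def by blast

lemma catD:
 assumes "is_category C"
 shows "f \<in> Hom C a b ==> a \<in> obj C \<and> b \<in> obj C" "a \<in> obj C ==> one C a \<in> Hom C a a"
  "f \<in> Hom C a b ==> g \<in> Hom C b c ==> cmp C g f \<in> Hom C a c"
  "f \<in> Hom C a b ==> cmp C (one C b) f = f" "f \<in> Hom C a b ==> cmp C f (one C a) = f"
  "f \<in> Hom C a b ==> g \<in> Hom C b c ==> h \<in> Hom C c d ==> cmp C h (cmp C g f) = cmp C (cmp C h g) f"
 using assms unfolding is_category_def Hom_arr by metis+

lemma funD: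
 assumes "is_functor A B F"
 shows "is_category A" "is_category B" "a \<in> obj A ==> fobj F a \<in> obj B"
  "f \<in> Hom A a b ==> farr F f \<in> Hom B (fobj F a) (fobj F b)" "a \<in> obj A ==> farr F (one A a) = one B (fobj F a)"
  "f \<in> Hom A a b ==> g \<in> Hom A b c ==> farr F (cmp A g f) = cmp B (farr F g) (farr F f)"
 using assms unfolding is_functor_def Hom_arr by auto

lemma functorI:
 assumes "is_category A" "is_category B" "!!a. a \<in> obj A ==> fobj F a \<in> obj B"
  "!!f a b. f \<in> Hom A a b ==> farr F f \<in> Hom B (fobj F a) (fobj F b)"
  "!!a. a \<in> obj A ==> farr F (one A a) = one B (fobj F a)"
  "!!f g a b c. f \<in> Hom A a b ==> g \<in> Hom A b c ==> farr F (cmp A g f) = cmp B (farr F g) (farr F f)"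
 shows "is_functor A B F"
 using assms unfolding is_functor_def Hom_arr by auto

lemma nat_transI:
 assumes "!!a. a \<in> obj A ==> tau a \<in> Hom B (fobj F a) (fobj G a)"
  "!!f a b. f \<in> Hom A a b ==> cmp B (tau b) (farr F f) = cmp B (farr G f) (tau a)"
 shows "nat_trans A B F G tau"
 using assms unfolding nat_trans_def Hom_arr by auto

lemma hom_category:
 assumes i: "!!a. a \<in> X ==> i a \<in> H a a"
  and k: "!!a b c f g. a \<in> X ==> b \<in> X ==> c \<in> X ==> f \<in> H a b ==> g \<in> H b c ==> k a g f \<in> H a c"
  and id: "!!a b f. a \<in> X ==> b \<in> X ==> f \<in> H a b ==> k a (i b) f = f \<and> k a f (i a) = f"
  and assoc: "!!a b c d f g h. a \<in> X ==> b \<in> X ==> c \<in> X ==> d \<in> X ==> f \<in> H a b ==> g \<in> H b c ==> h \<in> H c d ==>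
   k a h (k a g f) = k a (k b h g) f"
 shows "is_category (hom_category X H i k)"
 unfolding is_category_def hom_category_def Hom_def using assms by auto

lemma Hom_hom: "u \<in> Hom (hom_category X H i k) a b \<longleftrightarrow> a \<in> X \<and> b \<in> X \<and> snd (snd u) \<in> H a b \<and> u = (a, b, snd (snd u))"
 unfolding hom_category_def Hom_def by (cases u) auto

lemma hom_category_simps: "obj (hom_category X H i k) = X" "one (hom_category X H i k) a = (a, a, i a)"
 "u \<in> Hom (hom_category X H i k) a b ==> v \<in> Hom (hom_category X H i k) b c ==>
  cmp (hom_category X H i k) v u = (a, c, k a (snd (snd v)) (snd (snd u)))"
 unfolding hom_category_def Hom_def by auto

lemma one_iso: "is_category C ==> a \<in> obj C ==> is_iso C (one C a)"
 using catD(2)[of C a] catD(4)[of C "one C a" a a] unfolding is_iso_def Hom_arr by (intro conjI bexI[of _ "one C a"]) (auto simp: Hom_arr)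

text \<open>Surjectivity on objects is on the nose, so the quasi-inverse chooses preimages of
  objects and the second natural isomorphism is made of identities.\<close>

lemma equivalenceI:
 assumes F: "is_functor A B F" and surj: "!!b. b \<in> obj B ==> \<exists>a\<in>obj A. fobj F a = b"
  and ff: "!!a a' g. a \<in> obj A ==> a' \<in> obj A ==> g \<in> Hom B (fobj F a) (fobj F a') ==> \<exists>!f. f \<in> Hom A a a' \<and> farr F f = g"
 shows "is_equivalence A B F"
proof -
 note A = funD(1)[OF F] and B = funD(2)[OF F]
 define s where "s b = (SOME a. a \<in> obj A \<and> fobj F a = b)" for b
 have s: "s b \<in> obj A" "fobj F (s b) = b" if "b \<in> obj B" for b
  using someI_ex[of "%a. a \<in> obj A \<and> fobj F a = b"] surj[OF that] unfolding s_def by blast+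
 define l where "l a a' g = (THE f. f \<in> Hom A a a' \<and> farr F f = g)" for a a' g
 have l: "l a a' g \<in> Hom A a a'" "farr F (l a a' g) = g" if "a \<in> obj A" "a' \<in> obj A" "g \<in> Hom B (fobj F a) (fobj F a')" for a a' g
  using theI'[OF ff[OF that]] unfolding l_def by blast+
 have u: "f = f'" if "f \<in> Hom A a a'" "f' \<in> Hom A a a'" "farr F f = farr F f'" for f f' a a'
  using ex1E[OF ff[OF conjunct1[OF catD(1)[OF A that(1)]] conjunct2[OF catD(1)[OF A that(1)]] funD(4)[OF F that(1)]]] that by metis
 define G where "G = \<lparr> fobj = s, farr = %g. l (s (dom B g)) (s (cod B g)) g \<rparr>"
 have Go: "fobj G b = s b" for b unfolding G_def by simp
 have Ga: "farr G g \<in> Hom A (s b) (s b')" "farr F (farr G g) = g" if "g \<in> Hom B b b'" for g b b'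
 proof -
  note o = catD(1)[OF B that]
  have e: "farr G g = l (s b) (s b') g" using that unfolding G_def Hom_arr by simp
  have g: "g \<in> Hom B (fobj F (s b)) (fobj F (s b'))" using that s o by simp
  show "farr G g \<in> Hom A (s b) (s b')" "farr F (farr G g) = g" unfolding e using l[OF _ _ g] s(1) o by blast+
 qed
 have G: "is_functor B A G"
 proof (rule functorI[OF B A]; (unfold Go)?)
  show "farr G (one B b) = one A (s b)" if b: "b \<in> obj B" for b
   by (rule u[OF Ga(1)[OF catD(2)[OF B b]] catD(2)[OF A s(1)[OF b]]]) (simp add: Ga(2)[OF catD(2)[OF B b]] funD(5)[OF F s(1)[OF b]] s(2)[OF b])
  show "farr G (cmp B g f) = cmp A (farr G g) (farr G f)" if f: "f \<in> Hom B a b" and g: "g \<in> Hom B b c" for f g a b c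
   by (rule u[OF Ga(1)[OF catD(3)[OF B f g]] catD(3)[OF A Ga(1)[OF f] Ga(1)[OF g]]])
    (simp add: Ga(2)[OF catD(3)[OF B f g]] funD(6)[OF F Ga(1)[OF f] Ga(1)[OF g]] Ga(2)[OF f] Ga(2)[OF g])
 qed (use s(1) Ga(1) in auto)
 let ?sig = "%a. l a (s (fobj F a)) (one B (fobj F a))"
 have o: "one B (fobj F a) \<in> Hom B (fobj F a) (fobj F (s (fobj F a)))" "one B (fobj F a) \<in> Hom B (fobj F (s (fobj F a))) (fobj F a)"
  "s (fobj F a) \<in> obj A" if "a \<in> obj A" for a
  using s[OF funD(3)[OF F that]] catD(2)[OF B funD(3)[OF F that]] by simp_all
 note sig = l[OF _ o(3) o(1)]
 have "nat_iso A A id_functor (G \<circ>\<^sub>F F) ?sig" unfolding nat_iso_def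
 proof (intro conjI nat_transI ballI)
  show "?sig a \<in> Hom A (fobj id_functor a) (fobj (G \<circ>\<^sub>F F) a)" if "a \<in> obj A" for a
   using sig(1)[OF that that that] unfolding id_functor_def comp_functor_def Go by simp
  show "cmp A (?sig b) (farr id_functor f) = cmp A (farr (G \<circ>\<^sub>F F) f) (?sig a)" if f: "f \<in> Hom A a b" for f a b
  proof -
   note ab = conjunct1[OF catD(1)[OF A f]] conjunct2[OF catD(1)[OF A f]]
   note Ff = funD(4)[OF F f] and sa = sig(1)[OF ab(1) ab(1) ab(1)] and sb = sig(1)[OF ab(2) ab(2) ab(2)]
   have "cmp A (?sig b) f = cmp A (farr G (farr F f)) (?sig a)"
    by (rule u[OF catD(3)[OF A f sb] catD(3)[OF A sa Ga(1)[OF Ff]]])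
     (simp add: funD(6)[OF F f sb] funD(6)[OF F sa Ga(1)[OF Ff]] Ga(2)[OF Ff] sig(2)[OF ab(1) ab(1) ab(1)] sig(2)[OF ab(2) ab(2) ab(2)]
      catD(4)[OF B Ff] catD(5)[OF B Ff])
   thus ?thesis unfolding id_functor_def comp_functor_def by simp
  qed
  fix a assume a: "a \<in> obj A"
  let ?r = "l (s (fobj F a)) a (one B (fobj F a))"
  note r = l[OF o(3)[OF a] a o(2)[OF a]] and sa = sig[OF a a a] and oo = catD(2)[OF B funD(3)[OF F a]]
  have "cmp A ?r (?sig a) = one A a"
   by (rule u[OF catD(3)[OF A sa(1) r(1)] catD(2)[OF A a]]) (simp add: funD(6)[OF F sa(1) r(1)] r(2) sa(2) funD(5)[OF F a] catD(4)[OF B oo])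
  moreover have "cmp A (?sig a) ?r = one A (s (fobj F a))"
   by (rule u[OF catD(3)[OF A r(1) sa(1)] catD(2)[OF A o(3)[OF a]]])
    (simp add: funD(6)[OF F r(1) sa(1)] r(2) sa(2) funD(5)[OF F o(3)[OF a]] catD(4)[OF B oo] s(2)[OF funD(3)[OF F a]])
  ultimately show "is_iso A (?sig a)" unfolding is_iso_def using sa(1) r(1) by (auto simp: Hom_arr)
 qed
 moreover have "nat_iso B B (F \<circ>\<^sub>F G) id_functor (one B)" unfolding nat_iso_def
 proof (intro conjI nat_transI ballI)
  show "one B b \<in> Hom B (fobj (F \<circ>\<^sub>F G) b) (fobj id_functor b)" if "b \<in> obj B" for b
   using catD(2)[OF B that] s(2)[OF that] unfolding id_functor_def comp_functor_def Go by simp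
  show "cmp B (one B b) (farr (F \<circ>\<^sub>F G) f) = cmp B (farr id_functor f) (one B a)" if f: "f \<in> Hom B a b" for f a b
   using Ga(2)[OF f] catD(4,5)[OF B f] unfolding id_functor_def comp_functor_def by simp
  show "is_iso B (one B b)" if "b \<in> obj B" for b by (rule one_iso[OF B that])
 qed
 ultimately show ?thesis unfolding is_equivalence_def using F G by blast
qed

text \<open>The hypotheses \<open>full\<close> and \<open>alg\<close> speak of algebras without mentioning the monad: \<open>e\<close> and \<open>m\<close> are
  components of the counit and \<open>z\<close> is the left adjoint applied to \<open>bet\<close>, being determined by their composites with \<open>eta\<close>.\<close>

lemma monadicI:
 assumes U: "is_functor A B U"
  and F: "!!b. b \<in> obj B ==> F b \<in> obj A \<and> eta b \<in> Hom B b (fobj U (F b))"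
  and univ: "!!b a f. b \<in> obj B ==> a \<in> obj A ==> f \<in> Hom B b (fobj U a) ==> \<exists>g\<in>Hom A (F b) a. cmp B (farr U g) (eta b) = f"
  and uniq: "!!b a g g'. g \<in> Hom A (F b) a ==> g' \<in> Hom A (F b) a ==> b \<in> obj B ==> cmp B (farr U g) (eta b) = cmp B (farr U g') (eta b) ==> g = g'"
  and faith: "!!a a' f f'. f \<in> Hom A a a' ==> f' \<in> Hom A a a' ==> farr U f = farr U f' ==> f = f'"
  and full: "!!a a' f e p. a \<in> obj A ==> e \<in> Hom A (F (fobj U a)) a ==> cmp B (farr U e) (eta (fobj U a)) = one B (fobj U a) ==>
   f \<in> Hom B (fobj U a) (fobj U a') ==> p \<in> Hom A (F (fobj U a)) a' ==> cmp B f (farr U e) = farr U p ==> \<exists>g\<in>Hom A a a'. farr U g = f"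
  and alg: "!!b bet m z. b \<in> obj B ==> bet \<in> Hom B (fobj U (F b)) b ==> cmp B bet (eta b) = one B b ==>
   m \<in> Hom A (F (fobj U (F b))) (F b) ==> z \<in> Hom A (F (fobj U (F b))) (F b) ==>
   cmp B (farr U m) (eta (fobj U (F b))) = one B (fobj U (F b)) ==> cmp B (farr U z) (eta (fobj U (F b))) = cmp B (eta b) bet ==>
   cmp B bet (farr U m) = cmp B bet (farr U z) ==> \<exists>a\<in>obj A. fobj U a = b \<and> (\<exists>e\<in>Hom A (F b) a. farr U e = bet)"
 shows "monadic A B U"
proof -
 note A = funD(1)[OF U] and B = funD(2)[OF U]
 define ex where "ex b a f = (SOME g. g \<in> Hom A (F b) a \<and> cmp B (farr U g) (eta b) = f)" for b a f
 have ex: "ex b a f \<in> Hom A (F b) a" "cmp B (farr U (ex b a f)) (eta b) = f" if "b \<in> obj B" "a \<in> obj A" "f \<in> Hom B b (fobj U a)" for b a f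
  using someI_ex[of "%g. g \<in> Hom A (F b) a \<and> cmp B (farr U g) (eta b) = f"] univ[OF that] unfolding ex_def by blast+
 note Fo = conjunct1[OF F] and etah = conjunct2[OF F]
 define L where "L = \<lparr> fobj = F, farr = %u. ex (dom B u) (F (cod B u)) (cmp B (eta (cod B u)) u) \<rparr>"
 have Lo: "fobj L b = F b" for b unfolding L_def by simp
 have La: "farr L u \<in> Hom A (F b) (F b')" "cmp B (farr U (farr L u)) (eta b) = cmp B (eta b') u" if u: "u \<in> Hom B b b'" for u b b'
 proof -
  note o = catD(1)[OF B u]
  have e: "farr L u = ex b (F b') (cmp B (eta b') u)" using u unfolding L_def Hom_arr by simp
  note x = ex[OF conjunct1[OF o] Fo[OF conjunct2[OF o]] catD(3)[OF B u etah[OF conjunct2[OF o]]]]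
  show "farr L u \<in> Hom A (F b) (F b')" "cmp B (farr U (farr L u)) (eta b) = cmp B (eta b') u" unfolding e using x by auto
 qed
 have Ueta: "cmp B (farr U (cmp A k g)) (eta b) = cmp B (farr U k) (cmp B (farr U g) (eta b))"
  if "b \<in> obj B" "g \<in> Hom A (F b) a" "k \<in> Hom A a a'" for b g k a a'
  using funD(6)[OF U that(2,3)] catD(6)[OF B etah[OF that(1)] funD(4)[OF U that(2)] funD(4)[OF U that(3)]] by simp
 have L: "is_functor B A L"
 proof (rule functorI[OF B A]; (unfold Lo)?)
  show "farr L (one B b) = one A (F b)" if b: "b \<in> obj B" for b
  proof (rule uniq[OF La(1)[OF catD(2)[OF B b]] catD(2)[OF A Fo[OF b]] b])
   show "cmp B (farr U (farr L (one B b))) (eta b) = cmp B (farr U (one A (F b))) (eta b)"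
    by (simp add: La(2)[OF catD(2)[OF B b]] funD(5)[OF U Fo[OF b]] catD(4)[OF B etah[OF b]] catD(5)[OF B etah[OF b]])
  qed
  show "farr L (cmp B g f) = cmp A (farr L g) (farr L f)" if f: "f \<in> Hom B a b" and g: "g \<in> Hom B b c" for f g a b c
  proof (rule uniq[OF La(1)[OF catD(3)[OF B f g]] catD(3)[OF A La(1)[OF f] La(1)[OF g]]])
   have o: "a \<in> obj B" "b \<in> obj B" "c \<in> obj B" using catD(1)[OF B f] catD(1)[OF B g] by auto
   show "a \<in> obj B" by (rule o)
   show "cmp B (farr U (farr L (cmp B g f))) (eta a) = cmp B (farr U (cmp A (farr L g) (farr L f))) (eta a)"
    unfolding Ueta[OF o(1) La(1)[OF f] La(1)[OF g]] La(2)[OF f] La(2)[OF catD(3)[OF B f g]]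
     catD(6)[OF B f etah[OF o(2)] funD(4)[OF U La(1)[OF g]]] La(2)[OF g] catD(6)[OF B f g etah[OF o(3)]] ..
  qed
 qed (use Fo La(1) in auto)
 define eps where "eps a = ex (fobj U a) a (one B (fobj U a))" for a
 note Uo = funD(3)[OF U]
 have eps: "eps a \<in> Hom A (F (fobj U a)) a" "cmp B (farr U (eps a)) (eta (fobj U a)) = one B (fobj U a)" if "a \<in> obj A" for a
  unfolding eps_def using ex[OF Uo[OF that] that catD(2)[OF B Uo[OF that]]] by auto
 have epsn: "cmp A (eps a') (farr L (farr U f)) = cmp A f (eps a)" if f: "f \<in> Hom A a a'" for f a a'
 proof -
  have o: "a \<in> obj A" "a' \<in> obj A" using catD(1)[OF A f] by auto
  note Uf = funD(4)[OF U f]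
  show ?thesis
  proof (rule uniq[OF catD(3)[OF A La(1)[OF Uf] eps(1)[OF o(2)]] catD(3)[OF A eps(1)[OF o(1)] f] Uo[OF o(1)]])
   show "cmp B (farr U (cmp A (eps a') (farr L (farr U f)))) (eta (fobj U a)) = cmp B (farr U (cmp A f (eps a))) (eta (fobj U a))"
    unfolding Ueta[OF Uo[OF o(1)] La(1)[OF Uf] eps(1)[OF o(2)]] Ueta[OF Uo[OF o(1)] eps(1)[OF o(1)] f] La(2)[OF Uf] eps(2)[OF o(1)]
     catD(6)[OF B Uf etah[OF Uo[OF o(2)]] funD(4)[OF U eps(1)[OF o(2)]]] eps(2)[OF o(2)] catD(4)[OF B Uf] catD(5)[OF B Uf] ..
  qed
 qed
 have tri: "cmp A (eps (F b)) (farr L (eta b)) = one A (F b)" if b: "b \<in> obj B" for b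
 proof (rule uniq[OF catD(3)[OF A La(1)[OF etah[OF b]] eps(1)[OF Fo[OF b]]] catD(2)[OF A Fo[OF b]] b])
  show "cmp B (farr U (cmp A (eps (F b)) (farr L (eta b)))) (eta b) = cmp B (farr U (one A (F b))) (eta b)"
   unfolding Ueta[OF b La(1)[OF etah[OF b]] eps(1)[OF Fo[OF b]]] La(2)[OF etah[OF b]] funD(5)[OF U Fo[OF b]]
    catD(6)[OF B etah[OF b] etah[OF Uo[OF Fo[OF b]]] funD(4)[OF U eps(1)[OF Fo[OF b]]]] eps(2)[OF Fo[OF b]] ..
 qed
 have adj: "is_adjunction A B L U eta eps"
  unfolding is_adjunction_def using L U tri eps
  by (auto intro!: nat_transI simp: id_functor_def comp_functor_def Lo etah La(2) epsn)
 let ?T = "U \<circ>\<^sub>F L" and ?mu = "%b. farr U (eps (fobj L b))"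
 let ?E = "em_category B ?T eta ?mu" and ?K = "comparison_functor A U eps"
 have T: "fobj ?T b = fobj U (F b)" "farr ?T f = farr U (farr L f)" for b f unfolding comp_functor_def Lo by auto
 have Tf: "is_functor B B ?T"
 proof (rule functorI[OF B B]; (unfold T)?)
  show "farr U (farr L (one B a)) = one B (fobj U (F a))" if "a \<in> obj B" for a
   using that by (simp add: funD(5)[OF L] Lo funD(5)[OF U Fo])
  show "farr U (farr L (cmp B g f)) = cmp B (farr U (farr L g)) (farr U (farr L f))" if "f \<in> Hom B a b" "g \<in> Hom B b c" for f g a b c
   using funD(6)[OF L that] funD(6)[OF U La(1)[OF that(1)] La(1)[OF that(2)]] by simp
 qed (auto intro!: Uo Fo funD(4)[OF U] La(1))
 have Eo: "obj ?E = {x. em_algebra B ?T eta ?mu x}" unfolding em_category_def by (rule hom_category_simps)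
 have Eb: "b \<in> obj B" "bet \<in> Hom B (fobj U (F b)) b" if "em_algebra B ?T eta ?mu (b, bet)" for b bet
  using that unfolding em_algebra_def T by auto
 have EH: "u \<in> Hom ?E (b, bet) (b', bet') \<longleftrightarrow> (b, bet) \<in> obj ?E \<and> (b', bet') \<in> obj ?E \<and> snd (snd u) \<in> Hom B b b' \<and>
  cmp B (snd (snd u)) bet = cmp B bet' (farr U (farr L (snd (snd u)))) \<and> u = ((b, bet), (b', bet'), snd (snd u))" for u b b' bet bet'
  unfolding Eo unfolding em_category_def Hom_hom T by auto
 have E: "is_category ?E" unfolding em_category_def
 proof (rule hom_category; clarify)
  fix b bet assume "em_algebra B ?T eta ?mu (b, bet)"
  note o = Eb[OF this]
  show "one B (fst (b, bet)) \<in> Hom B (fst (b, bet)) (fst (b, bet)) \<and> cmp B (one B (fst (b, bet))) (snd (b, bet)) = cmp B (snd (b, bet)) (farr ?T (one B (fst (b, bet))))"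
   using catD(2)[OF B o(1)] catD(4,5)[OF B o(2)] funD(5)[OF Tf o(1)] T by simp
 next
  fix b bet b' bet' b'' bet'' f g
  assume "em_algebra B ?T eta ?mu (b, bet)" "em_algebra B ?T eta ?mu (b', bet')" "em_algebra B ?T eta ?mu (b'', bet'')"
   and f: "f \<in> Hom B (fst (b, bet)) (fst (b', bet'))" "cmp B f (snd (b, bet)) = cmp B (snd (b', bet')) (farr ?T f)"
   and g: "g \<in> Hom B (fst (b', bet')) (fst (b'', bet''))" "cmp B g (snd (b', bet')) = cmp B (snd (b'', bet'')) (farr ?T g)"
  hence o: "bet \<in> Hom B (fobj ?T b) b" "bet' \<in> Hom B (fobj ?T b') b'" "bet'' \<in> Hom B (fobj ?T b'') b''" and f': "f \<in> Hom B b b'" "g \<in> Hom B b' b''"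
   using Eb(2) T by auto
  note Tf' = funD(4)[OF Tf f'(1)] funD(4)[OF Tf f'(2)]
  show "cmp B g f \<in> Hom B (fst (b, bet)) (fst (b'', bet'')) \<and> cmp B (cmp B g f) (snd (b, bet)) = cmp B (snd (b'', bet'')) (farr ?T (cmp B g f))"
   using catD(3)[OF B f'] catD(6)[OF B o(1) f'] f(2) catD(6)[OF B Tf'(1) o(2) f'(2)] g(2) catD(6)[OF B Tf' o(3)] funD(6)[OF Tf f'] by simp
 qed (auto intro: catD(4,5)[OF B] catD(6)[OF B])
 have Ko: "fobj ?K a = (fobj U a, farr U (eps a))" for a unfolding comparison_functor_def Let_def by simp
 have Ka: "farr ?K f = (fobj ?K a, fobj ?K a', farr U f)" if "f \<in> Hom A a a'" for f a a'
  using that unfolding comparison_functor_def Let_def Hom_arr by simp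
 have K1: "fobj ?K a \<in> obj ?E" if a: "a \<in> obj A" for a
  using epsn[OF eps(1)[OF a]] funD(6)[OF U La(1)[OF funD(4)[OF U eps(1)[OF a]]] eps(1)[OF a]]
   funD(6)[OF U eps(1)[OF Fo[OF Uo[OF a]]] eps(1)[OF a]] Uo[OF a] funD(4)[OF U eps(1)[OF a]] eps(2)[OF a]
  unfolding Eo Ko em_algebra_def by (simp add: T Lo)
 have K2: "cmp B (farr U f) (farr U (eps a)) = cmp B (farr U (eps a')) (farr U (farr L (farr U f)))" if f: "f \<in> Hom A a a'" for f a a'
  using epsn[OF f] funD(6)[OF U La(1)[OF funD(4)[OF U f]] eps(1)] funD(6)[OF U eps(1) f] catD(1)[OF A f] by simp
 have K: "is_functor A ?E ?K"
 proof (rule functorI[OF A E])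
  show K3: "farr ?K f \<in> Hom ?E (fobj ?K a) (fobj ?K a')" if f: "f \<in> Hom A a a'" for f a a'
   using K1 K2[OF f] funD(4)[OF U f] catD(1)[OF A f] unfolding Ka[OF f] unfolding Ko EH by simp
  show "farr ?K (one A a) = one ?E (fobj ?K a)" if a: "a \<in> obj A" for a
   unfolding Ka[OF catD(2)[OF A a]] funD(5)[OF U a] by (simp add: em_category_def hom_category_simps Ko)
  show "farr ?K (cmp A g f) = cmp ?E (farr ?K g) (farr ?K f)" if f: "f \<in> Hom A a b" and g: "g \<in> Hom A b c" for f g a b c
   using hom_category_simps(3)[OF K3[OF f, unfolded em_category_def] K3[OF g, unfolded em_category_def]]
   unfolding Ka[OF catD(3)[OF A f g]] Ka[OF f] Ka[OF g] funD(6)[OF U f g] em_category_def by simp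
 qed (rule K1)
 have "is_equivalence A ?E ?K"
 proof (rule equivalenceI[OF K])
  fix x assume x: "x \<in> obj ?E"
  obtain b bet where bbet: "x = (b, bet)" by (cases x)
  have e: "em_algebra B ?T eta ?mu (b, bet)" using x unfolding Eo bbet by simp
  note b = Eb[OF e]
  have beta: "cmp B bet (eta b) = one B b" and bm: "cmp B bet (farr U (eps (F b))) = cmp B bet (farr U (farr L bet))"
   using e unfolding em_algebra_def by (simp_all add: T Lo)
  \<comment> \<open>m is the counit at the free object and z is \<open>L\<close> applied to
    \<open>bet\<close>; their composites with the unit are those that \<open>alg\<close> asks
    for.\<close>
  obtain a g where a: "a \<in> obj A" "fobj U a = b" "g \<in> Hom A (F b) a" "farr U g = bet"
   using alg[OF b beta eps(1)[OF Fo[OF b(1)]] La(1)[OF b(2)] eps(2)[OF Fo[OF b(1)]] La(2)[OF b(2)] bm] by blast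
  \<comment> \<open>Both composites with the unit are the identity, so the structure map found is
    the counit, and the comparison functor hits (b, bet) exactly.\<close>
  have "g = eps a"
   using uniq[OF a(3) eps(1)[OF a(1), unfolded a(2)] b(1)] eps(2)[OF a(1)] a(2,4) beta by simp
  thus "\<exists>a\<in>obj A. fobj ?K a = x" unfolding bbet Ko using a by blast
 next
  fix a a' g assume a: "a \<in> obj A" "a' \<in> obj A" and g: "g \<in> Hom ?E (fobj ?K a) (fobj ?K a')"
  define f where "f = snd (snd g)"
  have f: "f \<in> Hom B (fobj U a) (fobj U a')" "cmp B f (farr U (eps a)) = cmp B (farr U (eps a')) (farr U (farr L f))"
   and g': "g = (fobj ?K a, fobj ?K a', f)" using g unfolding f_def Ko EH by auto
  note p = catD(3)[OF A La(1)[OF f(1)] eps(1)[OF a(2)]]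
  \<comment> \<open>f commutes with the structure maps, so f after the counit is U of the counit
    after \<open>L\<close> f; this composite plays the part of p.\<close>
  obtain h where h: "h \<in> Hom A a a'" "farr U h = f"
   using full[OF a(1) eps[OF a(1)] f(1) p] f(2) funD(6)[OF U La(1)[OF f(1)] eps(1)[OF a(2)]] by auto
  show "\<exists>!f. f \<in> Hom A a a' \<and> farr ?K f = g"
  proof (rule ex1I[of _ h])
   show "h \<in> Hom A a a' \<and> farr ?K h = g" using h Ka[OF h(1)] g' by simp
   show "h' = h" if "h' \<in> Hom A a a' \<and> farr ?K h' = g" for h'
    by (rule faith[of _ a a']) (use that h g' Ka[of h' a a'] in auto)
  qed
 qed
 thus ?thesis unfolding monadic_def using adj by blast
qed

section \<open>The two categories and monadicity\<close>

definition mp :: "'o \<times> 'o \<times> (nat => 'u => 'u) \<times> (nat => 'u => 'u) => nat => 'u => 'u" where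
 "mp u = fst (snd (snd u))"

text \<open>The arrow with a given total map: the base component is the only possible one, by
  \<open>ptm_h\<close>, and both are cut down to the carriers.\<close>

definition mk :: "('u, 'z) ptgraph_scheme => ('u, 'z) ptgraph_scheme => (nat => 'u => 'u) => (('u, 'z) ptgraph_scheme, 'u) arrow" where
 "mk a b f = (a, b, (%n. restrict (f n) (tcell a n)), (%n. restrict (%g. cmap b n (f n (pt a n g))) (gcell a n)))"

text \<open>Treats both categories at once. P is the non-extensional notion of morphism, closed
  under plain composition and insensitive to values outside the carriers.\<close>

locale homcat =
 fixes X :: "('u, 'z) ptgraph_scheme set" and P and H and C
 assumes C: "C = hom_category X H hom_id hom_comp"
  and X: "a \<in> X ==> is_ptgraph a"
  and H: "(f, h) \<in> H a b \<longleftrightarrow> f \<in> ext_maps (tot a) \<and> h \<in> ext_maps (base a) \<and> P a b f h"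
  and P_ptm: "P a b f h ==> ptm a b f h"
  and P_comp: "a \<in> X ==> b \<in> X ==> c \<in> X ==> P a b f h ==> P b c f' h' ==> P a c (%n x. f' n (f n x)) (%n x. h' n (h n x))"
  and P_id: "a \<in> X ==> P a a (%_ x. x) (%_ x. x)"
  and P_cong: "a \<in> X ==> P a b f h ==> (!!n x. x \<in> tcell a n ==> f n x = f' n x) ==>
   (!!n g. g \<in> gcell a n ==> h n g = h' n g) ==> P a b f' h'"
begin

text \<open>Base components are recovered from unit cells, so arrows that agree on cells are
  equal.\<close>

lemma H_eqI:
 assumes b: "b \<in> X" and u: "u \<in> H a b" "v \<in> H a b" and eq: "agree a (fst u) (fst v)"
 shows "u = v"
proof -
 obtain f h f' h' where uv: "u = (f, h)" "v = (f', h')" by (cases u, cases v)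
 have e: "f \<in> ext_maps (tot a)" "h \<in> ext_maps (base a)" "f' \<in> ext_maps (tot a)" "h' \<in> ext_maps (base a)"
  and p: "ptm a b f h" "ptm a b f' h'" using u P_ptm unfolding uv H by auto
 have "f n = f' n" for n
  by (rule extensionalityI[of _ "tcell a n"]) (use e eq in \<open>auto simp: ext_maps_def agree_def uv\<close>)
 hence f: "f = f'" by blast
 have "h n = h' n" for n
  by (rule extensionalityI[of _ "gcell a n"])
   (use e f ptm_h[OF X[OF b] p(1)] ptm_h[OF X[OF b] p(2)] in \<open>auto simp: ext_maps_def\<close>)
 thus ?thesis using f uv by blast
qed

lemma H_comp:
 assumes o: "a \<in> X" "b \<in> X" "c \<in> X" and u: "u \<in> H a b" "v \<in> H b c"
 shows "hom_comp a v u \<in> H a c"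
proof -
 obtain f h f' h' where uv: "u = (f, h)" "v = (f', h')" by (cases u, cases v)
 have p: "P a b f h" "P b c f' h'" using u unfolding uv H by auto
 have "P a c (%n. compose (tcell a n) (f' n) (f n)) (%n. compose (gcell a n) (h' n) (h n))"
  by (rule P_cong[OF o(1) P_comp[OF o p]]) (simp_all add: compose_eq)
 thus ?thesis unfolding uv hom_comp_def by (simp add: H ext_maps_def compose_def)
qed

lemma H_id: "a \<in> X ==> hom_id a \<in> H a a"
 unfolding hom_id_def H by (auto simp: ext_maps_def intro: P_cong[OF _ P_id])

lemma H_cell: "u \<in> H a b ==> x \<in> tcell a n ==> fst u n x \<in> tcell b n"
 using omap_cell[OF ptmD(1)[OF P_ptm]] by (cases u) (auto simp: H)

lemma fst_comp: "x \<in> tcell a n ==> fst (hom_comp a v u) n x = fst v n (fst u n x)"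
 unfolding hom_comp_def by (simp add: case_prod_beta compose_eq)

lemma is_cat: "is_category C" unfolding C
proof (rule hom_category)
 fix a b u assume o: "a \<in> X" "b \<in> X" and u: "u \<in> H a b"
 have "hom_comp a (hom_id b) u = u"
  by (rule H_eqI[OF o(2) H_comp[OF o o(2) u H_id[OF o(2)]] u]) (simp add: agree_def fst_comp hom_id_def H_cell[OF u])
 moreover have "hom_comp a u (hom_id a) = u"
  by (rule H_eqI[OF o(2) H_comp[OF o(1) o H_id[OF o(1)] u] u]) (simp add: agree_def fst_comp hom_id_def)
 ultimately show "hom_comp a (hom_id b) u = u \<and> hom_comp a u (hom_id a) = u" by blast
next
 fix a b c d u v w assume o: "a \<in> X" "b \<in> X" "c \<in> X" "d \<in> X" and u: "u \<in> H a b" "v \<in> H b c" "w \<in> H c d"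
 show "hom_comp a w (hom_comp a v u) = hom_comp a (hom_comp b w v) u"
  by (rule H_eqI[OF o(4) H_comp[OF o(1,3,4) H_comp[OF o(1-3) u(1,2)] u(3)] H_comp[OF o(1,2,4) u(1) H_comp[OF o(2-4) u(2,3)]]])
   (simp add: agree_def fst_comp H_cell[OF u(1)])
qed (auto intro: H_comp H_id)

lemma objC: "obj C = X"
 unfolding C by (rule hom_category_simps)

lemma HomD:
 assumes "u \<in> Hom C a b"
 shows "a \<in> X" "b \<in> X" "\<exists>h. P a b (mp u) h" "u = (a, b, snd (snd u))" "snd (snd u) \<in> H a b"
 using assms H[of "mp u" "snd (snd (snd u))" a b] unfolding C Hom_hom mp_def by auto

lemma Hom_eqI: "u \<in> Hom C a b ==> v \<in> Hom C a b ==> agree a (mp u) (mp v) ==> u = v"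
 using H_eqI[of b "snd (snd u)" a "snd (snd v)"] HomD[of u a b] HomD[of v a b] unfolding mp_def by metis

lemma mp_cell: "u \<in> Hom C a b ==> x \<in> tcell a n ==> mp u n x \<in> tcell b n"
 using HomD(3) P_ptm ptmD(1) omap_cell by metis

lemma mk_Hom:
 assumes "a \<in> X" "b \<in> X" and p: "P a b f h"
 shows "mk a b f \<in> Hom C a b"
proof -
 have "P a b (%n. restrict (f n) (tcell a n)) (%n. restrict (%g. cmap b n (f n (pt a n g))) (gcell a n))"
  by (rule P_cong[OF assms(1) p]) (auto simp: ptm_h[OF X[OF assms(2)] P_ptm[OF p], symmetric])
 thus ?thesis unfolding C Hom_hom mk_def using assms by (simp add: H ext_maps_def)
qed

lemma mp_mk: "x \<in> tcell a n ==> mp (mk a b f) n x = f n x"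
 unfolding mp_def mk_def by simp

lemma mp_one: "x \<in> tcell a n ==> mp (one C a) n x = x"
 unfolding C hom_category_simps mp_def hom_id_def by simp

lemma mp_cmp: "u \<in> Hom C a b ==> v \<in> Hom C b c ==> x \<in> tcell a n ==> mp (cmp C v u) n x = mp v n (mp u n x)"
 unfolding C hom_category_simps(3) mp_def by (simp add: fst_comp)

end

lemma ctm_id: "ctob C ==> ctm C C (%_ x. x) (%_ x. x)"
 using ptm_id[OF ctobD(3)] T_map_ident[OF pgD(2)[OF ctobD(3)], of C]
 unfolding ctm_def mulm_def by (auto simp: pb_iff)

interpretation tg: homcat "{C :: 'u ptgraph. is_ptgraph C \<and> constant_ograph (base C)}" ptm ptgraph_hom TGr_pc
proof
 show "(f, h) \<in> ptgraph_hom a b \<longleftrightarrow> f \<in> ext_maps (tot a) \<and> h \<in> ext_maps (base a) \<and> ptm a b f h" for f h and a b :: "'u ptgraph"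
  unfolding ptgraph_hom_def ptm_def by auto
qed (auto simp: TGr_pc_def intro: ptm_comp ptm_id ptm_cong)

interpretation ct: homcat "{C :: 'u ctcat. ctob C}" ctm ctcat_hom CTCat_c
proof
 show "(f, h) \<in> ctcat_hom a b \<longleftrightarrow> f \<in> ext_maps (tot a) \<and> h \<in> ext_maps (base a) \<and> ctm a b f h" for f h and a b :: "'u ctcat"
  unfolding ctcat_hom_def tcat_hom_def ptgraph_hom_def ctm_def mulm_def ptm_def by auto
qed (auto simp: CTCat_c_def ctob_def[abs_def, symmetric] intro: ctm_comp ctm_id ctm_cong ctobD ctmD)

lemma trunc_simps [simp]: "base (ptgraph.truncate C) = base C" "tot (ptgraph.truncate C) = tot C" "dmap (ptgraph.truncate C) = dmap C"
 "cmap (ptgraph.truncate C) = cmap C" "pt (ptgraph.truncate C) = pt C"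
 unfolding ptgraph.truncate_def by simp_all

lemma ptm_trunc: "ptm (ptgraph.truncate a) b f h \<longleftrightarrow> ptm a b f h" "ptm a (ptgraph.truncate b) f h \<longleftrightarrow> ptm a b f h"
 unfolding ptm_def by simp_all

lemma is_ptgraph_trunc: "is_ptgraph (ptgraph.truncate a) \<longleftrightarrow> is_ptgraph a"
 unfolding is_ptgraph_def is_tgraph_def by simp

text \<open>A value of an operation in a is e of the same operation in Q applied to lifts along s.
  Since both e and f e = p preserve the operations, so does f; the splitting s is merely a map of
  pointed graphs.\<close>

lemma descent:
 assumes o: "ctob a" "ctob a'" "ctob Q" and e: "ctm Q a e l" and s: "ptm a Q s l'"
  and es: "!!n x. x \<in> tcell a n ==> e n (s n x) = x" and f: "ptm a a' f h" and p: "ctm Q a' p k"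
  and fe: "!!n x. x \<in> tcell Q n ==> f n (e n x) = p n x"
 shows "ctm a a' f h"
proof -
 note G = ctobD(3)[OF o(1)] ctobD(3)[OF o(2)] ctobD(3)[OF o(3)]
 note O = pgD(2)[OF G(1)] pgD(2)[OF G(2)] pgD(2)[OF G(3)] and sc = omap_cell[OF ptmD(1)[OF s]]
 have "f n (mul a n (K, x)) = mul a' n (T_map (tot a') f n K, f n x)" if k: "(K, x) \<in> pcell a n" for n K x
 proof -
  let ?K = "T_map (tot Q) s n K"
  note k' = pb_map_cell[OF G(1,3) s k]
  have c: "K \<in> Tcell (tot a) n" "x \<in> tcell a n" using k unfolding pb_iff by auto
  have "T_map (tot a) e n ?K = K"
   using T_map_comp[OF O(1,3,1) ptmD(1)[OF s] ptmD(1)[OF ctmD(2)[OF e]] c(1)] T_map_ident[OF O(1) c(1) es] by simp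
  hence "mul a n (K, x) = e n (mul Q n (?K, s n x))" using ctmD(3)[OF e k'] es[OF c(2)] by simp
  moreover have "T_map (tot a') p n ?K = T_map (tot a') f n K"
   unfolding T_map_comp[OF O(1,3,2) ptmD(1)[OF s] ptmD(1)[OF ctmD(2)[OF p]] c(1)]
   by (rule T_map_cong[OF O(1) c(1)]) (simp add: fe[OF sc, symmetric] es)
  ultimately show ?thesis using fe[OF ctobD(9)[OF o(3) k']] ctmD(3)[OF p k'] fe[OF sc[OF c(2)]] es[OF c(2)] by simp
 qed
 moreover have "f (Suc i) (contr a i x y) = contr a' i (f i x) (f i y)" if c: "(x, y) \<in> contractible_pairs a i" for i x y
 proof -
  note c' = contractible_push[OF G(1) ctobD(4)[OF o(1)] G(3) ctobD(4)[OF o(3)] s c]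
  have x: "x \<in> tcell a i" "y \<in> tcell a i" using contractible_cells[OF c] by auto
  show ?thesis
   using ctmD(4)[OF e c'] ctmD(4)[OF p c'] fe[OF ctobD(5)[OF o(3) c']] fe[OF sc[OF x(1)]] fe[OF sc[OF x(2)]] es[OF x(1)] es[OF x(2)] by simp
 qed
 ultimately show ?thesis unfolding ctm_def mulm_def using f by blast
qed

text \<open>The operations of an algebra \<open>bet\<close> on \<open>b\<close> are those of the free object, transported along the splitting
  \<open>s\<close> of \<open>bet\<close>.\<close>

lemma algebra_object:
 fixes b :: "'u ptgraph"
 assumes b: "is_ptgraph b" "constant_ograph (base b)" and o: "ctob Q" "ctob W" and s: "ptm b Q s s'" and bet: "ptm Q b bet bet'"
  and bets: "!!n x. x \<in> tcell b n ==> bet n (s n x) = x" and m: "ctm W Q m m'" and z: "ctm W Q z z'" and r: "ptm Q W r r'"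
  and mr: "!!n x. x \<in> tcell Q n ==> m n (r n x) = x" and zr: "!!n x. x \<in> tcell Q n ==> z n (r n x) = s n (bet n x)"
  and mz: "!!n x. x \<in> tcell W n ==> bet n (m n x) = bet n (z n x)"
 shows "\<exists>B. ctob B \<and> ptgraph.truncate B = b \<and> ctm Q B bet bet'"
proof -
 define B :: "'u ctcat" where "B = \<lparr> base = base b, tot = tot b, dmap = dmap b, cmap = cmap b, pt = pt b,
  mul = (%n (K, x). bet n (mul Q n (T_map (tot Q) s n K, s n x))), contr = (%k x y. bet (Suc k) (contr Q k (s k x) (s k y))) \<rparr>"
 have Bb: "ptgraph.truncate B = b" unfolding B_def ptgraph.truncate_def by simp
 have Bm: "mul B n (K, x) = bet n (mul Q n (T_map (tot Q) s n K, s n x))" "contr B k x y = bet (Suc k) (contr Q k (s k x) (s k y))" for n K x k y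
  unfolding B_def by simp_all
 have B: "is_ptgraph B" "constant_ograph (base B)" using b is_ptgraph_trunc[of B] trunc_simps(1)[of B] unfolding Bb by simp_all
 have s: "ptm B Q s s'" and bet: "ptm Q B bet bet'" using s bet ptm_trunc(1)[of B Q s s'] ptm_trunc(2)[of Q B bet bet'] unfolding Bb by auto
 have bets: "bet n (s n x) = x" if "x \<in> tcell B n" for n x using bets that unfolding B_def by simp
 note G = B(1) ctobD(3)[OF o(1)] ctobD(3)[OF o(2)]
 note O = pgD(2)[OF G(1)] pgD(2)[OF G(2)] pgD(2)[OF G(3)]
 note sc = omap_cell[OF ptmD(1)[OF s]] and rc = omap_cell[OF ptmD(1)[OF r]]
 \<comment> \<open>Lift the arguments along r. Then m returns them and z sends them to their images
   under s after \<open>bet\<close>; \<open>bet\<close> identifies the two products, which is the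
   claim.\<close>
 have "bet n (mul Q n (K, x)) = mul B n (T_map (tot B) bet n K, bet n x)" if k: "(K, x) \<in> pcell Q n" for n K x
 proof -
  note k' = pb_map_cell[OF G(2,3) r k]
  have c: "K \<in> Tcell (tot Q) n" "x \<in> tcell Q n" using k unfolding pb_iff by auto
  have "T_map (tot Q) m n (T_map (tot W) r n K) = K"
   using T_map_comp[OF O(2,3,2) ptmD(1)[OF r] ptmD(1)[OF ctmD(2)[OF m]] c(1)] T_map_ident[OF O(2) c(1) mr] by simp
  moreover have "T_map (tot Q) z n (T_map (tot W) r n K) = T_map (tot Q) s n (T_map (tot B) bet n K)"
   unfolding T_map_comp[OF O(2,3,2) ptmD(1)[OF r] ptmD(1)[OF ctmD(2)[OF z]] c(1)]
    T_map_comp[OF O(2,1,2) ptmD(1)[OF bet] ptmD(1)[OF s] c(1)]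
   by (rule T_map_cong[OF O(2) c(1)]) (rule zr)
  ultimately show ?thesis
   using mz[OF ctobD(9)[OF o(2) k']] ctmD(3)[OF m k'] ctmD(3)[OF z k'] mr[OF c(2)] zr[OF c(2)] unfolding Bm by simp
 qed
 moreover have "bet (Suc i) (contr Q i x y) = contr B i (bet i x) (bet i y)" if c: "(x, y) \<in> contractible_pairs Q i" for i x y
 proof -
  note c' = contractible_push[OF G(2) ctobD(4)[OF o(1)] G(3) ctobD(4)[OF o(2)] r c]
  have x: "x \<in> tcell Q i" "y \<in> tcell Q i" using contractible_cells[OF c] by auto
  show ?thesis
   using ctmD(4)[OF m c'] ctmD(4)[OF z c'] mz[OF ctobD(5)[OF o(2) c']] mr[OF x(1)] mr[OF x(2)] zr[OF x(1)] zr[OF x(2)] unfolding Bm by simp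
 qed
 ultimately have cB: "ctm Q B bet bet'" unfolding ctm_def mulm_def using bet by blast
 \<comment> \<open>\<open>final_lift\<close> with one stage: s lifts the ingredients of every law,
   including the cells of T of the pullback.\<close>
 have "ctob B"
 proof (rule final_lift[of B "{()}" "%_. Q" "%_. bet" "%_. bet'"])
  have pb: "pbmap B bet n (pbmap Q s n p) = p" if "p \<in> pcell B n" for n p
   using that T_map_comp[OF O(1,2,1) ptmD(1)[OF s] ptmD(1)[OF bet]] T_map_ident[OF O(1) _ bets] bets unfolding pbmap_def by (cases p) (auto simp: pb_iff)
  show "\<exists>j\<in>{()}. \<exists>x'\<in>tcell Q n. bet n x' = x" if "x \<in> tcell B n" for n x using sc bets that by blast
  show "\<exists>j\<in>{()}. \<exists>p'\<in>pcell Q n. pbmap B bet n p' = p" if p: "p \<in> pcell B n" for n p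
   using pb[OF p] omap_cell[OF pbmap_ograph_map[OF G(1,2) s] p] by blast
  show "\<exists>j\<in>{()}. \<exists>x' y'. (x', y') \<in> contractible_pairs Q k \<and> bet k x' = x \<and> bet k y' = y" if "(x, y) \<in> contractible_pairs B k" for k x y
   using contractible_push[OF B G(2) ctobD(4)[OF o(1)] s that] contractible_cells[OF that] bets by blast
  fix n tht x assume tht: "tht \<in> Tcell (pullback B) n" and x: "x \<in> tcell B n" and eq: "T_map (base B) (%i Kx. cmap B i (snd Kx)) n tht = dmap B n x"
  note PB = pb_ograph[OF G(1)] pb_ograph[OF G(2)] and sp = pbmap_ograph_map[OF G(1,2) s]
  note cs = ograph_map_comp[OF snd_ograph_map pgD(4)[OF G(1)]] ograph_map_comp[OF snd_ograph_map pgD(4)[OF G(2)]]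
  let ?tht = "T_map (pullback Q) (pbmap Q s) n tht"
  have "T_map (base Q) (%i Kx. cmap Q i (snd Kx)) n ?tht = T_map (base Q) (%i Kx. cmap Q i (snd (pbmap Q s i Kx))) n tht"
   by (rule T_map_comp[OF PB pgD(1)[OF G(2)] sp cs(2) tht])
  also have "\<dots> = T_map (base Q) (%i Kx. s' i (cmap B i (snd Kx))) n tht"
   by (rule T_map_cong[OF PB(1) tht]) (use ptmD(4)[OF s] in \<open>auto simp: pbmap_def pb_iff\<close>)
  also have "\<dots> = T_map (base Q) s' n (dmap B n x)"
   unfolding eq[symmetric] by (rule T_map_comp[OF PB(1) pgD(1)[OF G(1)] pgD(1)[OF G(2)] cs(1) ptmD(2)[OF s] tht, symmetric])
  also have "\<dots> = dmap Q n (s n x)" using ptmD(3)[OF s x] by simp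
  finally have e: "T_map (base Q) (%i Kx. cmap Q i (snd Kx)) n ?tht = dmap Q n (s n x)" .
  have "T_map (pullback B) (pbmap B bet) n ?tht = tht"
   using T_map_comp[OF PB PB(1) sp pbmap_ograph_map[OF G(2,1) bet] tht] T_map_ident[OF PB(1) tht pb] by simp
  thus "\<exists>j\<in>{()}. \<exists>tht'\<in>Tcell (pullback Q) n. \<exists>x'\<in>tcell Q n.
     T_map (base Q) (%i Kx. cmap Q i (snd Kx)) n tht' = dmap Q n x' \<and>
     T_map (pullback B) (pbmap B bet) n tht' = tht \<and> bet n x' = x"
   using e T_map_cell[OF PB sp tht] sc[OF x] bets[OF x] by blast
 qed (use B o cB in auto)
 thus ?thesis using Bb cB by blast
qed

theorem (in universe) forgetful_monadic: "monadic (CTCat_c :: ('u ctcat, ('u ctcat, 'u) arrow) category) TGr_pc forgetful"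
proof -
 let ?A = "CTCat_c :: ('u ctcat, ('u ctcat, 'u) arrow) category" and ?B = "TGr_pc :: ('u ptgraph, ('u ptgraph, 'u) arrow) category"
 let ?U = "forgetful :: ('u ctcat, ('u ctcat, 'u) arrow, 'u ptgraph, ('u ptgraph, 'u) arrow) cfunctor"
 have Uo: "fobj ?U a = ptgraph.truncate a" and Um: "mp (farr ?U u) = mp u" for a u unfolding forgetful_def mp_def by (simp_all add: case_prod_beta)
 have UH: "farr ?U u \<in> Hom ?B (ptgraph.truncate a) (ptgraph.truncate b)" if u: "u \<in> Hom ?A a b" for u a b
 proof -
  note o = ct.HomD[OF u]
  have "(mp u, snd (snd (snd u))) \<in> ctcat_hom a b" using o(5) unfolding mp_def by simp
  hence "(mp u, snd (snd (snd u))) \<in> ptgraph_hom (ptgraph.truncate a) (ptgraph.truncate b)"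
   unfolding ct.H tg.H ptm_trunc using ctmD(2) by auto
  moreover have "farr ?U u = (ptgraph.truncate a, ptgraph.truncate b, mp u, snd (snd (snd u)))"
   using o(4) unfolding forgetful_def mp_def by (cases u) auto
  ultimately show ?thesis unfolding tg.C Hom_hom using o(1,2) by (simp add: is_ptgraph_trunc ctobD(3,4))
 qed
 have Uf: "is_functor ?A ?B ?U"
 proof (rule functorI[OF ct.is_cat tg.is_cat]; (unfold Uo)?)
  show "farr ?U (one ?A a) = one ?B (ptgraph.truncate a)" if a: "a \<in> obj ?A" for a
   by (rule tg.Hom_eqI[OF UH[OF catD(2)[OF ct.is_cat a]] catD(2)[OF tg.is_cat]])
    (use a in \<open>auto simp: Um agree_def ct.mp_one tg.mp_one ct.objC tg.objC ctobD(3,4) is_ptgraph_trunc\<close>)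
  show "farr ?U (cmp ?A g f) = cmp ?B (farr ?U g) (farr ?U f)" if f: "f \<in> Hom ?A a b" and g: "g \<in> Hom ?A b c" for f g a b c
   by (rule tg.Hom_eqI[OF UH[OF catD(3)[OF ct.is_cat f g]] catD(3)[OF tg.is_cat UH[OF f] UH[OF g]]])
    (simp add: Um agree_def ct.mp_cmp[OF f g] tg.mp_cmp[OF UH[OF f] UH[OF g]])
 qed (use UH in \<open>auto simp: ct.objC tg.objC ctobD(3,4) is_ptgraph_trunc\<close>)
 have bo: "is_ptgraph b" "constant_ograph (base b)" if "b \<in> obj ?B" for b using that unfolding tg.objC by auto
 \<comment> \<open>Free object and unit form one pair, so that they can be chosen for all b
   together.\<close>
 define fr where "fr b p \<longleftrightarrow> ctob (fst p) \<and> (\<exists>eta'. ptm b (fst p) (snd p) eta') \<and>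
   (\<forall>M f h. ctob M --> ptm b M f h --> (\<exists>g k. ctm (fst p) M g k \<and> agree b (%n x. g n (snd p n x)) f)) \<and>
   (\<forall>M g k g' k'. ctob M --> ctm (fst p) M g k --> ctm (fst p) M g' k' -->
    agree b (%n x. g n (snd p n x)) (%n x. g' n (snd p n x)) --> agree (fst p) g g')"
  for b :: "'u ptgraph" and p :: "'u ctcat \<times> (nat => 'u => 'u)"
 have "\<exists>p. fr b p" if b: "b \<in> obj ?B" for b
 proof -
  obtain N eta eta' where "ctob N \<and> ptm b N eta eta' \<and> (\<forall>M f h. ctob M --> ptm b M f h --> (\<exists>g k. ctm N M g k \<and> agree b (%n x. g n (eta n x)) f)) \<and>
   (\<forall>M g k g' k'. ctob M --> ctm N M g k --> ctm N M g' k' --> agree b (%n x. g n (eta n x)) (%n x. g' n (eta n x)) --> agree N g g')"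
   using free_exists[OF bo[OF b]] by (elim exE)
  hence "fr b (N, eta)" unfolding fr_def fst_conv snd_conv by blast
  thus ?thesis by blast
 qed
 hence "\<forall>b\<in>obj ?B. \<exists>p. fr b p" by blast
 from bchoice[OF this] obtain q where q: "\<forall>b\<in>obj ?B. fr b (q b)" by blast
 define F eta where "F b = fst (q b)" and "eta b = snd (q b)" for b
 have F: "ctob (F b)" "\<exists>h. ptm b (F b) (eta b) h"
  and Fex: "!!M f h. ctob M ==> ptm b M f h ==> \<exists>g k. ctm (F b) M g k \<and> agree b (%n x. g n (eta b n x)) f"
  and Fun: "!!M g k g' k'. ctob M ==> ctm (F b) M g k ==> ctm (F b) M g' k' ==>
    agree b (%n x. g n (eta b n x)) (%n x. g' n (eta b n x)) ==> agree (F b) g g'" if b: "b \<in> obj ?B" for b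
  using bspec[OF q b] unfolding fr_def F_def eta_def by blast+
 define y where "y b = mk b (ptgraph.truncate (F b)) (eta b)" for b
 have y: "y b \<in> Hom ?B b (ptgraph.truncate (F b))" if b: "b \<in> obj ?B" for b
  unfolding y_def using F[OF b] bo[OF b] by (auto intro!: tg.mk_Hom simp: ptm_trunc is_ptgraph_trunc ctobD(3,4))
 have ym: "mp (y b) n x = eta b n x" if "x \<in> tcell b n" for b n x unfolding y_def by (rule tg.mp_mk[OF that])
 have yc: "mp (cmp ?B (farr ?U g) (y b)) n x = mp g n (eta b n x)" if "b \<in> obj ?B" "g \<in> Hom ?A (F b) a" "x \<in> tcell b n" for b g a n x
  using tg.mp_cmp[OF y[OF that(1)] UH[OF that(2)] that(3)] ym[OF that(3)] unfolding Um by simp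
 have Bm: "\<exists>h. ptm b a (mp f) h" if "f \<in> Hom ?B b (ptgraph.truncate a)" for f b and a :: "'u ctcat"
  using tg.HomD(3)[OF that] unfolding ptm_trunc .
 have yeta: "mp g n (mp (y b) n x) = mp f n x" if "cmp ?B (farr ?U g) (y b) = f" "b \<in> obj ?B" "g \<in> Hom ?A (F b) a" "x \<in> tcell b n" for b f g a n x
  using yc[OF that(2-4)] ym[OF that(4)] that(1) by simp
 show ?thesis
 proof (rule monadicI[OF Uf, of F y]; (unfold Uo)?)
  show "F b \<in> obj ?A \<and> y b \<in> Hom ?B b (ptgraph.truncate (F b))" if "b \<in> obj ?B" for b using F y that unfolding ct.objC by blast
 next
  fix b a f assume b: "b \<in> obj ?B" and a: "a \<in> obj ?A" and f: "f \<in> Hom ?B b (ptgraph.truncate a)"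
  have a': "ctob a" using a unfolding ct.objC by simp
  obtain h where "ptm b a (mp f) h" using Bm[OF f] by blast
  then obtain g k where g: "ctm (F b) a g k" "agree b (%n x. g n (eta b n x)) (mp f)" using Fex[OF b a'] by blast
  have g': "mk (F b) a g \<in> Hom ?A (F b) a" by (rule ct.mk_Hom[OF _ _ g(1)]) (use F[OF b] a' in auto)
  obtain h where h: "ptm b (F b) (eta b) h" using F[OF b] by blast
  have "cmp ?B (farr ?U (mk (F b) a g)) (y b) = f"
   by (rule tg.Hom_eqI[OF catD(3)[OF tg.is_cat y[OF b] UH[OF g']] f])
    (use g(2) yc[OF b g'] ct.mp_mk[OF omap_cell[OF ptmD(1)[OF h]]] in \<open>auto simp: agree_def\<close>)
  thus "\<exists>g\<in>Hom ?A (F b) a. cmp ?B (farr ?U g) (y b) = f" using g' by blast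
 next
  fix b a g g' assume g: "g \<in> Hom ?A (F b) a" "g' \<in> Hom ?A (F b) a" and b: "b \<in> obj ?B" and e: "cmp ?B (farr ?U g) (y b) = cmp ?B (farr ?U g') (y b)"
  have "agree b (%n x. mp g n (eta b n x)) (%n x. mp g' n (eta b n x))"
   using yc[OF b g(1)] yc[OF b g(2)] e unfolding agree_def by metis
  moreover have "ctob a" using ct.HomD(2)[OF g(1)] by simp
  ultimately have "agree (F b) (mp g) (mp g')" using Fun[OF b] ct.HomD(3)[OF g(1)] ct.HomD(3)[OF g(2)] by blast
  thus "g = g'" by (rule ct.Hom_eqI[OF g])
 next
  fix a a' f f' assume "f \<in> Hom ?A a a'" "f' \<in> Hom ?A a a'" and e: "farr ?U f = farr ?U f'"
  thus "f = f'" using Um[of f] Um[of f'] by (intro ct.Hom_eqI) (auto simp: agree_def)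
 next
  fix a a' f e p assume a: "a \<in> obj ?A" and e: "e \<in> Hom ?A (F (ptgraph.truncate a)) a"
   and ey: "cmp ?B (farr ?U e) (y (ptgraph.truncate a)) = one ?B (ptgraph.truncate a)"
   and f: "f \<in> Hom ?B (ptgraph.truncate a) (ptgraph.truncate a')" and p: "p \<in> Hom ?A (F (ptgraph.truncate a)) a'"
   and fe: "cmp ?B f (farr ?U e) = farr ?U p"
  note b = tg.HomD(1)[OF f, folded tg.objC]
  have o: "ctob a" "ctob a'" using ct.HomD(2)[OF e] ct.HomD(2)[OF p] by auto
  obtain h l k where h: "ptm a a' (mp f) h" and l: "ctm (F (ptgraph.truncate a)) a (mp e) l" and k: "ctm (F (ptgraph.truncate a)) a' (mp p) k"
   using tg.HomD(3)[OF f] ct.HomD(3)[OF e] ct.HomD(3)[OF p] unfolding ptm_trunc by blast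
  obtain l' where l': "ptm a (F (ptgraph.truncate a)) (mp (y (ptgraph.truncate a))) l'" using tg.HomD(3)[OF y[OF b]] unfolding ptm_trunc by blast
  have "ctm a a' (mp f) h"
  proof (rule descent[OF o F(1)[OF b] l l' _ h k])
   show "mp e n (mp (y (ptgraph.truncate a)) n x) = x" if "x \<in> tcell a n" for n x
    using yeta[OF ey b e] that by (simp add: tg.mp_one)
   show "mp f n (mp e n x) = mp p n x" if "x \<in> tcell (F (ptgraph.truncate a)) n" for n x
    using tg.mp_cmp[OF UH[OF e] f, of x n] that unfolding fe Um by simp
  qed
  hence g: "mk a a' (mp f) \<in> Hom ?A a a'" using o by (intro ct.mk_Hom) auto
  have "farr ?U (mk a a' (mp f)) = f" by (rule tg.Hom_eqI[OF UH[OF g] f]) (simp add: agree_def Um ct.mp_mk)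
  thus "\<exists>g\<in>Hom ?A a a'. farr ?U g = f" using g by blast
 next
  fix b bet m z
  let ?Q = "F b" and ?W = "F (ptgraph.truncate (F b))"
  assume b: "b \<in> obj ?B" and bet: "bet \<in> Hom ?B (ptgraph.truncate ?Q) b" and bety: "cmp ?B bet (y b) = one ?B b"
   and m: "m \<in> Hom ?A ?W ?Q" and z: "z \<in> Hom ?A ?W ?Q"
   and my: "cmp ?B (farr ?U m) (y (ptgraph.truncate ?Q)) = one ?B (ptgraph.truncate ?Q)"
   and zy: "cmp ?B (farr ?U z) (y (ptgraph.truncate ?Q)) = cmp ?B (y b) bet"
   and mz: "cmp ?B bet (farr ?U m) = cmp ?B bet (farr ?U z)"
  note q = tg.HomD(1)[OF bet, folded tg.objC]
  obtain s' where s: "ptm b ?Q (mp (y b)) s'" using Bm[OF y[OF b]] by blast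
  obtain r' where r: "ptm ?Q ?W (mp (y (ptgraph.truncate ?Q))) r'" using Bm[OF y[OF q]] unfolding ptm_trunc by blast
  obtain bet' where bet': "ptm ?Q b (mp bet) bet'" using tg.HomD(3)[OF bet] unfolding ptm_trunc by blast
  obtain m' z' where m': "ctm ?W ?Q (mp m) m'" and z': "ctm ?W ?Q (mp z) z'" using ct.HomD(3)[OF m] ct.HomD(3)[OF z] by blast
  have "\<exists>B. ctob B \<and> ptgraph.truncate B = b \<and> ctm ?Q B (mp bet) bet'"
  proof (rule algebra_object[OF bo[OF b] F(1)[OF b] F(1)[OF q] s bet' _ m' z' r])
   show "mp bet n (mp (y b) n x) = x" if "x \<in> tcell b n" for n x
    using tg.mp_cmp[OF y[OF b] bet that] tg.mp_one[OF that] bety by simp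
   show "mp m n (mp (y (ptgraph.truncate ?Q)) n x) = x" if "x \<in> tcell ?Q n" for n x
    using yeta[OF my q m] that by (simp add: tg.mp_one)
   show "mp z n (mp (y (ptgraph.truncate ?Q)) n x) = mp (y b) n (mp bet n x)" if "x \<in> tcell ?Q n" for n x
    using yeta[OF zy q z] tg.mp_cmp[OF bet y[OF b]] that by simp
   show "mp bet n (mp m n x) = mp bet n (mp z n x)" if "x \<in> tcell ?W n" for n x
    using tg.mp_cmp[OF UH[OF m] bet, of x n] tg.mp_cmp[OF UH[OF z] bet, of x n] that mz unfolding Um by simp
  qed
  then obtain B where B: "ctob B" "ptgraph.truncate B = b" "ctm ?Q B (mp bet) bet'" by blast
  have e: "mk ?Q B (mp bet) \<in> Hom ?A ?Q B" using B F(1)[OF b] by (intro ct.mk_Hom) auto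
  have "farr ?U (mk ?Q B (mp bet)) = bet" by (rule tg.Hom_eqI[OF UH[OF e, unfolded B(2)] bet]) (simp add: agree_def Um ct.mp_mk)
  thus "\<exists>a\<in>obj ?A. ptgraph.truncate a = b \<and> (\<exists>e\<in>Hom ?A ?Q a. farr ?U e = bet)" using B e unfolding ct.objC by blast
 qed
qed

section \<open>Local presentability\<close>

lemma Set_cat_Hom: "u \<in> Hom Set_cat X Y \<longleftrightarrow> snd (snd u) \<in> X \<rightarrow>\<^sub>E Y \<and> u = (X, Y, snd (snd u))"
 unfolding Set_cat_def Hom_hom by auto

text \<open>Over a directed diagram, a cocone of sets is a colimit once every element comes from a
  stage and elements of one stage with equal images become equal later. For hom-sets these two
  conditions are factorization and its essential uniqueness.\<close>

lemma hom_colimit: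
 assumes A: "is_category A" and D: "is_functor J A D" and J: "is_category J"
  and dir: "!!i j. i \<in> obj J ==> j \<in> obj J ==> \<exists>k\<in>obj J. Hom J i k \<noteq> {} \<and> Hom J j k \<noteq> {}"
  and c: "is_cocone A J D x io"
  and surj: "!!g. g \<in> Hom A a x ==> \<exists>i\<in>obj J. \<exists>q\<in>Hom A a (fobj D i). cmp A (io i) q = g"
  and inj: "!!i q q'. i \<in> obj J ==> q \<in> Hom A a (fobj D i) ==> q' \<in> Hom A a (fobj D i) ==> cmp A (io i) q = cmp A (io i) q' ==>
   \<exists>j. \<exists>u\<in>Hom J i j. cmp A (farr D u) q = cmp A (farr D u) q'"
 shows "is_colimit Set_cat J (hom_functor A a \<circ>\<^sub>F D) (fobj (hom_functor A a) x) (%i. farr (hom_functor A a) (io i))"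
proof -
 let ?F = "hom_functor A a"
 have io: "io i \<in> Hom A (fobj D i) x" if "i \<in> obj J" for i using c that unfolding is_cocone_def by blast
 have ioD: "cmp A (io j) (farr D u) = io i" if "u \<in> Hom J i j" for u i j using c that unfolding is_cocone_def Hom_arr by blast
 have Fo: "fobj ?F b = Hom A a b" for b unfolding hom_functor_def by simp
 have Fa: "farr ?F f = (Hom A a b, Hom A a d, restrict (%g. cmp A f g) (Hom A a b))" "farr ?F f \<in> Hom Set_cat (Hom A a b) (Hom A a d)"
  if f: "f \<in> Hom A b d" for f b d
 proof -
  show e: "farr ?F f = (Hom A a b, Hom A a d, restrict (%g. cmp A f g) (Hom A a b))" using f unfolding hom_functor_def Hom_arr by simp
  show "farr ?F f \<in> Hom Set_cat (Hom A a b) (Hom A a d)" unfolding e Set_cat_Hom using catD(3)[OF A _ f] by auto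
 qed
 note Ft = hom_category_simps(3)[where H = "%X Y. X \<rightarrow>\<^sub>E Y" and X = UNIV, folded Set_cat_def]
 have Dc: "cmp A (farr D u) q \<in> Hom A a (fobj D j)" "cmp A (io j) (cmp A (farr D u) q) = cmp A (io i) q"
  if u: "u \<in> Hom J i j" and q: "q \<in> Hom A a (fobj D i)" for u i j q
  using catD(3)[OF A q funD(4)[OF D u]] catD(6)[OF A q funD(4)[OF D u] io] catD(1)[OF J u] ioD[OF u] by auto
 show ?thesis unfolding is_colimit_def
 proof (intro conjI allI impI)
  show "is_cocone Set_cat J (?F \<circ>\<^sub>F D) (fobj ?F x) (%i. farr ?F (io i))" unfolding is_cocone_def
  proof (intro conjI ballI)
   show "fobj ?F x \<in> obj Set_cat" unfolding Set_cat_def hom_category_simps by simp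
   show "farr ?F (io i) \<in> Hom Set_cat (fobj (?F \<circ>\<^sub>F D) i) (fobj ?F x)" if "i \<in> obj J" for i
    using Fa(2)[OF io[OF that]] unfolding comp_functor_def by (simp add: Fo)
   fix u assume "u \<in> arr J"
   hence u: "u \<in> Hom J (dom J u) (cod J u)" unfolding Hom_arr by simp
   note o = catD(1)[OF J u]
   note iu = io[OF conjunct2[OF o]] and ui = io[OF conjunct1[OF o]]
   show "cmp Set_cat (farr ?F (io (cod J u))) (farr (?F \<circ>\<^sub>F D) u) = farr ?F (io (dom J u))"
    using Ft[OF Fa(2)[OF funD(4)[OF D u], unfolded Set_cat_def] Fa(2)[OF iu, unfolded Set_cat_def], folded Set_cat_def]
     Dc[OF u] unfolding comp_functor_def by (auto simp: Fa(1)[OF iu] Fa(1)[OF ui] Fa(1)[OF funD(4)[OF D u]] compose_def intro!: restrict_ext)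
  qed
 next
  fix Y ka assume k: "is_cocone Set_cat J (?F \<circ>\<^sub>F D) Y ka"
  define k where "k i = snd (snd (ka i))" for i
  have ka: "ka i = (Hom A a (fobj D i), Y, k i)" "k i \<in> Hom A a (fobj D i) \<rightarrow>\<^sub>E Y" "ka i \<in> Hom Set_cat (Hom A a (fobj D i)) Y" if "i \<in> obj J" for i
   using k that unfolding is_cocone_def Set_cat_Hom k_def comp_functor_def by (auto simp: Fo)
  have kD: "k j (cmp A (farr D u) q) = k i q" if u: "u \<in> Hom J i j" and q: "q \<in> Hom A a (fobj D i)" for u i j q
  proof -
   note o = catD(1)[OF J u]
   have "cmp Set_cat (ka j) (farr ?F (farr D u)) = ka i" using k u unfolding is_cocone_def comp_functor_def Hom_arr by auto
   hence "compose (Hom A a (fobj D i)) (k j) (restrict (%g. cmp A (farr D u) g) (Hom A a (fobj D i))) = k i"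
    using Ft[OF Fa(2)[OF funD(4)[OF D u], unfolded Set_cat_def] ka(3)[OF conjunct2[OF o], unfolded Set_cat_def], folded Set_cat_def]
     ka(1) o by (simp add: Fa(1)[OF funD(4)[OF D u]])
   from fun_cong[OF this, of q] show ?thesis using q by (simp add: compose_def)
  qed
  \<comment> \<open>Representatives at different stages are moved to a common one, where
    \<open>inj\<close> applies.\<close>
  have wd: "k i q = k j q'" if i: "i \<in> obj J" "j \<in> obj J" and q: "q \<in> Hom A a (fobj D i)" "q' \<in> Hom A a (fobj D j)" and e: "cmp A (io i) q = cmp A (io j) q'" for i j q q'
  proof -
   obtain m u v where m: "m \<in> obj J" and u: "u \<in> Hom J i m" and v: "v \<in> Hom J j m" using dir[OF i] by blast
   have "cmp A (io m) (cmp A (farr D u) q) = cmp A (io m) (cmp A (farr D v) q')" unfolding Dc(2)[OF u q(1)] Dc(2)[OF v q(2)] by (rule e)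
   from inj[OF m Dc(1)[OF u q(1)] Dc(1)[OF v q(2)] this] obtain l w where w: "w \<in> Hom J m l"
    and ew: "cmp A (farr D w) (cmp A (farr D u) q) = cmp A (farr D w) (cmp A (farr D v) q')" by blast
   show ?thesis using kD[OF w Dc(1)[OF u q(1)]] kD[OF w Dc(1)[OF v q(2)]] ew kD[OF u q(1)] kD[OF v q(2)] by simp
  qed
  define G where "G g = (SOME y. \<exists>i\<in>obj J. \<exists>q\<in>Hom A a (fobj D i). cmp A (io i) q = g \<and> y = k i q)" for g
  have G: "G (cmp A (io i) q) = k i q" if "i \<in> obj J" "q \<in> Hom A a (fobj D i)" for i q
   unfolding G_def by (rule some_equality) (use that wd in blast)+
  have GE: "restrict G (Hom A a x) \<in> Hom A a x \<rightarrow>\<^sub>E Y"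
  proof (rule restrict_PiE_iff[THEN iffD2], rule ballI)
   fix g assume "g \<in> Hom A a x"
   from surj[OF this] obtain i q where i: "i \<in> obj J" "q \<in> Hom A a (fobj D i)" "cmp A (io i) q = g" by blast
   show "G g \<in> Y" using G[OF i(1,2)] i(3) PiE_mem[OF ka(2)[OF i(1)] i(2)] by simp
  qed
  have ck: "cmp Set_cat f (farr ?F (io i)) = (Hom A a (fobj D i), Y, compose (Hom A a (fobj D i)) (snd (snd f)) (restrict (%g. cmp A (io i) g) (Hom A a (fobj D i))))"
   if "f \<in> Hom Set_cat (Hom A a x) Y" "i \<in> obj J" for f i
   using Ft[OF Fa(2)[OF io[OF that(2)], unfolded Set_cat_def] that(1)[unfolded Set_cat_def], folded Set_cat_def] by (simp add: Fa(1)[OF io[OF that(2)]])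
  show "\<exists>!f. f \<in> Hom Set_cat (fobj ?F x) Y \<and> (\<forall>i\<in>obj J. cmp Set_cat f (farr ?F (io i)) = ka i)"
  proof (rule ex1I[of _ "(Hom A a x, Y, restrict G (Hom A a x))"]; (unfold Fo)?)
   have g: "(Hom A a x, Y, restrict G (Hom A a x)) \<in> Hom Set_cat (Hom A a x) Y" unfolding Set_cat_Hom using GE by simp
   have "compose (Hom A a (fobj D i)) (restrict G (Hom A a x)) (restrict (%g. cmp A (io i) g) (Hom A a (fobj D i))) = k i" if i: "i \<in> obj J" for i
    by (rule extensionalityI[of _ "Hom A a (fobj D i)"])
     (use ka(2)[OF i] G[OF i] catD(3)[OF A _ io[OF i]] in \<open>auto simp: compose_def PiE_def\<close>)
   thus "(Hom A a x, Y, restrict G (Hom A a x)) \<in> Hom Set_cat (Hom A a x) Y \<and>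
     (\<forall>i\<in>obj J. cmp Set_cat (Hom A a x, Y, restrict G (Hom A a x)) (farr ?F (io i)) = ka i)"
    using g ck[OF g] ka(1) by simp
   fix f assume f: "f \<in> Hom Set_cat (Hom A a x) Y \<and> (\<forall>i\<in>obj J. cmp Set_cat f (farr ?F (io i)) = ka i)"
   hence f': "snd (snd f) \<in> Hom A a x \<rightarrow>\<^sub>E Y" "f = (Hom A a x, Y, snd (snd f))" unfolding Set_cat_Hom by auto
   have fk: "snd (snd f) (cmp A (io i) q) = k i q" if "i \<in> obj J" "q \<in> Hom A a (fobj D i)" for i q
   proof -
    have "compose (Hom A a (fobj D i)) (snd (snd f)) (restrict (%g. cmp A (io i) g) (Hom A a (fobj D i))) = k i"
     using f ck[of f i] that(1) ka(1)[OF that(1)] by auto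
    from fun_cong[OF this, of q] show ?thesis using that(2) by (simp add: compose_def)
   qed
   have "snd (snd f) = restrict G (Hom A a x)"
   proof (rule extensionalityI[of _ "Hom A a x"])
    show "snd (snd f) \<in> extensional (Hom A a x)" using f'(1) unfolding PiE_def by blast
    fix g assume g: "g \<in> Hom A a x"
    from surj[OF g] obtain i q where "i \<in> obj J" "q \<in> Hom A a (fobj D i)" "cmp A (io i) q = g" by blast
    thus "snd (snd f) g = restrict G (Hom A a x) g" using fk G g by auto
   qed simp
   thus "f = (Hom A a x, Y, restrict G (Hom A a x))" using f'(2) by simp
  qed
 qed
qed

section \<open>Cocompleteness and presentability of finitely presented objects\<close>

context universe
begin

text \<open>Diagrams must be indexed by categories on the type \<open>'u\<close>, so objects and
  arrows of the inclusion order are coded there.\<close>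

lemma poset_category:
 assumes J: "sm (J :: 'b set set)"
 shows "\<exists>(C :: ('u, 'u) category) d. small_category C \<and> bij_betw d (obj C) J \<and>
  (\<forall>f\<in>arr C. \<forall>g\<in>arr C. dom C f = dom C g \<and> cod C f = cod C g --> f = g) \<and>
  (\<forall>i\<in>obj C. \<forall>j\<in>obj C. Hom C i j \<noteq> {} \<longleftrightarrow> d i \<subseteq> d j)"
proof -
 obtain c :: "'b set => 'u" where c: "inj_on c J" using sm_inj[OF J] by blast
 define X where "X = c ` J"
 define d where "d = inv_into J c"
 have d: "bij_betw d X J" unfolding X_def d_def by (rule bij_betw_inv_into[OF inj_on_imp_bij_betw[OF c]])
 have X: "sm X" unfolding X_def by (rule sm_image[OF J])
 obtain q :: "'u \<times> 'u => 'u" where q: "inj_on q (X \<times> X)" using sm_inj[OF sm_Times[OF X X]] by blast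
 define R where "R = {(i, j). i \<in> X \<and> j \<in> X \<and> d i \<subseteq> d j}"
 define p where "p = inv_into (X \<times> X) q"
 have p: "p (q (i, j)) = (i, j)" if "i \<in> X" "j \<in> X" for i j unfolding p_def using inv_into_f_f[OF q] that by blast
 define C :: "('u, 'u) category" where "C = \<lparr> obj = X, arr = q ` R, dom = (%f. fst (p f)), cod = (%f. snd (p f)), one = (%i. q (i, i)),
  cmp = (%g f. q (fst (p f), snd (p g))) \<rparr>"
 have H: "f \<in> Hom C i j \<longleftrightarrow> (i, j) \<in> R \<and> f = q (i, j)" for f i j unfolding Hom_arr C_def R_def by (auto simp: p)
 have "is_category C" unfolding is_category_def Hom_arr unfolding C_def R_def by (auto simp: p intro!: imageI)
 moreover have "sm (arr C)" unfolding C_def by (simp, rule sm_image[OF sm_subset[OF sm_Times[OF X X]]]) (auto simp: R_def)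
 ultimately have "small_category C" unfolding small_category_def sm_iff using X unfolding C_def by simp
 moreover have "\<forall>f\<in>arr C. \<forall>g\<in>arr C. dom C f = dom C g \<and> cod C f = cod C g --> f = g" unfolding C_def R_def by (auto simp: p)
 moreover have "bij_betw d (obj C) J" using d unfolding C_def by simp
 moreover have "\<forall>i\<in>obj C. \<forall>j\<in>obj C. Hom C i j \<noteq> {} \<longleftrightarrow> d i \<subseteq> d j"
 proof (intro ballI)
  fix i j assume "i \<in> obj C" "j \<in> obj C"
  hence "(i, j) \<in> R \<longleftrightarrow> d i \<subseteq> d j" unfolding R_def C_def by simp
  thus "Hom C i j \<noteq> {} \<longleftrightarrow> d i \<subseteq> d j" using H by blast
 qed
 ultimately show ?thesis by blast
qed

abbreviation CT :: "('u ctcat, ('u ctcat, 'u) arrow) category" where "CT \<equiv> CTCat_c"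

text \<open>Translates a diagram of arrows into the transition maps of \<open>colim_exists\<close>.
  Keeping only the total maps loses nothing, since agreement on cells is equality of arrows.\<close>

lemma CT_cocomplete: "cocomplete TYPE('u) CT"
 unfolding cocomplete_def
proof (intro allI impI)
 fix J :: "('u, 'u) category" and D :: "('u, 'u, 'u ctcat, ('u ctcat, 'u) arrow) cfunctor"
 assume a: "small_category J \<and> is_functor J CT D"
 hence D: "is_functor J CT D" and Jc: "is_category J" and sm: "sm (obj J)" "sm (arr J)" unfolding small_category_def sm_iff by auto
 define R where "R = (%u. (dom J u, cod J u, mp (farr D u))) ` arr J"
 have u: "farr D u \<in> Hom CT (fobj D (dom J u)) (fobj D (cod J u))" "dom J u \<in> obj J" "cod J u \<in> obj J" if "u \<in> arr J" for u
  using funD(4)[OF D, of u] catD(1)[OF Jc, of u] that unfolding Hom_arr by auto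
 have Do: "ctob (fobj D j)" if "j \<in> obj J" for j using funD(3)[OF D that] unfolding ct.objC by simp
 have R: "j \<in> obj J \<and> k \<in> obj J \<and> (\<exists>h. ptm (fobj D j) (fobj D k) f h)" if "(j, k, f) \<in> R" for j k f
  using that u ct.HomD(3)[OF u(1)] ctmD(2) unfolding R_def by blast
 have coc: "is_cocone CT J D N ka \<longleftrightarrow> cocone (obj J) (fobj D) R N (%j. mp (ka j))" if ka: "\<forall>j\<in>obj J. ka j \<in> Hom CT (fobj D j) N" and N: "ctob N" for N ka
 proof -
  have "cmp CT (ka (cod J w)) (farr D w) = ka (dom J w) \<longleftrightarrow>
   agree (fobj D (dom J w)) (%n x. mp (ka (cod J w)) n (mp (farr D w) n x)) (mp (ka (dom J w)))" if w: "w \<in> arr J" for w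
  proof -
   note k = bspec[OF ka u(3)[OF w]] bspec[OF ka u(2)[OF w]]
   show ?thesis
    using ct.Hom_eqI[OF catD(3)[OF ct.is_cat u(1)[OF w] k(1)] k(2)] ct.mp_cmp[OF u(1)[OF w] k(1)] unfolding agree_def by auto
  qed
  moreover have "\<forall>j\<in>obj J. \<exists>l. ctm (fobj D j) N (mp (ka j)) l" using ct.HomD(3)[OF bspec[OF ka]] by blast
  ultimately show ?thesis using ka N unfolding is_cocone_def cocone_def R_def ct.objC by auto
 qed
 obtain N io where N: "cocone (obj J) (fobj D) R N io"
  and ex: "!!M ka. cocone (obj J) (fobj D) R M ka ==> \<exists>g k. ctm N M g k \<and> (\<forall>j\<in>obj J. agree (fobj D j) (%n x. g n (io j n x)) (ka j))"
  and un: "!!M g k g' k'. ctob M ==> ctm N M g k ==> ctm N M g' k' ==>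
    \<forall>j\<in>obj J. agree (fobj D j) (%n x. g n (io j n x)) (%n x. g' n (io j n x)) ==> agree N g g'"
  using colim_exists[OF sm(1) Do R sm_image[OF sm(2), of "%u. (dom J u, cod J u, mp (farr D u))", folded R_def]] by blast
 have No: "ctob N" and iom: "!!j. j \<in> obj J ==> \<exists>l. ctm (fobj D j) N (io j) l" using N unfolding cocone_def by auto
 define i where "i j = mk (fobj D j) N (io j)" for j
 have i: "i j \<in> Hom CT (fobj D j) N" if "j \<in> obj J" for j unfolding i_def using iom[OF that] Do[OF that] No by (auto intro: ct.mk_Hom)
 have im: "mp (i j) n x = io j n x" if "x \<in> tcell (fobj D j) n" for j n x unfolding i_def by (rule ct.mp_mk[OF that])
 have "cocone (obj J) (fobj D) R N (%j. mp (i j))"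
  using N im ct.HomD(3)[OF i] ct.mp_cell[OF u(1)] unfolding cocone_def agree_def R_def by auto
 hence "is_cocone CT J D N i" using coc i No by blast
 moreover have "\<exists>!f. f \<in> Hom CT N y \<and> (\<forall>j\<in>obj J. cmp CT f (i j) = ka j)" if k: "is_cocone CT J D y ka" for y ka
 proof -
  have y: "ctob y" and ka: "ka j \<in> Hom CT (fobj D j) y" if "j \<in> obj J" for j using k that unfolding is_cocone_def ct.objC by auto
  have yo: "ctob y" using k unfolding is_cocone_def ct.objC by auto
  obtain g h where g: "ctm N y g h" "\<forall>j\<in>obj J. agree (fobj D j) (%n x. g n (io j n x)) (mp (ka j))"
   using ex coc[OF _ yo] k ka by blast
  have gH: "mk N y g \<in> Hom CT N y" using g(1) No yo by (auto intro: ct.mk_Hom)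
  have c: "cmp CT f (i j) = ka j \<longleftrightarrow> agree (fobj D j) (%n x. mp f n (io j n x)) (mp (ka j))" if "f \<in> Hom CT N y" "j \<in> obj J" for f j
   using ct.Hom_eqI[OF catD(3)[OF ct.is_cat i[OF that(2)] that(1)] ka[OF that(2)]] ct.mp_cmp[OF i[OF that(2)] that(1)] im unfolding agree_def by auto
  have "mp (mk N y g) n (io j n x) = g n (io j n x)" if "j \<in> obj J" "x \<in> tcell (fobj D j) n" for j n x
   using ct.mp_mk ct.mp_cell[OF i[OF that(1)] that(2)] im[OF that(2)] by metis
  hence "mk N y g \<in> Hom CT N y \<and> (\<forall>j\<in>obj J. cmp CT (mk N y g) (i j) = ka j)" using gH g(2) c[OF gH] unfolding agree_def by auto
  moreover have "f = f'" if f: "f \<in> Hom CT N y \<and> (\<forall>j\<in>obj J. cmp CT f (i j) = ka j)" "f' \<in> Hom CT N y \<and> (\<forall>j\<in>obj J. cmp CT f' (i j) = ka j)" for f f'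
  proof (rule ct.Hom_eqI[of _ N y])
   obtain h h' where h: "ctm N y (mp f) h" "ctm N y (mp f') h'" using ct.HomD(3) f by blast
   show "agree N (mp f) (mp f')" by (rule un[OF yo h]) (use c[OF conjunct1[OF f(1)]] c[OF conjunct1[OF f(2)]] f in \<open>simp add: agree_def\<close>)
  qed (use f in auto)
  ultimately show ?thesis by blast
 qed
 ultimately show "\<exists>x io. is_colimit CT J D x io" unfolding is_colimit_def by blast
qed

lemma represents_arr:
 assumes r: "represents R Q u" and M: "ctob M" and a: "\<forall>al\<in>R. holds M a al"
 shows "\<exists>f\<in>Hom CT Q M. \<forall>(n, v)\<in>decl R. mp f n (u n v) = a n v"
proof -
 have Q: "ctob Q" "\<forall>al\<in>R. holds Q u al" using r unfolding represents_def by auto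
 obtain f h where f: "ctm Q M f h" "\<forall>(n, v)\<in>decl R. f n (u n v) = a n v" using r M a unfolding represents_def by meson
 have "u n v \<in> tcell Q n" if "(n, v) \<in> decl R" for n v using that Q(2) unfolding decl_def by force
 hence "\<forall>(n, v)\<in>decl R. mp (mk Q M f) n (u n v) = a n v" using f(2) ct.mp_mk by fastforce
 moreover have "mk Q M f \<in> Hom CT Q M" using f(1) Q(1) M by (auto intro: ct.mk_Hom)
 ultimately show ?thesis by blast
qed

lemma represents_eq:
 assumes r: "represents R Q u" and f: "f \<in> Hom CT Q M" "f' \<in> Hom CT Q M" and e: "\<forall>(n, v)\<in>decl R. mp f n (u n v) = mp f' n (u n v)"
 shows "f = f'"
proof (rule ct.Hom_eqI[OF f])
 have "ctob M" using ct.HomD(2)[OF f(1)] by simp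
 thus "agree Q (mp f) (mp f')" using r ct.HomD(3)[OF f(1)] ct.HomD(3)[OF f(2)] e unfolding represents_def by blast
qed

text \<open>An arrow out of Q is determined by the finite list of values at the generators, and
  lists over the small set of cells of M form a small set.\<close>

lemma Hom_small:
 assumes r: "represents R Q u" and fin: "finite R"
 shows "sm (Hom CT Q M)"
proof (cases "ctob M")
 case True
 obtain xs where xs: "set xs = decl R" using finite_list[OF finite_decl[OF fin]] by blast
 have h: "\<forall>al\<in>R. holds Q u al" using r unfolding represents_def by blast
 have uc: "u n v \<in> tcell Q n" if "(n, v) \<in> decl R" for n v using that h unfolding decl_def by force
 let ?f = "%f. map (%(n, v). mp f n (u n v)) xs"
 have "inj_on ?f (Hom CT Q M)"
  by (intro inj_onI represents_eq[OF r]) (auto simp: xs[symmetric])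
 moreover have "?f ` Hom CT Q M \<subseteq> lists (\<Union>n. tcell M n)"
  using ct.mp_cell uc unfolding xs[symmetric] by fastforce
 ultimately show ?thesis using sm_image_inj sm_subset[OF sm_lists[OF cells_small[OF ctobD(3)[OF True]]]] by blast
next
 case False
 hence "Hom CT Q M = {}" using ct.HomD(2) by fastforce
 thus ?thesis by (simp add: sm_finite)
qed

text \<open>The given colimit L is compared with the explicit colimit E, about which
  \<open>factor\<close> and \<open>factor_unique\<close> speak. The universal property of L gives k
  from L to E, \<open>E_desc\<close> gives p back, and p k = 1 suffices to transfer both statements
  to L.\<close>

lemma represents_presentable:
 fixes r :: "'u rel"
 assumes rc: "regular_cardinal r" and r: "represents R Q u" and fin: "finite R"
 shows "presentable r CT Q"
proof -
 have Q: "ctob Q" using r unfolding represents_def by blast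
 have main: "is_colimit Set_cat J (hom_functor CT Q \<circ>\<^sub>F D) (fobj (hom_functor CT Q) L) (%i. farr (hom_functor CT Q) (io i))"
  if J: "small_category J" "directed_poset r J" and D: "is_functor J CT D" and L: "is_colimit CT J D L io" for J :: "('u, 'u) category" and D L io
 proof -
  have Jc: "is_category J" and thin: "!!f g i j. f \<in> Hom J i j ==> g \<in> Hom J i j ==> f = g"
   using J(2) unfolding directed_poset_def Hom_arr by auto
  have bd: "\<exists>j\<in>obj J. \<forall>i\<in>S. Hom J i j \<noteq> {}" if S: "S \<subseteq> obj J" "finite S" for S
  proof -
   have "Well_order r" "infinite (Field r)" using rc unfolding regular_cardinal_def by (auto dest: card_order_on_well_order_on)
   hence "|S| <o r" using finite_ordLess_infinite[OF card_of_Well_order[of S]] S(2) by (simp add: Field_card_of)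
   thus ?thesis using J(2) S(1) unfolding directed_poset_def by blast
  qed
  define le where "le i j \<longleftrightarrow> Hom J i j \<noteq> {}" for i j
  \<comment> \<open>J is a poset, so w i j is the only arrow from i to j and transition maps depend
    on i and j alone.\<close>
  define w where "w i j = (SOME u. u \<in> Hom J i j)" for i j
  have w: "w i j \<in> Hom J i j" if "le i j" for i j using that unfolding le_def w_def by (simp add: some_in_eq)
  define tr where "tr i j = mp (farr D (w i j))" for i j
  have trw: "tr i j = mp (farr D v)" if "v \<in> Hom J i j" for v i j using thin[OF that w] that unfolding tr_def le_def by auto
  interpret dd: dirdiag U "obj J" le "fobj D" tr
  proof
   show "obj J \<noteq> {}" using bd[of "{}"] by auto
   show "small U (obj J)" using J(1) unfolding small_category_def sm_iff by blast
   show "le j j" if "j \<in> obj J" for j using catD(2)[OF Jc that] unfolding le_def by blast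
   show "le i k" if "le i j" "le j k" for i j k using catD(3)[OF Jc w[OF that(1)] w[OF that(2)]] unfolding le_def by blast
   show "\<exists>l\<in>obj J. le i l \<and> le j l" if "i \<in> obj J" "j \<in> obj J" for i j using bd[of "{i, j}"] that unfolding le_def by auto
   show "ctob (fobj D j)" if "j \<in> obj J" for j using funD(3)[OF D that] unfolding ct.objC by simp
   show "\<exists>h. ctm (fobj D i) (fobj D j) (tr i j) h" if "le i j" for i j
    unfolding tr_def by (rule ct.HomD(3)[OF funD(4)[OF D w[OF that]]])
   show "tr j j n x = x" if "j \<in> obj J" "x \<in> tcell (fobj D j) n" for j n x
    unfolding trw[OF catD(2)[OF Jc that(1)]] funD(5)[OF D that(1)] by (rule ct.mp_one[OF that(2)])
   show "tr j k n (tr i j n x) = tr i k n x" if "le i j" "le j k" "x \<in> tcell (fobj D i) n" for i j k n x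
    unfolding trw[OF catD(3)[OF Jc w[OF that(1)] w[OF that(2)]]] funD(6)[OF D w[OF that(1)] w[OF that(2)]] tr_def[of i j] tr_def[of j k]
    by (rule ct.mp_cmp[OF funD(4)[OF D w[OF that(1)]] funD(4)[OF D w[OF that(2)]] that(3), symmetric])
  qed
  have io: "io j \<in> Hom CT (fobj D j) L" if "j \<in> obj J" for j using L that unfolding is_colimit_def is_cocone_def by blast
  have ioD: "cmp CT (io j) (farr D v) = io i" if "v \<in> Hom J i j" for v i j using L that unfolding is_colimit_def is_cocone_def Hom_arr by blast
  have Lo: "ctob L" using L unfolding is_colimit_def is_cocone_def ct.objC by auto
  define E where "E = dd.E"
  define e where "e j = mk (fobj D j) E (dd.e j)" for j
  have e: "e j \<in> Hom CT (fobj D j) E" if "j \<in> obj J" for j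
   unfolding e_def E_def using dd.D[OF that] dd.E_object dd.E_ctm[OF that] by (auto intro: ct.mk_Hom)
  have em: "mp (e j) n x = dd.e j n x" if "x \<in> tcell (fobj D j) n" for j n x unfolding e_def by (rule ct.mp_mk[OF that])
  have "is_cocone CT J D E e" unfolding is_cocone_def
  proof (intro conjI ballI)
   show "E \<in> obj CT" unfolding ct.objC E_def using dd.E_object by simp
   fix v assume "v \<in> arr J"
   hence v: "v \<in> Hom J (dom J v) (cod J v)" unfolding Hom_arr by simp
   note o = catD(1)[OF Jc v] and Dv = funD(4)[OF D v]
   have le: "le (dom J v) (cod J v)" using v unfolding le_def by blast
   show "cmp CT (e (cod J v)) (farr D v) = e (dom J v)"
    by (rule ct.Hom_eqI[OF catD(3)[OF ct.is_cat Dv e[OF conjunct2[OF o]]] e[OF conjunct1[OF o]]])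
     (use dd.e_tr[OF conjunct1[OF o] conjunct2[OF o] le] in \<open>simp add: agree_def ct.mp_cmp[OF Dv e[OF conjunct2[OF o]]] em ct.mp_cell[OF Dv] trw[OF v]\<close>)
  qed (rule e)
  then obtain k where k: "k \<in> Hom CT L E" "!!j. j \<in> obj J ==> cmp CT k (io j) = e j" using L unfolding is_colimit_def by blast
  have "\<exists>g l. ctm dd.E L g l \<and> (\<forall>j\<in>obj J. \<forall>n. \<forall>x\<in>tcell (fobj D j) n. g n (dd.e j n x) = mp (io j) n x)"
  proof (rule dd.E_desc[OF Lo])
   show "\<exists>l. ctm (fobj D j) L (mp (io j)) l" if "j \<in> obj J" for j by (rule ct.HomD(3)[OF io[OF that]])
   show "mp (io j) n (tr i j n x) = mp (io i) n x" if "i \<in> obj J" "j \<in> obj J" "le i j" "x \<in> tcell (fobj D i) n" for i j n x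
    using ct.mp_cmp[OF funD(4)[OF D w[OF that(3)]] io[OF that(2)] that(4)] ioD[OF w[OF that(3)]] unfolding tr_def by simp
  qed
  then obtain g l where g: "ctm E L g l" "!!j n x. j \<in> obj J ==> x \<in> tcell (fobj D j) n ==> g n (dd.e j n x) = mp (io j) n x" unfolding E_def by blast
  define p where "p = mk E L g"
  have p: "p \<in> Hom CT E L" unfolding p_def using g(1) Lo dd.E_object unfolding E_def by (auto intro: ct.mk_Hom)
  have pe: "cmp CT p (e j) = io j" if j: "j \<in> obj J" for j
   by (rule ct.Hom_eqI[OF catD(3)[OF ct.is_cat e[OF j] p] io[OF j]])
    (use g(2)[OF j] ct.mp_mk[OF ct.mp_cell[OF e[OF j]], of _ _ L g] in \<open>simp add: agree_def ct.mp_cmp[OF e[OF j] p] em p_def[symmetric]\<close>)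
  \<comment> \<open>Both sides are arrows from L to L that fix the cocone \<open>io\<close>, so the
    uniqueness part of the colimit L equates them.\<close>
  have pk: "cmp CT p k = one CT L"
  proof -
   have "cmp CT (cmp CT p k) (io j) = io j" if "j \<in> obj J" for j
    using catD(6)[OF ct.is_cat io[OF that] k(1) p] k(2)[OF that] pe[OF that] by simp
   moreover have "cmp CT (one CT L) (io j) = io j" if "j \<in> obj J" for j by (rule catD(4)[OF ct.is_cat io[OF that]])
   moreover have "is_cocone CT J D L io" using L unfolding is_colimit_def by blast
   hence "\<exists>!f. f \<in> Hom CT L L \<and> (\<forall>i\<in>obj J. cmp CT f (io i) = io i)" using L unfolding is_colimit_def by blast
   moreover have "one CT L \<in> Hom CT L L" using catD(2)[OF ct.is_cat] Lo unfolding ct.objC by simp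
   ultimately show ?thesis using catD(3)[OF ct.is_cat k(1) p] by blast
  qed
  show ?thesis
  proof (rule hom_colimit[OF ct.is_cat D Jc])
   show "\<exists>k\<in>obj J. Hom J i k \<noteq> {} \<and> Hom J j k \<noteq> {}" if "i \<in> obj J" "j \<in> obj J" for i j using dd.dir[OF that] unfolding le_def .
   show "is_cocone CT J D L io" using L unfolding is_colimit_def by blast
  next
   fix f assume f: "f \<in> Hom CT Q L"
   note kf = catD(3)[OF ct.is_cat f k(1)]
   obtain h where h: "ctm Q dd.E (mp (cmp CT k f)) h" using ct.HomD(3)[OF kf] unfolding E_def by blast
   obtain j q h' where j: "j \<in> obj J" "ctm Q (fobj D j) q h'" "agree Q (%n x. dd.e j n (q n x)) (mp (cmp CT k f))"
    using dd.factor[OF r fin h] by blast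
   have q: "mk Q (fobj D j) q \<in> Hom CT Q (fobj D j)" using Q dd.D[OF j(1)] j(2) by (auto intro: ct.mk_Hom)
   have qc: "q n x \<in> tcell (fobj D j) n" if "x \<in> tcell Q n" for n x using omap_cell[OF ptmD(1)[OF ctmD(2)[OF j(2)]] that] .
   have "cmp CT (e j) (mk Q (fobj D j) q) = cmp CT k f"
    by (rule ct.Hom_eqI[OF catD(3)[OF ct.is_cat q e[OF j(1)]] kf])
     (use j(3) in \<open>simp add: agree_def ct.mp_cmp[OF q e[OF j(1)]] ct.mp_mk em qc\<close>)
   hence "cmp CT (io j) (mk Q (fobj D j) q) = f"
    using catD(6)[OF ct.is_cat q e[OF j(1)] p] pe[OF j(1)] catD(6)[OF ct.is_cat f k(1) p] pk catD(4)[OF ct.is_cat f] by simp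
   thus "\<exists>i\<in>obj J. \<exists>q\<in>Hom CT Q (fobj D i). cmp CT (io i) q = f" using j(1) q by blast
  next
   fix i q q' assume i: "i \<in> obj J" and q: "q \<in> Hom CT Q (fobj D i)" "q' \<in> Hom CT Q (fobj D i)" and eq: "cmp CT (io i) q = cmp CT (io i) q'"
   have "cmp CT (e i) q = cmp CT (e i) q'"
    using eq catD(6)[OF ct.is_cat q(1) io[OF i] k(1)] catD(6)[OF ct.is_cat q(2) io[OF i] k(1)] k(2)[OF i] by simp
   hence "dd.e i n (mp q n x) = dd.e i n (mp q' n x)" if "x \<in> tcell Q n" for n x
    using ct.mp_cmp[OF q(1) e[OF i] that] ct.mp_cmp[OF q(2) e[OF i] that] em[OF ct.mp_cell[OF q(1) that]] em[OF ct.mp_cell[OF q(2) that]] by simp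
   hence ag: "agree Q (%n x. dd.e i n (mp q n x)) (%n x. dd.e i n (mp q' n x))" unfolding agree_def by blast
   obtain h h' where h: "ctm Q (fobj D i) (mp q) h" "ctm Q (fobj D i) (mp q') h'" using ct.HomD(3)[OF q(1)] ct.HomD(3)[OF q(2)] by blast
   from dd.factor_unique[OF r fin i h ag] obtain l where l: "le i l" "agree Q (%n x. tr i l n (mp q n x)) (%n x. tr i l n (mp q' n x))" by blast
   note Dw = funD(4)[OF D w[OF l(1)]]
   have "cmp CT (farr D (w i l)) q = cmp CT (farr D (w i l)) q'"
    by (rule ct.Hom_eqI[OF catD(3)[OF ct.is_cat q(1) Dw] catD(3)[OF ct.is_cat q(2) Dw]])
     (use l(2) in \<open>simp add: agree_def ct.mp_cmp[OF q(1) Dw] ct.mp_cmp[OF q(2) Dw] tr_def\<close>)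
   thus "\<exists>j. \<exists>u\<in>Hom J i j. cmp CT (farr D u) q = cmp CT (farr D u) q'" using w[OF l(1)] by blast
  qed
 qed
 show ?thesis unfolding presentable_def preserves_colimits_def ct.objC
  by (intro conjI allI impI main) (use Q in auto)
qed

end

section \<open>Generation by countably many finitely presented objects\<close>

context universe
begin

text \<open>Finitely many variables can be renamed to natural numbers. Systems arising from
  different objects thus all occur, up to renaming, among countably many.\<close>

lemma represents_nat:
 fixes Q :: "'u ctcat"
 assumes r: "represents R Q u" and fin: "finite R"
 shows "\<exists>(R' :: nat atom set) rho. finite R' \<and> (\<exists>(Q :: 'u ctcat) u. represents R' Q u) \<and> (\<forall>(Q :: 'u ctcat) u. represents R' Q u --> represents R Q (%n v. u n (rho v)))"
proof -
 let ?V = "\<Union> (set_atom ` R)"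
 have "finite ?V" using fin finite_set_atom by (intro finite_UN_I) auto
 from finite_imp_inj_to_nat_seg[OF this] obtain rho :: "_ => nat" where rho: "inj_on rho ?V" by blast
 let ?R = "map_atom rho ` R"
 have "map_atom (inv_into ?V rho) (map_atom rho al) = map_atom (%v. v) al" if "al \<in> R" for al
  unfolding atom.map_comp by (rule atom.map_cong[OF refl]) (use that inv_into_f_f[OF rho] in auto)
 hence e: "map_atom (inv_into ?V rho) ` ?R = R" by (auto simp: atom.map_ident image_image)
 have "\<Union> (set_atom ` ?R) \<subseteq> rho ` ?V" by (auto simp: atom.set_map)
 hence "inj_on (inv_into ?V rho) (\<Union> (set_atom ` ?R))" by (rule inj_on_inv_into)
 from represents_rename[OF this, unfolded e, OF r] have "\<exists>(Q :: 'u ctcat) u. represents ?R Q u" by blast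
 thus ?thesis using represents_rename[OF rho] fin by blast
qed

text \<open>The finite parts of the tautological presentation of x are directed under inclusion,
  because unions of two parts are parts and sets of fewer than r parts are finite. Their
  representing objects have colimit x by \<open>density\<close>.\<close>

lemma CT_dense:
 fixes r :: "'u rel"
 assumes x: "x \<in> obj CT" and Qr: "!!R. gd x R ==> Q R \<in> P \<and> represents R (Q R) (u R)"
  and rc: "!!S. |S :: 'u set| <o r ==> finite S"
 shows "\<exists>(J :: ('u, 'u) category) D io. small_category J \<and> directed_poset r J \<and> is_functor J CT D \<and>
  (\<forall>i\<in>obj J. fobj D i \<in> P) \<and> is_colimit CT J D x io"
proof -
 have xo: "ctob x" using x unfolding ct.objC by simp
 let ?G = "{R. gd x R}"
 have "sm ?G" by (rule sm_subset[OF sm_Fpow[OF sm_tru[OF xo]]]) (auto simp: gd_def)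
 from poset_category[OF this] obtain J :: "('u, 'u) category" and d where J: "small_category J" and d: "bij_betw d (obj J) ?G"
  and thin: "\<forall>f\<in>arr J. \<forall>g\<in>arr J. dom J f = dom J g \<and> cod J f = cod J g --> f = g"
  and le: "\<forall>i\<in>obj J. \<forall>j\<in>obj J. Hom J i j \<noteq> {} \<longleftrightarrow> d i \<subseteq> d j" by blast
 have Jc: "is_category J" using J unfolding small_category_def by blast
 have dg: "gd x (d i)" if "i \<in> obj J" for i using bij_betw_apply[OF d that] by simp
 have dsur: "\<exists>i\<in>obj J. d i = R" if "gd x R" for R
 proof -
  have "R \<in> d ` obj J" using bij_betw_imp_surj_on[OF d] that by simp
  thus ?thesis by blast
 qed
 have mono: "d i \<subseteq> d j" if "f \<in> Hom J i j" for f i j using le catD(1)[OF Jc that] that by blast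
 have dir: "\<exists>j\<in>obj J. \<forall>i\<in>S. Hom J i j \<noteq> {}" if S: "S \<subseteq> obj J" "|S| <o r" for S
 proof -
  have "finite S ==> S \<subseteq> obj J ==> gd x (\<Union> (d ` S))"
   by (induction S rule: finite_induct) (auto simp: gd_empty intro!: gd_Un[OF xo] dg)
  from dsur[OF this[OF rc[OF S(2)] S(1)]] obtain j where j: "j \<in> obj J" "d j = \<Union> (d ` S)" by blast
  have "Hom J i j \<noteq> {}" if "i \<in> S" for i
  proof -
   have "i \<in> obj J" "d i \<subseteq> d j" using that S(1) j(2) by auto
   thus ?thesis using bspec[OF bspec[OF le] j(1)] by simp
  qed
  thus ?thesis using j(1) by blast
 qed
 have anti: "i = j" if "i \<in> obj J" "j \<in> obj J" "Hom J i j \<noteq> {}" "Hom J j i \<noteq> {}" for i j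
  using le that bij_betw_imp_inj_on[OF d] by (metis inj_onD subset_antisym)
 have dp: "directed_poset r J" unfolding directed_poset_def using Jc thin anti dir by blast
 have Qo: "ctob (Q R)" and rep: "represents R (Q R) (u R)" if "gd x R" for R using Qr[OF that] unfolding represents_def by auto
 have hu: "\<forall>al\<in>R. holds (Q R') (u R') al" if "R \<subseteq> R'" "gd x R'" for R R' using rep[OF that(2)] that(1) unfolding represents_def by blast
 \<comment> \<open>The arrow that corresponds to a solution a of R in M.\<close>
 define ar where "ar R M a = (SOME f. f \<in> Hom CT (Q R) M \<and> (\<forall>(n, v)\<in>decl R. mp f n (u R n v) = a n v))" for R M a
 have ar: "ar R M a \<in> Hom CT (Q R) M" "(n, v) \<in> decl R ==> mp (ar R M a) n (u R n v) = a n v"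
  if "gd x R" "ctob M" "\<forall>al\<in>R. holds M a al" for R M a n v
  using someI_ex[OF represents_arr[OF rep[OF that(1)] that(2,3), unfolded Bex_def], folded ar_def] by auto
 have uc: "u R n v \<in> tcell (Q R) n" if "gd x R" "(n, v) \<in> decl R" for R n v
  using hu[OF subset_refl that(1)] that(2) unfolding decl_def by force
 \<comment> \<open>The universal solution of a larger part also solves the smaller one, and so
   represents a transition map; functoriality is checked on declared variables.\<close>
 define D where "D = \<lparr> fobj = (%i. Q (d i)), farr = (%f. ar (d (dom J f)) (Q (d (cod J f))) (u (d (cod J f)))) \<rparr>"
 have Do: "fobj D i = Q (d i)" for i unfolding D_def by simp
 have Da: "farr D f \<in> Hom CT (Q (d i)) (Q (d j))" "(n, v) \<in> decl (d i) ==> mp (farr D f) n (u (d i) n v) = u (d j) n v" if f: "f \<in> Hom J i j" for f i j n v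
 proof -
  note o = dg[OF conjunct1[OF catD(1)[OF Jc f]]] dg[OF conjunct2[OF catD(1)[OF Jc f]]]
  have e: "farr D f = ar (d i) (Q (d j)) (u (d j))" using f unfolding D_def Hom_arr by simp
  show "farr D f \<in> Hom CT (Q (d i)) (Q (d j))" "(n, v) \<in> decl (d i) ==> mp (farr D f) n (u (d i) n v) = u (d j) n v"
   unfolding e by (rule ar[OF o(1) Qo[OF o(2)] hu[OF mono[OF f] o(2)]])+
 qed
 have D: "is_functor J CT D"
 proof (rule functorI[OF Jc ct.is_cat]; (unfold Do)?)
  show "Q (d i) \<in> obj CT" if "i \<in> obj J" for i using Qo[OF dg[OF that]] unfolding ct.objC by simp
  show "farr D f \<in> Hom CT (Q (d i)) (Q (d j))" if "f \<in> Hom J i j" for f i j by (rule Da(1)[OF that])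
  show "farr D (one J i) = one CT (Q (d i))" if i: "i \<in> obj J" for i
  proof (rule represents_eq[OF rep[OF dg[OF i]] Da(1)[OF catD(2)[OF Jc i]] catD(2)[OF ct.is_cat]])
   show "Q (d i) \<in> obj CT" using Qo[OF dg[OF i]] unfolding ct.objC by simp
   show "\<forall>(n, v)\<in>decl (d i). mp (farr D (one J i)) n (u (d i) n v) = mp (one CT (Q (d i))) n (u (d i) n v)"
    using Da(2)[OF catD(2)[OF Jc i]] uc[OF dg[OF i]] by (auto simp: ct.mp_one)
  qed
  show "farr D (cmp J g f) = cmp CT (farr D g) (farr D f)" if f: "f \<in> Hom J i j" and g: "g \<in> Hom J j k" for f g i j k
  proof (rule represents_eq[OF rep Da(1)[OF catD(3)[OF Jc f g]] catD(3)[OF ct.is_cat Da(1)[OF f] Da(1)[OF g]]])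
   show di: "gd x (d i)" using dg catD(1)[OF Jc f] by blast
   show "\<forall>(n, v)\<in>decl (d i). mp (farr D (cmp J g f)) n (u (d i) n v) = mp (cmp CT (farr D g) (farr D f)) n (u (d i) n v)"
    using Da(2)[OF catD(3)[OF Jc f g]] Da(2)[OF f] Da(2)[OF g] decl_mono[OF mono[OF f]] ct.mp_cmp[OF Da(1)[OF f] Da(1)[OF g] uc[OF di]] by auto
  qed
 qed
 have hx: "\<forall>al\<in>R. holds x (%_ v. v) al" if "gd x R" for R using that unfolding gd_def tru_def by blast
 define io where "io i = ar (d i) x (%_ v. v)" for i
 have io: "io i \<in> Hom CT (fobj D i) x" "(n, v) \<in> decl (d i) ==> mp (io i) n (u (d i) n v) = v" if "i \<in> obj J" for i n v
  unfolding io_def Do using ar[OF dg[OF that] xo hx[OF dg[OF that]]] by auto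
 have "is_cocone CT J D x io" unfolding is_cocone_def
 proof (intro conjI ballI x)
  fix f assume "f \<in> arr J"
  hence f: "f \<in> Hom J (dom J f) (cod J f)" unfolding Hom_arr by simp
  have o: "dom J f \<in> obj J" "cod J f \<in> obj J" using catD(1)[OF Jc f] by auto
  note Df = funD(4)[OF D f]
  show "cmp CT (io (cod J f)) (farr D f) = io (dom J f)"
   by (rule represents_eq[OF rep[OF dg[OF o(1)]] catD(3)[OF ct.is_cat Df io(1)[OF o(2)], unfolded Do] io(1)[OF o(1), unfolded Do]])
    (use ct.mp_cmp[OF Df io(1)[OF o(2)], unfolded Do] uc[OF dg[OF o(1)]] Da(2)[OF f] io(2)[OF o(1)] io(2)[OF o(2)] decl_mono[OF mono[OF f]] in auto)
 qed (rule io)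
 moreover have "\<exists>!f. f \<in> Hom CT x y \<and> (\<forall>i\<in>obj J. cmp CT f (io i) = ka i)" if k: "is_cocone CT J D y ka" for y ka
 proof -
  have y: "ctob y" and ka: "!!i. i \<in> obj J ==> ka i \<in> Hom CT (fobj D i) y" and kaD: "!!f i j. f \<in> Hom J i j ==> cmp CT (ka j) (farr D f) = ka i"
   using k unfolding is_cocone_def ct.objC Hom_arr by auto
  define d' where "d' = inv_into (obj J) d"
  have d': "d' R \<in> obj J" "d (d' R) = R" if "gd x R" for R
   using inv_into_into[of R d "obj J"] f_inv_into_f[of R d "obj J"] bij_betw_imp_surj_on[OF d] that unfolding d'_def by simp_all
  have ka': "ka (d' R) \<in> Hom CT (Q R) y" if "gd x R" for R using ka[OF d'(1)[OF that]] d'(2)[OF that] unfolding Do by simp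
  have "\<exists>f h. ctm x y f h \<and> (\<forall>R. gd x R --> (\<forall>(n, v)\<in>decl R. mp (ka (d' R)) n (u R n v) = f n v))"
  proof (rule density[OF xo y rep])
   show "\<exists>k. ctm (Q R) y (mp (ka (d' R))) k" if "gd x R" for R by (rule ct.HomD(3)[OF ka'[OF that]])
   show "mp (ka (d' R')) n (u R' n v) = mp (ka (d' R)) n (u R n v)" if R: "gd x R" "gd x R'" "R \<subseteq> R'" "(n, v) \<in> decl R" for R R' n v
   proof -
    have "Hom J (d' R) (d' R') \<noteq> {}" using le d'[OF R(1)] d'[OF R(2)] R(3) by simp
    then obtain f where f: "f \<in> Hom J (d' R) (d' R')" by blast
    have "mp (cmp CT (ka (d' R')) (farr D f)) n (u R n v) = mp (ka (d' R')) n (mp (farr D f) n (u R n v))"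
     by (rule ct.mp_cmp[OF funD(4)[OF D f] ka[OF d'(1)[OF R(2)]]]) (use uc[OF R(1,4)] in \<open>simp add: Do d'(2)[OF R(1)]\<close>)
    thus ?thesis using Da(2)[OF f, unfolded d'(2)[OF R(1)] d'(2)[OF R(2)], OF R(4)] kaD[OF f] by simp
   qed
  qed
  then obtain f h where f: "ctm x y f h" and fk: "!!R n v. gd x R ==> (n, v) \<in> decl R ==> mp (ka (d' R)) n (u R n v) = f n v" by blast
  have F: "mk x y f \<in> Hom CT x y" using f xo y by (auto intro: ct.mk_Hom)
  have dc: "v \<in> tcell x n" if "gd x R" "(n, v) \<in> decl R" for R n v using gd_fsub[OF xo that(1)] that(2) unfolding fsub_def by blast
  have d'd: "d' (d i) = i" if "i \<in> obj J" for i unfolding d'_def by (rule inv_into_f_f[OF bij_betw_imp_inj_on[OF d] that])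
  have "cmp CT (mk x y f) (io i) = ka i" if i: "i \<in> obj J" for i
   by (rule represents_eq[OF rep[OF dg[OF i]] catD(3)[OF ct.is_cat io(1)[OF i] F, unfolded Do] ka[OF i, unfolded Do]])
    (use ct.mp_cmp[OF io(1)[OF i] F, unfolded Do] uc[OF dg[OF i]] io(2)[OF i] ct.mp_mk[OF dc[OF dg[OF i]]] fk[OF dg[OF i], unfolded d'd[OF i]] in auto)
  moreover have "g = g'" if g: "g \<in> Hom CT x y" "\<forall>i\<in>obj J. cmp CT g (io i) = ka i" and g': "g' \<in> Hom CT x y" "\<forall>i\<in>obj J. cmp CT g' (io i) = ka i" for g g'
  proof (rule ct.Hom_eqI[OF g(1) g'(1)])
   have "mp g n v = mp g' n v" if v: "v \<in> tcell x n" for n v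
   proof -
    obtain R where R: "gd x R" "AUs x Ident n v \<in> R" using gd_ex[OF xo AUs_tru[OF ctobD(3)[OF xo] v]] by blast
    then obtain i where i: "i \<in> obj J" "d i = R" using dsur by blast
    have nv: "(n, v) \<in> decl (d i)" using R(2) unfolding i(2) decl_def AUs_def by blast
    show ?thesis
     using ct.mp_cmp[OF io(1)[OF i(1)] g(1), unfolded Do, OF uc[OF dg[OF i(1)] nv]]
      ct.mp_cmp[OF io(1)[OF i(1)] g'(1), unfolded Do, OF uc[OF dg[OF i(1)] nv]] io(2)[OF i(1) nv] g(2) g'(2) i(1) by simp
   qed
   thus "agree x (mp g) (mp g')" unfolding agree_def by blast
  qed
  ultimately show ?thesis using F by blast
 qed
 ultimately have "is_colimit CT J D x io" unfolding is_colimit_def by blast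
 moreover have "\<forall>i\<in>obj J. fobj D i \<in> P" unfolding Do using Qr dg by blast
 ultimately show ?thesis using J dp D by blast
qed

theorem CT_locally_presentable: "locally_presentable TYPE('u) CT"
proof -
 obtain f :: "nat => 'u" where f: "inj f" using infinite_countable_subset[OF infinite_u] by blast
 \<comment> \<open>Aleph-null, realised as a relation on \<open>'u\<close> because the definition
   takes r there.\<close>
 define r :: "'u rel" where "r = |range f|"
 have iso: "r =o natLeq" unfolding r_def
  using ordIso_transitive[OF ordIso_symmetric[OF card_of_ordIsoI[OF inj_on_imp_bij_betw[OF f]]] card_of_nat] .
 have Fr: "infinite (Field r)" unfolding r_def Field_card_of using range_inj_infinite[OF f] .
 have Cr: "Card_order r" unfolding r_def by (rule card_of_Card_order)
 have rc: "regular_cardinal r" unfolding regular_cardinal_def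
  using Cr Fr stable_regularCard[OF Cr Fr stable_ordIso1[OF stable_natLeq iso]] by blast
 have rU: "r <o |UNIV :: 'u set|" using sm_countable[of "range f"] unfolding small_def r_def by simp
 have fin: "finite S" if "|S :: 'u set| <o r" for S using ordLess_ordIso_trans[OF that iso] finite_iff_ordLess_natLeq by blast
 \<comment> \<open>One object is chosen for each finite system over the natural numbers. Fixing it
   before x is considered keeps the set of generators countable.\<close>
 define ch where "ch R = (SOME Q :: 'u ctcat. \<exists>u. represents R Q u)" for R :: "nat atom set"
 define P where "P = ch ` {R. finite R \<and> (\<exists>(Q :: 'u ctcat) u. represents R Q u)}"
 have ch: "\<exists>u. represents R (ch R) u" if "\<exists>(Q :: 'u ctcat) u. represents R Q u" for R
  unfolding ch_def by (rule someI_ex[OF that])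
 have P: "\<exists>(R :: nat atom set) u. finite R \<and> represents R Q u" if "Q \<in> P" for Q using that ch unfolding P_def by blast
 have "countable P" unfolding P_def
  by (intro countable_image countable_subset[OF _ countable_Collect_finite[where 'a = "nat atom"]]) auto
 hence Ps: "sm P" by (rule sm_countable)
 have "\<exists>(J :: ('u, 'u) category) D io. small_category J \<and> directed_poset r J \<and> is_functor J CT D \<and>
  (\<forall>i\<in>obj J. fobj D i \<in> P) \<and> is_colimit CT J D x io" if x: "x \<in> obj CT" for x
 proof -
  have "\<exists>p. fst p \<in> P \<and> represents R (fst p) (snd p)" if R: "gd x R" for R
  proof -
   obtain Q u where r: "represents R (Q :: 'u ctcat) u" using gd_represented[OF _ R] x unfolding ct.objC by blast
   have "finite R" using R unfolding gd_def by blast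
   from represents_nat[OF r this] obtain R' :: "nat atom set" and rho where R': "finite R'" "\<exists>(Q :: 'u ctcat) u. represents R' Q u"
    "\<forall>(Q :: 'u ctcat) u. represents R' Q u --> represents R Q (%n v. u n (rho v))" by (elim exE) (elim conjE, rule that)
   obtain u' where u': "represents R' (ch R') u'" using ch[OF R'(2)] by blast
   have "ch R' \<in> P" unfolding P_def using R'(1,2) by blast
   hence "fst (ch R', %n v. u' n (rho v)) \<in> P \<and> represents R (fst (ch R', %n v. u' n (rho v))) (snd (ch R', %n v. u' n (rho v)))"
    using R'(3) u' unfolding fst_conv snd_conv by blast
   thus ?thesis by (rule exI)
  qed
  hence "\<forall>R\<in>{R. gd x R}. \<exists>p. fst p \<in> P \<and> represents R (fst p) (snd p)" by blast
  from bchoice[OF this] obtain p where p: "\<forall>R\<in>{R. gd x R}. fst (p R) \<in> P \<and> represents R (fst (p R)) (snd (p R))" by blast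
  show ?thesis by (rule CT_dense[OF x, of "%R. fst (p R)" P "%R. snd (p R)" r]) (use p fin in auto)
 qed
 moreover have "P \<subseteq> obj CT" using P unfolding ct.objC represents_def by blast
 moreover have "\<forall>a\<in>P. \<forall>b\<in>P. small TYPE('u) (Hom CT a b)" unfolding sm_iff using P Hom_small by blast
 moreover have "\<forall>a\<in>P. presentable r CT a" using P represents_presentable[OF rc] by blast
 ultimately show ?thesis unfolding locally_presentable_def sm_iff using ct.is_cat CT_cocomplete rc rU Ps by blast
qed

end

theorem mainTheorem1:
  assumes "uncountable (UNIV :: 'u set)"
    and "regular_cardinal |UNIV :: 'u set|"
  shows "locally_presentable TYPE('u) (CTCat_c :: ('u ctcat, ('u ctcat, 'u) arrow) category) \<and>
    monadic (CTCat_c :: ('u ctcat, ('u ctcat, 'u) arrow) category) TGr_pc forgetful"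
proof -
  interpret universe "TYPE('u)" by (unfold_locales) (use assms in auto)
  show ?thesis using CT_locally_presentable forgetful_monadic by blast
qed

end
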